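(* Fix an integer $N\ge1$ and, for $M\in\mathbb{N}\cup\{\infty\}$, consider the backward stochastic Riccati equation $$\left\{\begin{aligned} d\Sigma_r^{M}=&\int_E\left[\Sigma_r^{M}C_r^*(\theta)-\Theta_r^{M}(\theta)\right]\left(I_n+\Sigma_r^{M}+\Theta_r^{M}(\theta)\right)^{-1}\left[C_r(\theta)\Sigma_r^{M}-\Theta_r^{M}(\theta)\right]\hat q(dr\,d\theta)\\&+\int_E\Theta_r^{M}(\theta)\,\tilde q(dr\,d\theta)+\left(A_r\Sigma_r^{M}+\Sigma_r^{M}A_r^*-NB_rB_r^*\right)dr,\quad 0\le r\le T,\\ \Sigma_T^{M}=&M^{-1}I_n\end{aligned}\right.\tag{R$_M$}$$ (with $M^{-1}I_n:=0_n$ if $M=\infty$). 1. If (R$_M$) admits a solution for some $M\in\mathbb{N}\cup\{\infty\}$, then the solution is unique. This solution is uniformly bounded from above, and the upper bound can be chosen independent of $M$. 2. If (R$_M$) admits a solution for some $M\in\mathbb{N}$, then $\Sigma^M$ and $\Sigma^M+\Theta^M(\cdot)$ are positive definite and uniformly bounded from below by $c_MI_n$ for some $c_M>0$. 3. Assume that (R$_M$) admits a solution for every $M\in\mathbb{N}\cup\{\infty\}$. Then the unique solution $(\Sigma^M,\Theta^M)$ converges, as $M\to\infty$, uniformly (in $\mathbb{L}^\infty(\Omega;\mathbb{D}([0,T];\mathcal{S}^n))\times\mathbb{L}^\infty(\Omega\times[0,T]\times E,q;\mathcal{S}^n)$) to $(\Sigma^\infty,\Theta^\infty)$. Moreover,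 the sequences $(\Sigma^M)_{M\ge1}$ and $(\Sigma^M+\Theta^M)_{M\ge1}$ are non-increasing (in the order of symmetric matrices). 4. Assume that (a) $E$ is an at most countable set of modes endowed with the discrete topology and (b) the coefficients $A,B,C$ are jump time-homogeneous. Then (R$_M$) admits a unique solution for every $M\in\mathbb{N}\cup\{\infty\}$.
   Context: **Mode process.** Fix $T>0$, an integer $J>1$, and integers $n,d\ge1$. $E$ is a metric space with Borel $\sigma$-field $\mathcal{B}(E)$; $\lambda:E\times\mathbb{R}_+\to\mathbb{R}_+$ is continuous and bounded; $Q:E\times\mathbb{R}_+\to\mathcal{P}(E)$ (probability measures on $E$) satisfies $Q(\gamma,t,\{\gamma\})=0$ for all $(\gamma,t)$, and $\gamma\mapsto Q(\gamma,t,\cdot)$ is weakly continuous uniformly in $t$. Fix $\gamma_0\in E$. On $(\Omega,\mathbb{P})$ the mode process $\Gamma$ has jump times $T_0:=0<T_1<\dots<T_J$ and marks $\gamma_j=\Gamma_{T_j}$: given the past up to the $(j-1)$-th jump ($1\le j\le J$), $\mathbb{P}(T_j-T_{j-1}\ge t)=\exp(-\int_0^t\lambda(\gamma_{j-1},T_{j-1}+r)dr)$, and given in addition $T_j$, $\gamma_j$ has law $Q(\gamma_{j-1},T_j,\cdot)$; $\Gamma_t=\gamma_{j}$ on $[T_j,T_{j+1})$; after the $J$-th jump there are no further jumps. $\mathcal{F}_{[0,t]}:=\sigma\{\Gamma_s:s\in[0,t]\}$; $\mathcal{P}$ is the predictable $\sigma$-field. $q(A):=\sum_{j=1}^J\mathbf{1}_{(T_j,\Gamma_{T_j})\in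 A}$ for $A\in\mathcal{B}(\mathbb{R}_+)\otimes\mathcal{B}(E)$, $\hat q$ is its compensator, equal to $\lambda(\gamma_j,t)Q(\gamma_j,t,d\theta)dt$ on $T_j<t\le T_{j+1}$, $j<J$, and to $0$ after $T_J$; $\tilde q:=q-\hat q$. **Spaces.** $\mathcal{S}^n$ is the space of symmetric $n\times n$ matrices; $^*$ is transposition; $I_n$, $0_n$ are the identity and zero matrices. For a Euclidean space $\mathcal{E}$: $\mathbb{L}^p(\Omega\times[0,T],\mathcal{P},\mathbb{P}\times\mathcal{L}eb;\mathcal{E})$ is the usual space of predictable processes; $\mathbb{L}^p(\Omega;\mathbb{D}([0,T];\mathcal{E}))$ is the space of progressively measurable càdlàg processes whose supremum norm over $[0,T]$ is in $\mathbb{L}^p$ (essentially bounded if $p=\infty$); $\mathbb{L}^p(\Omega\times[0,T]\times E,q;\mathcal{E})$ is the space of $\mathcal{P}\otimes\mathcal{B}(E)$-measurable $\Phi$ with $\mathbb{E}[\int_{[0,T]\times E}\|\Phi_r(\theta)\|^pq(dr,d\theta)]<\infty$ (essentially bounded if $p=\infty$). **Coefficients (standing assumption).** $A\in\mathbb{L}^\infty(\Omega\times[0,T],\mathcal{P},\mathbb{P}\times\mathcal{L}eb;\mathbb{R}^{n\times n})$, $B\in\mathbb{L}^\infty(\Omega\times[0,T],\mathcal{P},\mathbb{P}\times\mathcal{L}eb;\mathbb{R}^{n\times d})$, $C\in\mathbb{L}^2(\Omega\times[0,T]\times E,q;\mathbb{R}^{n\times n})$ with $\|C\|_\infty:=\mathrm{esssup}_{\omega}\sup_{r\in[0,T],\theta\in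 E}\|C_r(\omega,\theta)\|<\infty$; and $A_t,B_t,C_t(\cdot)$ vanish on $\{t>T_J\}$. **Solution of (R$_M$).** $\mathbb{N}$ denotes the positive integers. A solution of (R$_M$) is a couple $(\Sigma^M,\Theta^M)\in\mathbb{L}^\infty(\Omega;\mathbb{D}([0,T];\mathcal{S}^n))\times\mathbb{L}^\infty(\Omega\times[0,T]\times E,q;\mathcal{S}^n)$ such that: $\Sigma^M_t$ is positive definite if $M<\infty$ (positive semi-definite if $M=\infty$) $\mathbb{P}\times\mathcal{L}eb$-a.s., and $\Sigma^M_t+\Theta^M_t(\theta)$ is positive definite if $M<\infty$ (positive semi-definite if $M=\infty$) $\mathbb{P}(d\omega)\hat q(\omega,dt,d\theta)$-a.s.; $\Sigma^M$ is continuous except, possibly, at the jump times; and the integral form of (R$_M$) on $[t,T]$ holds $\mathbb{P}$-a.s. for all $0\le t\le T$. **Jump time-homogeneity.** Given a metric space $\mathcal{E}$, a predictable process $f:\Omega\times[0,T]\to\mathcal{E}$ is jump time-homogeneous if there are functions $f^j:E^{j+1}\times[0,T]\to\mathcal{E}$ with $f_t(\omega)=f^j(\gamma_0,\Gamma_{T_1}(\omega),\dots,\Gamma_{T_j}(\omega),t)$ on $T_j(\omega)<t\le T_{j+1}(\omega)$; for $C$, which also depends on $\theta\in E$, the functions depend in addition on $\theta$. *)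

theory Defs
  imports "HOL-Probability.Probability"
begin

section \<open>Symmetric matrices\<close>

definition sym_mats :: "(real^'n^'n) set" where
  "sym_mats = {X. transpose X = X}"

definition posdef :: "real^'n^'n \<Rightarrow> bool" where
  "posdef X \<longleftrightarrow> X \<in> sym_mats \<and> (\<forall>v. v \<noteq> 0 \<longrightarrow> 0 < v \<bullet> (X *v v))"

definition possemidef :: "real^'n^'n \<Rightarrow> bool" where
  "possemidef X \<longleftrightarrow> X \<in> sym_mats \<and> (\<forall>v. 0 \<le> v \<bullet> (X *v v))"

definition loewner_le :: "real^'n^'n \<Rightarrow> real^'n^'n \<Rightarrow> bool"  (infix \<open>\<preceq>\<close> 50) where
  "X \<preceq> Y \<longleftrightarrow> possemidef (Y - X)"

section \<open>The mode process\<close>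

text \<open>
  The process starts in \<open>\<gamma>\<^sub>0\<close> and jumps at most \<open>J\<close> times. The jump times are \<^term>\<open>\<tau> j\<close>, with values in \<open>[0, \<infinity>]\<close>: the rate may vanish, so
  that a jump need not occur in finite time. They increase strictly as long as they are finite,
  and \<^term>\<open>\<tau> j = (\<lambda>_. \<infinity>)\<close> for \<open>j > J\<close>. The mark \<^term>\<open>\<gamma> j \<omega>\<close> is only
  meaningful if \<^term>\<open>\<tau> j \<omega> < \<infinity>\<close>. The filtration is the one generated by the mode process,
  without completion. The conditional laws are versions of the library's conditional expectation,
  given the \<open>\<sigma>\<close>-fields generated by the first \<open>j\<close> jump times and marks, resp. by these and the
  next jump time. That \<^term>\<open>Q\<close> is jointly measurable is part of being a transition kernel and
  does not follow from its continuity in the mode.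
\<close>

definition mode :: "(nat \<Rightarrow> 'w \<Rightarrow> ereal) \<Rightarrow> (nat \<Rightarrow> 'w \<Rightarrow> 'e) \<Rightarrow> real \<Rightarrow> 'w \<Rightarrow> 'e" where
  "mode \<tau> \<gamma> t \<omega> = \<gamma> (THE j. \<tau> j \<omega> \<le> ereal t \<and> ereal t < \<tau> (Suc j) \<omega>) \<omega>"

definition mode_filtration ::
  "'w set \<Rightarrow> (nat \<Rightarrow> 'w \<Rightarrow> ereal) \<Rightarrow> (nat \<Rightarrow> 'w \<Rightarrow> 'e::metric_space) \<Rightarrow> real \<Rightarrow> 'w measure" where
  "mode_filtration \<Omega> \<tau> \<gamma> t =
     sigma \<Omega> {mode \<tau> \<gamma> s -` S \<inter> \<Omega> |s S. 0 \<le> s \<and> s \<le> t \<and> S \<in> sets borel}"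

definition past ::
  "'w set \<Rightarrow> (nat \<Rightarrow> 'w \<Rightarrow> ereal) \<Rightarrow> (nat \<Rightarrow> 'w \<Rightarrow> 'e::metric_space) \<Rightarrow> nat \<Rightarrow> 'w measure" where
  "past \<Omega> \<tau> \<gamma> j =
     sigma \<Omega> ({\<tau> i -` S \<inter> \<Omega> |i S. i \<le> j \<and> S \<in> sets borel} \<union>
              {\<gamma> i -` S \<inter> \<Omega> |i S. i \<le> j \<and> S \<in> sets borel})"

definition past_and_next_time ::
  "'w set \<Rightarrow> (nat \<Rightarrow> 'w \<Rightarrow> ereal) \<Rightarrow> (nat \<Rightarrow> 'w \<Rightarrow> 'e::metric_space) \<Rightarrow> nat \<Rightarrow> 'w measure" where
  "past_and_next_time \<Omega> \<tau> \<gamma> j =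
     sigma \<Omega> (sets (past \<Omega> \<tau> \<gamma> j) \<union> {\<tau> (Suc j) -` S \<inter> \<Omega> |S. S \<in> sets borel})"

locale mode_process = prob_space P
  for P :: "'w measure" +
  fixes J :: nat
    and lam :: "'e::metric_space \<Rightarrow> real \<Rightarrow> real"
    and Q :: "'e \<Rightarrow> real \<Rightarrow> 'e measure"
    and \<gamma>\<^sub>0 :: 'e
    and \<tau> :: "nat \<Rightarrow> 'w \<Rightarrow> ereal"
    and \<gamma> :: "nat \<Rightarrow> 'w \<Rightarrow> 'e"
  assumes J_gt_1: "1 < J"
    and lam_nonneg: "\<And>x t. 0 \<le> t \<Longrightarrow> 0 \<le> lam x t"
    and lam_continuous: "continuous_on (UNIV \<times> {0..}) (\<lambda>(x, t). lam x t)"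
    and lam_bounded: "\<exists>K. \<forall>x. \<forall>t\<ge>0. lam x t \<le> K"
    and Q_kernel: "(\<lambda>(x, t). Q x t) \<in> borel \<Otimes>\<^sub>M restrict_space borel {0..} \<rightarrow>\<^sub>M prob_algebra borel"
    and Q_no_self_jump: "\<And>x t. 0 \<le> t \<Longrightarrow> measure (Q x t) {x} = 0"
    and Q_weakly_continuous:
      "\<And>(f :: 'e \<Rightarrow> real) x. continuous_on UNIV f \<Longrightarrow> bounded (range f) \<Longrightarrow>
         uniform_limit {0..} (\<lambda>y t. \<integral>z. f z \<partial>Q y t) (\<lambda>t. \<integral>z. f z \<partial>Q x t) (at x)"
    and time_measurable: "\<And>j. \<tau> j \<in> borel_measurable P"
    and mark_measurable: "\<And>j. \<gamma> j \<in> P \<rightarrow>\<^sub>M borel"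
    and time_0: "\<And>\<omega>. \<omega> \<in> space P \<Longrightarrow> \<tau> 0 \<omega> = 0"
    and mark_0: "\<And>\<omega>. \<omega> \<in> space P \<Longrightarrow> \<gamma> 0 \<omega> = \<gamma>\<^sub>0"
    and time_less: "\<And>\<omega> j. \<omega> \<in> space P \<Longrightarrow> \<tau> j \<omega> < \<infinity> \<Longrightarrow> \<tau> j \<omega> < \<tau> (Suc j) \<omega>"
    and time_infinite: "\<And>\<omega> j. \<omega> \<in> space P \<Longrightarrow> \<tau> j \<omega> = \<infinity> \<Longrightarrow> \<tau> (Suc j) \<omega> = \<infinity>"
    and time_after_J: "\<And>\<omega> j. \<omega> \<in> space P \<Longrightarrow> J < j \<Longrightarrow> \<tau> j \<omega> = \<infinity>"
    and time_law: "\<And>j t. j < J \<Longrightarrow> 0 \<le> t \<Longrightarrow>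
        AE \<omega> in P. \<tau> j \<omega> < \<infinity> \<longrightarrow>
          real_cond_exp P (past (space P) \<tau> \<gamma> j)
            (indicator {\<omega> \<in> space P. \<tau> j \<omega> + ereal t \<le> \<tau> (Suc j) \<omega>}) \<omega>
          = exp (- (LINT r:{0..t}|lborel. lam (\<gamma> j \<omega>) (real_of_ereal (\<tau> j \<omega>) + r)))"
    and mark_law: "\<And>j S. j < J \<Longrightarrow> S \<in> sets borel \<Longrightarrow>
        AE \<omega> in P. \<tau> (Suc j) \<omega> < \<infinity> \<longrightarrow>
          real_cond_exp P (past_and_next_time (space P) \<tau> \<gamma> j)
            (indicator {\<omega> \<in> space P. \<gamma> (Suc j) \<omega> \<in> S}) \<omega>
          = measure (Q (\<gamma> j \<omega>) (real_of_ereal (\<tau> (Suc j) \<omega>))) S"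

definition jump_measure ::
  "nat \<Rightarrow> (nat \<Rightarrow> 'w \<Rightarrow> ereal) \<Rightarrow> (nat \<Rightarrow> 'w \<Rightarrow> 'e::metric_space) \<Rightarrow> 'w \<Rightarrow> (real \<times> 'e) measure" where
  "jump_measure J \<tau> \<gamma> \<omega> =
     measure_of UNIV (sets (borel \<Otimes>\<^sub>M borel))
       (\<lambda>S. \<Sum>j | 1 \<le> j \<and> j \<le> J \<and> \<tau> j \<omega> < \<infinity>. indicator S (real_of_ereal (\<tau> j \<omega>), \<gamma> j \<omega>))"

definition compensator ::
  "nat \<Rightarrow> ('e::metric_space \<Rightarrow> real \<Rightarrow> real) \<Rightarrow> ('e \<Rightarrow> real \<Rightarrow> 'e measure) \<Rightarrow>
   (nat \<Rightarrow> 'w \<Rightarrow> ereal) \<Rightarrow> (nat \<Rightarrow> 'w \<Rightarrow> 'e) \<Rightarrow> 'w \<Rightarrow> (real \<times> 'e) measure" where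
  "compensator J lam Q \<tau> \<gamma> \<omega> =
     measure_of UNIV (sets (borel \<Otimes>\<^sub>M borel))
       (\<lambda>S. \<Sum>j<J. \<integral>\<^sup>+ r. indicator {r. \<tau> j \<omega> < ereal r \<and> ereal r \<le> \<tau> (Suc j) \<omega>} r
                     * ennreal (lam (\<gamma> j \<omega>) r) * emeasure (Q (\<gamma> j \<omega>) r) (Pair r -` S) \<partial>lborel)"

section \<open>Spaces of processes\<close>

text \<open>
  Processes are written \<^term>\<open>X t \<omega>\<close>, and \<^term>\<open>Y t \<theta> \<omega>\<close> if they also depend on a mode
  \<^term>\<open>\<theta>\<close>. The set \<^term>\<open>V\<close> is the range in which they take their values. Equality in
  these spaces is equality almost everywhere, see \<open>eq_D\<close> and \<open>eq_q\<close>.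
\<close>

definition predictable :: "'w set \<Rightarrow> (real \<Rightarrow> 'w measure) \<Rightarrow> real \<Rightarrow> ('w \<times> real) measure" where
  "predictable \<Omega> F T =
     sigma (\<Omega> \<times> {0..T})
       ({G \<times> {0} |G. G \<in> sets (F 0)} \<union>
        {G \<times> {s<..t} |G s t. 0 \<le> s \<and> s \<le> t \<and> t \<le> T \<and> G \<in> sets (F s)})"

definition Linf_pred ::
  "'w measure \<Rightarrow> (real \<Rightarrow> 'w measure) \<Rightarrow> real \<Rightarrow> (real \<Rightarrow> 'w \<Rightarrow> 'v::euclidean_space) set" where
  "Linf_pred P F T =
     {X. (\<lambda>(\<omega>, t). X t \<omega>) \<in> borel_measurable (predictable (space P) F T) \<and>
         (\<exists>K. AE (\<omega>, t) in P \<Otimes>\<^sub>M restrict_space lborel {0..T}. norm (X t \<omega>) \<le> K)}"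

definition cadlag_on :: "real \<Rightarrow> (real \<Rightarrow> 'v::topological_space) \<Rightarrow> bool" where
  "cadlag_on T f \<longleftrightarrow>
     (\<forall>t\<in>{0..<T}. (f \<longlongrightarrow> f t) (at_right t)) \<and> (\<forall>t\<in>{0<..T}. \<exists>l. (f \<longlongrightarrow> l) (at_left t))"

definition progressive ::
  "(real \<Rightarrow> 'w measure) \<Rightarrow> real \<Rightarrow> (real \<Rightarrow> 'w \<Rightarrow> 'v::euclidean_space) \<Rightarrow> bool" where
  "progressive F T X \<longleftrightarrow>
     (\<forall>t\<in>{0..T}. (\<lambda>(\<omega>, s). X s \<omega>) \<in> borel_measurable (F t \<Otimes>\<^sub>M restrict_space borel {0..t}))"

definition Linf_D ::
  "'w measure \<Rightarrow> (real \<Rightarrow> 'w measure) \<Rightarrow> real \<Rightarrow> 'v::euclidean_space set \<Rightarrow>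
   (real \<Rightarrow> 'w \<Rightarrow> 'v) set" where
  "Linf_D P F T V =
     {X. (\<forall>\<omega>\<in>space P. \<forall>t\<in>{0..T}. X t \<omega> \<in> V) \<and> progressive F T X \<and>
         (\<forall>\<omega>\<in>space P. cadlag_on T (\<lambda>t. X t \<omega>)) \<and>
         (\<exists>K. AE \<omega> in P. \<forall>t\<in>{0..T}. norm (X t \<omega>) \<le> K)}"

definition predictable_field ::
  "'w measure \<Rightarrow> (real \<Rightarrow> 'w measure) \<Rightarrow> real \<Rightarrow>
   (real \<Rightarrow> 'e::metric_space \<Rightarrow> 'w \<Rightarrow> 'v::euclidean_space) \<Rightarrow> bool" where
  "predictable_field P F T Y \<longleftrightarrow>
     (\<lambda>((\<omega>, t), \<theta>). Y t \<theta> \<omega>) \<in> borel_measurable (predictable (space P) F T \<Otimes>\<^sub>M borel)"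

definition Linf_q ::
  "'w measure \<Rightarrow> (real \<Rightarrow> 'w measure) \<Rightarrow> real \<Rightarrow> ('w \<Rightarrow> (real \<times> 'e::metric_space) measure) \<Rightarrow>
   'v::euclidean_space set \<Rightarrow> (real \<Rightarrow> 'e \<Rightarrow> 'w \<Rightarrow> 'v) set" where
  "Linf_q P F T q V =
     {Y. (\<forall>\<omega>\<in>space P. \<forall>t\<in>{0..T}. \<forall>\<theta>. Y t \<theta> \<omega> \<in> V) \<and> predictable_field P F T Y \<and>
         (\<exists>K. AE \<omega> in P. AE (t, \<theta>) in q \<omega>. t \<in> {0..T} \<longrightarrow> norm (Y t \<theta> \<omega>) \<le> K)}"

definition L2_q ::
  "'w measure \<Rightarrow> (real \<Rightarrow> 'w measure) \<Rightarrow> real \<Rightarrow> ('w \<Rightarrow> (real \<times> 'e::metric_space) measure) \<Rightarrow>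
   (real \<Rightarrow> 'e \<Rightarrow> 'w \<Rightarrow> 'v::euclidean_space) set" where
  "L2_q P F T q =
     {Y. predictable_field P F T Y \<and>
         (\<integral>\<^sup>+ \<omega>. (\<integral>\<^sup>+ x. indicator ({0..T} \<times> UNIV) x * ennreal ((norm (Y (fst x) (snd x) \<omega>))\<^sup>2) \<partial>q \<omega>) \<partial>P)
           < \<infinity>}"

definition eq_D ::
  "'w measure \<Rightarrow> real \<Rightarrow> (real \<Rightarrow> 'w \<Rightarrow> 'v) \<Rightarrow> (real \<Rightarrow> 'w \<Rightarrow> 'v) \<Rightarrow> bool" where
  "eq_D P T X X' \<longleftrightarrow> (AE \<omega> in P. \<forall>t\<in>{0..T}. X t \<omega> = X' t \<omega>)"

definition eq_q ::
  "'w measure \<Rightarrow> real \<Rightarrow> ('w \<Rightarrow> (real \<times> 'e) measure) \<Rightarrow>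
   (real \<Rightarrow> 'e \<Rightarrow> 'w \<Rightarrow> 'v) \<Rightarrow> (real \<Rightarrow> 'e \<Rightarrow> 'w \<Rightarrow> 'v) \<Rightarrow> bool" where
  "eq_q P T q Y Y' \<longleftrightarrow> (AE \<omega> in P. AE (t, \<theta>) in q \<omega>. t \<in> {0..T} \<longrightarrow> Y t \<theta> \<omega> = Y' t \<theta> \<omega>)"

section \<open>Coefficients\<close>

definition riccati_coefficients ::
  "'w measure \<Rightarrow> real \<Rightarrow> nat \<Rightarrow> (nat \<Rightarrow> 'w \<Rightarrow> ereal) \<Rightarrow> (nat \<Rightarrow> 'w \<Rightarrow> 'e::metric_space) \<Rightarrow>
   (real \<Rightarrow> 'w \<Rightarrow> real^'n^'n) \<Rightarrow> (real \<Rightarrow> 'w \<Rightarrow> real^'d^'n) \<Rightarrow> (real \<Rightarrow> 'e \<Rightarrow> 'w \<Rightarrow> real^'n^'n) \<Rightarrow> bool"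
where
  "riccati_coefficients P T J \<tau> \<gamma> A B C \<longleftrightarrow>
     A \<in> Linf_pred P (mode_filtration (space P) \<tau> \<gamma>) T \<and>
     B \<in> Linf_pred P (mode_filtration (space P) \<tau> \<gamma>) T \<and>
     C \<in> L2_q P (mode_filtration (space P) \<tau> \<gamma>) T (jump_measure J \<tau> \<gamma>) \<and>
     (\<exists>K. AE \<omega> in P. \<forall>r\<in>{0..T}. \<forall>\<theta>. norm (C r \<theta> \<omega>) \<le> K) \<and>
     (\<forall>\<omega>\<in>space P. \<forall>t\<in>{0..T}. \<tau> J \<omega> < ereal t \<longrightarrow>
        A t \<omega> = 0 \<and> B t \<omega> = 0 \<and> (\<forall>\<theta>. C t \<theta> \<omega> = 0))"

text \<open>
  The functions \<open>f\<^sup>j\<close> on \<open>E\<^bsup>j+1\<^esup> \<times> [0, T]\<close> are encoded as one function \<^term>\<open>f\<close> of a list of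
  modes (of length \<open>j + 1\<close>) and the time. For a process that also depends on a mode
  \<^term>\<open>\<theta>\<close>, the type \<^typ>\<open>'v\<close> is a function type.
\<close>

definition jump_time_homogeneous ::
  "'w measure \<Rightarrow> real \<Rightarrow> (nat \<Rightarrow> 'w \<Rightarrow> ereal) \<Rightarrow> (nat \<Rightarrow> 'w \<Rightarrow> 'e) \<Rightarrow> (real \<Rightarrow> 'w \<Rightarrow> 'v) \<Rightarrow> bool" where
  "jump_time_homogeneous P T \<tau> \<gamma> X \<longleftrightarrow>
     (\<exists>f :: 'e list \<Rightarrow> real \<Rightarrow> 'v. \<forall>\<omega>\<in>space P. \<forall>t\<in>{0..T}. \<forall>j.
        \<tau> j \<omega> < ereal t \<and> ereal t \<le> \<tau> (Suc j) \<omega> \<longrightarrow>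
        X t \<omega> = f (map (\<lambda>i. \<gamma> i \<omega>) [0..<Suc j]) t)"

section \<open>The backward stochastic Riccati equation\<close>

definition terminal_value :: "enat \<Rightarrow> real^'n^'n" where
  "terminal_value M = mat (case M of enat m \<Rightarrow> 1 / real m | \<infinity> \<Rightarrow> 0)"

definition pos_type :: "enat \<Rightarrow> real^'n^'n \<Rightarrow> bool" where
  "pos_type M X \<longleftrightarrow> (if M < \<infinity> then posdef X else possemidef X)"

text \<open>
  The integrand of the equation with respect to the compensator. The library's \<^term>\<open>matrix_inv\<close>
  is a choice of an inverse; solutions have \<^term>\<open>s + h\<close> positive semi-definite almost
  everywhere, so that \<^term>\<open>mat 1 + s + h\<close> is invertible there.
\<close>

definition jump_generator :: "real^'n^'n \<Rightarrow> real^'n^'n \<Rightarrow> real^'n^'n \<Rightarrow> real^'n^'n" where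
  "jump_generator c s h =
     (s ** transpose c - h) ** matrix_inv (mat 1 + s + h) ** (c ** s - h)"

definition compensated_integral ::
  "(real \<times> 'e) measure \<Rightarrow> (real \<times> 'e) measure \<Rightarrow> (real \<times> 'e) set \<Rightarrow> (real \<times> 'e \<Rightarrow> 'v::euclidean_space) \<Rightarrow> 'v"
where
  "compensated_integral \<mu> \<nu> S f = (LINT x:S|\<mu>. f x) - (LINT x:S|\<nu>. f x)"

definition riccati_solution ::
  "'w measure \<Rightarrow> real \<Rightarrow> nat \<Rightarrow> ('e::metric_space \<Rightarrow> real \<Rightarrow> real) \<Rightarrow> ('e \<Rightarrow> real \<Rightarrow> 'e measure) \<Rightarrow>
   (nat \<Rightarrow> 'w \<Rightarrow> ereal) \<Rightarrow> (nat \<Rightarrow> 'w \<Rightarrow> 'e) \<Rightarrow>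
   (real \<Rightarrow> 'w \<Rightarrow> real^'n^'n) \<Rightarrow> (real \<Rightarrow> 'w \<Rightarrow> real^'d^'n) \<Rightarrow> (real \<Rightarrow> 'e \<Rightarrow> 'w \<Rightarrow> real^'n^'n) \<Rightarrow>
   nat \<Rightarrow> enat \<Rightarrow> (real \<Rightarrow> 'w \<Rightarrow> real^'n^'n) \<Rightarrow> (real \<Rightarrow> 'e \<Rightarrow> 'w \<Rightarrow> real^'n^'n) \<Rightarrow> bool"
where
  "riccati_solution P T J lam Q \<tau> \<gamma> A B C N M \<Sigma> \<Theta> \<longleftrightarrow>
     \<Sigma> \<in> Linf_D P (mode_filtration (space P) \<tau> \<gamma>) T sym_mats \<and>
     \<Theta> \<in> Linf_q P (mode_filtration (space P) \<tau> \<gamma>) T (jump_measure J \<tau> \<gamma>) sym_mats \<and>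
     (AE (\<omega>, t) in P \<Otimes>\<^sub>M restrict_space lborel {0..T}. pos_type M (\<Sigma> t \<omega>)) \<and>
     (AE \<omega> in P. AE (t, \<theta>) in compensator J lam Q \<tau> \<gamma> \<omega>.
        t \<in> {0..T} \<longrightarrow> pos_type M (\<Sigma> t \<omega> + \<Theta> t \<theta> \<omega>)) \<and>
     (\<forall>\<omega>\<in>space P. \<forall>t\<in>{0..T}. (\<forall>j\<in>{1..J}. \<tau> j \<omega> \<noteq> ereal t) \<longrightarrow>
        continuous (at t within {0..T}) (\<lambda>s. \<Sigma> s \<omega>)) \<and>
     (AE \<omega> in P. \<forall>t\<in>{0..T}.
        terminal_value M - \<Sigma> t \<omega> =
          (LINT x:{t<..T} \<times> UNIV|compensator J lam Q \<tau> \<gamma> \<omega>.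
             jump_generator (C (fst x) (snd x) \<omega>) (\<Sigma> (fst x) \<omega>) (\<Theta> (fst x) (snd x) \<omega>))
          + compensated_integral (jump_measure J \<tau> \<gamma> \<omega>) (compensator J lam Q \<tau> \<gamma> \<omega>)
              ({t<..T} \<times> UNIV) (\<lambda>x. \<Theta> (fst x) (snd x) \<omega>)
          + (LINT r:{t<..T}|lborel. A r \<omega> ** \<Sigma> r \<omega> + \<Sigma> r \<omega> ** transpose (A r \<omega>)
                - real N *\<^sub>R (B r \<omega> ** transpose (B r \<omega>))))"

end

theory Submission
  imports Defs
begin

text \<open>
  Between two jumps the equation is a backward ordinary differential equation for \<open>\<Sigma>\<close>, whose driver is
  bounded on unit vectors by a multiple of \<open>norm (\<Sigma> *v v)\<close> (plus a constant from above). A Gronwall argument along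
  the smallest eigenvalue then gives the bounds on the event that no jump follows. The law of the next jump
  carries statements about \<open>\<Sigma>\<close> at the jump times to statements that hold almost everywhere for the compensator, and from the
  event without further jumps to all paths; a downward induction on the number of jumps compares two solutions.
  For existence, the equation is solved for every list of visited modes by recursion on the number of remaining jumps.
\<close>

text \<open>The estimates rest on \<open>U = \<Sigma> + \<Theta>\<close>, the value after a jump. In
  terms of \<open>\<Sigma>\<close> and \<open>U\<close> the quadratic form of the jump term is
  \<open>hq\<close>, where \<open>U\<close> enters only through \<open>res U\<close>, the inverse of
  \<open>I + U\<close>. As \<open>0 \<le> res U \<le> I\<close>, this form is bounded below by a
  multiple of \<open>- norm (\<Sigma> *v v)\<close>, which vanishes on the kernel of
  \<open>\<Sigma>\<close>; a bound by the norm of \<open>\<Sigma>\<close> alone would not keep the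
  positive cone invariant. As \<open>res\<close> is antitone, an order between values after the jump
  becomes an order between drivers. The obstacle is that \<open>\<Theta>\<close> is controlled only
  at the jumps or up to null sets of the compensator. The left limit of \<open>\<Sigma>\<close> plus
  \<open>\<Theta>\<close> is predictable and equals \<open>\<Sigma>\<close> at the jump times, so
  bounds on \<open>\<Sigma>\<close> there become bounds on \<open>\<Sigma> + \<Theta>\<close> for
  the compensator. Conversely, an adapted process between two jumps depends on the past alone, given
  which the absence of a jump up to \<open>T\<close> has positive probability; this connects
  \<open>\<Sigma>\<close> with its deterministic terminal value.\<close>

section \<open>Matrix norms, symmetric matrices and the positive semi-definite cone\<close>

lemma norm_matrix_vector_le: "norm (A *v x) <= norm A * norm (x :: real^'n)" for A :: "real^'n^'m"
proof -
 have "norm (A *v x) = L2_set (%i. norm ((A *v x) $ i)) UNIV"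
  by (simp add: norm_vec_def)
 also have "\<dots> <= L2_set (%i. norm (A $ i) * norm x) UNIV"
  by (rule L2_set_mono) (auto simp: matrix_vector_mul_component Cauchy_Schwarz_ineq2)
 also have "\<dots> = norm A * norm x"
  by (simp add: norm_vec_def[of A] L2_set_left_distrib)
 finally show ?thesis .
qed

lemma norm_transpose [simp]: "norm (transpose X) = norm (X :: real^'i^'j)"
proof -
 have "(\<Sum>i\<in>UNIV. \<Sum>j\<in>UNIV. (X $ j $ i)\<^sup>2) = (\<Sum>j\<in>UNIV. \<Sum>i\<in>UNIV. (X $ j $ i)\<^sup>2)"
  by (rule sum.swap)
 then show ?thesis
  by (simp add: norm_vec_def L2_set_def transpose_def sum_nonneg)
qed

text \<open>Row \<open>i\<close> of the product is \<open>transpose B\<close> applied to row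
  \<open>i\<close> of \<open>A\<close>, so the vector estimate applies row by row. The norm on
  matrices is the Frobenius norm, and it is submultiplicative with constant 1.\<close>

lemma norm_matrix_mult_le: "norm (A ** B) <= norm A * norm B"
 for A :: "real^'n^'m" and B :: "real^'k^'n"
proof -
 have row: "(A ** B) $ i = transpose B *v (A $ i)" for i
  by (simp add: matrix_matrix_mult_def vector_matrix_mult_def vec_eq_iff mult.commute)
 have le: "norm (transpose B *v (A $ i)) <= norm (A $ i) * norm B" for i
  by (metis norm_matrix_vector_le mult.commute norm_transpose)
 have "norm (A ** B) = L2_set (%i. norm ((A ** B) $ i)) UNIV"
  by (simp add: norm_vec_def)
 also have "\<dots> <= L2_set (%i. norm (A $ i) * norm B) UNIV"
  unfolding row by (rule L2_set_mono[OF le]) auto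
 also have "\<dots> = norm A * norm B"
  by (simp add: norm_vec_def[of A] L2_set_left_distrib)
 finally show ?thesis .
qed

lemma bounded_bilinear_matrix_mult:
 "bounded_bilinear ((**) :: real^'n^'m => real^'k^'n => real^'k^'m)"
proof
 show "\<exists>K. \<forall>(a :: real^'n^'m) (b :: real^'k^'n). norm (a ** b) <= norm a * norm b * K"
  by (intro exI[of _ 1]) (simp add: norm_matrix_mult_le)
qed (simp_all add: matrix_matrix_mult_def vec_eq_iff sum.distrib algebra_simps sum_distrib_left)

lemma bounded_bilinear_matrix_vector_mult:
 "bounded_bilinear ((*v) :: real^'n^'m => real^'n => real^'m)"
proof
 show "\<exists>K. \<forall>(a :: real^'n^'m) (b :: real^'n). norm (a *v b) <= norm a * norm b * K"
  by (intro exI[of _ 1]) (simp add: norm_matrix_vector_le)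
qed (simp_all add: algebra_simps scaleR_matrix_vector_assoc)

lemma bounded_linear_transpose: "bounded_linear (transpose :: real^'n^'m => real^'m^'n)"
proof (rule bounded_linear_intro[of _ 1])
 show "norm (transpose x) <= norm x * 1" for x :: "real^'n^'m" by simp
qed (auto simp: transpose_def vec_eq_iff)

text \<open>A quadratic form is linear in its matrix; this lets it pass through the matrix-valued
  integrals over modes and times.\<close>

lemma bounded_linear_quadratic: "bounded_linear (%X. v \<bullet> (X *v v))" for v :: "real^'n"
 by (rule bounded_linear_compose[OF bounded_linear_inner_right
    bounded_bilinear.bounded_linear_left[OF bounded_bilinear_matrix_vector_mult]])

lemma transpose_dot: "u \<bullet> (transpose X *v w) = w \<bullet> (X *v u)" for X :: "real^'n^'m"
 by (simp add: inner_commute[of u] dot_lmul_matrix)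

lemma sym_matsD': "X \<in> sym_mats ==> u \<bullet> (X *v w) = w \<bullet> (X *v u)"
 using transpose_dot[of u X w] by (simp add: sym_mats_def del: transpose_matrix_vector)

lemma sym_matsD: "X \<in> sym_mats ==> u \<bullet> (X *v w) = (X *v u) \<bullet> w"
 by (subst sym_matsD') (simp_all add: inner_commute)

lemma transpose_add: "transpose (X + Y) = transpose X + transpose Y"
 and transpose_diff: "transpose (X - Y) = transpose X - transpose Y"
 and transpose_scaleR: "transpose (c *\<^sub>R X) = c *\<^sub>R transpose X"
 and transpose_minus: "transpose (- X) = - transpose X"
 for X Y :: "real^'n^'m"
 by (auto simp: transpose_def vec_eq_iff)

lemma sym_mats_add: "X \<in> sym_mats ==> Y \<in> sym_mats ==> X + Y \<in> sym_mats"
 and sym_mats_diff: "X \<in> sym_mats ==> Y \<in> sym_mats ==> X - Y \<in> sym_mats"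
 and sym_mats_scaleR: "X \<in> sym_mats ==> c *\<^sub>R X \<in> sym_mats"
 and sym_mats_mat: "mat k \<in> sym_mats"
 and sym_mats_0: "0 \<in> sym_mats"
 by (auto simp: sym_mats_def transpose_add transpose_diff transpose_scaleR)
   (auto simp: transpose_def vec_eq_iff)

lemma closed_sym_mats: "closed sym_mats"
 unfolding sym_mats_def
 by (intro closed_Collect_eq continuous_intros linear_continuous_on bounded_linear_transpose)

lemma mat_vec: "mat k *v v = k *\<^sub>R v" for v :: "real^'n"
 by (simp add: vec_eq_iff matrix_vector_mult_def mat_def if_distrib[of "%x. x * _"] cong: if_cong)

lemma mat_eq_scaleR: "mat k = k *\<^sub>R (mat 1 :: real^'n^'n)"
 by (simp add: vec_eq_iff mat_def)

text \<open>The cone is an intersection of closed half spaces, one for each \<open>v\<close>.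
  Closedness is needed in the limit of the Euler scheme and whenever a property is carried along
  right limits.\<close>

lemma closed_possemidef: "closed {X :: real^'n^'n. possemidef X}"
proof -
 have "{X :: real^'n^'n. possemidef X} = sym_mats \<inter> (\<Inter>v. {X. 0 <= v \<bullet> (X *v v)})"
  by (auto simp: possemidef_def)
 then show ?thesis
  by (auto intro!: closed_Int closed_sym_mats closed_INT closed_Collect_le
    linear_continuous_on bounded_linear_quadratic)
qed

lemma possemidef_unit:
 assumes "X \<in> sym_mats" "\<And>v. norm v = 1 ==> 0 <= v \<bullet> (X *v v)"
 shows "possemidef X"
 unfolding possemidef_def
proof (intro conjI allI)
 show "0 <= v \<bullet> (X *v v)" for v
 proof (cases "v = 0")
  case False
  define u where "u = (1 / norm v) *\<^sub>R v"
  have u: "norm u = 1" "norm v *\<^sub>R u = v"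
   using False by (auto simp: u_def)
  have "v \<bullet> (X *v v) = (norm v)\<^sup>2 * (u \<bullet> (X *v u))"
   by (subst (1 2) u(2)[symmetric]) (simp add: matrix_vector_mult_scaleR power2_eq_square)
  then show ?thesis
   using assms(2)[OF u(1)] by simp
 qed simp
qed (fact assms(1))

lemma possemidefD: "possemidef X ==> X \<in> sym_mats" "possemidef X ==> 0 <= v \<bullet> (X *v v)"
 by (auto simp: possemidef_def)

text \<open>By polarisation: the numerical radius of a symmetric matrix bounds its operator
  norm.\<close>

lemma sym_mats_norm_le:
 fixes X :: "real^'n^'n"
 assumes X: "X \<in> sym_mats" and e: "\<And>v. \<bar>v \<bullet> (X *v v)\<bar> <= e * (v \<bullet> v)"
 shows "norm (X *v w) <= e * norm w"
proof -
 have e0: "0 <= e * (v \<bullet> v)" for v :: "real^'n" using e[of v] by linarith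
 have *: "4 * (u \<bullet> (X *v w)) <= 2 * e * (u \<bullet> u + w \<bullet> w)" for u w
 proof -
  have "(u + w) \<bullet> (X *v (u + w)) - (u - w) \<bullet> (X *v (u - w)) = 2 * (u \<bullet> (X *v w) + w \<bullet> (X *v u))"
   by (simp add: algebra_simps)
  moreover have "u \<bullet> (X *v w) = w \<bullet> (X *v u)" by (rule sym_matsD'[OF X])
  moreover have "(u + w) \<bullet> (u + w) + (u - w) \<bullet> (u - w) = 2 * (u \<bullet> u + w \<bullet> w)"
   by (simp add: algebra_simps inner_commute)
  ultimately show ?thesis
   using e[of "u + w"] e[of "u - w"] unfolding abs_le_iff
   by (smt (verit, best) distrib_left mult.assoc mult.commute)
 qed
 show ?thesis
 proof (cases "X *v w = 0 \<or> w = 0")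
  case True
  then show ?thesis
   using e0[of w] by (cases "w = 0") (auto simp: dot_square_norm zero_le_mult_iff)
 next
  case False
  then have n: "norm (X *v w) > 0" "norm w > 0" by auto
  \<comment> \<open>The direction of \<open>X *v w\<close> at the length of \<open>w\<close>: then
    both squares in the polarised bound equal \<open>w \<bullet> w\<close>, and no factor is
    lost.\<close>
  define u where "u = (norm w / norm (X *v w)) *\<^sub>R (X *v w)"
  have "norm u = norm w" using n by (simp add: u_def)
  then have uu: "u \<bullet> u = w \<bullet> w" by (metis norm_eq)
  have "u \<bullet> (X *v w) = norm w * norm (X *v w)"
   using n by (simp add: u_def dot_square_norm power2_eq_square)
  then have "norm w * norm (X *v w) <= e * (w \<bullet> w)"
   using *[of u w] uu by simp
  then have "norm w * norm (X *v w) <= norm w * (e * norm w)"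
   by (simp add: dot_square_norm power2_eq_square ac_simps)
  then show ?thesis using n by simp
 qed
qed

text \<open>The columns are the images of the unit vectors, and the Euclidean norm of the column
  norms is at most their sum; hence the factor \<open>CARD('n)\<close>.\<close>

lemma norm_matrix_le_of_vector:
 fixes X :: "real^'n^'n"
 assumes "\<And>w. norm (X *v w) <= e * norm w"
 shows "norm X <= real CARD('n) * e"
proof -
 have col: "norm (transpose X $ j) <= e" for j
 proof -
  have "transpose X $ j = X *v axis j 1"
   by (simp add: transpose_def matrix_vector_mult_basis column_def)
  then show ?thesis using assms[of "axis j 1"] by (simp add: norm_axis_1)
 qed
 have "norm X = norm (transpose X)" by simp
 also have "\<dots> <= (\<Sum>j\<in>UNIV. norm (transpose X $ j))"
  unfolding norm_vec_def[of "transpose X"] by (rule L2_set_le_sum) auto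
 also have "\<dots> <= (\<Sum>j\<in>(UNIV :: 'n set). e)" by (intro sum_mono col)
 finally show ?thesis by simp
qed

section \<open>The resolvent\<close>

text \<open>The inverse that occurs in \<open>jump_generator\<close>. Since
  \<open>matrix_inv\<close> is a choice, every property below is stated for positive semi-definite
  \<open>U\<close>, where \<open>I + U\<close> is invertible.\<close>

definition res :: "real^'n^'n => real^'n^'n" where
 "res U = matrix_inv (mat 1 + U)"

text \<open>A kernel vector \<open>x\<close> of \<open>I + U\<close> satisfies
  \<open>x \<bullet> x + x \<bullet> (U *v x) = 0\<close>, a sum of two nonnegative terms.\<close>

lemma res_inverse:
 assumes "possemidef U"
 shows "(mat 1 + U) ** res U = mat 1" "res U ** (mat 1 + U) = mat 1"
proof -
 have "inj ((*v) (mat 1 + U))"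
 proof (rule injI)
  fix x y assume "(mat 1 + U) *v x = (mat 1 + U) *v y"
  then have "(x - y) \<bullet> ((mat 1 + U) *v (x - y)) = 0"
   by (simp add: algebra_simps)
  then have "(x - y) \<bullet> (x - y) + (x - y) \<bullet> (U *v (x - y)) = 0"
   by (simp only: matrix_vector_mult_add_rdistrib matrix_vector_mul_lid inner_add_right)
  then show "x = y"
   using possemidefD(2)[OF assms, of "x - y"]
   by (metis add_nonneg_eq_0_iff eq_iff_diff_eq_0 inner_eq_zero_iff inner_ge_zero)
 qed
 then have "\<exists>B. B ** (mat 1 + U) = mat 1"
  using matrix_left_invertible_injective by blast
 then have "invertible (mat 1 + U)"
  by (meson invertible_def matrix_left_right_inverse)
 then show "(mat 1 + U) ** res U = mat 1" "res U ** (mat 1 + U) = mat 1"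
  unfolding res_def matrix_inv_def invertible_def
  by (metis (mono_tags, lifting) someI)+
qed

lemma res_vec:
 assumes "possemidef U"
 shows "res U *v x + U *v (res U *v x) = x" "res U *v (x + U *v x) = x"
proof -
 have "(mat 1 + U) *v (res U *v x) = x" "res U *v ((mat 1 + U) *v x) = x"
  by (simp_all add: matrix_vector_mul_assoc res_inverse[OF assms] del: matrix_vector_mul_assoc[symmetric])
 then show "res U *v x + U *v (res U *v x) = x" "res U *v (x + U *v x) = x"
  by (simp_all add: matrix_vector_mult_add_rdistrib)
qed

lemma res_sym:
 assumes U: "possemidef U"
 shows "res U \<in> sym_mats"
proof -
 have "x \<bullet> (res U *v y) = y \<bullet> (res U *v x)" for x y
 proof -
  have "x \<bullet> (res U *v y) = (res U *v x + U *v (res U *v x)) \<bullet> (res U *v y)"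
   by (simp add: res_vec[OF U])
  also have "\<dots> = (res U *v y + U *v (res U *v y)) \<bullet> (res U *v x)"
  proof -
   have "(a + U *v a) \<bullet> b = a \<bullet> b + b \<bullet> (U *v a)" for a b
    by (simp add: inner_add_left inner_add_right inner_commute)
   then show ?thesis
    using sym_matsD'[OF possemidefD(1)[OF U], of "res U *v x" "res U *v y"]
    by (metis inner_commute)
  qed
  finally show ?thesis by (simp add: res_vec[OF U])
 qed
 then have "x \<bullet> (transpose (res U) *v y) = x \<bullet> (res U *v y)" for x y
  by (simp only: transpose_dot)
 then have "transpose (res U) *v y = res U *v y" for y
  by (metis vector_eq_ldot)
 then show ?thesis unfolding sym_mats_def by (simp only: matrix_eq mem_Collect_eq) simp
qed

text \<open>With \<open>y = res U *v x\<close> one has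
  \<open>x \<bullet> y = y \<bullet> y + y \<bullet> (U *v y)\<close>, which is at least the square
  of \<open>norm y\<close>; everything else is Cauchy-Schwarz.\<close>

lemma res_bounds:
 assumes U: "possemidef U"
 shows "norm (res U *v x) <= norm x" "0 <= x \<bullet> (res U *v x)" "x \<bullet> (res U *v x) <= x \<bullet> x"
proof -
 define y where "y = res U *v x"
 have x: "x = y + U *v y" by (simp add: y_def res_vec[OF U])
 have p: "0 <= y \<bullet> (U *v y)" by (rule possemidefD[OF U])
 have xy: "x \<bullet> y = y \<bullet> y + y \<bullet> (U *v y)"
  using x by (metis inner_add_right inner_commute)
 then have "norm y * norm y <= x \<bullet> y" using p by (simp add: dot_square_norm power2_eq_square)
 also have le: "x \<bullet> y <= norm x * norm y" by (rule norm_cauchy_schwarz)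
 finally have n: "norm y <= norm x"
  by (metis mult_right_le_imp_le norm_ge_zero norm_le_zero_iff less_eq_real_def)
 then show "norm (res U *v x) <= norm x" by (simp add: y_def)
 show "0 <= x \<bullet> (res U *v x)" using xy p by (simp add: y_def)
 have "norm x * norm y <= norm x * norm x" using n by (simp add: mult_left_mono)
 then show "x \<bullet> (res U *v x) <= x \<bullet> x"
  using le by (simp add: y_def dot_square_norm power2_eq_square)
qed

text \<open>The identity \<open>*\<close> is the second resolvent identity and measures the gap. The
  identity \<open>**\<close> writes the same gap as a sum of three nonnegative terms and gives its
  sign; positivity of \<open>U1 - U2\<close> is not visible from \<open>*\<close>, where two
  different vectors occur.\<close>

lemma res_diff:
 assumes U1: "possemidef U1" and U2: "possemidef U2" and U12: "possemidef (U1 - U2)"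
 shows "x \<bullet> (res U1 *v x) <= x \<bullet> (res U2 *v x)"
  and "(\<And>v. v \<bullet> ((U1 - U2) *v v) <= e * (v \<bullet> v)) ==>
     x \<bullet> (res U2 *v x) - x \<bullet> (res U1 *v x) <= e * (x \<bullet> x)"
proof -
 define y1 y2 where "y1 = res U1 *v x" and "y2 = res U2 *v x"
 have x: "x = y1 + U1 *v y1" "x = y2 + U2 *v y2" by (simp_all add: y1_def y2_def res_vec[OF U1] res_vec[OF U2])
 have s: "y2 \<bullet> (U1 *v y1) = y1 \<bullet> (U1 *v y2)" "y2 \<bullet> (U2 *v y1) = y1 \<bullet> (U2 *v y2)"
  by (rule sym_matsD'[OF possemidefD(1)], fact)+
 have *: "x \<bullet> y2 - x \<bullet> y1 = y2 \<bullet> ((U1 - U2) *v y1)"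
 proof -
  have "x \<bullet> y2 = y1 \<bullet> y2 + (U1 *v y1) \<bullet> y2" using x(1) by (metis inner_add_left)
  moreover have "x \<bullet> y1 = y2 \<bullet> y1 + (U2 *v y2) \<bullet> y1" using x(2) by (metis inner_add_left)
  ultimately show ?thesis using s
   by (simp add: matrix_vector_mult_diff_rdistrib inner_diff_right inner_commute)
 qed
 have **: "x \<bullet> y2 - x \<bullet> y1 = y1 \<bullet> ((U1 - U2) *v y1) + ((y2 - y1) \<bullet> (y2 - y1) + (y2 - y1) \<bullet> (U2 *v (y2 - y1)))"
 proof -
  have e: "(y2 - y1) + U2 *v (y2 - y1) = (U1 - U2) *v y1"
   using x by (simp add: algebra_simps)
  have "(y2 - y1) \<bullet> (y2 - y1) + (y2 - y1) \<bullet> (U2 *v (y2 - y1)) = (y2 - y1) \<bullet> ((U1 - U2) *v y1)"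
   by (metis e inner_add_right)
  then show ?thesis using * by (simp add: inner_diff_left)
 qed
 show "x \<bullet> (res U1 *v x) <= x \<bullet> (res U2 *v x)"
  using ** possemidefD(2)[OF U12, of y1] possemidefD(2)[OF U2, of "y2 - y1"] inner_ge_zero[of "y2 - y1"]
  unfolding y1_def y2_def by linarith
 assume e: "\<And>v. v \<bullet> ((U1 - U2) *v v) <= e * (v \<bullet> v)"
 have "norm ((U1 - U2) *v y1) <= e * norm y1"
  using e possemidefD(2)[OF U12] by (intro sym_mats_norm_le possemidefD(1)[OF U12]) auto
 \<comment> \<open>The hypothesis on \<open>e\<close> yields its sign only when tested on a nonzero
   vector.\<close>
 moreover have e0: "0 <= e" if "x \<noteq> 0"
  using e[of x] possemidefD(2)[OF U12, of x] that
  by (metis inner_gt_zero_iff linorder_not_less mult_less_0_iff order_trans)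
 moreover have "norm y1 <= norm x" "norm y2 <= norm x"
  unfolding y1_def y2_def by (rule res_bounds, fact)+
 ultimately have "y2 \<bullet> ((U1 - U2) *v y1) <= norm x * (e * norm x)" if "x \<noteq> 0"
  using that by (intro order.trans[OF norm_cauchy_schwarz] mult_mono)
    (auto intro: order.trans mult_left_mono)
 then have "y2 \<bullet> ((U1 - U2) *v y1) <= e * (x \<bullet> x)"
  by (cases "x = 0") (auto simp: y1_def dot_square_norm power2_eq_square ac_simps)
 then show "x \<bullet> (res U2 *v x) - x \<bullet> (res U1 *v x) <= e * (x \<bullet> x)"
  using * by (simp add: y1_def y2_def)
qed

section \<open>Comparison for backward matrix equations\<close>

text \<open>
 Near the boundary of the cone, the increment of \<open>X\<close> over a step of length \<open>h\<close> is bounded below by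
 \<open>2 h w \<bullet> X v\<close> with bounded \<open>w\<close>, and \<open>v \<bullet> Y v + 2 h w \<bullet> Y v + h\<^sup>2 w \<bullet> Y w \<ge> 0\<close> for
 \<open>Y = X + m I \<ge> 0\<close>. Thus each step of a backward Euler scheme loses only \<open>O(h\<^sup>2)\<close>.
\<close>

lemma euler_step:
 fixes X0 Xr :: "real^'n^'n"
 assumes Y: "possemidef (X0 + mat m)" and v: "norm v = 1" and h: "0 < h"
  and k: "0 <= k" and m: "0 <= m" and b: "norm X0 + m * norm (mat 1 :: real^'n^'n) <= b"
  and d: "norm (Xr - X0) <= c * h"
 shows "- k * norm (Xr *v v) \<ge> - (1 / h) * (v \<bullet> (X0 *v v) + m) - k * m - (k\<^sup>2 * b + k * c) * h"
proof -
 define Y where "Y = X0 + mat m"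
 define z where "z = Y *v v"
 \<comment> \<open>Among vectors of length at most \<open>k / 2\<close> this one minimises
   \<open>w \<bullet> z\<close>; it turns the norm in \<open>- k * norm z\<close> into the linear
   expression \<open>2 * (w \<bullet> z)\<close>, to which positivity of \<open>Y\<close> at
   \<open>v + h *\<^sub>R w\<close> can be applied.\<close>
 define w where "w = (if z = 0 then 0 else - (k / 2 / norm z) *\<^sub>R z)"
 have nw: "norm w <= k / 2" using k by (simp add: w_def)
 have wz: "2 * (w \<bullet> z) = - k * norm z"
  by (simp add: w_def dot_square_norm power2_eq_square)
 have nY: "norm Y <= b"
 proof -
  have "norm Y <= norm X0 + norm (mat m :: real^'n^'n)" unfolding Y_def by (rule norm_triangle_ineq)
  then show ?thesis using b m by (simp add: mat_eq_scaleR[of m])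
 qed
 have Ysym: "Y \<in> sym_mats" using possemidefD(1)[OF Y] by (simp add: Y_def)
 have "0 <= (v + h *\<^sub>R w) \<bullet> (Y *v (v + h *\<^sub>R w))" using possemidefD(2)[OF Y] by (simp add: Y_def)
 also have "\<dots> = v \<bullet> z + h * (2 * (w \<bullet> z)) + h\<^sup>2 * (w \<bullet> (Y *v w))"
  using sym_matsD'[OF Ysym, of v w]
  by (simp add: z_def matrix_vector_right_distrib matrix_vector_mult_scaleR inner_add_left inner_add_right
    algebra_simps power2_eq_square)
 finally have 1: "0 <= v \<bullet> z - h * (k * norm z) + h\<^sup>2 * (w \<bullet> (Y *v w))" by (simp add: wz)
 have "w \<bullet> (Y *v w) <= norm w * (norm Y * norm w)"
  by (intro order.trans[OF norm_cauchy_schwarz] mult_left_mono norm_matrix_vector_le) auto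
 also have "\<dots> <= k * (b * k)"
  using nw nY k order.trans[OF norm_ge_zero nY] by (intro mult_mono) auto
 finally have "h\<^sup>2 * (w \<bullet> (Y *v w)) <= h\<^sup>2 * (k * (b * k))" by (intro mult_left_mono) auto
 with 1 have "h * (k * norm z) <= v \<bullet> z + h\<^sup>2 * (k\<^sup>2 * b)" by (simp add: power2_eq_square ac_simps)
 then have 2: "k * norm z <= (1 / h) * (v \<bullet> z) + h * (k\<^sup>2 * b)"
  using h by (simp add: field_simps power2_eq_square)
 have vz: "v \<bullet> z = v \<bullet> (X0 *v v) + m"
  using v by (simp add: z_def Y_def matrix_vector_mult_add_rdistrib mat_vec inner_add_right norm_eq_1)
 \<comment> \<open>Passing from \<open>Y\<close> back to \<open>Xr\<close> costs \<open>m\<close>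
   for the added multiple of the identity and \<open>c * h\<close> for the distance between the two
   times.\<close>
 have "norm (Xr *v v) <= norm z + m + c * h"
 proof -
  have "Xr *v v = z + (Xr - X0) *v v - m *\<^sub>R v"
   by (simp add: z_def Y_def matrix_vector_mult_add_rdistrib matrix_vector_mult_diff_rdistrib mat_vec)
  also have "norm \<dots> <= norm z + norm ((Xr - X0) *v v) + norm (m *\<^sub>R v)"
   by (intro order.trans[OF norm_triangle_ineq4] add_right_mono norm_triangle_ineq)
  finally show ?thesis
   using norm_matrix_vector_le[of "Xr - X0" v] d v m by simp
 qed
 then have "k * norm (Xr *v v) <= k * norm z + k * m + k * c * h"
  using k by (metis distrib_left mult.assoc mult_left_mono)
 then show ?thesis using 2 unfolding vz by (simp add: algebra_simps)
qed

text \<open>Discrete Gronwall estimate: each of the \<open>i\<close> steps contributes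
  \<open>c * h\<^sup>2\<close>, amplified by at most \<open>exp (k * h * i)\<close>.\<close>

lemma euler_gronwall:
 fixes m :: "nat => real"
 assumes "m 0 = 0" "\<And>i. i < n ==> m (Suc i) <= (1 + k * h) * m i + c * h\<^sup>2"
  and "0 <= k" "0 <= h" "0 <= c"
 shows "i <= n ==> m i <= real i * (exp (k * h * real i) * c * h\<^sup>2)"
proof (induction i)
 case (Suc i)
 have e: "1 + k * h <= exp (k * h)" by (rule exp_ge_add_one_self)
 have kh: "0 <= k * h" using assms by simp
 have "m (Suc i) <= (1 + k * h) * m i + c * h\<^sup>2" using assms(2) Suc by simp
 also have "\<dots> <= (1 + k * h) * (real i * (exp (k * h * real i) * c * h\<^sup>2)) + c * h\<^sup>2"
  using Suc kh by (intro add_right_mono mult_left_mono) auto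
 also have "\<dots> <= exp (k * h) * (real i * (exp (k * h * real i) * c * h\<^sup>2)) + exp (k * h * real (Suc i)) * (c * h\<^sup>2)"
 proof (rule add_mono)
  show "c * h\<^sup>2 <= exp (k * h * real (Suc i)) * (c * h\<^sup>2)"
  proof -
   have "1 * (c * h\<^sup>2) <= exp (k * h * real (Suc i)) * (c * h\<^sup>2)"
    using assms(3-5) by (intro mult_right_mono) auto
   then show ?thesis by simp
  qed
 qed (use assms e in \<open>auto intro!: mult_right_mono\<close>)
 also have "\<dots> = real (Suc i) * (exp (k * h * real (Suc i)) * c * h\<^sup>2)"
  by (simp add: exp_add[symmetric] algebra_simps)
 finally show ?case .
qed (use assms in simp)

lemma set_integrable_const_Ioc: "set_integrable lborel {s<..t :: real} (%_. q :: 'v::euclidean_space)"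
 unfolding set_integrable_def
 by (intro integrable_scaleR_left integrable_real_indicator emeasure_bounded_finite
   bounded_subset[OF compact_imp_bounded[OF compact_Icc[of s t]]]) auto

text \<open>A driver bounded below by \<open>- k * norm (X v)\<close> cannot push \<open>X\<close>
  out of the cone, because at a boundary direction \<open>X v = 0\<close> the bound is zero. The
  Euler steps replace a differentiation of the smallest eigenvalue. In each step \<open>v\<close> is
  fixed before integrating, so the null set in \<open>low\<close> may depend on
  \<open>v\<close>.\<close>

lemma backward_comparison:
 fixes X :: "real => real^'n^'n"
 assumes aT: "a <= T"
  and sym: "\<And>t. t \<in> {a..T} ==> X t \<in> sym_mats"
  and lip: "\<And>s t. s \<in> {a..T} ==> t \<in> {a..T} ==> norm (X s - X t) <= c * \<bar>s - t\<bar>"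
  and eq: "\<And>v s t. norm v = 1 ==> a <= s ==> s < t ==> t <= T ==>
   set_integrable lborel {s<..t} (\<phi> v) & (LINT r:{s<..t}|lborel. \<phi> v r) <= v \<bullet> (X s *v v) - v \<bullet> (X t *v v)"
  and low: "\<And>v. norm v = 1 ==> AE r in lborel. r \<in> {a<..T} --> - k * norm (X r *v v) <= \<phi> v r"
  and k: "0 <= k" and T: "possemidef (X T)"
  and t: "t \<in> {a..T}"
 shows "possemidef (X t)"
proof (cases "t = T")
 case False
 have tT: "t < T" "a <= t" using False t by auto
 have c: "0 <= c" using lip[of t T] tT norm_ge_zero[of "X t - X T"]
  by (smt (verit, ccfv_SIG) atLeastAtMost_iff mult_nonneg_nonpos2 zero_le_mult_iff)
 define n1 where "n1 = norm (mat 1 :: real^'n^'n)"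
 have n1: "0 < n1" unfolding n1_def
  by (metis mat_0 mat_eq_scaleR mat_vec matrix_vector_mult_0 norm_axis_1 norm_zero scaleR_one zero_less_norm_iff zero_neq_one matrix_vector_mul_lid)
 \<comment> \<open>A bound for \<open>X s + mat m\<close> that is uniform in \<open>s\<close> and in
   \<open>m \<le> 1\<close>, so that the error constant \<open>c'\<close> is the same in all
   steps.\<close>
 define b where "b = norm (X T) + c * (T - a) + n1"
 have Xb: "norm (X s) <= b - n1" if "s \<in> {a..T}" for s
 proof -
  have "norm (X s) <= norm (X T) + norm (X s - X T)" by norm
  also have "norm (X s - X T) <= c * \<bar>s - T\<bar>" using lip[of s T] that aT by auto
  also have "\<dots> <= c * (T - a)" using that c by (intro mult_left_mono) auto
  finally show ?thesis by (simp add: b_def)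
 qed
 have b0: "0 <= b" using Xb[of T] aT norm_ge_zero[of "X T"] n1 by (simp add: b_def)
 define c' where "c' = k\<^sup>2 * b + k * c"
 have c'0: "0 <= c'" using k b0 c by (simp add: c'_def)
 \<comment> \<open>One step backwards in time: a defect \<open>m\<close> at \<open>s + h\<close>,
   meaning that \<open>X (s + h) + mat m\<close> is positive semi-definite, grows to
   \<open>(1 + k * h) * m + c' * h\<^sup>2\<close> at \<open>s\<close>.\<close>
 have step: "possemidef (X s + mat ((1 + k * h) * m + c' * h\<^sup>2))"
  if s: "a <= s" "0 < h" "s + h <= T" and m: "0 <= m" "m <= 1" and p: "possemidef (X (s + h) + mat m)" for s h m
 proof (rule possemidef_unit)
  show "X s + mat ((1 + k * h) * m + c' * h\<^sup>2) \<in> sym_mats"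
   using s by (intro sym_mats_add sym_mats_mat sym) auto
  fix v :: "real^'n" assume v: "norm v = 1"
  define X0 where "X0 = X (s + h)"
  define q where "q = - (1 / h) * (v \<bullet> (X0 *v v) + m) - k * m - c' * h"
  have int: "set_integrable lborel {s<..s + h} (\<phi> v)"
   and le: "(LINT r:{s<..s + h}|lborel. \<phi> v r) <= v \<bullet> (X s *v v) - v \<bullet> (X0 *v v)"
   using eq[OF v, of s "s + h"] s by (auto simp: X0_def)
  have "AE r in lborel. r \<in> {s<..s + h} --> q <= \<phi> v r"
   using low[OF v]
  proof eventually_elim
   case (elim r)
   show ?case
   proof
    assume r: "r \<in> {s<..s + h}"
    have "m * n1 <= 1 * n1" using m n1 by (intro mult_right_mono) auto
    then have "norm X0 + m * norm (mat 1 :: real^'n^'n) <= b"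
     using Xb[of "s + h"] s by (simp add: X0_def n1_def[symmetric])
    moreover have "norm (X r - X0) <= c * h"
    proof -
     have "norm (X r - X0) <= c * \<bar>r - (s + h)\<bar>" unfolding X0_def using r s by (intro lip) auto
     also have "\<dots> <= c * h" using r c by (intro mult_left_mono) auto
     finally show ?thesis .
    qed
    ultimately have "q <= - k * norm (X r *v v)"
     unfolding q_def c'_def using euler_step[of X0 m v h k b "X r" c] p v s m k by (simp add: X0_def)
    then show "q <= \<phi> v r" using elim r s by auto
   qed
  qed
  then have "(LINT r:{s<..s + h}|lborel. q) <= (LINT r:{s<..s + h}|lborel. \<phi> v r)"
   using int by (intro set_integral_mono_AE set_integrable_const_Ioc) auto
  moreover have "(LINT r:{s<..s + h}|lborel. q) = h * q"
   using s by (simp add: set_lebesgue_integral_def)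
  moreover have "h * q = - (v \<bullet> (X0 *v v) + m) - k * m * h - c' * h\<^sup>2"
   using s by (simp add: q_def field_simps power2_eq_square)
  ultimately have "0 <= v \<bullet> (X s *v v) + m + k * m * h + c' * h\<^sup>2" using le by simp
  then show "0 <= v \<bullet> ((X s + mat ((1 + k * h) * m + c' * h\<^sup>2)) *v v)"
   using v by (simp add: matrix_vector_mult_add_rdistrib mat_vec inner_add_right norm_eq_1 algebra_simps)
 qed
 \<comment> \<open>The bound on the defect at \<open>t\<close> after \<open>n\<close> steps of
   length \<open>(T - t) / n\<close>: \<open>n\<close> errors of order \<open>1 / n\<^sup>2\<close>,
   so it tends to zero. The smallness \<open>e n \<le> 1\<close> keeps all intermediate defects
   within the range allowed in \<open>step\<close>.\<close>
 define e where "e = (%n. (T - t)\<^sup>2 * exp (k * (T - t)) * c' / real n)"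
 have lim: "e \<longlonglongrightarrow> 0" unfolding e_def by real_asymp
 have fin: "possemidef (X t + mat (e n))" if n: "0 < n" "e n <= 1" for n
 proof -
  define h where "h = (T - t) / real n"
  have h: "0 < h" "h * real n = T - t" using n tT by (auto simp: h_def)
  define m where "m = rec_nat (0 :: real) (%_ x. (1 + k * h) * x + c' * h\<^sup>2)"
  have m0: "m 0 = 0" and mS: "m (Suc i) = (1 + k * h) * m i + c' * h\<^sup>2" for i by (simp_all add: m_def)
  have mpos: "0 <= m i" for i by (induction i) (use k h c'0 in \<open>simp_all add: m0 mS\<close>)
  have me: "m i <= e n" if "i <= n" for i
  proof -
   have "m i <= real i * (exp (k * h * real i) * c' * h\<^sup>2)"
    by (rule euler_gronwall[where n = n]) (use m0 mS k h c'0 that in auto)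
   also have "\<dots> <= real n * (exp (k * h * real n) * c' * h\<^sup>2)"
    using that k h c'0 by (intro mult_mono mult_right_mono) (auto intro!: mult_left_mono mult_nonneg_nonneg)
   also have "\<dots> = e n"
   proof -
    have "k * h * real n = k * (T - t)" using h by (simp add: mult.assoc)
    moreover have "real n * h\<^sup>2 = (T - t)\<^sup>2 / real n"
     using n by (simp add: h_def power2_eq_square)
    ultimately show ?thesis by (simp add: e_def mult.left_commute[of "real n"] mult.assoc)
   qed
   finally show ?thesis .
  qed
  have "i <= n ==> possemidef (X (T - h * real i) + mat (m i))" for i
  proof (induction i)
   case 0
   then show ?case using T by (simp add: m0 mat_eq_scaleR[of 0])
  next
   case (Suc i)
   have hi: "h * real (Suc i) <= T - t" using Suc(2) h by (metis mult_left_mono less_imp_le of_nat_le_iff)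
   show ?case unfolding mS
    by (rule step) (use Suc hi tT h mpos me[of i] n in \<open>auto simp: algebra_simps\<close>)
  qed
  from this[of n] have p: "possemidef (X t + mat (m n))" using h by simp
  show ?thesis
   unfolding possemidef_def
  proof (intro conjI allI)
   show "X t + mat (e n) \<in> sym_mats" by (intro sym_mats_add sym_mats_mat sym t)
   fix v :: "real^'n"
   have "m n * (v \<bullet> v) <= e n * (v \<bullet> v)" using me[of n] by (intro mult_right_mono) auto
   then show "0 <= v \<bullet> ((X t + mat (e n)) *v v)"
    using possemidefD(2)[OF p, of v]
    by (simp add: matrix_vector_mult_add_rdistrib mat_vec inner_add_right)
  qed
 qed
 have "(%n. X t + e n *\<^sub>R mat 1) \<longlonglongrightarrow> X t + 0 *\<^sub>R mat 1"
  by (intro tendsto_intros lim)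
 moreover have "\<forall>\<^sub>F n in sequentially. X t + e n *\<^sub>R mat 1 \<in> {X. possemidef X}"
  using order_tendstoD(2)[OF lim zero_less_one] eventually_gt_at_top[of 0]
  by eventually_elim (use fin in \<open>auto simp: mat_eq_scaleR[of "e _"]\<close>)
 ultimately show ?thesis
  using Lim_in_closed_set[OF closed_possemidef] by fastforce
qed (use T in simp)

text \<open>An absolutely continuous symmetric function with essentially bounded density, written
  backwards: \<open>\<Psi>\<close> is minus the derivative of \<open>S\<close>. Only the integrated
  form is kept, since the drivers are merely measurable in time.\<close>

definition backward_ode :: "real => real => (real => real^'n^'n) => (real => real^'n^'n) => bool" where
 "backward_ode a T S \<Psi> \<longleftrightarrow>
   set_integrable lborel {a<..T} \<Psi> & (\<exists>c\<ge>0. AE r in lborel. r \<in> {a<..T} --> norm (\<Psi> r) <= c) &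
   (\<forall>t\<in>{a..T}. S t \<in> sym_mats) &
   (\<forall>s t. a <= s --> s <= t --> t <= T --> S s - S t = (LINT r:{s<..t}|lborel. \<Psi> r))"

lemma set_lebesgue_integral_Ioc_norm_le:
 fixes f :: "real => 'v::euclidean_space"
 assumes f: "set_integrable lborel {s<..t} f" and st: "s <= t"
  and c: "AE r in lborel. r \<in> {s<..t} --> norm (f r) <= c"
 shows "norm (LINT r:{s<..t}|lborel. f r) <= c * (t - s)"
proof -
 have "norm (LINT r:{s<..t}|lborel. f r) <= (LINT r:{s<..t}|lborel. norm (f r))"
  by (rule set_integral_norm_bound[OF f])
 also have "\<dots> <= (LINT r:{s<..t}|lborel. c)"
  using c by (intro set_integral_mono_AE set_integrable_norm f set_integrable_const_Ioc) auto
 also have "\<dots> = c * (t - s)" using st by (simp add: set_lebesgue_integral_def mult.commute)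
 finally show ?thesis .
qed

lemma backward_ode_lipschitz:
 assumes "backward_ode a T S \<Psi>"
 obtains c where "0 <= c" "\<And>s t. s \<in> {a..T} ==> t \<in> {a..T} ==> norm (S s - S t) <= c * \<bar>s - t\<bar>"
proof -
 obtain c where c: "0 <= c" "AE r in lborel. r \<in> {a<..T} --> norm (\<Psi> r) <= c"
  using assms by (auto simp: backward_ode_def)
 have *: "norm (S s - S t) <= c * (t - s)" if "a <= s" "s <= t" "t <= T" for s t
 proof -
  have "S s - S t = (LINT r:{s<..t}|lborel. \<Psi> r)" using assms that by (auto simp: backward_ode_def)
  also have "norm \<dots> <= c * (t - s)"
  proof (rule set_lebesgue_integral_Ioc_norm_le)
   show "set_integrable lborel {s<..t} \<Psi>"
    by (rule set_integrable_subset[of _ "{a<..T}"]) (use assms that in \<open>auto simp: backward_ode_def\<close>)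
   show "AE r in lborel. r \<in> {s<..t} --> norm (\<Psi> r) <= c"
    using c(2) by eventually_elim (use that in auto)
  qed (use that in simp)
  finally show ?thesis .
 qed
 have "norm (S s - S t) <= c * \<bar>s - t\<bar>" if "s \<in> {a..T}" "t \<in> {a..T}" for s t
  using *[of s t] *[of t s] that norm_minus_commute[of "S s" "S t"] by (cases "s <= t") auto
 then show ?thesis using that c(1) by blast
qed

text \<open>The scalar solution of the backward equation whose driver is \<open>k\<close> times the
  solution. It serves as a barrier in the comparisons and as the weight of the fixed point
  argument.\<close>

lemma exp_backward_ode:
 fixes m k T :: real
 assumes "s <= t"
 shows "set_integrable lborel {s<..t} (%r. k * (m * exp (k * (T - r))))"
  and "(LINT r:{s<..t}|lborel. k * (m * exp (k * (T - r)))) = m * exp (k * (T - s)) - m * exp (k * (T - t))"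
proof -
 have c: "continuous_on {s..t} (%r. k * (m * exp (k * (T - r))))" by (intro continuous_intros)
 have i: "set_integrable lborel {s..t} (%r. k * (m * exp (k * (T - r))))"
  using borel_integrable_compact[OF compact_Icc c] by (simp add: set_integrable_def indicator_def if_distrib cong: if_cong)
 then show "set_integrable lborel {s<..t} (%r. k * (m * exp (k * (T - r))))"
  by (rule set_integrable_subset) auto
 have "(LINT r:{s<..t}|lborel. k * (m * exp (k * (T - r)))) = (LINT r:{s..t}|lborel. k * (m * exp (k * (T - r))))"
  unfolding set_lebesgue_integral_def
 proof (rule integral_cong_AE)
  show "AE r in lborel. indicator {s<..t} r *\<^sub>R (k * (m * exp (k * (T - r)))) =
    indicator {s..t} r *\<^sub>R (k * (m * exp (k * (T - r))))"
   using AE_lborel_singleton[of s] by eventually_elim (auto simp: indicator_def)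
 qed measurable
 also have "\<dots> = - (m * exp (k * (T - t))) - - (m * exp (k * (T - s)))"
  unfolding set_lebesgue_integral_def
  by (rule integral_FTC_Icc[OF assms _ c])
    (auto intro!: derivative_eq_intros simp: has_real_derivative_iff_has_vector_derivative[symmetric])
 finally show "(LINT r:{s<..t}|lborel. k * (m * exp (k * (T - r)))) = m * exp (k * (T - s)) - m * exp (k * (T - t))"
  by simp
qed

lemma exp_lipschitz:
 fixes m k T :: real
 shows "\<exists>c\<ge>0. \<forall>s\<in>{a..T}. \<forall>t\<in>{a..T}. \<bar>m * exp (k * (T - s)) - m * exp (k * (T - t))\<bar> <= c * \<bar>s - t\<bar>"
proof -
 have "continuous_on {a..T} (%r. k * (m * exp (k * (T - r))))" by (intro continuous_intros)
 then have "bounded ((%r. k * (m * exp (k * (T - r)))) ` {a..T})"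
  by (intro compact_imp_bounded compact_continuous_image) auto
 then obtain c where c: "0 < c" "\<And>r. r \<in> {a..T} ==> \<bar>k * (m * exp (k * (T - r)))\<bar> <= c"
  by (force simp: bounded_pos)
 have *: "\<bar>m * exp (k * (T - s)) - m * exp (k * (T - t))\<bar> <= c * \<bar>s - t\<bar>"
  if "s \<in> {a..T}" "t \<in> {a..T}" "s <= t" for s t
 proof -
  have "norm (LINT r:{s<..t}|lborel. k * (m * exp (k * (T - r)))) <= c * (t - s)"
   by (rule set_lebesgue_integral_Ioc_norm_le[OF exp_backward_ode(1)]) (use c(2) that in auto)
  then show ?thesis using that unfolding exp_backward_ode(2)[OF that(3)] by simp
 qed
 show ?thesis
  using c(1) * by (intro exI[of _ c]) (metis abs_minus_commute less_imp_le linorder_linear)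
qed

text \<open>Comparison with an exponential multiple of the identity. With
  \<open>\<sigma> = 1\<close> and negative \<open>m\<close> it yields lower bounds on
  \<open>S\<close>, with \<open>\<sigma> = - 1\<close> and positive \<open>m\<close> upper
  bounds.\<close>

lemma backward_ode_comparison_aux:
 fixes S \<Psi> :: "real => real^'n^'n" and \<sigma> :: real
 assumes ode: "backward_ode a T S \<Psi>" and aT: "a <= T" and \<sigma>: "\<sigma> = 1 \<or> \<sigma> = - 1"
  and low: "\<And>v. norm v = 1 ==> AE r in lborel. r \<in> {a<..T} -->
    - \<kappa> * norm (\<sigma> *\<^sub>R (S r *v v) + (m * exp (k * (T - r))) *\<^sub>R v)
      <= \<sigma> * (v \<bullet> (\<Psi> r *v v)) + k * (m * exp (k * (T - r)))"
  and \<kappa>: "0 <= \<kappa>" and T: "possemidef (\<sigma> *\<^sub>R S T + mat m)" and t: "t \<in> {a..T}"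
 shows "possemidef (\<sigma> *\<^sub>R S t + mat (m * exp (k * (T - t))))"
proof -
 define X where "X = (%t. \<sigma> *\<^sub>R S t + mat (m * exp (k * (T - t))))"
 obtain c where c: "0 <= c" "\<And>s t. s \<in> {a..T} ==> t \<in> {a..T} ==> norm (S s - S t) <= c * \<bar>s - t\<bar>"
  using backward_ode_lipschitz[OF ode] by blast
 obtain d where d: "0 <= d" "\<And>s t. s \<in> {a..T} ==> t \<in> {a..T} ==>
   \<bar>m * exp (k * (T - s)) - m * exp (k * (T - t))\<bar> <= d * \<bar>s - t\<bar>"
  using exp_lipschitz[of a T m k] by blast
 define n1 where "n1 = norm (mat 1 :: real^'n^'n)"
 have Xv: "X r *v v = \<sigma> *\<^sub>R (S r *v v) + (m * exp (k * (T - r))) *\<^sub>R v" for r v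
  by (simp add: X_def matrix_vector_mult_add_rdistrib mat_vec scaleR_matrix_vector_assoc)
 have "possemidef (X t)"
 proof (rule backward_comparison[where X = X and a = a and T = T and k = \<kappa> and c = "c + d * n1"
    and \<phi> = "%v r. \<sigma> * (v \<bullet> (\<Psi> r *v v)) + k * (m * exp (k * (T - r)))"])
  show "X t \<in> sym_mats" if "t \<in> {a..T}" for t
   using ode that unfolding X_def by (intro sym_mats_add sym_mats_scaleR sym_mats_mat) (auto simp: backward_ode_def)
  show "norm (X s - X t) <= (c + d * n1) * \<bar>s - t\<bar>" if "s \<in> {a..T}" "t \<in> {a..T}" for s t
  proof -
   have "X s - X t = \<sigma> *\<^sub>R (S s - S t) + (m * exp (k * (T - s)) - m * exp (k * (T - t))) *\<^sub>R mat 1"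
    by (simp add: X_def mat_eq_scaleR[of "m * _"] algebra_simps)
   also have "norm \<dots> <= norm (S s - S t) + \<bar>m * exp (k * (T - s)) - m * exp (k * (T - t))\<bar> * n1"
    using \<sigma> by (intro order.trans[OF norm_triangle_ineq]) (auto simp: n1_def)
   also have "\<dots> <= c * \<bar>s - t\<bar> + d * \<bar>s - t\<bar> * n1"
    using c d that by (intro add_mono mult_right_mono) (auto simp: n1_def)
   finally show ?thesis by (simp add: algebra_simps)
  qed
  show "set_integrable lborel {s<..t} (%r. \<sigma> * (v \<bullet> (\<Psi> r *v v)) + k * (m * exp (k * (T - r)))) &
    (LINT r:{s<..t}|lborel. \<sigma> * (v \<bullet> (\<Psi> r *v v)) + k * (m * exp (k * (T - r)))) <= v \<bullet> (X s *v v) - v \<bullet> (X t *v v)"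
   if v: "norm v = 1" and st: "a <= s" "s < t" "t <= T" for v s t
  proof
   have i: "set_integrable lborel {s<..t} \<Psi>"
    by (rule set_integrable_subset[of _ "{a<..T}"]) (use ode st in \<open>auto simp: backward_ode_def\<close>)
   then have iv: "set_integrable lborel {s<..t} (%r. v \<bullet> (\<Psi> r *v v))"
    and ev: "(LINT r:{s<..t}|lborel. v \<bullet> (\<Psi> r *v v)) = v \<bullet> ((LINT r:{s<..t}|lborel. \<Psi> r) *v v)"
    using integrable_bounded_linear[OF bounded_linear_quadratic, of lborel "%r. indicator {s<..t} r *\<^sub>R \<Psi> r" v]
     integral_bounded_linear[OF bounded_linear_quadratic, of lborel "%r. indicator {s<..t} r *\<^sub>R \<Psi> r" v]
    by (simp_all add: set_integrable_def set_lebesgue_integral_def scaleR_matrix_vector_assoc[symmetric])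
   have st': "s <= t" using st by simp
   show "set_integrable lborel {s<..t} (%r. \<sigma> * (v \<bullet> (\<Psi> r *v v)) + k * (m * exp (k * (T - r))))"
    by (intro set_integral_add set_integrable_mult_right iv exp_backward_ode(1) st')
   have "(LINT r:{s<..t}|lborel. \<sigma> * (v \<bullet> (\<Psi> r *v v)) + k * (m * exp (k * (T - r))))
     = \<sigma> * (v \<bullet> ((S s - S t) *v v)) + (m * exp (k * (T - s)) - m * exp (k * (T - t)))"
   proof -
    have "(LINT r:{s<..t}|lborel. \<sigma> * (v \<bullet> (\<Psi> r *v v)) + k * (m * exp (k * (T - r))))
     = (LINT r:{s<..t}|lborel. \<sigma> * (v \<bullet> (\<Psi> r *v v))) + (LINT r:{s<..t}|lborel. k * (m * exp (k * (T - r))))"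
     by (intro set_integral_add(2) set_integrable_mult_right iv exp_backward_ode(1) st')
    also have "(LINT r:{s<..t}|lborel. \<sigma> * (v \<bullet> (\<Psi> r *v v))) = \<sigma> * (v \<bullet> ((S s - S t) *v v))"
     using ode st ev by (auto simp: backward_ode_def)
    finally show ?thesis unfolding exp_backward_ode(2)[OF st'] .
   qed
   also have "\<dots> = v \<bullet> (X s *v v) - v \<bullet> (X t *v v)"
    using v by (simp add: Xv matrix_vector_mult_diff_rdistrib inner_add_right inner_diff_right norm_eq_1 algebra_simps)
   finally show "(LINT r:{s<..t}|lborel. \<sigma> * (v \<bullet> (\<Psi> r *v v)) + k * (m * exp (k * (T - r)))) <= v \<bullet> (X s *v v) - v \<bullet> (X t *v v)"
    by simp
  qed
  show "AE r in lborel. r \<in> {a<..T} --> - \<kappa> * norm (X r *v v) <= \<sigma> * (v \<bullet> (\<Psi> r *v v)) + k * (m * exp (k * (T - r)))"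
   if "norm v = 1" for v unfolding Xv by (rule low[OF that])
 qed (use aT \<kappa> T t in \<open>auto simp: X_def\<close>)
 then show ?thesis by (simp add: X_def)
qed

text \<open>With the barrier \<open>g\<close>, the term \<open>\<kappa> * norm (S v)\<close> is at
  most \<open>\<kappa> * norm ((g - S) v) + \<kappa> * g\<close>, and \<open>m \<le> g\<close>
  absorbs the constant; hence the rate \<open>\<kappa> + \<kappa>'\<close>. The constant is written
  as \<open>\<kappa>' * m\<close>, so that the conclusion is proportional to \<open>m\<close>, which
  the stability estimate between two solutions needs.\<close>

lemma backward_ode_upper:
 fixes S \<Psi> :: "real => real^'n^'n"
 assumes ode: "backward_ode a T S \<Psi>" and aT: "a <= T"
  and up: "AE r in lborel. r \<in> {a<..T} --> (\<forall>v. norm v = 1 --> v \<bullet> (\<Psi> r *v v) <= \<kappa> * norm (S r *v v) + \<kappa>' * m)"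
  and \<kappa>: "0 <= \<kappa>" "0 <= \<kappa>'" "0 <= m" and T: "S T \<preceq> mat m" and t: "t \<in> {a..T}"
 shows "S t \<preceq> mat (m * exp ((\<kappa> + \<kappa>') * (T - t)))"
proof -
 have "possemidef ((- 1) *\<^sub>R S t + mat (m * exp ((\<kappa> + \<kappa>') * (T - t))))"
 proof (rule backward_ode_comparison_aux[OF ode aT, where \<kappa> = \<kappa>])
  fix v :: "real^'n" assume v: "norm v = 1"
  show "AE r in lborel. r \<in> {a<..T} -->
    - \<kappa> * norm ((- 1) *\<^sub>R (S r *v v) + (m * exp ((\<kappa> + \<kappa>') * (T - r))) *\<^sub>R v)
      <= (- 1) * (v \<bullet> (\<Psi> r *v v)) + (\<kappa> + \<kappa>') * (m * exp ((\<kappa> + \<kappa>') * (T - r)))"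
   using up
  proof eventually_elim
   case (elim r)
   show ?case
   proof
    assume r: "r \<in> {a<..T}"
    define g where "g = m * exp ((\<kappa> + \<kappa>') * (T - r))"
    have g: "m <= g" "0 <= g" using \<kappa> r by (auto simp: g_def mult_le_cancel_left1)
    have "norm (S r *v v) <= norm ((- 1) *\<^sub>R (S r *v v) + g *\<^sub>R v) + norm (g *\<^sub>R v)"
     using norm_triangle_ineq4[of "g *\<^sub>R v" "(- 1) *\<^sub>R (S r *v v) + g *\<^sub>R v"] by simp
    then have "\<kappa> * norm (S r *v v) <= \<kappa> * norm ((- 1) *\<^sub>R (S r *v v) + g *\<^sub>R v) + \<kappa> * g"
     using g \<kappa> v by (metis abs_of_nonneg distrib_left mult.right_neutral mult_left_mono norm_scaleR)
    moreover have "v \<bullet> (\<Psi> r *v v) <= \<kappa> * norm (S r *v v) + \<kappa>' * m" using elim r v by auto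
    moreover have "\<kappa>' * m <= \<kappa>' * g" using g \<kappa> by (intro mult_left_mono) auto
    ultimately show "- \<kappa> * norm ((- 1) *\<^sub>R (S r *v v) + (m * exp ((\<kappa> + \<kappa>') * (T - r))) *\<^sub>R v)
      <= (- 1) * (v \<bullet> (\<Psi> r *v v)) + (\<kappa> + \<kappa>') * (m * exp ((\<kappa> + \<kappa>') * (T - r)))"
     unfolding g_def[symmetric] by (simp add: algebra_simps)
   qed
  qed
 qed (use T \<kappa> t in \<open>auto simp: loewner_le_def\<close>)
 then show ?thesis by (simp add: loewner_le_def)
qed

text \<open>The barrier decays at rate \<open>\<kappa>\<close> but stays positive. For this the
  lower bound on the driver must not contain a constant term.\<close>

lemma backward_ode_lower:
 fixes S \<Psi> :: "real => real^'n^'n"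
 assumes ode: "backward_ode a T S \<Psi>" and aT: "a <= T"
  and low: "AE r in lborel. r \<in> {a<..T} --> (\<forall>v. norm v = 1 --> - \<kappa> * norm (S r *v v) <= v \<bullet> (\<Psi> r *v v))"
  and \<kappa>: "0 <= \<kappa>" "0 <= m" and T: "mat m \<preceq> S T" and t: "t \<in> {a..T}"
 shows "mat (m * exp (- \<kappa> * (T - t))) \<preceq> S t"
proof -
 have "possemidef (1 *\<^sub>R S t + mat ((- m) * exp ((- \<kappa>) * (T - t))))"
 proof (rule backward_ode_comparison_aux[OF ode aT, where \<kappa> = \<kappa>])
  fix v :: "real^'n" assume v: "norm v = 1"
  show "AE r in lborel. r \<in> {a<..T} -->
    - \<kappa> * norm (1 *\<^sub>R (S r *v v) + ((- m) * exp ((- \<kappa>) * (T - r))) *\<^sub>R v)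
      <= 1 * (v \<bullet> (\<Psi> r *v v)) + (- \<kappa>) * ((- m) * exp ((- \<kappa>) * (T - r)))"
   using low
  proof eventually_elim
   case (elim r)
   show ?case
   proof
    assume r: "r \<in> {a<..T}"
    define g where "g = m * exp (- \<kappa> * (T - r))"
    have g: "0 <= g" using \<kappa> r by (auto simp: g_def)
    have "norm (S r *v v) <= norm (S r *v v - g *\<^sub>R v) + norm (g *\<^sub>R v)"
     using norm_triangle_ineq[of "S r *v v - g *\<^sub>R v" "g *\<^sub>R v"] by simp
    then have "\<kappa> * norm (S r *v v) <= \<kappa> * norm (S r *v v - g *\<^sub>R v) + \<kappa> * g"
     using g \<kappa> v by (metis abs_of_nonneg distrib_left mult.right_neutral mult_left_mono norm_scaleR)
    moreover have "- \<kappa> * norm (S r *v v) <= v \<bullet> (\<Psi> r *v v)" using elim r v by auto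
    moreover have "(- m) * exp ((- \<kappa>) * (T - r)) = - g" by (simp add: g_def)
    ultimately show "- \<kappa> * norm (1 *\<^sub>R (S r *v v) + ((- m) * exp ((- \<kappa>) * (T - r))) *\<^sub>R v)
      <= 1 * (v \<bullet> (\<Psi> r *v v)) + (- \<kappa>) * ((- m) * exp ((- \<kappa>) * (T - r)))"
     by (simp only: scaleR_one) (simp add: algebra_simps)
   qed
  qed
 next
  show "possemidef (1 *\<^sub>R S T + mat (- m))"
   using T by (simp add: loewner_le_def mat_eq_scaleR[of m] mat_eq_scaleR[of "- m"])
 qed (use \<kappa> t in auto)
 then show ?thesis
  by (simp add: loewner_le_def mat_eq_scaleR[of "m * _"] mat_eq_scaleR[of "- (m * _)"])
qed

section \<open>The Riccati driver\<close>

text \<open>The quadratic form of \<open>h - jump_generator c s h\<close> after completing the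
  square, with \<open>D = I + c\<close>, \<open>S = s\<close> and \<open>U = s + h\<close>.\<close>

definition hq :: "real^'n^'n => real^'n^'n => real^'n^'n => real^'n => real" where
 "hq D S U v = v \<bullet> v + 2 * (v \<bullet> (D *v (S *v v))) - v \<bullet> (S *v v)
   - (v + D *v (S *v v)) \<bullet> (res U *v (v + D *v (S *v v)))"

lemma jump_generator_sym:
 assumes s: "s \<in> sym_mats" and h: "h \<in> sym_mats" and U: "possemidef (s + h)"
 shows "h - jump_generator c s h \<in> sym_mats"
proof -
 have "transpose (s ** transpose c - h) = c ** s - h"
  using s h by (simp add: transpose_diff matrix_transpose_mul sym_mats_def)
 moreover have "transpose (c ** s - h) = s ** transpose c - h"
  using s h by (simp add: transpose_diff matrix_transpose_mul sym_mats_def)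
 moreover have "transpose (res (s + h)) = res (s + h)"
  using res_sym[OF U] by (simp add: sym_mats_def)
 ultimately have "transpose (jump_generator c s h) = jump_generator c s h"
  unfolding jump_generator_def res_def[of "s + h", unfolded add.assoc[symmetric], symmetric]
  by (simp only: matrix_transpose_mul matrix_mul_assoc)
 then show ?thesis using h by (simp add: sym_mats_def transpose_diff)
qed

text \<open>With \<open>w = v + (I + c) s v\<close> and \<open>y = v + (s + h) v\<close> one has
  \<open>(c s - h) v = w - y\<close>, and \<open>res (s + h)\<close> maps \<open>y\<close> back to
  \<open>v\<close>. Expanding the square therefore leaves the resolvent only in the term formed with
  \<open>w\<close>.\<close>

lemma jump_generator_quadratic:
 assumes s: "s \<in> sym_mats" and h: "h \<in> sym_mats" and U: "possemidef (s + h)"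
 shows "v \<bullet> ((h - jump_generator c s h) *v v) = hq (mat 1 + c) s (s + h) v"
proof -
 define V where "V = res (s + h)"
 define w where "w = v + (mat 1 + c) *v (s *v v)"
 define y where "y = v + (s + h) *v v"
 have Vs: "V \<in> sym_mats" unfolding V_def by (rule res_sym[OF U])
 have Vy: "V *v y = v" unfolding V_def y_def by (rule res_vec[OF U])
 have z: "(c ** s - h) *v v = w - y"
  by (simp add: w_def y_def matrix_vector_mult_add_rdistrib matrix_vector_mult_diff_rdistrib
    matrix_vector_mul_assoc[symmetric])
 have t: "v \<bullet> ((s ** transpose c - h) *v x) = (w - y) \<bullet> x" for x
 proof -
  have e: "s ** transpose c - h = transpose (c ** s - h)"
   using s h by (simp add: transpose_diff matrix_transpose_mul sym_mats_def)
  show ?thesis unfolding e transpose_dot z by (rule inner_commute)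
 qed
 have "v \<bullet> (jump_generator c s h *v v) = (w - y) \<bullet> (V *v (w - y))"
 proof -
  have "jump_generator c s h *v v = (s ** transpose c - h) *v (V *v ((c ** s - h) *v v))"
   by (simp add: jump_generator_def V_def res_def add.assoc matrix_vector_mul_assoc matrix_mul_assoc)
  then show ?thesis by (simp only: t z)
 qed
 also have "\<dots> = w \<bullet> (V *v w) - 2 * (w \<bullet> v) + y \<bullet> v"
  using sym_matsD'[OF Vs, of y w]
  by (simp add: matrix_vector_mult_diff_distrib Vy inner_diff_left inner_diff_right)
 finally show ?thesis
  unfolding hq_def w_def[symmetric] V_def[symmetric]
  by (simp add: w_def y_def matrix_vector_mult_add_rdistrib matrix_vector_mult_diff_rdistrib
    inner_add_left inner_diff_right inner_add_right inner_commute)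
qed

text \<open>For the upper bound the resolvent term is dropped. For the lower bound the resolvent is
  replaced by the identity: the square of \<open>v + D S v\<close> then cancels both the constant
  \<open>v \<bullet> v\<close> and the mixed term, and only \<open>- v \<bullet> S v\<close> and
  minus the square of \<open>D S v\<close> remain. This cancellation is the reason why no constant
  appears below.\<close>

lemma hq_bounds:
 fixes v :: "real^'n"
 assumes U: "possemidef U" and v: "norm v = 1" and D: "\<And>x. norm (D *v x) <= \<delta> * norm x" and \<delta>: "0 <= \<delta>"
 shows "hq D S U v <= 1 + (2 * \<delta> + 1) * norm (S *v v)"
  and "norm (S *v v) <= K ==> - (1 + \<delta>\<^sup>2 * K) * norm (S *v v) <= hq D S U v"
proof -
 define w where "w = v + D *v (S *v v)"
 have vv: "v \<bullet> v = 1" using v by (simp add: norm_eq_1)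
 have Sv: "\<bar>v \<bullet> (S *v v)\<bar> <= norm (S *v v)" using Cauchy_Schwarz_ineq2[of v "S *v v"] v by simp
 have DSv: "norm (D *v (S *v v)) <= \<delta> * norm (S *v v)" by (rule D)
 have DSv': "\<bar>v \<bullet> (D *v (S *v v))\<bar> <= \<delta> * norm (S *v v)"
  using Cauchy_Schwarz_ineq2[of v "D *v (S *v v)"] v DSv by simp
 show "hq D S U v <= 1 + (2 * \<delta> + 1) * norm (S *v v)"
  using res_bounds(2)[OF U, of w] Sv DSv' unfolding hq_def w_def[symmetric] vv by (simp add: algebra_simps)
 assume K: "norm (S *v v) <= K"
 have ww: "w \<bullet> w = 1 + 2 * (v \<bullet> (D *v (S *v v))) + norm (D *v (S *v v)) * norm (D *v (S *v v))"
  unfolding w_def inner_add_left inner_add_right vv inner_commute[of "D *v (S *v v)" v]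
  by (simp add: dot_square_norm[of "D *v (S *v v)"] power2_eq_square)
 have "norm (D *v (S *v v)) * norm (D *v (S *v v)) <= (\<delta> * norm (S *v v)) * (\<delta> * K)"
  using DSv K \<delta> order.trans[OF DSv mult_left_mono[OF K \<delta>]] by (intro mult_mono) auto
 then show "- (1 + \<delta>\<^sup>2 * K) * norm (S *v v) <= hq D S U v"
  using res_bounds(3)[OF U, of w] Sv unfolding hq_def w_def[symmetric] vv ww
  by (simp add: algebra_simps power2_eq_square)
qed

text \<open>Fact \<open>3\<close> splits the difference into a part linear in
  \<open>x = (S1 - S2) v\<close>, a change of the vector \<open>w\<close> with \<open>U2\<close>
  kept, and a change of \<open>U\<close> with \<open>w1\<close> kept. The last part is nonnegative
  by antitonicity of the resolvent and at most \<open>e\<close> times the square of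
  \<open>w1\<close>. The constant \<open>L\<close> collects \<open>2 * \<delta> + 1\<close> from the
  linear part and \<open>2 * \<delta> * (1 + \<delta> * K)\<close> from the sum
  \<open>w1 + w2\<close>.\<close>

lemma hq_diff:
 fixes v :: "real^'n"
 assumes U1: "possemidef U1" and U2: "possemidef U2" and U: "possemidef (U1 - U2)"
  and v: "norm v = 1" and D: "\<And>x. norm (D *v x) <= \<delta> * norm x" and \<delta>: "0 <= \<delta>"
  and K: "norm (S1 *v v) <= K" "norm (S2 *v v) <= K"
  and L: "L = 2 * \<delta> + 1 + 2 * \<delta> * (1 + \<delta> * K)"
 shows "- L * norm ((S1 - S2) *v v) <= hq D S1 U1 v - hq D S2 U2 v"
  and "U1 - U2 \<preceq> mat e ==>
     hq D S1 U1 v - hq D S2 U2 v <= L * norm ((S1 - S2) *v v) + (1 + \<delta> * K)\<^sup>2 * e"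
proof -
 define w1 w2 x where "w1 = v + D *v (S1 *v v)" and "w2 = v + D *v (S2 *v v)" and "x = (S1 - S2) *v v"
 have vv: "v \<bullet> v = 1" using v by (simp add: norm_eq_1)
 have wx: "w1 - w2 = D *v x"
  by (simp add: w1_def w2_def x_def matrix_vector_mult_diff_rdistrib matrix_vector_mult_diff_distrib)
 have nw: "norm (v + D *v (S *v v)) <= 1 + \<delta> * K" if "norm (S *v v) <= K" for S
  using norm_triangle_ineq[of v "D *v (S *v v)"] v D[of "S *v v"] mult_left_mono[OF that \<delta>] by simp
 then have nw12: "norm w1 <= 1 + \<delta> * K" "norm w2 <= 1 + \<delta> * K" using K by (auto simp: w1_def w2_def)
 have Dx: "norm (D *v x) <= \<delta> * norm x" by (rule D)
 have 1: "\<bar>v \<bullet> x\<bar> <= norm x" "\<bar>v \<bullet> (D *v x)\<bar> <= \<delta> * norm x"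
  using Cauchy_Schwarz_ineq2[of v x] Cauchy_Schwarz_ineq2[of v "D *v x"] v Dx by auto
 have "w1 \<bullet> (res U2 *v w1) - w2 \<bullet> (res U2 *v w2) = (D *v x) \<bullet> (res U2 *v (w1 + w2))"
  using sym_matsD'[OF res_sym[OF U2], of w1 w2] unfolding wx[symmetric]
  by (simp add: matrix_vector_right_distrib inner_diff_left inner_add_right)
 also have "\<bar>\<dots>\<bar> <= norm (D *v x) * norm (res U2 *v (w1 + w2))" by (rule Cauchy_Schwarz_ineq2)
 also have "\<dots> <= (\<delta> * norm x) * (2 * (1 + \<delta> * K))"
  using Dx \<delta> order.trans[OF res_bounds(1)[OF U2, of "w1 + w2"] norm_triangle_ineq[of w1 w2]] nw12
  by (intro mult_mono) auto
 finally have 2: "\<bar>w1 \<bullet> (res U2 *v w1) - w2 \<bullet> (res U2 *v w2)\<bar> <= 2 * \<delta> * (1 + \<delta> * K) * norm x"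
  by (simp add: algebra_simps)
 have 3: "hq D S1 U1 v - hq D S2 U2 v = 2 * (v \<bullet> (D *v x)) - v \<bullet> x
   - (w1 \<bullet> (res U2 *v w1) - w2 \<bullet> (res U2 *v w2)) + (w1 \<bullet> (res U2 *v w1) - w1 \<bullet> (res U1 *v w1))"
  unfolding hq_def w1_def[symmetric] w2_def[symmetric]
  by (simp add: x_def matrix_vector_mult_diff_rdistrib matrix_vector_mult_diff_distrib inner_diff_right)
 show "- L * norm ((S1 - S2) *v v) <= hq D S1 U1 v - hq D S2 U2 v"
  using 1 2 res_diff(1)[OF U1 U2 U, of w1] unfolding 3 x_def[symmetric] L by (simp add: algebra_simps abs_le_iff)
 assume e: "U1 - U2 \<preceq> mat e"
 have e': "v \<bullet> ((U1 - U2) *v v) <= e * (v \<bullet> v)" for v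
  using e by (simp add: loewner_le_def possemidef_def matrix_vector_mult_diff_rdistrib mat_vec inner_diff_right)
 have e0: "0 <= e" using e'[of v] possemidefD(2)[OF U, of v] vv by simp
 have "w1 \<bullet> w1 <= (1 + \<delta> * K)\<^sup>2" using nw12(1) by (simp add: dot_square_norm power_mono)
 then have "e * (w1 \<bullet> w1) <= (1 + \<delta> * K)\<^sup>2 * e" using e0 by (simp add: mult.commute mult_left_mono)
 then show "hq D S1 U1 v - hq D S2 U2 v <= L * norm ((S1 - S2) *v v) + (1 + \<delta> * K)\<^sup>2 * e"
  using 1 2 res_diff(2)[OF U1 U2 U e', of w1] unfolding 3 x_def[symmetric] L
  by (simp add: algebra_simps abs_le_iff)
qed

text \<open>Minus the time derivative of \<open>\<Sigma>\<close> between jumps. The summand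
  \<open>h\<close> in the integrand stems from the compensated integral of \<open>\<Theta>\<close>,
  of which only minus the compensator is left as long as no jump occurs.\<close>

definition driver ::
 "real => 'e measure => real^'n^'n => real^'d^'n => ('e => real^'n^'n) => nat => real^'n^'n =>
  ('e => real^'n^'n) => real^'n^'n" where
 "driver l \<mu> a b c N s h =
   l *\<^sub>R (\<integral>th. h th - jump_generator (c th) s (h th) \<partial>\<mu>) - (a ** s + s ** transpose a)
   + real N *\<^sub>R (b ** transpose b)"

text \<open>The conditions on \<open>\<mu>\<close>, \<open>c\<close> and \<open>h\<close> are
  imposed only where the rate is positive: elsewhere a property that holds almost everywhere for the
  compensator says nothing about them.\<close>

definition admissible ::
 "real => real => 'e measure => real^'n^'n => real^'d^'n => ('e => real^'n^'n) => real^'n^'n =>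
  ('e => real^'n^'n) => bool" where
 "admissible K l \<mu> a b c s h \<longleftrightarrow> 0 <= l & l <= K & norm a <= K & norm b <= K & s \<in> sym_mats &
   (l \<noteq> 0 --> prob_space \<mu> & integrable \<mu> (%th. h th - jump_generator (c th) s (h th)) &
    (AE th in \<mu>. norm (c th) <= K & h th \<in> sym_mats & possemidef (s + h th)))"

lemma norm_one_plus_le:
 fixes c :: "real^'n^'n"
 assumes "norm c <= K"
 shows "norm ((mat 1 + c) *v x) <= (1 + K) * norm x"
 using norm_triangle_ineq[of x "c *v x"] norm_matrix_vector_le[of c x] mult_right_mono[OF assms norm_ge_zero[of x]]
 by (simp add: matrix_vector_mult_add_rdistrib algebra_simps)

lemma driver_quadratic:
 assumes adm: "admissible K l \<mu> a b c s h"
 shows "v \<bullet> (driver l \<mu> a b c N s h *v v) =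
   l * (\<integral>th. v \<bullet> ((h th - jump_generator (c th) s (h th)) *v v) \<partial>\<mu>) - 2 * (v \<bullet> (a *v (s *v v)))
   + real N * ((transpose b *v v) \<bullet> (transpose b *v v))" (is "_ = l * ?I - _ + _")
  and "l \<noteq> 0 ==> integrable \<mu> (%th. v \<bullet> ((h th - jump_generator (c th) s (h th)) *v v))"
proof -
 have I: "?I = v \<bullet> ((\<integral>th. h th - jump_generator (c th) s (h th) \<partial>\<mu>) *v v) &
    integrable \<mu> (%th. v \<bullet> ((h th - jump_generator (c th) s (h th)) *v v))" if "l \<noteq> 0"
  using adm that integral_bounded_linear[OF bounded_linear_quadratic]
   integrable_bounded_linear[OF bounded_linear_quadratic] by (auto simp: admissible_def)
 have q: "v \<bullet> ((a ** s + s ** transpose a) *v v) = 2 * (v \<bullet> (a *v (s *v v)))"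
 proof -
  have s: "s \<in> sym_mats" using adm by (simp add: admissible_def)
  have "v \<bullet> ((s ** transpose a) *v v) = (s *v v) \<bullet> (transpose a *v v)"
   by (simp only: matrix_vector_mul_assoc[symmetric] sym_matsD[OF s])
  then show ?thesis
   by (simp only: matrix_vector_mult_add_rdistrib inner_add_right transpose_dot)
     (simp add: matrix_vector_mul_assoc)
 qed
 have n: "v \<bullet> ((b ** transpose b) *v v) = (transpose b *v v) \<bullet> (transpose b *v v)"
  by (simp only: matrix_vector_mul_assoc[symmetric])
    (metis transpose_dot transpose_transpose)
 show "v \<bullet> (driver l \<mu> a b c N s h *v v) = l * ?I - 2 * (v \<bullet> (a *v (s *v v)))
   + real N * ((transpose b *v v) \<bullet> (transpose b *v v))"
  unfolding driver_def q[symmetric] n[symmetric] using I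
  by (cases "l = 0") (simp_all only: matrix_vector_mult_add_rdistrib matrix_vector_mult_diff_rdistrib
    inner_add_right inner_diff_right scaleR_matrix_vector_assoc[symmetric] inner_scaleR_right, simp_all)
 show "l \<noteq> 0 ==> integrable \<mu> (%th. v \<bullet> ((h th - jump_generator (c th) s (h th)) *v v))" using I by simp
qed

lemma inner_product_le:
 fixes v :: "real^'n"
 assumes "norm v = 1" "norm a <= K"
 shows "\<bar>v \<bullet> (a *v x)\<bar> <= K * norm x"
 using Cauchy_Schwarz_ineq2[of v "a *v x"] norm_matrix_vector_le[of a x] assms
  mult_right_mono[OF assms(2) norm_ge_zero[of x]] by simp

text \<open>In \<open>k\<close>, the first summand is the rate times the factor in
  \<open>hq_bounds\<close> for \<open>\<delta> = 1 + K\<close>, and \<open>2 * K\<close> comes from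
  the two terms with \<open>a\<close>. In \<open>k'\<close>, \<open>K\<close> is the rate times the
  constant 1 and \<open>N * K\<^sup>2\<close> comes from the term with \<open>b\<close>.\<close>

lemma driver_upper:
 fixes v :: "real^'n"
 assumes adm: "admissible K l \<mu> a b c s h" and v: "norm v = 1" and K: "0 <= K"
  and k: "K * (2 * (1 + K) + 1) + 2 * K <= k" "K + real N * K\<^sup>2 <= k'"
 shows "v \<bullet> (driver l \<mu> a b c N s h *v v) <= k * norm (s *v v) + k'"
proof -
 let ?I = "\<integral>th. v \<bullet> ((h th - jump_generator (c th) s (h th)) *v v) \<partial>\<mu>"
 have sv: "0 <= norm (s *v v)" by simp
 have l: "0 <= l" "l <= K" "norm a <= K" "norm b <= K" using adm by (auto simp: admissible_def)
 define u where "u = 1 + (2 * (1 + K) + 1) * norm (s *v v)"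
 have u: "0 <= u" using K by (simp add: u_def)
 have "l * ?I <= l * u"
 proof (cases "l = 0")
  case False
  have s: "s \<in> sym_mats" and ae: "AE th in \<mu>. norm (c th) <= K & h th \<in> sym_mats & possemidef (s + h th)"
   using adm False by (auto simp: admissible_def)
  interpret prob_space \<mu> using adm False by (simp add: admissible_def)
  have "?I <= (\<integral>th. u \<partial>\<mu>)"
  proof (rule integral_mono_AE)
   show "AE th in \<mu>. v \<bullet> ((h th - jump_generator (c th) s (h th)) *v v) <= u"
    using ae
   proof eventually_elim
    case (elim th)
    then show ?case
     using hq_bounds(1)[of "s + h th" v "mat 1 + c th" "1 + K" s] K v
     by (simp add: jump_generator_quadratic[OF s] norm_one_plus_le u_def)
   qed
  qed (use driver_quadratic(2)[OF adm False] in auto)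
  then show ?thesis using l(1) by (intro mult_left_mono) (auto simp: prob_space)
 qed simp
 also have "\<dots> <= K * u" using l u by (intro mult_right_mono) auto
 finally have 1: "l * ?I <= K * u" .
 have "norm (transpose b *v v) <= K"
  using norm_matrix_vector_le[of "transpose b" v] l v by (simp del: transpose_matrix_vector)
 then have "(transpose b *v v) \<bullet> (transpose b *v v) <= K\<^sup>2"
  unfolding dot_square_norm by (intro power_mono) auto
 then have 2: "real N * ((transpose b *v v) \<bullet> (transpose b *v v)) <= real N * K\<^sup>2"
  by (intro mult_left_mono) auto
 have 3: "\<bar>v \<bullet> (a *v (s *v v))\<bar> <= K * norm (s *v v)" by (rule inner_product_le) fact+
 have "v \<bullet> (driver l \<mu> a b c N s h *v v) <= K * u + 2 * (K * norm (s *v v)) + real N * K\<^sup>2"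
  unfolding driver_quadratic(1)[OF adm] using 1 2 3 by linarith
 also have "\<dots> = (K * (2 * (1 + K) + 1) + 2 * K) * norm (s *v v) + (K + real N * K\<^sup>2)"
  by (simp add: u_def algebra_simps)
 also have "\<dots> <= k * norm (s *v v) + k'" using k by (intro add_mono mult_right_mono) auto
 finally show ?thesis .
qed

text \<open>The term with \<open>b\<close> is nonnegative and is dropped, so the bound is
  homogeneous in \<open>norm (s v)\<close>. The price is that the factor depends on an a priori
  bound \<open>R\<close> of \<open>s\<close>.\<close>

lemma driver_lower:
 fixes v :: "real^'n"
 assumes adm: "admissible K l \<mu> a b c s h" and v: "norm v = 1" and K: "0 <= K"
  and R: "norm (s *v v) <= R" and k: "K * (1 + (1 + K)\<^sup>2 * R) + 2 * K <= k"
 shows "- k * norm (s *v v) <= v \<bullet> (driver l \<mu> a b c N s h *v v)"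
proof -
 let ?I = "\<integral>th. v \<bullet> ((h th - jump_generator (c th) s (h th)) *v v) \<partial>\<mu>"
 have R0: "0 <= R" using R norm_ge_zero order.trans by blast
 have l: "0 <= l" "l <= K" "norm a <= K" "norm b <= K" using adm by (auto simp: admissible_def)
 define u where "u = (1 + (1 + K)\<^sup>2 * R) * norm (s *v v)"
 have u: "0 <= u" using R0 by (simp add: u_def)
 have "- l * u <= l * ?I"
 proof (cases "l = 0")
  case False
  have s: "s \<in> sym_mats" and ae: "AE th in \<mu>. norm (c th) <= K & h th \<in> sym_mats & possemidef (s + h th)"
   using adm False by (auto simp: admissible_def)
  interpret prob_space \<mu> using adm False by (simp add: admissible_def)
  have "(\<integral>th. - u \<partial>\<mu>) <= ?I"
  proof (rule integral_mono_AE)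
   show "AE th in \<mu>. - u <= v \<bullet> ((h th - jump_generator (c th) s (h th)) *v v)"
    using ae
   proof eventually_elim
    case (elim th)
    then have U: "possemidef (s + h th)" and h: "h th \<in> sym_mats" by auto
    have D: "norm ((mat 1 + c th) *v x) <= (1 + K) * norm x" for x
     using elim by (intro norm_one_plus_le) auto
    have "- u <= hq (mat 1 + c th) s (s + h th) v"
     using hq_bounds(2)[OF U v D _ R] K by (simp only: u_def mult_minus_left)
    then show ?case unfolding jump_generator_quadratic[OF s h U] .
   qed
  qed (use driver_quadratic(2)[OF adm False] in auto)
  then have "l * - u <= l * ?I" using l(1) by (intro mult_left_mono) (auto simp: prob_space)
  then show ?thesis by simp
 qed simp
 moreover have "- K * u <= - l * u" using l u by (simp add: mult_right_mono)
 ultimately have 1: "- K * u <= l * ?I" by simp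
 have 2: "0 <= real N * ((transpose b *v v) \<bullet> (transpose b *v v))" by simp
 have 3: "\<bar>v \<bullet> (a *v (s *v v))\<bar> <= K * norm (s *v v)" by (rule inner_product_le) fact+
 have "- k * norm (s *v v) <= - (K * (1 + (1 + K)\<^sup>2 * R) + 2 * K) * norm (s *v v)"
  using k by (intro mult_right_mono) auto
 also have "\<dots> = - K * u - 2 * (K * norm (s *v v))" by (simp add: u_def algebra_simps)
 also have "\<dots> <= v \<bullet> (driver l \<mu> a b c N s h *v v)"
  unfolding driver_quadratic(1)[OF adm] using 1 2 3 by linarith
 finally show ?thesis .
qed

text \<open>The terms with \<open>b\<close> cancel. The order of the values \<open>s + h\<close>
  after the jump suffices for the one-sided estimate; the other side also needs the size
  \<open>e\<close> of their difference.\<close>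

lemma driver_diff:
 fixes v :: "real^'n"
 assumes adm1: "admissible K l \<mu> a b c s1 h1" and adm2: "admissible K l \<mu> a b c s2 h2"
  and v: "norm v = 1" and K: "0 <= K"
  and R: "norm (s1 *v v) <= R" "norm (s2 *v v) <= R"
  and le: "l \<noteq> 0 ==> AE th in \<mu>. s2 + h2 th \<preceq> s1 + h1 th"
  and k: "K * (2 * (1 + K) + 1 + 2 * (1 + K) * (1 + (1 + K) * R)) + 2 * K <= k"
 shows "- k * norm ((s1 - s2) *v v) <= v \<bullet> ((driver l \<mu> a b c N s1 h1 - driver l \<mu> a b c N s2 h2) *v v)"
  and "(l \<noteq> 0 ==> AE th in \<mu>. (s1 + h1 th) - (s2 + h2 th) \<preceq> mat e) ==> 0 <= e ==> K * (1 + (1 + K) * R)\<^sup>2 <= k' ==>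
   v \<bullet> ((driver l \<mu> a b c N s1 h1 - driver l \<mu> a b c N s2 h2) *v v) <= k * norm ((s1 - s2) *v v) + k' * e"
proof -
 let ?q = "%s h th. v \<bullet> ((h th - jump_generator (c th) s (h th)) *v v)"
 define x where "x = (s1 - s2) *v v"
 define L where "L = 2 * (1 + K) + 1 + 2 * (1 + K) * (1 + (1 + K) * R)"
 have R0: "0 <= R" using R norm_ge_zero order.trans by blast
 have L0: "0 <= L" using K R0 by (simp add: L_def)
 have l: "0 <= l" "l <= K" "norm a <= K" "s1 \<in> sym_mats" "s2 \<in> sym_mats"
  using adm1 adm2 by (auto simp: admissible_def)
 have eq: "v \<bullet> ((driver l \<mu> a b c N s1 h1 - driver l \<mu> a b c N s2 h2) *v v) =
   l * (\<integral>th. ?q s1 h1 th - ?q s2 h2 th \<partial>\<mu>) - 2 * (v \<bullet> (a *v x))"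
 proof -
  have I: "l * (\<integral>th. ?q s1 h1 th - ?q s2 h2 th \<partial>\<mu>) = l * (\<integral>th. ?q s1 h1 th \<partial>\<mu>) - l * (\<integral>th. ?q s2 h2 th \<partial>\<mu>)"
  proof (cases "l = 0")
   case False
   then show ?thesis
    by (subst Bochner_Integration.integral_diff[OF driver_quadratic(2)[OF adm1] driver_quadratic(2)[OF adm2]])
     (simp_all only: right_diff_distrib not_False_eq_True)
  qed simp
  have x: "v \<bullet> (a *v x) = v \<bullet> (a *v (s1 *v v)) - v \<bullet> (a *v (s2 *v v))"
   by (simp add: x_def matrix_vector_mult_diff_distrib matrix_vector_mult_diff_rdistrib inner_diff_right)
  show ?thesis
   unfolding matrix_vector_mult_diff_rdistrib[of "driver _ _ _ _ _ _ _ _"] inner_diff_right[of v "driver _ _ _ _ _ _ _ _ *v v"]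
    driver_quadratic(1)[OF adm1] driver_quadratic(1)[OF adm2] I x by simp
 qed
 have 3: "\<bar>v \<bullet> (a *v x)\<bar> <= K * norm x" by (rule inner_product_le) fact+
 have kx: "(K * L + 2 * K) * norm x <= k * norm x" using k by (intro mult_right_mono) (auto simp: L_def)
 have pw: "- L * norm x <= ?q s1 h1 th - ?q s2 h2 th"
   "(s1 + h1 th) - (s2 + h2 th) \<preceq> mat e ==> ?q s1 h1 th - ?q s2 h2 th <= L * norm x + (1 + (1 + K) * R)\<^sup>2 * e"
  if "norm (c th) <= K & h1 th \<in> sym_mats & possemidef (s1 + h1 th)"
   "norm (c th) <= K & h2 th \<in> sym_mats & possemidef (s2 + h2 th)" "s2 + h2 th \<preceq> s1 + h1 th" for th e
 proof -
  have D: "norm ((mat 1 + c th) *v x) <= (1 + K) * norm x" for x using that by (intro norm_one_plus_le) auto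
  have U: "possemidef (s1 + h1 th)" "possemidef (s2 + h2 th)" "possemidef ((s1 + h1 th) - (s2 + h2 th))"
   and h: "h1 th \<in> sym_mats" "h2 th \<in> sym_mats"
   using that by (auto simp: loewner_le_def)
  show "- L * norm x <= ?q s1 h1 th - ?q s2 h2 th"
   unfolding jump_generator_quadratic[OF l(4) h(1) U(1)] jump_generator_quadratic[OF l(5) h(2) U(2)] x_def
   by (rule hq_diff(1)[OF U v D _ R L_def]) (use K in simp)
  show "?q s1 h1 th - ?q s2 h2 th <= L * norm x + (1 + (1 + K) * R)\<^sup>2 * e"
   if "(s1 + h1 th) - (s2 + h2 th) \<preceq> mat e"
   unfolding jump_generator_quadratic[OF l(4) h(1) U(1)] jump_generator_quadratic[OF l(5) h(2) U(2)] x_def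
   by (rule hq_diff(2)[OF U v D _ R L_def that]) (use K in simp)
 qed
 have lint: "l * (\<integral>th. ?q s1 h1 th - ?q s2 h2 th \<partial>\<mu>) \<ge> - K * (L * norm x)"
 proof (cases "l = 0")
  case False
  interpret prob_space \<mu> using adm1 False by (simp add: admissible_def)
  have "(\<integral>th. - L * norm x \<partial>\<mu>) <= (\<integral>th. ?q s1 h1 th - ?q s2 h2 th \<partial>\<mu>)"
  proof (rule integral_mono_AE)
   have "AE th in \<mu>. norm (c th) <= K & h1 th \<in> sym_mats & possemidef (s1 + h1 th)"
    "AE th in \<mu>. norm (c th) <= K & h2 th \<in> sym_mats & possemidef (s2 + h2 th)"
    using adm1 adm2 False by (auto simp: admissible_def)
   then show "AE th in \<mu>. - L * norm x <= ?q s1 h1 th - ?q s2 h2 th"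
    using le[OF False] by eventually_elim (rule pw(1))
  qed (use driver_quadratic(2)[OF adm1 False] driver_quadratic(2)[OF adm2 False] in auto)
  then have "l * (- L * norm x) <= l * (\<integral>th. ?q s1 h1 th - ?q s2 h2 th \<partial>\<mu>)"
   using l(1) by (intro mult_left_mono) (auto simp: prob_space)
  moreover have "l * (L * norm x) <= K * (L * norm x)" using l L0 by (intro mult_right_mono) auto
  ultimately show ?thesis by simp
 qed (use K L0 in simp)
 show "- k * norm ((s1 - s2) *v v) <= v \<bullet> ((driver l \<mu> a b c N s1 h1 - driver l \<mu> a b c N s2 h2) *v v)"
  unfolding eq x_def[symmetric] using lint 3 kx by (simp add: algebra_simps abs_le_iff)
 assume e: "l \<noteq> 0 ==> AE th in \<mu>. (s1 + h1 th) - (s2 + h2 th) \<preceq> mat e" and e0: "0 <= e"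
  and k': "K * (1 + (1 + K) * R)\<^sup>2 <= k'"
 define u where "u = L * norm x + (1 + (1 + K) * R)\<^sup>2 * e"
 have u0: "0 <= u" using L0 e0 by (simp add: u_def)
 have "l * (\<integral>th. ?q s1 h1 th - ?q s2 h2 th \<partial>\<mu>) <= K * u"
 proof (cases "l = 0")
  case False
  interpret prob_space \<mu> using adm1 False by (simp add: admissible_def)
  have "(\<integral>th. ?q s1 h1 th - ?q s2 h2 th \<partial>\<mu>) <= (\<integral>th. u \<partial>\<mu>)"
  proof (rule integral_mono_AE)
   have "AE th in \<mu>. norm (c th) <= K & h1 th \<in> sym_mats & possemidef (s1 + h1 th)"
    "AE th in \<mu>. norm (c th) <= K & h2 th \<in> sym_mats & possemidef (s2 + h2 th)"
    using adm1 adm2 False by (auto simp: admissible_def)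
   then show "AE th in \<mu>. ?q s1 h1 th - ?q s2 h2 th <= u"
    using le[OF False] e[OF False] unfolding u_def by eventually_elim (rule pw(2))
  qed (use driver_quadratic(2)[OF adm1 False] driver_quadratic(2)[OF adm2 False] in auto)
  then have "l * (\<integral>th. ?q s1 h1 th - ?q s2 h2 th \<partial>\<mu>) <= l * u"
   using l(1) by (intro mult_left_mono) (auto simp: prob_space)
  also have "\<dots> <= K * u" using l u0 by (intro mult_right_mono) auto
  finally show ?thesis .
 qed (use K u0 in simp)
 moreover have "K * (1 + (1 + K) * R)\<^sup>2 * e <= k' * e" using k' e0 by (rule mult_right_mono)
 ultimately show "v \<bullet> ((driver l \<mu> a b c N s1 h1 - driver l \<mu> a b c N s2 h2) *v v) <= k * norm ((s1 - s2) *v v) + k' * e"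
  unfolding eq x_def[symmetric] using 3 kx by (simp add: u_def algebra_simps abs_le_iff)
qed

section \<open>Filtrations of the mode process\<close>

context mode_process
begin

abbreviation "FF \<equiv> mode_filtration (space P) \<tau> \<gamma>"
abbreviation "GG \<equiv> past (space P) \<tau> \<gamma>"
abbreviation "GN \<equiv> past_and_next_time (space P) \<tau> \<gamma>"

lemma time_mono:
 assumes "w \<in> space P" "i <= j"
 shows "\<tau> i w <= \<tau> j w"
 using assms(2)
proof (induction rule: dec_induct)
 case (step n)
 then show ?case using time_less[OF assms(1), of n] time_infinite[OF assms(1), of n]
  by (cases "\<tau> n w = \<infinity>") (auto intro: order.trans)
qed simp

lemma time_strict_mono: "w \<in> space P ==> i < j ==> \<tau> i w < \<infinity> ==> \<tau> i w < \<tau> j w"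
 by (metis Suc_leI less_le_trans time_less time_mono)

lemma time_nonneg: "w \<in> space P ==> 0 <= \<tau> j w"
 using time_mono[of w 0 j] time_0 by auto

lemma time_Suc_J: "w \<in> space P ==> \<tau> (Suc J) w = \<infinity>"
 by (rule time_after_J) auto

lemma index_unique:
 assumes "w \<in> space P" "\<tau> i w <= ereal t" "ereal t < \<tau> (Suc i) w" "\<tau> j w <= ereal t" "ereal t < \<tau> (Suc j) w"
 shows "i = j"
 by (metis assms linorder_neqE_nat Suc_leI time_mono not_less order.trans)

lemma index_unique':
 assumes "w \<in> space P" "\<tau> i w < ereal t" "ereal t <= \<tau> (Suc i) w" "\<tau> j w < ereal t" "ereal t <= \<tau> (Suc j) w"
 shows "i = j"
 by (metis assms linorder_neqE_nat Suc_leI time_mono not_less order.trans)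

lemma index_exists:
 assumes "w \<in> space P" "0 <= t"
 obtains j where "j <= J" "\<tau> j w <= ereal t" "ereal t < \<tau> (Suc j) w"
proof -
 define j where "j = (GREATEST j. \<tau> j w <= ereal t)"
 have b: "\<forall>k. \<tau> k w <= ereal t --> k <= J"
  using time_after_J[OF assms(1)] by (metis ereal_infty_less_eq(1) PInfty_neq_ereal(1) not_le)
 have 0: "\<tau> 0 w <= ereal t" using assms time_0 by auto
 have 1: "\<tau> j w <= ereal t" unfolding j_def by (rule GreatestI_nat[of _ 0 J]) (use 0 b in auto)
 have "k <= j" if "\<tau> k w <= ereal t" for k
  unfolding j_def by (rule Greatest_le_nat[of _ _ J]) (use that b in auto)
 then have "ereal t < \<tau> (Suc j) w" by (metis not_less not_less_eq_eq order_refl)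
 then show ?thesis using that 1 b by blast
qed

text \<open>The intervals open on the left and closed on the right are those on which predictable
  objects keep their index. The index differs from that of \<open>index_exists\<close> exactly at
  jump times, where the preceding one is taken.\<close>

lemma index_exists':
 assumes "w \<in> space P" "0 < t"
 obtains j where "j <= J" "\<tau> j w < ereal t" "ereal t <= \<tau> (Suc j) w"
proof -
 obtain j where j: "j <= J" "\<tau> j w <= ereal t" "ereal t < \<tau> (Suc j) w"
  using index_exists[OF assms(1)] assms(2) by (metis less_imp_le)
 show ?thesis
 proof (cases "\<tau> j w = ereal t")
  case True
  then obtain i where i: "j = Suc i"
   using time_0[OF assms(1)] assms(2) by (cases j) (auto simp: zero_ereal_def)
  have "\<tau> i w < \<tau> j w"
   using time_mono[OF assms(1), of i j] time_strict_mono[OF assms(1), of i j] True i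
   by (metis ereal_infty_less(1) ereal_infty_less_eq(1) PInfty_neq_ereal(1) lessI less_imp_le)
  then show ?thesis using that[of i] True i j(1) by auto
 qed (use j that in auto)
qed

lemma mode_eq:
 assumes "w \<in> space P" "\<tau> j w <= ereal t" "ereal t < \<tau> (Suc j) w"
 shows "mode \<tau> \<gamma> t w = \<gamma> j w"
proof -
 have "(THE j. \<tau> j w <= ereal t & ereal t < \<tau> (Suc j) w) = j"
  using assms index_unique[OF assms(1)] by (intro the_equality) auto
 then show ?thesis by (simp add: mode_def)
qed

lemma space_FF [simp]: "space (FF t) = space P"
 by (simp add: mode_filtration_def space_measure_of_conv)
lemma space_GG [simp]: "space (GG j) = space P"
 by (simp add: past_def space_measure_of_conv)
lemma space_GN [simp]: "space (GN j) = space P"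
 by (simp add: past_and_next_time_def space_measure_of_conv)

lemma sets_GG_eq: "sets (GG j) = sigma_sets (space P)
  ({\<tau> i -` S \<inter> space P |i S. i <= j & S \<in> sets borel} \<union> {\<gamma> i -` S \<inter> space P |i S. i <= j & S \<in> sets borel})"
 unfolding past_def by (rule sets_measure_of) blast

lemma sets_GN_eq: "sets (GN j) = sigma_sets (space P)
  (sets (GG j) \<union> {\<tau> (Suc j) -` S \<inter> space P |S. S \<in> sets borel})"
 unfolding past_and_next_time_def
 by (rule sets_measure_of) (use sets.sets_into_space[of _ "GG j"] in auto)

lemma time_GG: "i <= j ==> \<tau> i \<in> borel_measurable (GG j)"
 by (rule measurableI) (simp, unfold sets_GG_eq space_GG, rule sigma_sets.Basic, blast)

lemma mark_GG: "i <= j ==> \<gamma> i \<in> GG j \<rightarrow>\<^sub>M borel"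
 by (rule measurableI) (simp, unfold sets_GG_eq space_GG, rule sigma_sets.Basic, blast)

lemma sets_GG: "sets (GG j) \<subseteq> sets P"
 unfolding sets_GG_eq
 by (rule sets.sigma_sets_subset) (use measurable_sets[OF time_measurable] measurable_sets[OF mark_measurable] in blast)

lemma sets_GG_GN: "sets (GG j) \<subseteq> sets (GN j)"
 unfolding sets_GN_eq by blast

lemma time_GN: "\<tau> (Suc j) \<in> borel_measurable (GN j)"
 by (rule measurableI) (simp, unfold sets_GN_eq space_GN, rule sigma_sets.Basic, blast)

lemma sets_GN: "sets (GN j) \<subseteq> sets P"
 unfolding sets_GN_eq
 by (rule sets.sigma_sets_subset) (use measurable_sets[OF time_measurable] sets_GG in blast)

lemma sets_FF_mono: "s <= t ==> sets (FF s) \<subseteq> sets (FF t)"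
proof -
 assume st: "s <= t"
 let ?g = "%t. {mode \<tau> \<gamma> s -` S \<inter> space P |s S. 0 <= s & s <= t & S \<in> sets (borel :: 'e measure)}"
 have *: "?g t \<subseteq> Pow (space P)" for t by auto
 show ?thesis unfolding mode_filtration_def sets_measure_of[OF *]
  by (rule sigma_sets_mono') (use st in force)
qed

lemma mode_preimage:
 assumes "0 <= t"
 shows "mode \<tau> \<gamma> t -` S \<inter> space P =
  (\<Union>i\<le>J. {w \<in> space P. \<tau> i w <= ereal t & ereal t < \<tau> (Suc i) w & \<gamma> i w \<in> S})"
proof (intro equalityI subsetI)
 fix w assume w: "w \<in> mode \<tau> \<gamma> t -` S \<inter> space P"
 then obtain j where "j <= J" "\<tau> j w <= ereal t" "ereal t < \<tau> (Suc j) w"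
  using index_exists[of w t] assms by auto
 then show "w \<in> (\<Union>i\<le>J. {w \<in> space P. \<tau> i w <= ereal t & ereal t < \<tau> (Suc i) w & \<gamma> i w \<in> S})"
  using w mode_eq[of w j t] by auto
qed (auto simp: mode_eq)

lemma sets_FF: "sets (FF t) \<subseteq> sets P"
proof -
 note time_measurable[measurable] mark_measurable[measurable]
 have *: "mode \<tau> \<gamma> s -` S \<inter> space P \<in> sets P" if "0 <= s" "S \<in> sets borel" for s S
  unfolding mode_preimage[OF that(1)] using that(2) by measurable
 show ?thesis unfolding mode_filtration_def
  by (subst sets_measure_of) (auto intro!: sets.sigma_sets_subset *)
qed

text \<open>Before the next jump, observing the mode process reveals nothing beyond the first
  \<open>j\<close> jumps and marks. The proof is an induction over the generated sigma
  field.\<close>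

lemma FF_trace:
 assumes "A \<in> sets (FF t)"
 shows "\<exists>A' \<in> sets (GG j). \<forall>w\<in>space P. ereal t < \<tau> (Suc j) w --> (w \<in> A \<longleftrightarrow> w \<in> A')"
proof -
 have "{mode \<tau> \<gamma> s -` S \<inter> space P |s S. 0 <= s & s <= t & S \<in> sets borel} \<subseteq> Pow (space P)" by auto
 then have "A \<in> sigma_sets (space P) {mode \<tau> \<gamma> s -` S \<inter> space P |s S. 0 <= s & s <= t & S \<in> sets borel}"
  using assms by (simp add: mode_filtration_def)
 then show ?thesis
 proof induction
  case (Basic A)
  then obtain s S where A: "A = mode \<tau> \<gamma> s -` S \<inter> space P" "0 <= s" "s <= t" and S[measurable]: "S \<in> sets borel" by auto
  \<comment> \<open>On the event that the next jump is after \<open>t\<close>, the mode at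
    \<open>s \<le> t\<close> is one of the marks up to \<open>j\<close>. For index \<open>j\<close>
    the condition \<open>s < \<tau> (Suc j)\<close> is left out: it holds on the event, and it is
    not measurable for the past.\<close>
  define A' where "A' = (\<Union>i\<in>{..<j}. {w \<in> space (GG j). \<tau> i w <= ereal s & ereal s < \<tau> (Suc i) w & \<gamma> i w \<in> S})
    \<union> {w \<in> space (GG j). \<tau> j w <= ereal s & \<gamma> j w \<in> S}"
  have "A' \<in> sets (GG j)"
   unfolding A'_def
  proof (intro sets.Un sets.finite_UN)
   show "{w \<in> space (GG j). \<tau> i w <= ereal s & ereal s < \<tau> (Suc i) w & \<gamma> i w \<in> S} \<in> sets (GG j)" if "i \<in> {..<j}" for i
   proof -
    have [measurable]: "\<tau> i \<in> borel_measurable (GG j)" "\<tau> (Suc i) \<in> borel_measurable (GG j)" "\<gamma> i \<in> GG j \<rightarrow>\<^sub>M borel"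
     using that by (auto intro: time_GG mark_GG)
    show ?thesis by measurable
   qed
   have [measurable]: "\<tau> j \<in> borel_measurable (GG j)" "\<gamma> j \<in> GG j \<rightarrow>\<^sub>M borel" by (auto intro: time_GG mark_GG)
   show "{w \<in> space (GG j). \<tau> j w <= ereal s & \<gamma> j w \<in> S} \<in> sets (GG j)" by measurable
  qed simp
  moreover have "w \<in> A \<longleftrightarrow> w \<in> A'" if w: "w \<in> space P" "ereal t < \<tau> (Suc j) w" for w
  proof -
   obtain i where i: "i <= J" "\<tau> i w <= ereal s" "ereal s < \<tau> (Suc i) w"
    using index_exists[OF w(1) A(2)] by blast
   have sj: "ereal s < \<tau> (Suc j) w" using w(2) A(3) by (meson ereal_less_eq(3) le_less_trans)
   have "i <= j"
   proof (rule ccontr)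
    assume "\<not> i <= j"
    then have "\<tau> (Suc j) w <= \<tau> i w" by (intro time_mono[OF w(1)]) simp
    with i(2) sj show False by (meson leD order.trans)
   qed
   have "w \<in> A' \<longleftrightarrow> \<gamma> i w \<in> S"
   proof
    assume "w \<in> A'"
    then obtain i' where i': "\<tau> i' w <= ereal s" "ereal s < \<tau> (Suc i') w" "\<gamma> i' w \<in> S"
     using sj unfolding A'_def by blast
    then show "\<gamma> i w \<in> S" using index_unique[OF w(1) i'(1,2) i(2,3)] by simp
   next
    assume "\<gamma> i w \<in> S"
    then show "w \<in> A'" using i w(1) \<open>i <= j\<close> unfolding A'_def
     by (cases "i = j") auto
   qed
   then show ?thesis using mode_eq[OF w(1) i(2,3)] w(1) by (simp add: A)
  qed
  ultimately show ?case by blast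
 next
  case (Compl A)
  then obtain A' where "A' \<in> sets (GG j)" "\<forall>w\<in>space P. ereal t < \<tau> (Suc j) w --> (w \<in> A \<longleftrightarrow> w \<in> A')" by auto
  then show ?case using sets.compl_sets[of A' "GG j"] by (intro bexI[of _ "space (GG j) - A'"]) auto
 next
  case (Union A)
  then have "\<forall>i. \<exists>A'. A' \<in> sets (GG j) & (\<forall>w\<in>space P. ereal t < \<tau> (Suc j) w --> (w \<in> A i \<longleftrightarrow> w \<in> A'))" by blast
  then obtain A' where "\<And>i. A' i \<in> sets (GG j)" "\<And>i. \<forall>w\<in>space P. ereal t < \<tau> (Suc j) w --> (w \<in> A i \<longleftrightarrow> w \<in> A' i)"
   by metis
  then show ?case by (intro bexI[of _ "\<Union>i. A' i"]) auto
 qed (intro bexI[of _ "{}"], auto)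
qed

text \<open>The cumulated hazard of the waiting time after the \<open>j\<close>-th jump;
  \<open>exp (- ilam j w t)\<close> is its conditional survival function.\<close>

definition ilam :: "nat => 'w => real => real" where
 "ilam j w t = (LINT r:{0..t}|lborel. lam (\<gamma> j w) (real_of_ereal (\<tau> j w) + r))"

lemma subalgebra_GG: "subalgebra P (GG j)"
 unfolding subalgebra_def using sets_GG by auto

lemma subalgebra_GN: "subalgebra P (GN j)"
 unfolding subalgebra_def using sets_GN by auto

lemma lam_continuous_time: "continuous_on {0..} (lam x)"
proof -
 have "continuous_on {0..} (%t. (%(x, t). lam x t) (x, t))"
  by (rule continuous_on_compose2[OF lam_continuous]) (auto intro!: continuous_intros)
 then show ?thesis by simp
qed

text \<open>Joint continuity alone is not enough: without separability of the modes the product of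
  the Borel sigma fields may be smaller than the Borel sigma field of the product. Rounding the time
  down to a grid leaves a countable patchwork of functions that are continuous in the mode. The
  cut-off at 0 makes the function total, as \<open>lam\<close> is controlled only for nonnegative
  times.\<close>

lemma lam_measurable: "(%p. lam (fst p) (max 0 (snd p))) \<in> borel_measurable (borel \<Otimes>\<^sub>M borel)"
proof (rule borel_measurable_LIMSEQ_real)
 fix n :: nat
 show "(%p. lam (fst p) (max 0 (of_int \<lfloor>real (Suc n) * snd p\<rfloor> / real (Suc n)))) \<in> borel_measurable (borel \<Otimes>\<^sub>M borel)"
 proof (rule measurable_compose_countable[where g = "%p. \<lfloor>real (Suc n) * snd p\<rfloor>"])
  fix i :: int
  have "continuous_on UNIV (%x. lam x (max 0 (of_int i / real (Suc n))))"
  proof -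
   have "continuous_on UNIV (%x. (%(x, t). lam x t) (x, max 0 (of_int i / real (Suc n))))"
    by (rule continuous_on_compose2[OF lam_continuous]) (auto intro!: continuous_intros)
   then show ?thesis by simp
  qed
  then have "(%x. lam x (max 0 (of_int i / real (Suc n)))) \<in> borel_measurable borel"
   by (rule borel_measurable_continuous_onI)
  then show "(%p. lam (fst p) (max 0 (of_int i / real (Suc n)))) \<in> borel_measurable (borel \<Otimes>\<^sub>M borel)"
   by (rule measurable_compose[OF measurable_fst])
 qed measurable
next
 fix p :: "'e \<times> real"
 have "(%n. of_int \<lfloor>real (Suc n) * snd p\<rfloor> / real (Suc n)) \<longlonglongrightarrow> snd p"
 proof (rule real_tendsto_sandwich)
  show "\<forall>\<^sub>F n in sequentially. snd p - 1 / real (Suc n) <= of_int \<lfloor>real (Suc n) * snd p\<rfloor> / real (Suc n)"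
  proof (intro always_eventually allI)
   fix n
   have "(real (Suc n) * snd p - 1) / real (Suc n) <= of_int \<lfloor>real (Suc n) * snd p\<rfloor> / real (Suc n)"
    by (intro divide_right_mono real_of_int_floor_ge_diff_one) simp
   then show "snd p - 1 / real (Suc n) <= of_int \<lfloor>real (Suc n) * snd p\<rfloor> / real (Suc n)"
    by (simp add: diff_divide_distrib)
  qed
  show "\<forall>\<^sub>F n in sequentially. of_int \<lfloor>real (Suc n) * snd p\<rfloor> / real (Suc n) <= snd p"
   by (intro always_eventually allI) (simp add: field_simps)
  show "(%n. snd p - 1 / real (Suc n)) \<longlonglongrightarrow> snd p" by real_asymp
 qed simp
 then have "(%n. max 0 (of_int \<lfloor>real (Suc n) * snd p\<rfloor> / real (Suc n))) \<longlonglongrightarrow> max 0 (snd p)"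
  by (intro tendsto_intros)
 then show "(%n. lam (fst p) (max 0 (of_int \<lfloor>real (Suc n) * snd p\<rfloor> / real (Suc n)))) \<longlonglongrightarrow> lam (fst p) (max 0 (snd p))"
  by (intro continuous_on_tendsto_compose[OF lam_continuous_time]) auto
qed

lemma rate_continuous:
 assumes "w \<in> space P"
 shows "continuous_on {0..} (%r. lam (\<gamma> j w) (real_of_ereal (\<tau> j w) + r))"
 by (rule continuous_on_compose2[OF lam_continuous_time])
   (auto intro!: continuous_intros simp: time_nonneg[OF assms] real_of_ereal_pos)

text \<open>The derivative of the survival function is minus the rate times the survival function,
  so the waiting time has the density \<open>rate * exp (- ilam)\<close>.\<close>

lemma ilam_FTC:
 assumes "w \<in> space P" "0 <= a" "a <= b"
 shows "(\<integral>\<^sup>+r. indicator {a..b} r * ennreal (lam (\<gamma> j w) (real_of_ereal (\<tau> j w) + r) * exp (- ilam j w r)) \<partial>lborel)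
   = ennreal (exp (- ilam j w a) - exp (- ilam j w b))"
  and "ilam j w a <= ilam j w b"
proof -
 define f where "f = (%r. lam (\<gamma> j w) (real_of_ereal (\<tau> j w) + r))"
 have fc: "continuous_on {0..b} f" unfolding f_def
  by (rule continuous_on_subset[OF rate_continuous[OF assms(1)]]) auto
 have f0: "0 <= f r" if "0 <= r" for r
  unfolding f_def using that time_nonneg[OF assms(1), of j] by (intro lam_nonneg) (auto simp: real_of_ereal_pos)
 have il: "ilam j w t = integral {0..t} f" if "t \<in> {0..b}" for t
 proof -
  have "set_integrable lborel {0..t} f"
   using borel_integrable_compact[OF compact_Icc continuous_on_subset[OF fc]] that
   by (simp add: set_integrable_def indicator_def if_distrib cong: if_cong)
  then show ?thesis unfolding ilam_def f_def[symmetric] by (rule set_borel_integral_eq_integral)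
 qed
 have d: "((%t. ilam j w t) has_real_derivative f t) (at t within {a..b})" if "t \<in> {a..b}" for t
 proof -
  have "((%u. integral {0..u} f) has_vector_derivative f t) (at t within {0..b})"
   using that assms by (intro integral_has_vector_derivative fc) auto
  then have "((%u. integral {0..u} f) has_real_derivative f t) (at t within {a..b})"
   using assms by (auto simp: has_real_derivative_iff_has_vector_derivative intro: has_vector_derivative_within_subset)
  then show ?thesis
   by (rule has_field_derivative_transform_within[of _ _ _ _ 1]) (use that assms il in auto)
 qed
 have cil: "continuous_on {a..b} (%t. ilam j w t)"
  using d by (meson DERIV_continuous continuous_on_eq_continuous_within)
 have c: "continuous_on {a..b} (%r. f r * exp (- ilam j w r))"
  by (intro continuous_intros cil continuous_on_subset[OF fc]) (use assms in auto)
 have e: "(\<integral>r. indicator {a..b} r *\<^sub>R (f r * exp (- ilam j w r)) \<partial>lborel) = - exp (- ilam j w b) - - exp (- ilam j w a)"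
  by (rule integral_FTC_Icc[OF assms(3) _ c])
    (auto intro!: derivative_eq_intros d simp: has_real_derivative_iff_has_vector_derivative[symmetric])
 have i: "integrable lborel (%r. indicator {a..b} r *\<^sub>R (f r * exp (- ilam j w r)))"
  using borel_integrable_compact[OF compact_Icc c] by (simp add: indicator_def if_distrib cong: if_cong)
 have "(\<integral>\<^sup>+r. ennreal (indicator {a..b} r *\<^sub>R (f r * exp (- ilam j w r))) \<partial>lborel)
   = ennreal (exp (- ilam j w a) - exp (- ilam j w b))"
  by (subst nn_integral_eq_integral[OF i]) (use e f0 assms in \<open>auto simp: indicator_def\<close>)
 then show "(\<integral>\<^sup>+r. indicator {a..b} r * ennreal (lam (\<gamma> j w) (real_of_ereal (\<tau> j w) + r) * exp (- ilam j w r)) \<partial>lborel)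
   = ennreal (exp (- ilam j w a) - exp (- ilam j w b))"
  unfolding f_def by (simp add: ennreal_mult' ennreal_indicator)
 show "ilam j w a <= ilam j w b"
  unfolding il[of a, unfolded atLeastAtMost_iff, OF conjI, OF assms(2,3)]
   il[of b, unfolded atLeastAtMost_iff, OF conjI, OF order.trans[OF assms(2,3)] order_refl]
  using f0 fc assms
  by (intro integral_subset_le integrable_continuous_real) (auto intro: continuous_on_subset)
qed

end

section \<open>The compensator of the jumps\<close>

lemma nn_integral_distr_density:
 assumes [measurable]: "f \<in> borel_measurable M" "T \<in> M \<rightarrow>\<^sub>M N" "g \<in> borel_measurable N"
 shows "(\<integral>\<^sup>+y. g y \<partial>distr (density M f) N T) = (\<integral>\<^sup>+x. f x * g (T x) \<partial>M)"
 by (simp add: nn_integral_distr nn_integral_density)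

lemma emeasure_distr_density:
 assumes [measurable]: "f \<in> borel_measurable M" "T \<in> M \<rightarrow>\<^sub>M N" "A \<in> sets N"
 shows "emeasure (distr (density M f) N T) A = (\<integral>\<^sup>+x. f x * indicator A (T x) \<partial>M)"
 using nn_integral_distr_density[of f M T N "indicator A"] by simp

lemma exists_nat_interval: "\<exists>n. - real n <= x & x < real n"
proof -
 obtain n where "\<bar>x\<bar> < real n" using reals_Archimedean2 by blast
 then show ?thesis by (intro exI[of _ n]) linarith
qed

context mode_process
begin

lemma [measurable]: "\<tau> j \<in> borel_measurable P" "\<gamma> j \<in> P \<rightarrow>\<^sub>M borel"
 by (fact time_measurable mark_measurable)+

lemma lam_measurable'[measurable (raw)]:
 assumes [measurable]: "f \<in> M \<rightarrow>\<^sub>M borel" "g \<in> borel_measurable M"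
 shows "(%x. lam (f x) (max 0 (g x))) \<in> borel_measurable M"
 using measurable_compose[OF measurable_Pair[OF assms] lam_measurable] by simp

lemma id_GG: "(%w. w) \<in> P \<rightarrow>\<^sub>M GG j"
proof (rule measurableI)
 fix A assume "A \<in> sets (GG j)"
 moreover from this have "(%w. w) -` A \<inter> space P = A" using sets.sets_into_space[of A "GG j"] by auto
 ultimately show "(%w. w) -` A \<inter> space P \<in> sets P" using sets_GG by auto
qed simp

lemma sub_P:
 assumes "f \<in> GG j \<rightarrow>\<^sub>M N" shows "f \<in> P \<rightarrow>\<^sub>M N"
 using measurable_compose[OF id_GG assms] by simp

definition rate where "rate j w r = lam (\<gamma> j w) (max 0 (real_of_ereal (\<tau> j w) + r))"

lemma rate_eq: "w \<in> space P ==> 0 <= r ==> rate j w r = lam (\<gamma> j w) (real_of_ereal (\<tau> j w) + r)"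
 using time_nonneg[of w j] by (simp add: rate_def real_of_ereal_pos)

lemma rate_nonneg: "0 <= rate j w r"
 unfolding rate_def by (rule lam_nonneg) simp

lemma rate_measurable[measurable (raw)]:
 assumes [measurable]: "f \<in> M \<rightarrow>\<^sub>M GG j" "g \<in> borel_measurable M"
 shows "(%x. rate j (f x) (g x)) \<in> borel_measurable M"
proof -
 have [measurable]: "\<tau> j \<in> borel_measurable (GG j)" "\<gamma> j \<in> GG j \<rightarrow>\<^sub>M borel" by (auto intro: time_GG mark_GG)
 show ?thesis unfolding rate_def by measurable
qed

lemma ilam_rate: "w \<in> space P ==> ilam j w t = (\<integral>r. (if 0 <= r & r <= t then rate j w r else 0) \<partial>lborel)"
 unfolding ilam_def set_lebesgue_integral_def
 by (intro Bochner_Integration.integral_cong) (auto simp: indicator_def rate_eq)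

lemma ilam_measurable[measurable (raw)]:
 assumes [measurable]: "f \<in> M \<rightarrow>\<^sub>M GG j" "g \<in> borel_measurable M"
 shows "(%x. ilam j (f x) (g x)) \<in> borel_measurable M"
proof -
 have "(%x. \<integral>r. (if 0 <= r & r <= g x then rate j (f x) r else 0) \<partial>lborel) \<in> borel_measurable M"
  by measurable
 moreover have "f x \<in> space P" if "x \<in> space M" for x
  using measurable_space[OF assms(1) that] by simp
 ultimately show ?thesis
  by (subst measurable_cong[where g = "%x. \<integral>r. (if 0 <= r & r <= g x then rate j (f x) r else 0) \<partial>lborel"])
    (auto simp: ilam_rate)
qed

definition later where "later j t = {w \<in> space P. \<tau> j w + ereal t <= \<tau> (Suc j) w}"

lemma later_sets[measurable]: "later j t \<in> sets P"
 unfolding later_def by measurable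

text \<open>Integrating the conditional law over a set of the past removes the conditional
  expectation. The set must lie where \<open>\<tau> j\<close> is finite, since the law speaks only
  about this event.\<close>

lemma time_law_set:
 assumes j: "j < J" and t: "0 <= t" and H: "H \<in> sets (GG j)" and Hf: "\<And>w. w \<in> H ==> \<tau> j w < \<infinity>"
 shows "emeasure P (H \<inter> later j t) = (\<integral>\<^sup>+w. indicator H w * ennreal (exp (- ilam j w t)) \<partial>P)"
proof -
 have HP[measurable]: "H \<in> sets P" using H sets_GG by auto
 interpret S: finite_measure_subalgebra P "GG j"
  by unfold_locales (rule subalgebra_GG)
 note id_GG[measurable]
 let ?I = "indicator (later j t) :: 'w => real"
 have i: "integrable P ?I" by (rule integrable_const_bound[where B = 1]) auto
 have "measure P (H \<inter> later j t) = (\<integral>w\<in>H. ?I w \<partial>P)"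
  by (simp add: set_lebesgue_integral_def indicator_inter_arith[symmetric])
 also have "\<dots> = (\<integral>w\<in>H. real_cond_exp P (GG j) ?I w \<partial>P)"
  by (rule S.real_cond_exp_intA[OF i H])
 also have "\<dots> = (\<integral>w\<in>H. exp (- ilam j w t) \<partial>P)"
  unfolding set_lebesgue_integral_def
 proof (rule integral_cong_AE)
  show "AE w in P. indicator H w *\<^sub>R real_cond_exp P (GG j) ?I w = indicator H w *\<^sub>R exp (- ilam j w t)"
   using time_law[OF j t] unfolding later_def[symmetric] ilam_def[symmetric]
   by eventually_elim (auto simp: indicator_def dest: Hf)
 qed (use borel_measurable_cond_exp2[measurable] in measurable)
 finally have e: "measure P (H \<inter> later j t) = (\<integral>w. indicator H w * exp (- ilam j w t) \<partial>P)"
  by (simp add: set_lebesgue_integral_def)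
 have il: "0 <= ilam j w t" if "w \<in> space P" for w
  unfolding ilam_rate[OF that] by (intro Bochner_Integration.integral_nonneg) (auto simp: rate_nonneg)
 have "integrable P (%w. indicator H w * exp (- ilam j w t))"
  by (rule integrable_const_bound[where B = 1]) (auto simp: indicator_def il)
 from nn_integral_eq_integral[OF this] show ?thesis
  by (simp add: emeasure_eq_measure e[symmetric] ennreal_mult' ennreal_indicator)
qed

text \<open>Both sides are integrals of \<open>Y\<close> with respect to measures on the past that
  agree on all its sets, so the extension from sets to functions is one equality of
  measures.\<close>

lemma later_GG_integral:
 assumes j: "j < J" and t: "0 <= t" and Y: "Y \<in> borel_measurable (GG j)" and Yf: "\<And>w. w \<in> space P ==> \<tau> j w = \<infinity> ==> Y w = 0"
 shows "(\<integral>\<^sup>+w. Y w * indicator (later j t) w \<partial>P) = (\<integral>\<^sup>+w. Y w * ennreal (exp (- ilam j w t)) \<partial>P)"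
proof -
 note id_GG[measurable]
 have [measurable]: "\<tau> j \<in> borel_measurable (GG j)" by (rule time_GG) simp
 have F: "{w \<in> space P. \<tau> j w < \<infinity>} \<in> sets (GG j)"
  using measurable_sets[OF time_GG[of j j], of "{..<\<infinity>}"] by (simp add: vimage_def Int_def conj_commute)
 define M1 where "M1 = distr (density P (%w. indicator {w \<in> space P. \<tau> j w < \<infinity>} w * indicator (later j t) w)) (GG j) (%w. w)"
 define M2 where "M2 = distr (density P (%w. indicator {w \<in> space P. \<tau> j w < \<infinity>} w * ennreal (exp (- ilam j w t)))) (GG j) (%w. w)"
 have f1: "(%w. indicator {w \<in> space P. \<tau> j w < \<infinity>} w * indicator (later j t) w :: ennreal) \<in> borel_measurable P"
  by measurable
 have f2: "(%w. indicator {w \<in> space P. \<tau> j w < \<infinity>} w * ennreal (exp (- ilam j w t))) \<in> borel_measurable P"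
  by measurable
 have "M1 = M2"
 proof (rule measure_eqI)
  fix A assume "A \<in> sets M1"
  then have A: "A \<in> sets (GG j)" by (simp add: M1_def)
  then have AP[measurable]: "A \<in> sets P" and A': "(%w. w) -` A \<inter> space P = A"
   using sets_GG sets.sets_into_space[of A "GG j"] by auto
  let ?H = "A \<inter> {w \<in> space P. \<tau> j w < \<infinity>}"
  have H: "?H \<in> sets (GG j)" using A F by auto
  have "emeasure M1 A = emeasure P (?H \<inter> later j t)"
  proof -
   have HP: "?H \<in> sets P" using H sets_GG by auto
   have "emeasure M1 A = (\<integral>\<^sup>+w. indicator (?H \<inter> later j t) w \<partial>P)"
    unfolding M1_def emeasure_distr_density[OF f1 id_GG A]
    by (rule nn_integral_cong) (auto split: split_indicator)
   then show ?thesis using HP by simp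
  qed
  also have "\<dots> = (\<integral>\<^sup>+w. indicator ?H w * ennreal (exp (- ilam j w t)) \<partial>P)"
   by (rule time_law_set[OF j t H]) auto
  also have "\<dots> = emeasure M2 A"
   unfolding M2_def emeasure_distr_density[OF f2 id_GG A]
   by (rule nn_integral_cong) (auto split: split_indicator)
  finally show "emeasure M1 A = emeasure M2 A" .
 qed (simp add: M1_def M2_def)
 then have "(\<integral>\<^sup>+w. Y w \<partial>M1) = (\<integral>\<^sup>+w. Y w \<partial>M2)" by simp
 moreover have "(\<integral>\<^sup>+w. Y w \<partial>M1) = (\<integral>\<^sup>+w. Y w * indicator (later j t) w \<partial>P)"
  unfolding M1_def nn_integral_distr_density[OF f1 id_GG Y]
  by (rule nn_integral_cong) (auto simp: Yf split: split_indicator)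
 moreover have "(\<integral>\<^sup>+w. Y w \<partial>M2) = (\<integral>\<^sup>+w. Y w * ennreal (exp (- ilam j w t)) \<partial>P)"
  unfolding M2_def nn_integral_distr_density[OF f2 id_GG Y]
  by (rule nn_integral_cong) (auto simp: Yf mult.commute split: split_indicator)
 ultimately show ?thesis by simp
qed

text \<open>No property of the past is lost by waiting for the event that no jump occurs up to time \<open>T\<close>.\<close>

lemma past_null_transfer:
 assumes H: "H \<in> sets (GG j)" and Hf: "\<And>w. w \<in> H ==> \<tau> j w < \<infinity>" and j: "j <= J" and T: "0 <= T"
  and null: "AE w in P. w \<in> H --> \<not> ereal T < \<tau> (Suc j) w"
 shows "AE w in P. w \<notin> H"
proof (cases "j = J")
 case True
 show ?thesis using null AE_space by eventually_elim (auto simp: True time_Suc_J)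
next
 case False
 then have j: "j < J" using j by simp
 obtain K where K: "\<And>x t. 0 <= t ==> lam x t <= K" using lam_bounded by blast
 have HP[measurable]: "H \<in> sets P" using H sets_GG by auto
 \<comment> \<open>A waiting time of at least \<open>T + 1\<close> forces the strict inequality
   \<open>T < \<tau> (Suc j)\<close>, and its conditional probability is an exponential, hence
   positive on all of \<open>H\<close>.\<close>
 have "AE w in P. w \<notin> H \<inter> later j (T + 1)"
  using null AE_space
 proof eventually_elim
  case (elim w)
  show ?case
  proof
   assume w: "w \<in> H \<inter> later j (T + 1)"
   have "ereal T < ereal (T + 1)" by simp
   also have "\<dots> <= \<tau> j w + ereal (T + 1)" using time_nonneg[OF elim(2), of j] by (simp add: add_increasing)
   also have "\<dots> <= \<tau> (Suc j) w" using w by (simp add: later_def)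
   finally show False using elim w by simp
  qed
 qed
 then have "H \<inter> later j (T + 1) \<in> null_sets P"
  by (rule AE_iff_null_sets[THEN iffD2, rotated]) measurable
 then have "emeasure P (H \<inter> later j (T + 1)) = 0" by auto
 then have "(\<integral>\<^sup>+w. indicator H w * ennreal (exp (- ilam j w (T + 1))) \<partial>P) = 0"
  using time_law_set[OF j _ H Hf, of "T + 1"] T by simp
 then have "AE w in P. indicator H w * ennreal (exp (- ilam j w (T + 1))) = 0"
  by (subst (asm) nn_integral_0_iff_AE) (use id_GG[measurable] in measurable)
 then show ?thesis by eventually_elim (auto split: split_indicator_asm)
qed

text \<open>By the conditional density of the waiting time, evaluation at the jump is integration
  against \<open>rate * exp (- ilam)\<close>. The factor \<open>exp (- ilam)\<close> is itself the
  conditional probability of \<open>later\<close>, and exchanging it for that indicator produces the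
  compensator form, an integral of the rate up to the jump. The identity of the measures
  \<open>M1\<close> and \<open>M2\<close> is checked on rectangles of a past event and a half-open
  interval.\<close>

lemma time_transfer_shift:
 assumes j: "j < J" and g[measurable]: "g \<in> borel_measurable (GG j \<Otimes>\<^sub>M borel)"
 shows "(\<integral>\<^sup>+w. indicator {w \<in> space P. \<tau> (Suc j) w < \<infinity>} w * g (w, real_of_ereal (\<tau> (Suc j) w) - real_of_ereal (\<tau> j w)) \<partial>P)
  = (\<integral>\<^sup>+w. \<integral>\<^sup>+r. indicator {w \<in> space P. \<tau> j w < \<infinity>} w * (indicator (later j r) w * indicator {0<..} r) * ennreal (rate j w r) * g (w, r) \<partial>lborel \<partial>P)"
proof -
 note id_GG[measurable]
 have [measurable]: "\<tau> j \<in> borel_measurable (GG j)" by (rule time_GG) simp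
 have F: "{w \<in> space P. \<tau> j w < \<infinity>} \<in> sets (GG j)"
  using measurable_sets[OF time_GG[of j j], of "{..<\<infinity>}"] by (simp add: vimage_def Int_def conj_commute)
 have lm[measurable]: "(%p. indicator (later j (snd p)) (fst p) :: ennreal) \<in> borel_measurable (P \<Otimes>\<^sub>M borel)"
 proof -
  have "(%p. indicator (later j (snd p)) (fst p)) = (%p. indicator {p \<in> space (P \<Otimes>\<^sub>M borel). \<tau> j (fst p) + ereal (snd p) <= \<tau> (Suc j) (fst p)} p :: ennreal)"
   by (auto simp: later_def indicator_def space_pair_measure fun_eq_iff)
  then show ?thesis by simp
 qed
 let ?D = "%w. real_of_ereal (\<tau> (Suc j) w) - real_of_ereal (\<tau> j w)"
 let ?f = "%(w, r). indicator {w \<in> space P. \<tau> j w < \<infinity>} w * (indicator (later j r) w * indicator {0<..} r) * ennreal (rate j w r)"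
 have idm[measurable]: "(%p. p) \<in> P \<Otimes>\<^sub>M borel \<rightarrow>\<^sub>M GG j \<Otimes>\<^sub>M borel"
 proof -
  have "(%p. (fst p, snd p)) \<in> P \<Otimes>\<^sub>M borel \<rightarrow>\<^sub>M GG j \<Otimes>\<^sub>M borel" by measurable
  then show ?thesis by simp
 qed
 have fm[measurable]: "?f \<in> borel_measurable (P \<Otimes>\<^sub>M borel)"
 proof -
  have "(%p. indicator {w \<in> space P. \<tau> j w < \<infinity>} (fst p) * (indicator (later j (snd p)) (fst p) * indicator {0<..} (snd p)) * ennreal (rate j (fst p) (snd p))) \<in> borel_measurable (P \<Otimes>\<^sub>M borel)"
   by measurable
  then show ?thesis by (simp add: case_prod_beta')
 qed
 define M1 where "M1 = distr (density P (indicator {w \<in> space P. \<tau> (Suc j) w < \<infinity>})) (GG j \<Otimes>\<^sub>M borel) (%w. (w, ?D w))"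
 define M2 where "M2 = distr (density (P \<Otimes>\<^sub>M lborel) ?f) (GG j \<Otimes>\<^sub>M borel) (%p. p)"
 have e1: "emeasure M1 A = (\<integral>\<^sup>+w. indicator {w \<in> space P. \<tau> (Suc j) w < \<infinity>} w * indicator A (w, ?D w) \<partial>P)"
  if [measurable]: "A \<in> sets (GG j \<Otimes>\<^sub>M borel)" for A
  unfolding M1_def by (rule emeasure_distr_density) measurable
 have e2: "(\<integral>\<^sup>+p. h p \<partial>M2) = (\<integral>\<^sup>+w. \<integral>\<^sup>+r. ?f (w, r) * h (w, r) \<partial>lborel \<partial>P)"
  if [measurable]: "h \<in> borel_measurable (GG j \<Otimes>\<^sub>M borel)" for h
 proof -
  have "h \<in> borel_measurable (P \<Otimes>\<^sub>M borel)" using measurable_compose[OF idm that] by simp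
  then have hm[measurable]: "h \<in> borel_measurable (P \<Otimes>\<^sub>M lborel)" by (simp cong: measurable_cong_sets)
  have fm'[measurable]: "?f \<in> borel_measurable (P \<Otimes>\<^sub>M lborel)" using fm by (simp cong: measurable_cong_sets)
  have idm'[measurable]: "(%p. p) \<in> P \<Otimes>\<^sub>M lborel \<rightarrow>\<^sub>M GG j \<Otimes>\<^sub>M borel" using idm by (simp cong: measurable_cong_sets)
  have "(%p. ?f p * h p) \<in> borel_measurable (P \<Otimes>\<^sub>M lborel)"
   using fm' hm by (rule borel_measurable_times_ennreal)
  from lborel.nn_integral_fst[OF this] show ?thesis
   unfolding M2_def nn_integral_distr_density[OF fm' idm' that] by simp
 qed
 have "M1 = M2"
 proof (rule measure_eqI_generator_eq[where \<Omega> = "space P \<times> UNIV" and A = "%n. space P \<times> {- real n ..< real n}"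
   and E = "{a \<times> b |a b. a \<in> sets (GG j) & b \<in> range (%(a, b). {a ..< b :: real})}"])
  show "Int_stable {a \<times> b |a b. a \<in> sets (GG j) & b \<in> range (%(a, b). {a ..< b :: real})}"
  proof (rule Int_stableI)
   fix A B assume "A \<in> {a \<times> b |a b. a \<in> sets (GG j) & b \<in> range (%(a, b). {a ..< b :: real})}"
    "B \<in> {a \<times> b |a b. a \<in> sets (GG j) & b \<in> range (%(a, b). {a ..< b :: real})}"
   then obtain H1 H2 a b c d where "A = H1 \<times> {a..<b}" "B = H2 \<times> {c..<d}" "H1 \<in> sets (GG j)" "H2 \<in> sets (GG j)"
    by auto
   then have "A \<inter> B = (H1 \<inter> H2) \<times> {max a c..<min b d}" "H1 \<inter> H2 \<in> sets (GG j)" by (auto simp: Times_Int_Times)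
   then show "A \<inter> B \<in> {a \<times> b |a b. a \<in> sets (GG j) & b \<in> range (%(a, b). {a ..< b :: real})}"
    by (auto intro!: exI[of _ "H1 \<inter> H2"])
  qed
  have "sets (GG j \<Otimes>\<^sub>M borel) = sets (sigma (space (GG j) \<times> space borel) {a \<times> b |a b. a \<in> sets (GG j) & b \<in> range (%(a, b). {a ..< b :: real})})"
  proof (rule sets_pair_eq)
   show "sets borel = sigma_sets (space borel) (range (%(a, b). {a ..< b :: real}))"
    by (subst borel_eq_atLeastLessThan) (simp add: sets_measure_of)
   show "countable {space (GG j)}" "countable (range (%n. {- real n ..< real n}))" by auto
   show "\<Union> (range (%n. {- real n ..< real n})) = space borel"
   proof -
    show ?thesis using exists_nat_interval by auto
   qed
  qed (use sets.sets_into_space[of _ "GG j"] sets.sigma_sets_eq[of "GG j"] sets.top[of "GG j"] in auto)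
  then have s: "sets (GG j \<Otimes>\<^sub>M borel) = sigma_sets (space P \<times> UNIV) {a \<times> b |a b. a \<in> sets (GG j) & b \<in> range (%(a, b). {a ..< b :: real})}"
   using sets.sets_into_space[of _ "GG j"] by (subst (asm) sets_measure_of) auto
  then show "sets M1 = sigma_sets (space P \<times> UNIV) {a \<times> b |a b. a \<in> sets (GG j) & b \<in> range (%(a, b). {a ..< b :: real})}"
   "sets M2 = sigma_sets (space P \<times> UNIV) {a \<times> b |a b. a \<in> sets (GG j) & b \<in> range (%(a, b). {a ..< b :: real})}"
   by (simp_all add: M1_def M2_def)
  show "emeasure M1 X = emeasure M2 X" if XE: "X \<in> {a \<times> b |a b. a \<in> sets (GG j) & b \<in> range (%(a, b). {a ..< b :: real})}" for X
  proof -
   obtain H a b where X: "X = H \<times> {a..<b}" and H: "H \<in> sets (GG j)" using XE by auto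
   have HP[measurable]: "H \<in> sets P" using H sets_GG by auto
   have XM: "X \<in> sets (GG j \<Otimes>\<^sub>M borel)" using H by (auto simp: X)
   \<comment> \<open>Waiting times are positive, so the part of the interval below 0 has no mass;
     the law of the jump time is available for nonnegative arguments only.\<close>
   define a' where "a' = max 0 a"
   define H' where "H' = H \<inter> {w \<in> space P. \<tau> j w < \<infinity>}"
   have H': "H' \<in> sets (GG j)" and H'f: "\<And>w. w \<in> H' ==> \<tau> j w < \<infinity>" using H F by (auto simp: H'_def)
   have H'P[measurable]: "H' \<in> sets P" using H' sets_GG by auto
   show ?thesis
   proof (cases "a' <= b")
    case True
    have a': "0 <= a'" "0 <= b" using True by (auto simp: a'_def)
    have "emeasure M1 X = emeasure P (H' \<inter> later j a' - H' \<inter> later j b)"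
    proof -
     have "emeasure M1 X = (\<integral>\<^sup>+w. indicator (H' \<inter> later j a' - H' \<inter> later j b) w \<partial>P)"
      unfolding e1[OF XM]
     proof (rule nn_integral_cong)
      fix w assume w: "w \<in> space P"
      show "indicator {w \<in> space P. \<tau> (Suc j) w < \<infinity>} w * indicator X (w, ?D w) = (indicator (H' \<inter> later j a' - H' \<inter> later j b) w :: ennreal)"
       using w time_less[OF w, of j] time_infinite[OF w, of j] time_nonneg[OF w, of j] time_nonneg[OF w, of "Suc j"]
       by (cases "\<tau> j w"; cases "\<tau> (Suc j) w")
         (auto simp: X H'_def later_def a'_def indicator_def simp del: ereal_max)
     qed
     then show ?thesis by simp
    qed
    also have "\<dots> = emeasure P (H' \<inter> later j a') - emeasure P (H' \<inter> later j b)"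
    proof (rule emeasure_Diff)
     show "H' \<inter> later j b \<subseteq> H' \<inter> later j a'"
      using True unfolding later_def
      by (auto intro!: order.trans[OF add_left_mono[of "ereal a'" "ereal b"]])
    qed auto
    also have "\<dots> = (\<integral>\<^sup>+w. indicator H' w * ennreal (exp (- ilam j w a')) \<partial>P) - (\<integral>\<^sup>+w. indicator H' w * ennreal (exp (- ilam j w b)) \<partial>P)"
     using time_law_set[OF j a'(1) H' H'f] time_law_set[OF j a'(2) H' H'f] by simp
    also have "\<dots> = (\<integral>\<^sup>+w. indicator H' w * ennreal (exp (- ilam j w a')) - indicator H' w * ennreal (exp (- ilam j w b)) \<partial>P)"
    proof (rule nn_integral_diff[symmetric])
     show "(\<integral>\<^sup>+w. indicator H' w * ennreal (exp (- ilam j w b)) \<partial>P) \<noteq> \<infinity>"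
      using time_law_set[OF j a'(2) H' H'f] emeasure_finite[of "H' \<inter> later j b"] by simp
     show "AE w in P. indicator H' w * ennreal (exp (- ilam j w b)) <= indicator H' w * ennreal (exp (- ilam j w a'))"
      using ilam_FTC(2)[OF _ a'(1) True] by (intro AE_I2) (auto split: split_indicator intro!: ennreal_leI)
    qed measurable
    also have "\<dots> = (\<integral>\<^sup>+w. \<integral>\<^sup>+r. indicator H' w * (indicator {a'..b} r * ennreal (rate j w r * exp (- ilam j w r))) \<partial>lborel \<partial>P)"
    proof (rule nn_integral_cong)
     fix w assume w: "w \<in> space P"
     have m: "(%r. indicator {a'..b} r * ennreal (rate j w r * exp (- ilam j w r))) \<in> borel_measurable lborel"
     proof -
      have [measurable]: "(%r. w) \<in> borel \<rightarrow>\<^sub>M GG j" using w by simp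
      show ?thesis by measurable
     qed
     have "(\<integral>\<^sup>+r. indicator {a'..b} r * ennreal (rate j w r * exp (- ilam j w r)) \<partial>lborel) = ennreal (exp (- ilam j w a') - exp (- ilam j w b))"
      unfolding ilam_FTC(1)[OF w a'(1) True, symmetric]
      by (intro nn_integral_cong) (use a' in \<open>auto simp: rate_eq[OF w] split: split_indicator\<close>)
     then show "indicator H' w * ennreal (exp (- ilam j w a')) - indicator H' w * ennreal (exp (- ilam j w b)) =
       (\<integral>\<^sup>+r. indicator H' w * (indicator {a'..b} r * ennreal (rate j w r * exp (- ilam j w r))) \<partial>lborel)"
      using m by (simp add: nn_integral_cmult ennreal_minus split: split_indicator)
    qed
    also have "\<dots> = (\<integral>\<^sup>+r. \<integral>\<^sup>+w. indicator H' w * (indicator {a'..b} r * ennreal (rate j w r * exp (- ilam j w r))) \<partial>P \<partial>lborel)"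
    proof -
     interpret PL: pair_sigma_finite P lborel ..
     show ?thesis by (rule PL.Fubini'[symmetric]) measurable
    qed
    \<comment> \<open>For fixed \<open>r\<close> the survival function is replaced by the indicator
      of \<open>later j r\<close>; this is why the order of integration is exchanged before and
      restored afterwards.\<close>
    also have "\<dots> = (\<integral>\<^sup>+r. \<integral>\<^sup>+w. indicator H' w * (indicator {a'..b} r * ennreal (rate j w r)) * indicator (later j r) w \<partial>P \<partial>lborel)"
    proof (rule nn_integral_cong)
     fix r
     have [measurable]: "H' \<in> sets (GG j)" by (rule H')
     have [measurable]: "(%w. w) \<in> GG j \<rightarrow>\<^sub>M GG j" by simp
     show "(\<integral>\<^sup>+w. indicator H' w * (indicator {a'..b} r * ennreal (rate j w r * exp (- ilam j w r))) \<partial>P) =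
       (\<integral>\<^sup>+w. indicator H' w * (indicator {a'..b} r * ennreal (rate j w r)) * indicator (later j r) w \<partial>P)"
     proof (cases "r \<in> {a'..b}")
      case True
      then have r: "0 <= r" using a' by auto
      show ?thesis
       by (subst later_GG_integral[OF j r])
         (use H'f in \<open>auto simp: ennreal_mult' mult.assoc rate_nonneg split: split_indicator intro!: nn_integral_cong\<close>)
     qed simp
    qed
    also have "\<dots> = (\<integral>\<^sup>+w. \<integral>\<^sup>+r. indicator H' w * (indicator {a'..b} r * ennreal (rate j w r)) * indicator (later j r) w \<partial>lborel \<partial>P)"
    proof -
     interpret PL: pair_sigma_finite P lborel ..
     have "(%p. indicator H' (fst p) * (indicator {a'..b} (snd p) * ennreal (rate j (fst p) (snd p))) * indicator (later j (snd p)) (fst p)) \<in> borel_measurable (P \<Otimes>\<^sub>M lborel)"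
      using lm by measurable
     then show ?thesis by (intro PL.Fubini') (simp add: case_prod_beta')
    qed
    also have "\<dots> = emeasure M2 X"
    proof -
     have "emeasure M2 X = (\<integral>\<^sup>+p. indicator X p \<partial>M2)" using XM by (simp add: M2_def)
     also have "\<dots> = (\<integral>\<^sup>+w. \<integral>\<^sup>+r. indicator H' w * (indicator {a'..b} r * ennreal (rate j w r)) * indicator (later j r) w \<partial>lborel \<partial>P)"
      unfolding e2[OF borel_measurable_indicator[OF XM]]
     proof (rule nn_integral_cong, rule nn_integral_cong_AE)
      fix w
      \<comment> \<open>The two integrands may disagree at the end points \<open>0\<close> and
        \<open>b\<close> only.\<close>
      show "AE r in lborel. ?f (w, r) * indicator X (w, r) = indicator H' w * (indicator {a'..b} r * ennreal (rate j w r)) * indicator (later j r) w"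
       using AE_lborel_singleton[of 0] AE_lborel_singleton[of b]
       by eventually_elim (auto simp: X H'_def a'_def split: split_indicator)
     qed
     finally show ?thesis by simp
    qed
    finally show ?thesis .
   next
    case False
    have "emeasure M1 X = 0"
     unfolding e1[OF XM]
    proof (subst nn_integral_0_iff_AE)
     show "AE w in P. indicator {w \<in> space P. \<tau> (Suc j) w < \<infinity>} w * indicator X (w, ?D w) = (0 :: ennreal)"
     proof (rule AE_I2)
      fix w assume w: "w \<in> space P"
      show "indicator {w \<in> space P. \<tau> (Suc j) w < \<infinity>} w * indicator X (w, ?D w) = (0 :: ennreal)"
       using w time_less[OF w, of j] time_infinite[OF w, of j] time_nonneg[OF w, of j] time_nonneg[OF w, of "Suc j"] False
       by (cases "\<tau> j w"; cases "\<tau> (Suc j) w") (auto simp: X a'_def indicator_def)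
     qed
    qed (use XM in measurable)
    moreover have "emeasure M2 X = 0"
    proof -
     have "emeasure M2 X = (\<integral>\<^sup>+p. indicator X p \<partial>M2)" using XM by (simp add: M2_def)
     also have "\<dots> = 0"
      unfolding e2[OF borel_measurable_indicator[OF XM]]
     proof -
      have "?f (w, r) * indicator X (w, r) = 0" for w r
       using False by (auto simp: X a'_def split: split_indicator)
      then show "(\<integral>\<^sup>+w. \<integral>\<^sup>+r. ?f (w, r) * indicator X (w, r) \<partial>lborel \<partial>P) = 0"
       by (simp only: nn_integral_const mult_zero_left)
     qed
     finally show ?thesis .
    qed
    ultimately show ?thesis by simp
   qed
  qed
  show "emeasure M1 (space P \<times> {- real n..<real n}) \<noteq> \<infinity>" for n
  proof -
   have "emeasure M1 (space P \<times> {- real n..<real n}) <= (\<integral>\<^sup>+w. 1 \<partial>P)"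
   proof -
    have m: "space P \<times> {- real n..<real n} \<in> sets (GG j \<Otimes>\<^sub>M borel)"
     using sets.top[of "GG j"] by (intro pair_measureI) auto
    show ?thesis unfolding e1[OF m] by (rule nn_integral_mono) (auto split: split_indicator)
   qed
   also have "\<dots> = 1" by (simp add: emeasure_space_1)
   finally show ?thesis by (metis ennreal_one_less_top infinity_ennreal_def not_le)
  qed
  show "range (%n. space P \<times> {- real n..<real n}) \<subseteq> {a \<times> b |a b. a \<in> sets (GG j) & b \<in> range (%(a, b). {a ..< b :: real})}"
   using sets.top[of "GG j"] by auto
  show "(\<Union>n. space P \<times> {- real n..<real n}) = space P \<times> UNIV"
  proof -
   show ?thesis using exists_nat_interval by auto
  qed
 qed (use sets.sets_into_space[of _ "GG j"] in auto)
 then have "(\<integral>\<^sup>+p. g p \<partial>M1) = (\<integral>\<^sup>+w. \<integral>\<^sup>+r. ?f (w, r) * g (w, r) \<partial>lborel \<partial>P)" using e2[OF g] by simp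
 moreover have "(\<integral>\<^sup>+p. g p \<partial>M1) = (\<integral>\<^sup>+w. indicator {w \<in> space P. \<tau> (Suc j) w < \<infinity>} w * g (w, ?D w) \<partial>P)"
  unfolding M1_def by (rule nn_integral_distr_density) measurable
 ultimately show ?thesis by simp
qed

end

section \<open>Transfer of properties from the jump times to the compensator, and along adapted
  processes\<close>

lemma UN_if_zero: "(\<Union>n :: nat. if n = 0 then A else B) = A \<union> B"
proof
 show "A \<union> B \<subseteq> (\<Union>n :: nat. if n = 0 then A else B)"
  using UN_upper[of 0 UNIV "%n :: nat. if n = 0 then A else B"] UN_upper[of 1 UNIV "%n :: nat. if n = 0 then A else B"]
  by simp
qed (auto split: if_splits)

lemma space_predictable [simp]: "space (predictable \<Omega> F T) = \<Omega> \<times> {0..T}"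
 by (simp add: predictable_def space_measure_of_conv)

context mode_process
begin

text \<open>Translation invariance of the Lebesgue measure changes the elapsed time since the
  \<open>j\<close>-th jump into absolute time.\<close>

lemma time_transfer:
 assumes j: "j < J" and g[measurable]: "g \<in> borel_measurable (GG j \<Otimes>\<^sub>M borel)"
 shows "(\<integral>\<^sup>+w. indicator {w \<in> space P. \<tau> (Suc j) w < \<infinity>} w * g (w, real_of_ereal (\<tau> (Suc j) w)) \<partial>P)
  = (\<integral>\<^sup>+w. \<integral>\<^sup>+r. indicator {r. \<tau> j w < ereal r & ereal r <= \<tau> (Suc j) w} r * ennreal (lam (\<gamma> j w) (max 0 r)) * g (w, r) \<partial>lborel \<partial>P)"
proof -
 note id_GG[measurable]
 have [measurable]: "\<tau> j \<in> borel_measurable (GG j)" by (rule time_GG) simp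
 have gm: "(%p. g (fst p, real_of_ereal (\<tau> j (fst p)) + snd p)) \<in> borel_measurable (GG j \<Otimes>\<^sub>M borel)" by measurable
 have "(\<integral>\<^sup>+w. indicator {w \<in> space P. \<tau> (Suc j) w < \<infinity>} w * g (w, real_of_ereal (\<tau> (Suc j) w)) \<partial>P) =
   (\<integral>\<^sup>+w. \<integral>\<^sup>+r. indicator {w \<in> space P. \<tau> j w < \<infinity>} w * (indicator (later j r) w * indicator {0<..} r) * ennreal (rate j w r) * g (w, real_of_ereal (\<tau> j w) + r) \<partial>lborel \<partial>P)"
  using time_transfer_shift[OF j gm] by simp
 also have "\<dots> = (\<integral>\<^sup>+w. \<integral>\<^sup>+r. indicator {r. \<tau> j w < ereal r & ereal r <= \<tau> (Suc j) w} r * ennreal (lam (\<gamma> j w) (max 0 r)) * g (w, r) \<partial>lborel \<partial>P)"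
 proof (rule nn_integral_cong)
  fix w assume w: "w \<in> space P"
  show "(\<integral>\<^sup>+r. indicator {w \<in> space P. \<tau> j w < \<infinity>} w * (indicator (later j r) w * indicator {0<..} r) * ennreal (rate j w r) * g (w, real_of_ereal (\<tau> j w) + r) \<partial>lborel)
   = (\<integral>\<^sup>+r. indicator {r. \<tau> j w < ereal r & ereal r <= \<tau> (Suc j) w} r * ennreal (lam (\<gamma> j w) (max 0 r)) * g (w, r) \<partial>lborel)"
  proof (cases "\<tau> j w")
   case (real c)
   have [measurable]: "(%r. w) \<in> borel \<rightarrow>\<^sub>M GG j" using w by simp
   have m: "(%r. indicator {r. \<tau> j w < ereal r & ereal r <= \<tau> (Suc j) w} r * ennreal (lam (\<gamma> j w) (max 0 r)) * g (w, r)) \<in> borel_measurable borel"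
    by measurable
   show ?thesis
    by (subst nn_integral_real_affine[OF m, of 1 c])
      (auto intro!: nn_integral_cong simp: real w later_def rate_def split: split_indicator)
  qed (use time_nonneg[OF w, of j] in auto)
 qed
 finally show ?thesis .
qed

text \<open>The transition kernel, continued to negative times so that it is a kernel on the whole
  product and can be composed without restricted spaces.\<close>

definition Qm :: "'e => real => 'e measure" where "Qm x t = Q x (max 0 t)"

lemma Qm_kernel: "(%p. Qm (fst p) (snd p)) \<in> borel \<Otimes>\<^sub>M borel \<rightarrow>\<^sub>M prob_algebra borel"
proof -
 have "(%p. (fst p, max 0 (snd p))) \<in> borel \<Otimes>\<^sub>M borel \<rightarrow>\<^sub>M (borel :: 'e measure) \<Otimes>\<^sub>M restrict_space borel {0 :: real..}"
  by (intro measurable_Pair measurable_restrict_space2) auto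
 from measurable_compose[OF this Q_kernel] show ?thesis by (simp add: Qm_def)
qed

lemma Qm_measurable[measurable (raw)]:
 assumes "f \<in> M \<rightarrow>\<^sub>M borel" "g \<in> borel_measurable M"
 shows "(%x. Qm (f x) (g x)) \<in> M \<rightarrow>\<^sub>M prob_algebra borel"
 using measurable_compose[OF measurable_Pair[OF assms] Qm_kernel] by simp

lemma Qm_prob: "prob_space (Qm x t)" and sets_Qm[simp]: "sets (Qm x t) = sets borel" and space_Qm[simp]: "space (Qm x t) = UNIV"
proof -
 have "Qm x t \<in> space (prob_algebra borel)"
  using measurable_space[OF Qm_kernel, of "(x, t)"] by (simp add: space_pair_measure)
 then show "prob_space (Qm x t)" "sets (Qm x t) = sets borel" by (auto simp: space_prob_algebra)
 then show "space (Qm x t) = UNIV" using sets_eq_imp_space_eq by fastforce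
qed

lemma Qm_subprob[measurable (raw)]:
 assumes "f \<in> M \<rightarrow>\<^sub>M borel" "g \<in> borel_measurable M"
 shows "(%x. Qm (f x) (g x)) \<in> M \<rightarrow>\<^sub>M subprob_algebra borel"
 using Qm_measurable[OF assms] by (rule measurable_prob_algebraD)

lemma Qm_eq: "0 <= t ==> Qm x t = Q x t"
 by (simp add: Qm_def)

lemma mark_law_set:
 assumes j: "j < J" and G: "G \<in> sets (GN j)" and Gf: "\<And>w. w \<in> G ==> \<tau> (Suc j) w < \<infinity>" and S[measurable]: "S \<in> sets borel"
 shows "emeasure P (G \<inter> {w \<in> space P. \<gamma> (Suc j) w \<in> S}) =
  (\<integral>\<^sup>+w. indicator G w * emeasure (Qm (\<gamma> j w) (real_of_ereal (\<tau> (Suc j) w))) S \<partial>P)"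
proof -
 have GP[measurable]: "G \<in> sets P" using G sets_GN by auto
 interpret S: finite_measure_subalgebra P "GN j"
  by unfold_locales (rule subalgebra_GN)
 let ?E = "{w \<in> space P. \<gamma> (Suc j) w \<in> S}"
 let ?I = "indicator ?E :: 'w => real"
 let ?Q = "%w. Qm (\<gamma> j w) (real_of_ereal (\<tau> (Suc j) w))"
 have Qs[measurable]: "?Q \<in> P \<rightarrow>\<^sub>M subprob_algebra borel" by measurable
 have mQ[measurable]: "(%w. measure (?Q w) S) \<in> borel_measurable P"
  by (rule measurable_compose[OF Qs measurable_measure_subprob_algebra[OF S]])
 have i: "integrable P ?I" by (rule integrable_const_bound[where B = 1]) auto
 have "measure P (G \<inter> ?E) = (\<integral>w\<in>G. ?I w \<partial>P)"
  by (simp add: set_lebesgue_integral_def indicator_inter_arith[symmetric])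
 also have "\<dots> = (\<integral>w\<in>G. real_cond_exp P (GN j) ?I w \<partial>P)"
  by (rule S.real_cond_exp_intA[OF i G])
 also have "\<dots> = (\<integral>w\<in>G. measure (?Q w) S \<partial>P)"
  unfolding set_lebesgue_integral_def
 proof (rule integral_cong_AE)
  show "AE w in P. indicator G w *\<^sub>R real_cond_exp P (GN j) ?I w = indicator G w *\<^sub>R measure (?Q w) S"
   using mark_law[OF j S] AE_space
   by eventually_elim (auto simp: indicator_def Qm_eq real_of_ereal_pos time_nonneg dest: Gf)
 qed (use borel_measurable_cond_exp2[measurable] in measurable)
 finally have e: "measure P (G \<inter> ?E) = (\<integral>w. indicator G w * measure (?Q w) S \<partial>P)"
  by (simp add: set_lebesgue_integral_def)
 have "integrable P (%w. indicator G w * measure (?Q w) S)"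
  by (rule integrable_const_bound[where B = 1]) (auto simp: indicator_def prob_space.prob_le_1[OF Qm_prob])
 from nn_integral_eq_integral[OF this] show ?thesis
  by (simp add: emeasure_eq_measure e[symmetric] ennreal_mult' ennreal_indicator
    finite_measure.emeasure_eq_measure[OF prob_space.finite_measure[OF Qm_prob]])
qed

lemma predictable_gen_subset:
 "{G \<times> {0} |G. G \<in> sets (FF 0)} \<union> {G \<times> {s<..t} |G s t. 0 <= s & s <= t & t <= T & G \<in> sets (FF s)}
  \<subseteq> Pow (space P \<times> {0..T})" if "0 <= T"
 using that sets.sets_into_space[of _ "FF _"] by fastforce

abbreviation "pred T \<equiv> predictable (space P) FF T"

lemma sets_pred_eq: "0 <= T ==> sets (pred T) = sigma_sets (space P \<times> {0..T})
  ({G \<times> {0} |G. G \<in> sets (FF 0)} \<union> {G \<times> {s<..t} |G s t. 0 <= s & s <= t & t <= T & G \<in> sets (FF s)})"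
 unfolding predictable_def by (rule sets_measure_of[OF predictable_gen_subset])

lemma id_pred: assumes "0 <= T" shows "(%p. p) \<in> P \<Otimes>\<^sub>M restrict_space borel {0..T} \<rightarrow>\<^sub>M pred T"
 unfolding predictable_def
proof (rule measurable_measure_of[OF predictable_gen_subset[OF assms]])
 show "(%p. p) \<in> space (P \<Otimes>\<^sub>M restrict_space borel {0..T}) \<rightarrow> space P \<times> {0..T}"
  by (auto simp: space_pair_measure)
 have R: "B \<in> sets (restrict_space borel {0..T})" if "B \<subseteq> {0..T}" "B \<in> sets borel" for B :: "real set"
  using that by (auto simp: sets_restrict_space_iff)
 fix A assume A: "A \<in> {G \<times> {0} |G. G \<in> sets (FF 0)} \<union> {G \<times> {s<..t} |G s t. 0 <= s & s <= t & t <= T & G \<in> sets (FF s)}"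
 have "\<exists>G B t. A = G \<times> B & G \<in> sets (FF t) & B \<subseteq> {0..T} & B \<in> sets borel"
  using A
 proof (elim UnE CollectE exE conjE)
  fix G assume "A = G \<times> {0}" "G \<in> sets (FF 0)"
  then show ?thesis by (intro exI[of _ G] exI[of _ "{0}"] exI[of _ 0]) (use assms in simp)
 next
  fix G s t assume "A = G \<times> {s<..t}" "G \<in> sets (FF s)" "0 <= s" "t <= T"
  then show ?thesis by (intro exI[of _ G] exI[of _ "{s<..t}"] exI[of _ s]) auto
 qed
 then obtain G B t where GB: "A = G \<times> B" "G \<in> sets (FF t)" "B \<subseteq> {0..T}" "B \<in> sets borel"
  by blast
 then have "A \<in> sets (P \<Otimes>\<^sub>M restrict_space borel {0..T})"
  using sets_FF[of t] R[OF GB(3,4)] by (auto intro!: pair_measureI)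
 moreover have "A \<subseteq> space (P \<Otimes>\<^sub>M restrict_space borel {0..T})" using calculation by (rule sets.sets_into_space)
 ultimately show "(%p. p) -` A \<inter> space (P \<Otimes>\<^sub>M restrict_space borel {0..T}) \<in> sets (P \<Otimes>\<^sub>M restrict_space borel {0..T})"
  by (simp add: vimage_def Int_absorb2)
qed

text \<open>The minimum with \<open>T\<close> keeps the pair inside the space of the predictable
  sigma field also on paths whose jump comes after \<open>T\<close> or never.\<close>

lemma time_to_pred: "0 <= T ==> (%w. (w, min T (real_of_ereal (\<tau> i w)))) \<in> P \<rightarrow>\<^sub>M pred T"
 by (rule measurable_compose[OF _ id_pred])
   (auto intro!: measurable_Pair measurable_restrict_space2 simp: time_nonneg real_of_ereal_pos)

text \<open>This is the defining property of the compensator for a single jump. \<open>N1\<close> is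
  the law of path, jump time and mark, restricted to jumps up to \<open>T\<close>; \<open>N2\<close>
  puts the rate and the transition kernel in place of the jump. They agree on predictable sets times
  sets of marks, hence have the same null sets.\<close>

lemma predictable_transfer:
 assumes j: "j < J" and T: "0 <= T" and psi: "Measurable.pred (pred T \<Otimes>\<^sub>M borel) \<psi>"
  and ae: "AE w in P. \<tau> (Suc j) w <= ereal T --> \<psi> ((w, real_of_ereal (\<tau> (Suc j) w)), \<gamma> (Suc j) w)"
 shows "AE w in P. AE r in lborel. \<tau> j w < ereal r --> ereal r <= \<tau> (Suc j) w --> r <= T --> lam (\<gamma> j w) r \<noteq> 0 -->
   (AE th in Q (\<gamma> j w) r. \<psi> ((w, r), th))"
proof -
 define L where "L = restrict_space lborel {0..T}"
 have sL: "sets L = sets (restrict_space borel {0..T})" by (simp add: L_def sets_restrict_space)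
 interpret L: sigma_finite_measure L
  unfolding L_def by (rule sigma_finite_measure_restrict_space) (auto intro: sigma_finite_lborel)
 interpret PL: pair_sigma_finite P L ..
 have idL: "(%p. p) \<in> P \<Otimes>\<^sub>M L \<rightarrow>\<^sub>M pred T"
  using id_pred[OF T] sL by (simp cong: measurable_cong_sets sets_pair_measure_cong)
 have sndL[measurable]: "snd \<in> P \<Otimes>\<^sub>M L \<rightarrow>\<^sub>M borel"
 proof -
  have "(%x. x) \<in> L \<rightarrow>\<^sub>M borel" unfolding L_def by (intro measurable_restrict_space1) simp
  from measurable_compose[OF measurable_snd[of P L] this] show ?thesis by simp
 qed
 let ?ind = "%w. {r. \<tau> j w < ereal r & ereal r <= \<tau> (Suc j) w}"
 define f where "f = (%p. indicator (?ind (fst p)) (snd p) * ennreal (lam (\<gamma> j (fst p)) (max 0 (snd p))))"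
 have fm[measurable]: "f \<in> borel_measurable (P \<Otimes>\<^sub>M L)" unfolding f_def indicator_def by measurable
 define K where "K = (%p. distr (Qm (\<gamma> j (fst p)) (snd p)) (pred T \<Otimes>\<^sub>M borel) (%th. (p, th)))"
 have Km: "K \<in> P \<Otimes>\<^sub>M L \<rightarrow>\<^sub>M subprob_algebra (pred T \<Otimes>\<^sub>M borel)"
  unfolding K_def
 proof (rule measurable_distr2[where M = borel])
  have "(%p. (fst p, snd p)) \<in> (P \<Otimes>\<^sub>M L) \<Otimes>\<^sub>M borel \<rightarrow>\<^sub>M pred T \<Otimes>\<^sub>M borel"
   by (intro measurable_Pair measurable_compose[OF measurable_fst idL] measurable_snd)
  then show "(%(p, th). (p, th)) \<in> (P \<Otimes>\<^sub>M L) \<Otimes>\<^sub>M borel \<rightarrow>\<^sub>M pred T \<Otimes>\<^sub>M borel" by (simp add: id_def)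
 qed measurable
 define N1 where "N1 = distr (density P (indicator {w \<in> space P. \<tau> (Suc j) w <= ereal T})) (pred T \<Otimes>\<^sub>M borel)
   (%w. ((w, min T (real_of_ereal (\<tau> (Suc j) w))), \<gamma> (Suc j) w))"
 define N2 where "N2 = density (P \<Otimes>\<^sub>M L) f \<bind> K"
 have ne: "space (P \<Otimes>\<^sub>M L) \<noteq> {}" using not_empty T by (auto simp: space_pair_measure L_def)
 have mp: "(%w. ((w, min T (real_of_ereal (\<tau> (Suc j) w))), \<gamma> (Suc j) w)) \<in> P \<rightarrow>\<^sub>M pred T \<Otimes>\<^sub>M borel"
  by (intro measurable_Pair time_to_pred[OF T] mark_measurable)
 have e1: "emeasure N1 A = (\<integral>\<^sup>+w. indicator {w \<in> space P. \<tau> (Suc j) w <= ereal T} w * indicator A ((w, min T (real_of_ereal (\<tau> (Suc j) w))), \<gamma> (Suc j) w) \<partial>P)"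
  if "A \<in> sets (pred T \<Otimes>\<^sub>M borel)" for A
  unfolding N1_def by (rule emeasure_distr_density[OF _ mp that]) measurable
 have e2: "emeasure N2 (a \<times> S) = (\<integral>\<^sup>+w. \<integral>\<^sup>+r. f (w, r) * (indicator a (w, r) * emeasure (Qm (\<gamma> j w) r) S) \<partial>L \<partial>P)"
  if a: "a \<in> sets (pred T)" and S[measurable]: "S \<in> sets borel" for a S
 proof -
  have A: "a \<times> S \<in> sets (pred T \<Otimes>\<^sub>M borel)" using a S by auto
  have "a \<subseteq> space P \<times> {0..T}" using sets.sets_into_space[OF a] by simp
  then have aP: "a \<in> sets (P \<Otimes>\<^sub>M L)"
   using measurable_sets[OF idL a] by (simp add: space_pair_measure L_def Int_absorb2)
  have k: "emeasure (K p) (a \<times> S) = indicator a p * emeasure (Qm (\<gamma> j (fst p)) (snd p)) S" if p: "p \<in> space (P \<Otimes>\<^sub>M L)" for p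
  proof -
   have p': "p \<in> space (pred T)" using p by (auto simp: space_pair_measure L_def)
   have "(%th. (p, th)) \<in> Qm (\<gamma> j (fst p)) (snd p) \<rightarrow>\<^sub>M pred T \<Otimes>\<^sub>M borel"
    using p' by (intro measurable_Pair measurable_const) (auto simp: measurable_def)
   then have "emeasure (K p) (a \<times> S) = emeasure (Qm (\<gamma> j (fst p)) (snd p)) ((%th. (p, th)) -` (a \<times> S))"
    unfolding K_def by (subst emeasure_distr) (use A in auto)
   also have "(%th. (p, th)) -` (a \<times> S) = (if p \<in> a then S else {})" by auto
   finally show ?thesis by (auto simp: indicator_def)
  qed
  have Qe[measurable]: "(%p. emeasure (Qm (\<gamma> j (fst p)) (snd p)) S) \<in> borel_measurable (P \<Otimes>\<^sub>M L)"
   by (rule measurable_compose[OF _ measurable_emeasure_subprob_algebra[OF S]]) measurable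
  have gm: "(%p. indicator a p * emeasure (Qm (\<gamma> j (fst p)) (snd p)) S) \<in> borel_measurable (P \<Otimes>\<^sub>M L)"
   by (intro borel_measurable_times_ennreal borel_measurable_indicator aP Qe)
  have "emeasure N2 (a \<times> S) = (\<integral>\<^sup>+p. emeasure (K p) (a \<times> S) \<partial>density (P \<Otimes>\<^sub>M L) f)"
   unfolding N2_def using ne A Km by (intro emeasure_bind) simp_all
  also have "\<dots> = (\<integral>\<^sup>+p. indicator a p * emeasure (Qm (\<gamma> j (fst p)) (snd p)) S \<partial>density (P \<Otimes>\<^sub>M L) f)"
   by (rule nn_integral_cong) (simp add: k)
  also have "\<dots> = (\<integral>\<^sup>+p. f p * (indicator a p * emeasure (Qm (\<gamma> j (fst p)) (snd p)) S) \<partial>(P \<Otimes>\<^sub>M L))"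
   by (rule nn_integral_density[OF fm gm])
  also have "\<dots> = (\<integral>\<^sup>+w. \<integral>\<^sup>+r. f (w, r) * (indicator a (w, r) * emeasure (Qm (\<gamma> j w) r) S) \<partial>L \<partial>P)"
   using L.nn_integral_fst[OF borel_measurable_times_ennreal[OF fm gm]] by simp
  finally show ?thesis .
 qed
 define E1 where "E1 = {G \<times> {0} |G. G \<in> sets (FF 0)} \<union> {G \<times> {s<..t} |G s t. 0 <= s & s <= t & t <= T & G \<in> sets (FF s)}"
 have E1I: "G \<times> {0} \<in> E1" if "G \<in> sets (FF 0)" for G
  using that unfolding E1_def by blast
 have E1I': "G \<times> {s<..t} \<in> E1" if "G \<in> sets (FF s)" "0 <= s" "s <= t" "t <= T" for G s t
  using that unfolding E1_def by blast
 have E1E: thesis if "a \<in> E1" "\<And>G. a = G \<times> {0} ==> G \<in> sets (FF 0) ==> thesis"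
   "\<And>G s t. a = G \<times> {s<..t} ==> G \<in> sets (FF s) ==> 0 <= s ==> s <= t ==> t <= T ==> thesis" for a thesis
  using that unfolding E1_def by blast
 have E1sub: "E1 \<subseteq> Pow (space P \<times> {0..T})"
  unfolding E1_def by (rule predictable_gen_subset[OF T])
 have E1sets: "sets (pred T) = sigma_sets (space P \<times> {0..T}) E1"
  unfolding E1_def by (rule sets_pred_eq[OF T])
 let ?E = "{a \<times> S |a S. a \<in> E1 & S \<in> sets (borel :: 'e measure)}"
 have FFI: "G \<inter> G' \<in> sets (FF (max s s'))" if "G \<in> sets (FF s)" "G' \<in> sets (FF s')" for G G' s s'
  using that sets_FF_mono[of s "max s s'"] sets_FF_mono[of s' "max s s'"] by auto
 have E0: "{} \<in> E1" using E1I[of "{}"] by simp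
 have inter: "a \<inter> b \<in> E1" if ab: "a \<in> E1" "b \<in> E1" for a b
  using ab(1)
 proof (rule E1E)
  fix G assume a: "a = G \<times> {0}" "G \<in> sets (FF 0)"
  show ?thesis using ab(2)
  proof (rule E1E)
   fix G' assume "b = G' \<times> {0}" "G' \<in> sets (FF 0)"
   moreover from this have "a \<inter> b = (G \<inter> G') \<times> {0}" using a by auto
   ultimately show ?thesis using a E1I by auto
  next
   fix G' s t assume "b = G' \<times> {s<..t}" "0 <= s"
   then have "a \<inter> b = {}" using a by auto
   then show ?thesis using E0 by simp
  qed
 next
  fix G s t assume a: "a = G \<times> {s<..t}" "G \<in> sets (FF s)" "0 <= s" "s <= t" "t <= T"
  show ?thesis using ab(2)
  proof (rule E1E)
   fix G' assume "b = G' \<times> {0}" "G' \<in> sets (FF 0)"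
   then have "a \<inter> b = {}" using a by auto
   then show ?thesis using E0 by simp
  next
   fix G' s' t' assume b: "b = G' \<times> {s'<..t'}" "G' \<in> sets (FF s')" "0 <= s'" "s' <= t'" "t' <= T"
   have ab: "a \<inter> b = (G \<inter> G') \<times> {max s s'<..min t t'}" using a b by (auto simp: Times_Int_Times)
   show ?thesis
   proof (cases "max s s' <= min t t'")
    case True
    show ?thesis unfolding ab by (rule E1I'[OF FFI[OF a(2) b(2)]]) (use a b True in auto)
   next
    case False
    then have "a \<inter> b = {}" unfolding ab by auto
    then show ?thesis using E0 by simp
   qed
  qed
 qed
 have N12: "N1 = N2"
 proof (rule measure_eqI_generator_eq[where \<Omega> = "(space P \<times> {0..T}) \<times> UNIV" and E = ?E
    and A = "%n :: nat. if n = 0 then (space P \<times> {0}) \<times> UNIV else (space P \<times> {0<..T}) \<times> UNIV"])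
  show "Int_stable ?E"
  proof (rule Int_stableI)
   fix A B assume "A \<in> ?E" "B \<in> ?E"
   then obtain a S b S' where "A = a \<times> S" "B = b \<times> S'" "a \<in> E1" "b \<in> E1" "S \<in> sets borel" "S' \<in> sets borel" by blast
   then have "A \<inter> B = (a \<inter> b) \<times> (S \<inter> S')" "a \<inter> b \<in> E1" "S \<inter> S' \<in> sets borel"
    using inter[of a b] by (simp_all add: Times_Int_Times)
   then show "A \<inter> B \<in> ?E" by blast
  qed
  show "?E \<subseteq> Pow ((space P \<times> {0..T}) \<times> UNIV)"
   using E1sub by blast
  have "sets (pred T \<Otimes>\<^sub>M (borel :: 'e measure)) = sets (sigma (space (pred T) \<times> space (borel :: 'e measure)) ?E)"
  proof (rule sets_pair_eq)
   show "E1 \<subseteq> Pow (space (pred T))" using E1sub by simp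
   show "sets (pred T) = sigma_sets (space (pred T)) E1" using E1sets by simp
   show "countable {space P \<times> {0}, space P \<times> {0<..T}}" "countable {UNIV :: 'e set}" by auto
   show "{space P \<times> {0}, space P \<times> {0<..T}} \<subseteq> E1"
    using E1I[of "space P"] E1I'[of "space P" 0 T] T sets.top[of "FF 0"] by simp
   show "\<Union> {space P \<times> {0}, space P \<times> {0<..T}} = space (pred T)" using T by auto
  qed (use sets.sigma_sets_eq[of "borel :: 'e measure"] in auto)
  then have s: "sets (pred T \<Otimes>\<^sub>M (borel :: 'e measure)) = sigma_sets ((space P \<times> {0..T}) \<times> UNIV) ?E"
   using E1sub by (subst (asm) sets_measure_of) (simp_all, blast)
  have sN2: "sets N2 = sets (pred T \<Otimes>\<^sub>M borel)"
   unfolding N2_def using ne Km by (subst sets_bind[where N = "pred T \<Otimes>\<^sub>M borel"]) (auto simp: sets_kernel[OF Km])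
  show "sets N1 = sigma_sets ((space P \<times> {0..T}) \<times> UNIV) ?E" using s by (simp add: N1_def)
  show "sets N2 = sigma_sets ((space P \<times> {0..T}) \<times> UNIV) ?E" using s sN2 by simp
  fix X assume "X \<in> ?E"
  then obtain a S where X: "X = a \<times> S" "a \<in> E1" and S[measurable]: "S \<in> sets borel" by blast
  have a: "a \<in> sets (pred T)" using X(2) unfolding E1sets by (rule sigma_sets.Basic)
  have XM: "X \<in> sets (pred T \<Otimes>\<^sub>M borel)" using a S by (simp add: X(1))
  show "emeasure N1 X = emeasure N2 X"
   using X(2)
  proof (rule E1E)
   \<comment> \<open>Generators at time 0 have no mass on either side, since every jump time after
     the initial one is positive.\<close>
   fix G assume aG: "a = G \<times> {0}" and G: "G \<in> sets (FF 0)"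
   have "emeasure N1 X = (\<integral>\<^sup>+w. 0 \<partial>P)"
    unfolding e1[OF XM]
   proof (rule nn_integral_cong)
    fix w assume w: "w \<in> space P"
    have "0 < \<tau> (Suc j) w" using time_strict_mono[OF w, of 0 "Suc j"] time_0[OF w] by simp
    then show "indicator {w \<in> space P. \<tau> (Suc j) w <= ereal T} w * indicator X ((w, min T (real_of_ereal (\<tau> (Suc j) w))), \<gamma> (Suc j) w) = (0 :: ennreal)"
     by (cases "\<tau> (Suc j) w") (auto simp: X(1) aG indicator_def min_def)
   qed
   also have "\<dots> = emeasure N2 X"
    unfolding X(1) e2[OF a S]
   proof (rule nn_integral_cong)
    fix w assume w: "w \<in> space P"
    have "f (w, r) * (indicator a (w, r) * emeasure (Qm (\<gamma> j w) r) S) = 0" for r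
     using time_nonneg[OF w, of j] by (auto simp: f_def aG split: split_indicator) (auto simp: zero_ereal_def[symmetric])
    then show "0 = (\<integral>\<^sup>+r. f (w, r) * (indicator a (w, r) * emeasure (Qm (\<gamma> j w) r) S) \<partial>L)"
     by (simp only: nn_integral_const mult_zero_left)
   qed
   finally show ?thesis .
  next
   fix G s t assume aG: "a = G \<times> {s<..t}" and G: "G \<in> sets (FF s)" and st: "0 <= s" "s <= t" "t <= T"
   \<comment> \<open>An event known at time \<open>s\<close> is replaced by an event of the past of
     jump \<open>j\<close>, which is legitimate on \<open>s < \<tau> (Suc j)\<close>. The resulting
     set is determined by the past and the next jump time, so the laws of mark and time
     apply.\<close>
   obtain G' where G': "G' \<in> sets (GG j)" "\<And>w. w \<in> space P ==> ereal s < \<tau> (Suc j) w ==> w \<in> G \<longleftrightarrow> w \<in> G'"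
    using FF_trace[OF G, of j] by blast
   note G'(1)[measurable]
   let ?H = "G' \<inter> {w \<in> space (GN j). ereal s < \<tau> (Suc j) w & \<tau> (Suc j) w <= ereal t}"
   have H: "?H \<in> sets (GN j)"
   proof -
    have [measurable]: "\<tau> (Suc j) \<in> borel_measurable (GN j)" by (rule time_GN)
    have "{w \<in> space (GN j). ereal s < \<tau> (Suc j) w & \<tau> (Suc j) w <= ereal t} \<in> sets (GN j)" by measurable
    moreover have "G' \<in> sets (GN j)" using G'(1) sets_GG_GN by blast
    ultimately show ?thesis by (rule sets.Int[rotated])
   qed
   have HP: "?H \<in> sets P" using H sets_GN by auto
   have Hf: "\<tau> (Suc j) w < \<infinity>" if "w \<in> ?H" for w using that by auto
   have "emeasure N1 X = (\<integral>\<^sup>+w. indicator (?H \<inter> {w \<in> space P. \<gamma> (Suc j) w \<in> S}) w \<partial>P)"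
    unfolding e1[OF XM]
   proof (rule nn_integral_cong)
    fix w assume w: "w \<in> space P"
    show "indicator {w \<in> space P. \<tau> (Suc j) w <= ereal T} w * indicator X ((w, min T (real_of_ereal (\<tau> (Suc j) w))), \<gamma> (Suc j) w)
      = (indicator (?H \<inter> {w \<in> space P. \<gamma> (Suc j) w \<in> S}) w :: ennreal)"
     using st G'(2)[OF w] w time_nonneg[OF w, of "Suc j"]
     by (cases "\<tau> (Suc j) w") (auto simp: X(1) aG indicator_def min_def)
   qed
   also have "\<dots> = emeasure P (?H \<inter> {w \<in> space P. \<gamma> (Suc j) w \<in> S})"
    by (intro nn_integral_indicator sets.Int[OF HP]) measurable
   also have "\<dots> = (\<integral>\<^sup>+w. indicator ?H w * emeasure (Qm (\<gamma> j w) (real_of_ereal (\<tau> (Suc j) w))) S \<partial>P)"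
    by (rule mark_law_set[OF j H Hf S])
   also have "\<dots> = (\<integral>\<^sup>+w. indicator {w \<in> space P. \<tau> (Suc j) w < \<infinity>} w * (indicator G' w * indicator {s<..t} (real_of_ereal (\<tau> (Suc j) w)) * emeasure (Qm (\<gamma> j w) (real_of_ereal (\<tau> (Suc j) w))) S) \<partial>P)"
   proof (rule nn_integral_cong)
    fix w assume w: "w \<in> space P"
    show "indicator ?H w * emeasure (Qm (\<gamma> j w) (real_of_ereal (\<tau> (Suc j) w))) S = indicator {w \<in> space P. \<tau> (Suc j) w < \<infinity>} w * (indicator G' w * indicator {s<..t} (real_of_ereal (\<tau> (Suc j) w)) * emeasure (Qm (\<gamma> j w) (real_of_ereal (\<tau> (Suc j) w))) S)"
     using w time_nonneg[OF w, of "Suc j"] by (cases "\<tau> (Suc j) w") (auto simp: indicator_def)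
   qed
   also have "\<dots> = (\<integral>\<^sup>+w. \<integral>\<^sup>+r. indicator (?ind w) r * ennreal (lam (\<gamma> j w) (max 0 r)) * (indicator G' w * indicator {s<..t} r * emeasure (Qm (\<gamma> j w) r) S) \<partial>lborel \<partial>P)"
   proof -
    have [measurable]: "\<gamma> j \<in> GG j \<rightarrow>\<^sub>M borel" by (rule mark_GG) simp
    have [measurable]: "(%p. emeasure (Qm (\<gamma> j (fst p)) (snd p)) S) \<in> borel_measurable (GG j \<Otimes>\<^sub>M borel)"
     by (rule measurable_compose[OF _ measurable_emeasure_subprob_algebra[OF S]]) measurable
    have "(%p. indicator G' (fst p) * indicator {s<..t} (snd p) * emeasure (Qm (\<gamma> j (fst p)) (snd p)) S) \<in> borel_measurable (GG j \<Otimes>\<^sub>M borel)"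
     by measurable
    from time_transfer[OF j this] show ?thesis by simp
   qed
   also have "\<dots> = emeasure N2 X"
    unfolding X(1) e2[OF a S]
   proof (rule nn_integral_cong)
    fix w assume w: "w \<in> space P"
    have "(\<integral>\<^sup>+r. f (w, r) * (indicator a (w, r) * emeasure (Qm (\<gamma> j w) r) S) \<partial>L) =
     (\<integral>\<^sup>+r. f (w, r) * (indicator a (w, r) * emeasure (Qm (\<gamma> j w) r) S) * indicator {0..T} r \<partial>lborel)"
     unfolding L_def by (intro nn_integral_restrict_space) simp
    also have "\<dots> = (\<integral>\<^sup>+r. indicator (?ind w) r * ennreal (lam (\<gamma> j w) (max 0 r)) * (indicator G' w * indicator {s<..t} r * emeasure (Qm (\<gamma> j w) r) S) \<partial>lborel)"
    proof (rule nn_integral_cong)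
     fix r
     have "ereal s < \<tau> (Suc j) w" if "s < r" "ereal r <= \<tau> (Suc j) w"
      using that by (meson ereal_less(2) less_ereal.simps(1) less_le_trans)
     then show "f (w, r) * (indicator a (w, r) * emeasure (Qm (\<gamma> j w) r) S) * indicator {0..T} r =
      indicator (?ind w) r * ennreal (lam (\<gamma> j w) (max 0 r)) * (indicator G' w * indicator {s<..t} r * emeasure (Qm (\<gamma> j w) r) S)"
      using G'(2)[OF w] st by (auto simp: f_def aG split: split_indicator)
    qed
    finally show "(\<integral>\<^sup>+r. indicator (?ind w) r * ennreal (lam (\<gamma> j w) (max 0 r)) * (indicator G' w * indicator {s<..t} r * emeasure (Qm (\<gamma> j w) r) S) \<partial>lborel)
     = (\<integral>\<^sup>+r. f (w, r) * (indicator a (w, r) * emeasure (Qm (\<gamma> j w) r) S) \<partial>L)" by simp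
   qed
   finally show ?thesis .
  qed
 next
  fix n :: nat
  have A: "(if n = 0 then (space P \<times> {0}) \<times> UNIV else (space P \<times> {0<..T}) \<times> UNIV) \<in> sets (pred T \<Otimes>\<^sub>M (borel :: 'e measure))"
  proof -
   have "space P \<times> {0} \<in> E1" "space P \<times> {0<..T} \<in> E1" using E1I[of "space P"] E1I'[of "space P" 0 T] T sets.top[of "FF 0"] by simp_all
   then have "space P \<times> {0} \<in> sets (pred T)" "space P \<times> {0<..T} \<in> sets (pred T)"
    unfolding E1sets by (auto intro: sigma_sets.Basic)
   then show ?thesis by (auto intro!: pair_measureI)
  qed
  have "emeasure N1 (if n = 0 then (space P \<times> {0}) \<times> UNIV else (space P \<times> {0<..T}) \<times> UNIV) <= (\<integral>\<^sup>+w. 1 \<partial>P)"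
   unfolding e1[OF A] by (rule nn_integral_mono) (auto split: split_indicator)
  also have "\<dots> = 1" by (simp add: emeasure_space_1)
  finally show "emeasure N1 (if n = 0 then (space P \<times> {0}) \<times> UNIV else (space P \<times> {0<..T}) \<times> UNIV) \<noteq> \<infinity>"
   by (metis ennreal_one_less_top infinity_ennreal_def not_le)
 next
  show "range (%n :: nat. if n = 0 then (space P \<times> {0}) \<times> UNIV else (space P \<times> {0<..T}) \<times> UNIV) \<subseteq> ?E"
  proof -
   have "space P \<times> {0} \<in> E1" "space P \<times> {0<..T} \<in> E1" using E1I[of "space P"] E1I'[of "space P" 0 T] T sets.top[of "FF 0"] by simp_all
   then have "a \<times> UNIV \<in> ?E" if "a = space P \<times> {0} \<or> a = space P \<times> {0<..T}" for a
    using that by (intro CollectI exI[of _ a] exI[of _ UNIV]) auto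
   then show ?thesis by (simp add: image_subset_iff)
  qed
  show "(\<Union>n :: nat. if n = 0 then (space P \<times> {0}) \<times> UNIV else (space P \<times> {0<..T}) \<times> UNIV) = (space P \<times> {0..T}) \<times> (UNIV :: 'e set)"
  proof -
   have "{0..T} = {0} \<union> {0<..T}" using T by auto
   then show ?thesis unfolding UN_if_zero by (simp add: Sigma_Un_distrib1[symmetric] Sigma_Un_distrib2[symmetric])
  qed
 qed
 have aeN1: "AE z in N1. \<psi> z"
  unfolding N1_def
 proof (subst AE_distr_iff)
  show "AE w in density P (indicator {w \<in> space P. \<tau> (Suc j) w <= ereal T}). \<psi> ((w, min T (real_of_ereal (\<tau> (Suc j) w))), \<gamma> (Suc j) w)"
  proof (subst AE_density)
   show "AE w in P. 0 < (indicator {w \<in> space P. \<tau> (Suc j) w <= ereal T} w :: ennreal) --> \<psi> ((w, min T (real_of_ereal (\<tau> (Suc j) w))), \<gamma> (Suc j) w)"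
    using ae AE_space
   proof eventually_elim
    case (elim w)
    then show ?case using time_nonneg[OF elim(2), of "Suc j"]
     by (cases "\<tau> (Suc j) w") (auto simp: indicator_def min_def)
   qed
  qed measurable
  show "{x \<in> space (pred T \<Otimes>\<^sub>M borel). \<psi> x} \<in> sets (pred T \<Otimes>\<^sub>M borel)" using psi by measurable
  show "(%w. ((w, min T (real_of_ereal (\<tau> (Suc j) w))), \<gamma> (Suc j) w)) \<in> density P (indicator {w \<in> space P. \<tau> (Suc j) w <= ereal T}) \<rightarrow>\<^sub>M pred T \<Otimes>\<^sub>M borel"
   using mp by simp
 qed
 have "AE z in N2. \<psi> z" using aeN1 unfolding N12 .
 then have "AE p in density (P \<Otimes>\<^sub>M L) f. AE z in K p. \<psi> z"
  unfolding N2_def using Km psi by (subst (asm) AE_bind[where B = "pred T \<Otimes>\<^sub>M borel"]) simp_all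
 then have "AE p in P \<Otimes>\<^sub>M L. 0 < f p --> (AE z in K p. \<psi> z)" by (subst (asm) AE_density) simp_all
 then have "AE p in P \<Otimes>\<^sub>M L. 0 < f p --> (AE th in Qm (\<gamma> j (fst p)) (snd p). \<psi> (p, th))"
  using AE_space
 proof eventually_elim
  case (elim p)
  have p': "p \<in> space (pred T)" using elim(2) by (auto simp: space_pair_measure L_def)
  have "(%th. (p, th)) \<in> Qm (\<gamma> j (fst p)) (snd p) \<rightarrow>\<^sub>M pred T \<Otimes>\<^sub>M borel"
   using p' by (intro measurable_Pair measurable_const) (auto simp: measurable_def)
  then show ?case using elim(1) psi unfolding K_def by (subst (asm) AE_distr_iff) (auto simp: pred_def)
 qed
 then have "AE w in P. AE r in L. 0 < f (w, r) --> (AE th in Qm (\<gamma> j w) r. \<psi> ((w, r), th))"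
  by (drule_tac PL.AE_pair) (simp only: fst_conv snd_conv)
 then show ?thesis using AE_space
 proof eventually_elim
  case (elim w)
  then have "AE r in lborel. r \<in> {0..T} --> 0 < f (w, r) --> (AE th in Qm (\<gamma> j w) r. \<psi> ((w, r), th))"
   unfolding L_def by (subst (asm) AE_restrict_space_iff) auto
  then show ?case
  proof eventually_elim
   case (elim r)
   show ?case
   proof (intro impI)
    assume r: "\<tau> j w < ereal r" "ereal r <= \<tau> (Suc j) w" "r <= T" "lam (\<gamma> j w) r \<noteq> 0"
    have r0: "0 <= r" using r(1) time_nonneg[OF \<open>w \<in> space P\<close>, of j]
     by (metis ereal_less_eq(5) less_imp_le order.trans)
    then have "0 < f (w, r)" using r lam_nonneg[OF r0, of "\<gamma> j w"] by (auto simp: f_def indicator_def max_def)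
    then have "AE th in Qm (\<gamma> j w) r. \<psi> ((w, r), th)" using elim r r0 by auto
    then show "AE th in Q (\<gamma> j w) r. \<psi> ((w, r), th)" unfolding Qm_eq[OF r0] .
   qed
  qed
 qed
qed

text \<open>For fixed \<open>t\<close> the exceptional event before the next jump is an event of the
  past of jump \<open>j\<close>, so \<open>past_null_transfer\<close> removes the condition that no
  jump follows up to \<open>T\<close>. Rational times are treated simultaneously and right limits
  give the others; the time \<open>T\<close>, which has no right neighbourhood, is covered by the
  hypothesis itself.\<close>

lemma adapted_transfer:
 fixes X :: "real => 'w => 'v::euclidean_space"
 assumes j: "j <= J" and T: "0 <= T" and V: "closed V"
  and ad: "\<And>t. t \<in> {0..T} ==> X t \<in> borel_measurable (FF t)"
  and rc: "\<And>w t. w \<in> space P ==> t \<in> {0..<T} ==> ((%s. X s w) \<longlongrightarrow> X t w) (at_right t)"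
  and ae: "AE w in P. ereal T < \<tau> (Suc j) w --> (\<forall>t\<in>{0..T}. \<tau> j w <= ereal t --> X t w \<in> V)"
 shows "AE w in P. \<forall>t\<in>{0..T}. \<tau> j w <= ereal t & ereal t < \<tau> (Suc j) w --> X t w \<in> V"
proof -
 have 1: "AE w in P. \<tau> j w <= ereal t & ereal t < \<tau> (Suc j) w --> X t w \<in> V" if t: "t \<in> {0..T}" for t
 proof -
  have "{w \<in> space (FF t). X t w \<notin> V} \<in> sets (FF t)"
  proof -
   have [measurable]: "V \<in> sets borel" "X t \<in> borel_measurable (FF t)" using V ad[OF t] by auto
   show ?thesis by measurable
  qed
  from FF_trace[OF this, of j] obtain G where G1: "G \<in> sets (GG j)"
   and G2: "\<forall>w\<in>space P. ereal t < \<tau> (Suc j) w --> (w \<in> {w \<in> space (FF t). X t w \<notin> V} \<longleftrightarrow> w \<in> G)" by blast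
  have G: "G \<in> sets (GG j)" "\<And>w. w \<in> space P ==> ereal t < \<tau> (Suc j) w ==> X t w \<notin> V \<longleftrightarrow> w \<in> G"
   using G1 G2 by simp_all
  let ?H = "G \<inter> {w \<in> space (GG j). \<tau> j w <= ereal t}"
  have [measurable]: "\<tau> j \<in> borel_measurable (GG j)" by (rule time_GG) simp
  have "AE w in P. w \<notin> ?H"
  proof (rule past_null_transfer[OF _ _ j T])
   have "{w \<in> space (GG j). \<tau> j w <= ereal t} \<in> sets (GG j)" by measurable
   then show "?H \<in> sets (GG j)" using G(1) by (rule sets.Int[rotated])
   show "AE w in P. w \<in> ?H --> \<not> ereal T < \<tau> (Suc j) w"
    using ae AE_space
   proof eventually_elim
    case (elim w)
    have "ereal t < \<tau> (Suc j) w" if "ereal T < \<tau> (Suc j) w"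
     using that t by (meson atLeastAtMost_iff ereal_less_eq(3) le_less_trans)
    then show ?case using elim t G(2)[OF elim(2)] by auto
   qed
  qed auto
  then show ?thesis using AE_space by eventually_elim (use G in auto)
 qed
 have "AE w in P. \<forall>t\<in>\<rat> \<inter> {0..T}. \<tau> j w <= ereal t & ereal t < \<tau> (Suc j) w --> X t w \<in> V"
  by (subst AE_ball_countable) (auto intro: 1 countable_subset[OF _ countable_rat])
 then show ?thesis using ae AE_space
 proof eventually_elim
  case (elim w)
  show ?case
  proof (intro ballI impI)
   fix t assume t: "t \<in> {0..T}" and tj: "\<tau> j w <= ereal t & ereal t < \<tau> (Suc j) w"
   show "X t w \<in> V"
   proof (cases "t = T")
    case True
    then show ?thesis using elim(2) t tj by auto
   next
    case False
    then have tT: "t \<in> {0..<T}" using t by auto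
    show ?thesis
    proof (rule ccontr)
     assume "X t w \<notin> V"
     then have "\<forall>\<^sub>F s in at_right t. X s w \<in> - V"
      by (intro topological_tendstoD[OF rc[OF elim(3) tT]]) (use V in auto)
     then obtain b where b: "t < b" "\<And>s. t < s ==> s < b ==> X s w \<notin> V"
      unfolding eventually_at_right_field by auto
     obtain u where u: "ereal t < ereal u" "ereal u < \<tau> (Suc j) w"
      using tj ereal_dense2 by blast
     obtain q where q: "q \<in> \<rat>" "t < q" "q < min (min b u) T"
      using Rats_dense_in_real[of t "min (min b u) T"] b u tT by auto
     have "ereal q < \<tau> (Suc j) w" using q u by (meson less_ereal.simps(1) less_trans min_less_iff_conj)
     moreover have "\<tau> j w <= ereal q" using q tj by (meson ereal_less_eq(3) less_imp_le order.trans)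
     ultimately have "X q w \<in> V" using elim(1) q tT by auto
     then show False using b(2)[of q] q by auto
    qed
   qed
  qed
 qed
qed

end

section \<open>Measurability of the coefficients of the driver\<close>

lemma borel_measurable_matrix_mult[measurable (raw)]:
 fixes f :: "'a => real^'n^'m" and g :: "'a => real^'k^'n"
 assumes "f \<in> borel_measurable M" "g \<in> borel_measurable M"
 shows "(%x. f x ** g x) \<in> borel_measurable M"
 by (rule borel_measurable_continuous_Pair[OF assms])
   (intro bounded_bilinear.continuous_on[OF bounded_bilinear_matrix_mult] continuous_intros)

lemma borel_measurable_transpose[measurable (raw)]:
 fixes f :: "'a => real^'n^'m"
 assumes "f \<in> borel_measurable M"
 shows "(%x. transpose (f x)) \<in> borel_measurable M"
 using measurable_compose[OF assms borel_measurable_continuous_onI[OF linear_continuous_on[OF bounded_linear_transpose]]] .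

lemma continuous_on_det:
 assumes "\<And>i j. continuous_on S (%x. (f x :: real^'n^'n) $ i $ j)"
 shows "continuous_on S (%x. det (f x))"
 unfolding det_def by (intro continuous_intros assms)

text \<open>A formula that is rational in the entries, from which measurability of the chosen
  inverse can be read off.\<close>

lemma matrix_inv_cramer:
 fixes U :: "real^'n^'n"
 assumes "det U \<noteq> 0"
 shows "matrix_inv U = (\<chi> k l. det (\<chi> i j. if j = k then mat 1 $ i $ l else U $ i $ j) / det U)"
proof -
 have "\<exists>B. U ** B = mat 1 & B ** U = mat 1" using assms invertible_det_nz[of U] by (simp add: invertible_def)
 then have inv: "U ** matrix_inv U = mat 1" unfolding matrix_inv_def by (metis (mono_tags, lifting) someI_ex)
 show ?thesis
 proof (simp add: vec_eq_iff, intro allI)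
  fix k l
  have "U *v (transpose (matrix_inv U) $ l) = transpose (mat 1) $ l"
  proof -
   have "(U *v (transpose (matrix_inv U) $ l)) $ i = (U ** matrix_inv U) $ i $ l" for i
    by (simp add: matrix_vector_mult_def matrix_matrix_mult_def transpose_def)
   then show ?thesis by (simp add: inv vec_eq_iff transpose_def)
  qed
  then have "transpose (matrix_inv U) $ l = (\<chi> k. det(\<chi> i j. if j = k then transpose (mat 1) $ l $ i else U $ i $ j) / det U)"
   by (subst (asm) cramer[OF assms])
  moreover have "transpose (mat 1) $ l $ i = (mat 1 :: real^'n^'n) $ i $ l" for i
   by (simp add: transpose_def)
  ultimately have "transpose (matrix_inv U) $ l $ k = det(\<chi> i j. if j = k then mat 1 $ i $ l else U $ i $ j) / det U"
   by (simp only: vec_lambda_beta)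
  then show "matrix_inv U $ k $ l = det (\<chi> i j. if j = k then mat 1 $ i $ l else U $ i $ j) / det U"
   by (simp add: transpose_def)
 qed
qed

lemma borel_measurable_matrix_inv: "(matrix_inv :: real^'n^'n => real^'n^'n) \<in> borel_measurable borel"
proof -
 have d[measurable]: "det \<in> borel_measurable (borel :: (real^'n^'n) measure)"
  by (intro borel_measurable_continuous_onI continuous_on_det continuous_intros)
 \<comment> \<open>On singular matrices the choice is made from an empty set of candidates, so its
   value is the same for all of them.\<close>
 have s: "matrix_inv U = (SOME B :: real^'n^'n. False)" if "det U = 0" for U :: "real^'n^'n"
 proof -
  have "(%B. U ** B = mat 1 & B ** U = mat 1) = (%B. False)"
   using that invertible_det_nz[of U] by (auto simp: invertible_def)
  then show ?thesis unfolding matrix_inv_def by (simp only:)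
 qed
 have "(%U. if det U = 0 then SOME B. False else
   (\<chi> k l. det (\<chi> i j. if j = k then mat 1 $ i $ l else U $ i $ j) / det U)) \<in> borel_measurable (borel :: (real^'n^'n) measure)"
 proof (rule measurable_If)
  have "(%U. (1 / det U) *\<^sub>R (\<chi> k l. det (\<chi> i j. if j = k then mat 1 $ i $ l else U $ i $ j))) \<in> borel_measurable (borel :: (real^'n^'n) measure)"
  proof (rule borel_measurable_scaleR)
   have "continuous_on UNIV (%U :: real^'n^'n. \<chi> k l. det (\<chi> i j. if j = k then mat 1 $ i $ l else U $ i $ j) :: real^'n^'n)"
   proof (intro continuous_on_vec_lambda continuous_on_det)
    show "continuous_on UNIV (%U :: real^'n^'n. (\<chi> i j. if j = k then mat 1 $ i $ l else U $ i $ j) $ i $ j)" for k l i j :: 'n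
     by (cases "j = k") (auto intro!: continuous_intros)
   qed
   then show "(%U :: real^'n^'n. \<chi> k l. det (\<chi> i j. if j = k then mat 1 $ i $ l else U $ i $ j) :: real^'n^'n) \<in> borel_measurable borel"
    by (rule borel_measurable_continuous_onI)
  qed measurable
  moreover have "(%U. (1 / det U) *\<^sub>R (\<chi> k l. det (\<chi> i j. if j = k then mat 1 $ i $ l else U $ i $ j))) =
    (%U. \<chi> k l. det (\<chi> i j. if j = k then mat 1 $ i $ l else U $ i $ j) / det (U :: real^'n^'n))"
   by (simp add: fun_eq_iff vec_eq_iff)
  ultimately show "(%U. \<chi> k l. det (\<chi> i j. if j = k then mat 1 $ i $ l else U $ i $ j) / det (U :: real^'n^'n)) \<in> borel_measurable borel"
   by simp
 qed measurable
 moreover have "matrix_inv = (%U :: real^'n^'n. if det U = 0 then SOME B. False else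
   (\<chi> k l. det (\<chi> i j. if j = k then mat 1 $ i $ l else U $ i $ j) / det U))"
  using s matrix_inv_cramer by (auto simp: fun_eq_iff)
 ultimately show ?thesis by simp
qed

lemma jump_generator_measurable[measurable (raw)]:
 assumes [measurable]: "c \<in> borel_measurable M" "s \<in> borel_measurable M" "h \<in> borel_measurable M"
 shows "(%x. jump_generator (c x) (s x) (h x)) \<in> borel_measurable M"
proof -
 have [measurable]: "(%x. matrix_inv (mat 1 + s x + h x)) \<in> borel_measurable M"
  by (rule measurable_compose[OF _ borel_measurable_matrix_inv]) measurable
 show ?thesis unfolding jump_generator_def by measurable
qed

text \<open>The factor \<open>CARD('n)\<close> bounds the Frobenius norm of the resolvent, whose
  operator norm is at most 1.\<close>

lemma norm_jump_generator_le:
 fixes c s h :: "real^'n^'n"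
 assumes U: "possemidef (s + h)" and K: "norm c <= K" "norm s <= K" "norm h <= K"
 shows "norm (jump_generator c s h) <= (K * K + K) * (real CARD('n) * (K * K + K))"
proof -
 have K0: "0 <= K" using K(1) norm_ge_zero order.trans by blast
 have r: "norm (res (s + h)) <= real CARD('n)"
  using norm_matrix_le_of_vector[of "res (s + h)" 1] res_bounds(1)[OF U] by simp
 have 1: "norm (s ** transpose c - h) <= K * K + K"
  by (intro order.trans[OF norm_triangle_ineq4] add_mono order.trans[OF norm_matrix_mult_le] mult_mono) (use K K0 in auto)
 have 2: "norm (c ** s - h) <= K * K + K"
  by (intro order.trans[OF norm_triangle_ineq4] add_mono order.trans[OF norm_matrix_mult_le] mult_mono) (use K K0 in auto)
 have "jump_generator c s h = (s ** transpose c - h) ** (res (s + h) ** (c ** s - h))"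
  by (simp add: jump_generator_def res_def add.assoc matrix_mul_assoc)
 also have "norm \<dots> <= (K * K + K) * (real CARD('n) * (K * K + K))"
  by (intro order.trans[OF norm_matrix_mult_le] mult_mono 1 2 r) (use K0 in auto)
 finally show ?thesis .
qed

lemma measurable_lborelI: "f \<in> borel \<rightarrow>\<^sub>M N ==> f \<in> lborel \<rightarrow>\<^sub>M N"
 by simp

lemma measurable_density_lborelI: "f \<in> borel \<rightarrow>\<^sub>M N ==> f \<in> density lborel g \<rightarrow>\<^sub>M N"
 by simp

section \<open>Integrals with respect to the jump measure and its compensator\<close>

text \<open>The identity of the integrals is reduced to real functions by testing with the basis
  vectors. Boundedness of \<open>g\<close> and finiteness of \<open>M\<close> provide all
  integrability.\<close>

lemma bind_integral_euclidean:
 fixes g :: "'b => 'v::euclidean_space"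
 assumes fin: "finite_measure M" and K: "K \<in> M \<rightarrow>\<^sub>M prob_algebra N" and ne: "space M \<noteq> {}"
  and g[measurable]: "g \<in> borel_measurable N" and b: "\<And>x. norm (g x) <= B"
 shows "integrable (M \<bind> K) g" "(\<integral>y. g y \<partial>(M \<bind> K)) = (\<integral>x. \<integral>y. g y \<partial>K x \<partial>M)"
  "integrable M (%x. \<integral>y. g y \<partial>K x)"
proof -
 have Ks: "K \<in> M \<rightarrow>\<^sub>M subprob_algebra N" by (rule measurable_prob_algebraD[OF K])
 have sK: "sets (K x) = sets N" "prob_space (K x)" if "x \<in> space M" for x
  using measurable_space[OF K that] by (auto simp: space_prob_algebra)
 have sb: "sets (M \<bind> K) = sets N" using ne by (intro sets_bind[OF sets_kernel[OF Ks]]) auto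
 have gm: "g \<in> borel_measurable (M \<bind> K)" using g sb by (simp cong: measurable_cong_sets)
 interpret M: finite_measure M by fact
 have tot: "emeasure (K x) (space N) = 1" if "x \<in> space M" for x
  using prob_space.emeasure_space_1[OF sK(2)[OF that]] sets_eq_imp_space_eq[OF sK(1)[OF that]] by simp
 have spb: "space (M \<bind> K) = space N" using sb by (rule sets_eq_imp_space_eq)
 have "emeasure (M \<bind> K) (space (M \<bind> K)) = (\<integral>\<^sup>+x. emeasure (K x) (space N) \<partial>M)"
  unfolding spb by (rule emeasure_bind[OF ne Ks]) auto
 also have "\<dots> = (\<integral>\<^sup>+x. 1 \<partial>M)" by (rule nn_integral_cong) (simp add: tot)
 finally have "finite_measure (M \<bind> K)" by (intro finite_measureI) simp
 then interpret B: finite_measure "M \<bind> K" .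
 show ib: "integrable (M \<bind> K) g" by (rule B.integrable_const_bound[of _ B]) (use b gm in auto)
 have Kb: "integrable (K x) g" "norm (\<integral>y. g y \<partial>K x) <= B" if x: "x \<in> space M" for x
 proof -
  interpret Kx: prob_space "K x" by (rule sK[OF x])
  have "g \<in> borel_measurable (K x)" using g sK(1)[OF x] by (simp cong: measurable_cong_sets)
  then show i: "integrable (K x) g" by (intro Kx.integrable_const_bound[of _ B]) (use b in auto)
  have "norm (\<integral>y. g y \<partial>K x) <= (\<integral>y. norm (g y) \<partial>K x)" by (rule integral_norm_bound)
  also have "\<dots> <= (\<integral>y. B \<partial>K x)" using i b by (intro integral_mono) auto
  finally show "norm (\<integral>y. g y \<partial>K x) <= B" by (simp add: Kx.prob_space)
 qed
 have m: "(%x. \<integral>y. g y \<partial>K x) \<in> borel_measurable M"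
  by (rule measurable_compose[OF Ks integral_measurable_subprob_algebra[OF g]])
 show iM: "integrable M (%x. \<integral>y. g y \<partial>K x)"
  by (rule M.integrable_const_bound[of _ B]) (use Kb m in auto)
 show "(\<integral>y. g y \<partial>(M \<bind> K)) = (\<integral>x. \<integral>y. g y \<partial>K x \<partial>M)"
 proof (rule euclidean_eqI)
  fix e :: 'v assume e: "e \<in> Basis"
  have "(\<integral>y. g y \<partial>(M \<bind> K)) \<bullet> e = (\<integral>y. g y \<bullet> e \<partial>(M \<bind> K))"
   by (rule integral_inner_left[symmetric]) (use ib in simp)
  also have "\<dots> = (\<integral>x. \<integral>y. g y \<bullet> e \<partial>K x \<partial>M)"
  proof (rule integral_bind[where B = B and B' = 1 and K = N])
   show "\<bar>g x \<bullet> e\<bar> <= B" for x using Basis_le_norm[OF e, of "g x"] b[of x] by simp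
   show "AE x in M. emeasure (K x) (space (K x)) <= ennreal 1"
    using prob_space.emeasure_space_1[OF sK(2)] by (intro AE_I2) simp
  qed (use Ks fin in auto)
  also have "\<dots> = (\<integral>x. (\<integral>y. g y \<partial>K x) \<bullet> e \<partial>M)"
   by (rule Bochner_Integration.integral_cong) (auto simp: Kb(1))
  also have "\<dots> = (\<integral>x. \<integral>y. g y \<partial>K x \<partial>M) \<bullet> e"
   by (rule integral_inner_left) (use iM in simp)
  finally show "(\<integral>y. g y \<partial>(M \<bind> K)) \<bullet> e = (\<integral>x. \<integral>y. g y \<partial>K x \<partial>M) \<bullet> e" .
 qed
qed

context mode_process
begin

text \<open>The index of the interval, closed on the right, that contains \<open>r\<close>. The
  default \<open>J\<close> for \<open>r \<le> 0\<close> makes the rate \<open>crate\<close> vanish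
  there.\<close>

definition idx :: "'w => real => nat" where
 "idx w r = (if 0 < r then THE j. \<tau> j w < ereal r & ereal r <= \<tau> (Suc j) w else J)"

text \<open>Rate and mark kernel along a path: the compensator is \<open>crate w r dr\<close> times
  \<open>ck w r\<close>. Index \<open>J\<close> stands for the time after the last jump, with rate
  zero.\<close>

definition crate where "crate w r = (if idx w r < J then lam (\<gamma> (idx w r) w) r else 0)"

definition ck where "ck w r = Qm (\<gamma> (idx w r) w) r"

lemma idx_eq:
 assumes "w \<in> space P" "\<tau> j w < ereal r" "ereal r <= \<tau> (Suc j) w"
 shows "idx w r = j" "0 < r"
proof -
 have "0 < ereal r" using time_nonneg[OF assms(1), of j] assms(2) by (rule le_less_trans)
 then show "0 < r" by simp
 then show "idx w r = j"
  unfolding idx_def using assms index_unique'[OF assms(1)] by (auto intro!: the_equality)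
qed

lemma idx_props:
 assumes "w \<in> space P" "0 < r"
 shows "\<tau> (idx w r) w < ereal r" "ereal r <= \<tau> (Suc (idx w r)) w" "idx w r <= J"
proof -
 obtain j where "j <= J" "\<tau> j w < ereal r" "ereal r <= \<tau> (Suc j) w" using index_exists'[OF assms] .
 then show "\<tau> (idx w r) w < ereal r" "ereal r <= \<tau> (Suc (idx w r)) w" "idx w r <= J"
  using idx_eq[OF assms(1)] by auto
qed

lemma idx_measurable:
 assumes w: "w \<in> space P"
 shows "idx w \<in> borel \<rightarrow>\<^sub>M count_space UNIV"
proof (subst measurable_count_space_eq2_countable, intro conjI ballI)
 fix j :: nat
 have "idx w -` {j} \<inter> space borel = {r. 0 < r & \<tau> j w < ereal r & ereal r <= \<tau> (Suc j) w} \<union> (if j = J then {..0} else {})"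
 proof -
  have "idx w r = j \<longleftrightarrow> (0 < r & \<tau> j w < ereal r & ereal r <= \<tau> (Suc j) w) \<or> (r <= 0 & j = J)" for r
  proof (cases "0 < r")
   case True
   then show ?thesis using idx_eq(1)[OF w, of j r] idx_props(1,2)[OF w True] by auto
  next
   case False
   then show ?thesis by (auto simp: idx_def)
  qed
  then show ?thesis by auto
 qed
 then show "idx w -` {j} \<inter> space borel \<in> sets borel" by simp
qed auto

lemma ck_kernel:
 assumes w: "w \<in> space P" shows "ck w \<in> borel \<rightarrow>\<^sub>M prob_algebra borel"
 unfolding ck_def
 by (rule measurable_compose_countable[OF _ idx_measurable[OF w], where f = "%j r. Qm (\<gamma> j w) r"]) measurable

lemma crate_nonneg: "w \<in> space P ==> 0 <= crate w r"
 by (cases "0 < r") (auto simp: crate_def idx_def intro!: lam_nonneg)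

lemma crate_measurable:
 assumes w: "w \<in> space P" shows "crate w \<in> borel_measurable borel"
proof -
 have "(%r. if idx w r < J then lam (\<gamma> (idx w r) w) (max 0 r) else 0) \<in> borel_measurable borel"
  by (rule measurable_compose_countable[OF _ idx_measurable[OF w], where f = "%j r. if j < J then lam (\<gamma> j w) (max 0 r) else 0"]) measurable
 moreover have "(%r. if idx w r < J then lam (\<gamma> (idx w r) w) (max 0 r) else 0) = crate w"
  by (auto simp: fun_eq_iff crate_def idx_def max_def)
 ultimately show ?thesis by simp
qed

lemma ck_prob: "prob_space (ck w r)" and sets_ck[simp]: "sets (ck w r) = sets borel" and space_ck[simp]: "space (ck w r) = UNIV"
 by (simp_all add: ck_def Qm_prob)

definition pk where "pk w r = distr (ck w r) (borel \<Otimes>\<^sub>M borel) (Pair r)"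

lemma pk_kernel:
 assumes w: "w \<in> space P" shows "pk w \<in> borel \<rightarrow>\<^sub>M prob_algebra (borel \<Otimes>\<^sub>M borel)"
 unfolding pk_def
proof (rule measurable_distr_prob_space2[OF ck_kernel[OF w]])
 show "(%(r, th). (r, th)) \<in> borel \<Otimes>\<^sub>M borel \<rightarrow>\<^sub>M borel \<Otimes>\<^sub>M borel" by simp
qed

lemma Pair_measurable: "Pair r \<in> borel \<rightarrow>\<^sub>M borel \<Otimes>\<^sub>M borel" by simp

lemma Pair_ck: "Pair r \<in> ck w r \<rightarrow>\<^sub>M borel \<Otimes>\<^sub>M borel"
 by (simp cong: measurable_cong_sets)

text \<open>At each positive time exactly one interval is active, so the sum over \<open>j\<close>
  collapses to the index \<open>idx w r\<close>. Identifying the defining formula with a genuine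
  measure also settles its countable additivity.\<close>

lemma compensator_bind:
 assumes w: "w \<in> space P"
 shows "compensator J lam Q \<tau> \<gamma> w = density lborel (%r. ennreal (crate w r)) \<bind> pk w"
proof -
 let ?M = "density lborel (%r. ennreal (crate w r))"
 have cm: "crate w \<in> borel_measurable lborel" by (rule measurable_lborelI[OF crate_measurable[OF w]])
 have k: "pk w \<in> ?M \<rightarrow>\<^sub>M subprob_algebra (borel \<Otimes>\<^sub>M borel)"
  by (rule measurable_density_lborelI[OF measurable_prob_algebraD[OF pk_kernel[OF w]]])
 have s: "sets (?M \<bind> pk w) = sets (borel \<Otimes>\<^sub>M borel)" by (rule sets_bind[OF sets_kernel[OF k]]) auto
 then have sp: "space (?M \<bind> pk w) = UNIV" using sets_eq_imp_space_eq[OF s] by (simp add: space_pair_measure)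
 have e: "emeasure (?M \<bind> pk w) S = (\<Sum>j<J. \<integral>\<^sup>+ r. indicator {r. \<tau> j w < ereal r & ereal r <= \<tau> (Suc j) w} r
           * ennreal (lam (\<gamma> j w) r) * emeasure (Q (\<gamma> j w) r) (Pair r -` S) \<partial>lborel)" if S[measurable]: "S \<in> sets (borel \<Otimes>\<^sub>M borel)" for S
 proof -
  let ?g = "%j r. indicator {r. \<tau> j w < ereal r & ereal r <= \<tau> (Suc j) w} r
           * ennreal (lam (\<gamma> j w) (max 0 r)) * emeasure (Qm (\<gamma> j w) r) (Pair r -` S)"
  have gm: "?g j \<in> borel_measurable lborel" for j
  proof -
   have 3: "(%r. emeasure (Qm (\<gamma> j w) r) (Pair r -` S)) \<in> borel_measurable borel"
   proof (rule emeasure_measurable_subprob_algebra2)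
    have "(SIGMA r:space borel. Pair r -` S) = S" by auto
    then show "(SIGMA r:space borel. Pair r -` S) \<in> sets (borel \<Otimes>\<^sub>M borel)" using S by simp
   qed measurable
   have 1: "{r. \<tau> j w < ereal r & ereal r <= \<tau> (Suc j) w} \<in> sets borel" by simp
   have 2: "(%r. lam (\<gamma> j w) (max 0 r)) \<in> borel_measurable borel" by (rule lam_measurable') simp_all
   show ?thesis
    by (intro measurable_lborelI borel_measurable_times_ennreal borel_measurable_indicator 1
      measurable_compose[OF 2 measurable_ennreal] 3)
  qed
  have "emeasure (?M \<bind> pk w) S = (\<integral>\<^sup>+r. emeasure (pk w r) S \<partial>?M)"
   by (rule emeasure_bind[OF _ k S]) simp
  also have "\<dots> = (\<integral>\<^sup>+r. ennreal (crate w r) * emeasure (pk w r) S \<partial>lborel)"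
  proof (rule nn_integral_density)
   show "(%r. ennreal (crate w r)) \<in> borel_measurable lborel" using cm by (rule measurable_compose) simp
   show "(%r. emeasure (pk w r) S) \<in> borel_measurable lborel"
    by (rule measurable_lborelI, rule measurable_compose[OF measurable_prob_algebraD[OF pk_kernel[OF w]] measurable_emeasure_subprob_algebra[OF S]])
  qed
  also have "\<dots> = (\<integral>\<^sup>+r. (\<Sum>j<J. ?g j r) \<partial>lborel)"
  proof (rule nn_integral_cong)
   fix r :: real
   have pke: "emeasure (pk w r) S = emeasure (Qm (\<gamma> (idx w r) w) r) (Pair r -` S)"
    unfolding pk_def by (subst emeasure_distr[OF Pair_ck S]) (simp add: ck_def)
   show "ennreal (crate w r) * emeasure (pk w r) S = (\<Sum>j<J. ?g j r)"
   proof (cases "0 < r")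
    case True
    note ip = idx_props[OF w True]
    have "(\<Sum>j<J. ?g j r) = (\<Sum>j<J. if j = idx w r then ?g j r else 0)"
     by (rule sum.cong) (use index_unique'[OF w _ _ ip(1,2)] in \<open>auto simp: indicator_def\<close>)
    also have "\<dots> = (if idx w r < J then ?g (idx w r) r else 0)" by (simp add: sum.delta')
    finally show ?thesis unfolding pke using ip True by (simp add: crate_def indicator_def)
   next
    case False
    have "?g j r = 0" for j using idx_eq(2)[OF w, of j r] False by (auto simp: indicator_def)
    then show ?thesis using False by (simp add: crate_def idx_def)
   qed
  qed
  also have "\<dots> = (\<Sum>j<J. \<integral>\<^sup>+r. ?g j r \<partial>lborel)" by (rule nn_integral_sum) (rule gm)
  also have "\<dots> = (\<Sum>j<J. \<integral>\<^sup>+ r. indicator {r. \<tau> j w < ereal r & ereal r <= \<tau> (Suc j) w} r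
           * ennreal (lam (\<gamma> j w) r) * emeasure (Q (\<gamma> j w) r) (Pair r -` S) \<partial>lborel)"
  proof (intro sum.cong refl nn_integral_cong)
   fix j r
   show "?g j r = indicator {r. \<tau> j w < ereal r & ereal r <= \<tau> (Suc j) w} r
           * ennreal (lam (\<gamma> j w) r) * emeasure (Q (\<gamma> j w) r) (Pair r -` S)"
    using idx_eq(2)[OF w, of j r] by (cases "0 < r") (auto simp: indicator_def Qm_def max_def)
  qed
  finally show ?thesis .
 qed
 have "compensator J lam Q \<tau> \<gamma> w = measure_of UNIV (sets (borel \<Otimes>\<^sub>M borel)) (emeasure (?M \<bind> pk w))"
  unfolding compensator_def
 proof (rule measure_of_eq)
  show "sets (borel \<Otimes>\<^sub>M borel) \<subseteq> Pow (UNIV :: (real \<times> 'e) set)" by simp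
  fix S assume "S \<in> sigma_sets UNIV (sets ((borel :: real measure) \<Otimes>\<^sub>M (borel :: 'e measure)))"
  then have "S \<in> sets ((borel :: real measure) \<Otimes>\<^sub>M (borel :: 'e measure))"
   using sets.sigma_sets_eq[of "(borel :: real measure) \<Otimes>\<^sub>M (borel :: 'e measure)"] by (simp add: space_pair_measure)
  from e[OF this] show "(\<Sum>j<J. \<integral>\<^sup>+ r. indicator {r. \<tau> j w < ereal r & ereal r <= \<tau> (Suc j) w} r
           * ennreal (lam (\<gamma> j w) r) * emeasure (Q (\<gamma> j w) r) (Pair r -` S) \<partial>lborel) = emeasure (?M \<bind> pk w) S"
   by simp
 qed
 also have "\<dots> = ?M \<bind> pk w"
  using measure_of_of_measure[of "?M \<bind> pk w"] by (simp only: s sp)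
 finally show ?thesis .
qed

lemma compensator_AE_iff:
 assumes w: "w \<in> space P" and R: "Measurable.pred (borel \<Otimes>\<^sub>M borel) R"
 shows "(AE x in compensator J lam Q \<tau> \<gamma> w. R x) \<longleftrightarrow>
  (AE r in lborel. crate w r \<noteq> 0 --> (AE th in ck w r. R (r, th)))"
proof -
 let ?M = "density lborel (%r. ennreal (crate w r))"
 have cm: "crate w \<in> borel_measurable lborel" by (rule measurable_lborelI[OF crate_measurable[OF w]])
 have k: "pk w \<in> ?M \<rightarrow>\<^sub>M subprob_algebra (borel \<Otimes>\<^sub>M borel)"
  by (rule measurable_density_lborelI[OF measurable_prob_algebraD[OF pk_kernel[OF w]]])
 have "(AE x in compensator J lam Q \<tau> \<gamma> w. R x) \<longleftrightarrow> (AE r in ?M. AE y in pk w r. R y)"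
  unfolding compensator_bind[OF w] by (rule AE_bind[OF k R])
 also have "\<dots> \<longleftrightarrow> (AE r in lborel. 0 < ennreal (crate w r) --> (AE y in pk w r. R y))"
  using cm by (intro AE_density) simp
 also have "\<dots> \<longleftrightarrow> (AE r in lborel. crate w r \<noteq> 0 --> (AE th in ck w r. R (r, th)))"
 proof -
  have "(AE y in pk w r. R y) \<longleftrightarrow> (AE th in ck w r. R (r, th))" for r
   unfolding pk_def using R by (intro AE_distr_iff Pair_ck) (simp add: pred_def)
  moreover have "0 < ennreal (crate w r) \<longleftrightarrow> crate w r \<noteq> 0" for r
   using crate_nonneg[OF w, of r] by auto
  ultimately show ?thesis by (simp only:)
 qed
 finally show ?thesis .
qed

text \<open>The bound on \<open>f\<close> holds only almost everywhere for the compensator, while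
  the integral formula for composed kernels is available for bounded functions; a truncation
  mediates.\<close>

lemma compensator_integral:
 fixes f :: "real \<times> 'e => 'v::euclidean_space"
 assumes w: "w \<in> space P"
  and fm[measurable]: "(%x. indicator ({s<..t} \<times> UNIV) x *\<^sub>R f x) \<in> borel_measurable (borel \<Otimes>\<^sub>M borel)"
  and bd: "AE r in lborel. r \<in> {s<..t} --> crate w r \<noteq> 0 --> (AE th in ck w r. norm (f (r, th)) <= B)"
  and B: "0 <= B" and s0: "0 <= s"
 shows "set_integrable (compensator J lam Q \<tau> \<gamma> w) ({s<..t} \<times> UNIV) f"
  and "(LINT x:{s<..t} \<times> UNIV|compensator J lam Q \<tau> \<gamma> w. f x) = (LINT r:{s<..t}|lborel. crate w r *\<^sub>R (\<integral>th. f (r, th) \<partial>ck w r))"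
  and "set_integrable lborel {s<..t} (%r. crate w r *\<^sub>R (\<integral>th. f (r, th) \<partial>ck w r))"
proof -
 let ?S = "{s<..t} \<times> (UNIV :: 'e set)"
 let ?C = "compensator J lam Q \<tau> \<gamma> w"
 obtain K0 where K0: "\<And>x t. 0 <= t ==> lam x t <= K0" using lam_bounded by blast
 define K1 where "K1 = max K0 0"
 have crate_le: "crate w r <= K1" for r
  by (cases "0 < r") (auto simp: crate_def idx_def K1_def intro!: le_max_iff_disj[THEN iffD2] K0)
 note crate_measurable[OF w, measurable]
 define M where "M = density lborel (%r. ennreal (crate w r * indicator {s<..t} r))"
 have fin: "finite_measure M"
 proof (rule finite_measureI)
  have "emeasure M (space M) = (\<integral>\<^sup>+r. ennreal (crate w r * indicator {s<..t} r) \<partial>lborel)"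
   unfolding M_def
  proof (subst emeasure_density)
   show "(%r. ennreal (crate w r * indicator {s<..t} r)) \<in> borel_measurable lborel" by measurable
  qed simp_all
  also have "\<dots> <= (\<integral>\<^sup>+r. ennreal K1 * indicator {s<..t} r \<partial>lborel)"
   by (rule nn_integral_mono) (auto simp: indicator_def crate_le intro!: ennreal_leI)
  also have "\<dots> = ennreal K1 * emeasure lborel {s<..t}" by (rule nn_integral_cmult_indicator) simp
  also have "\<dots> < \<infinity>"
   using emeasure_bounded_finite[of "{s<..t}"] by (simp add: ennreal_mult_less_top bounded_subset[OF compact_imp_bounded[OF compact_Icc[of s t]]] subset_iff)
  finally show "emeasure M (space M) \<noteq> \<infinity>" by simp
 qed
 have k: "pk w \<in> M \<rightarrow>\<^sub>M prob_algebra (borel \<Otimes>\<^sub>M borel)"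
  unfolding M_def by (rule measurable_density_lborelI[OF pk_kernel[OF w]])
 have neM: "space M \<noteq> {}" by (simp add: M_def)
 \<comment> \<open>Bounded everywhere by \<open>B\<close>, and equal to \<open>f\<close> on the
   strip up to a null set of the compensator.\<close>
 define g where "g = (%x. if norm (indicator ?S x *\<^sub>R f x) <= B then indicator ?S x *\<^sub>R f x else 0)"
 have gm[measurable]: "g \<in> borel_measurable (borel \<Otimes>\<^sub>M borel)" unfolding g_def by measurable
 have gB: "norm (g x) <= B" for x using B by (simp add: g_def)
 note bi = bind_integral_euclidean[OF fin k neM gm gB]
 have sC: "sets ?C = sets (borel \<Otimes>\<^sub>M borel)"
  unfolding compensator_def using sets.sigma_sets_eq[of "(borel :: real measure) \<Otimes>\<^sub>M (borel :: 'e measure)"]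
  by (subst sets_measure_of) (simp_all add: space_pair_measure)
 have dC: "density ?C (indicator ?S) = M \<bind> pk w"
 proof (rule measure_eqI)
  have kk: "pk w \<in> M \<rightarrow>\<^sub>M subprob_algebra (borel \<Otimes>\<^sub>M borel)" by (rule measurable_prob_algebraD[OF k])
  have k2: "pk w \<in> density lborel (%r. ennreal (crate w r)) \<rightarrow>\<^sub>M subprob_algebra (borel \<Otimes>\<^sub>M borel)"
   by (rule measurable_density_lborelI[OF measurable_prob_algebraD[OF pk_kernel[OF w]]])
  show "sets (density ?C (indicator ?S)) = sets (M \<bind> pk w)"
   using sets_bind[OF sets_kernel[OF kk] neM] sC by simp
  fix A assume "A \<in> sets (density ?C (indicator ?S))"
  then have A[measurable]: "A \<in> sets (borel \<Otimes>\<^sub>M borel)" using sC by simp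
  have S[measurable]: "?S \<in> sets (borel \<Otimes>\<^sub>M borel)" by (intro pair_measureI) auto
  have em[measurable]: "(%r. emeasure (pk w r) X) \<in> borel_measurable borel" if "X \<in> sets (borel \<Otimes>\<^sub>M borel)" for X
   using measurable_compose[OF measurable_prob_algebraD[OF pk_kernel[OF w]] measurable_emeasure_subprob_algebra[OF that]] .
  have "emeasure (density ?C (indicator ?S)) A = (\<integral>\<^sup>+x. indicator ?S x * indicator A x \<partial>?C)"
   by (rule emeasure_density) (simp_all add: sC A S borel_measurable_indicator)
  also have "\<dots> = (\<integral>\<^sup>+x. indicator (A \<inter> ?S) x \<partial>?C)"
   by (rule nn_integral_cong) (auto split: split_indicator)
  also have "\<dots> = emeasure ?C (A \<inter> ?S)" using sC by (intro nn_integral_indicator) auto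
  also have "\<dots> = (\<integral>\<^sup>+r. emeasure (pk w r) (A \<inter> ?S) \<partial>density lborel (%r. ennreal (crate w r)))"
   unfolding compensator_bind[OF w] by (rule emeasure_bind[OF _ k2]) auto
  also have "\<dots> = (\<integral>\<^sup>+r. ennreal (crate w r) * emeasure (pk w r) (A \<inter> ?S) \<partial>lborel)"
   by (rule nn_integral_density) (simp_all add: em)
  also have "\<dots> = (\<integral>\<^sup>+r. ennreal (crate w r * indicator {s<..t} r) * emeasure (pk w r) A \<partial>lborel)"
  proof (rule nn_integral_cong)
   fix r :: real
   have "emeasure (pk w r) (A \<inter> ?S) = emeasure (ck w r) (Pair r -` (A \<inter> ?S))" "emeasure (pk w r) A = emeasure (ck w r) (Pair r -` A)"
    unfolding pk_def by (subst emeasure_distr[OF Pair_ck]; simp)+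
   moreover have "Pair r -` (A \<inter> ?S) = (if r \<in> {s<..t} then Pair r -` A else {})" by auto
   ultimately show "ennreal (crate w r) * emeasure (pk w r) (A \<inter> ?S) = ennreal (crate w r * indicator {s<..t} r) * emeasure (pk w r) A"
    by (simp add: indicator_def)
  qed
  also have "\<dots> = (\<integral>\<^sup>+r. emeasure (pk w r) A \<partial>M)"
   unfolding M_def by (rule nn_integral_density[symmetric]) (simp_all add: em)
  also have "\<dots> = emeasure (M \<bind> pk w) A" by (rule emeasure_bind[OF neM kk A, symmetric])
  finally show "emeasure (density ?C (indicator ?S)) A = emeasure (M \<bind> pk w) A" .
 qed
 have gmC: "g \<in> borel_measurable ?C" using gm sC by (simp cong: measurable_cong_sets)
 have SC: "?S \<in> sets ?C" unfolding sC by (intro pair_measureI) auto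
 have dC': "density ?C (%x. ennreal (indicator ?S x)) = M \<bind> pk w"
  using dC by (simp add: ennreal_indicator)
 have ig: "integrable ?C (%x. indicator ?S x *\<^sub>R g x)"
  using bi(1) unfolding dC'[symmetric] using SC gmC by (subst (asm) integrable_density) auto
 have eg: "(\<integral>x. g x \<partial>(M \<bind> pk w)) = (\<integral>x. indicator ?S x *\<^sub>R g x \<partial>?C)"
  unfolding dC'[symmetric] using SC gmC by (intro integral_density) auto
 have aeC: "AE x in ?C. indicator ?S x *\<^sub>R g x = indicator ?S x *\<^sub>R f x"
 proof -
  have "AE x in ?C. norm (indicator ?S x *\<^sub>R f x) <= B"
  proof (subst compensator_AE_iff[OF w])
   show "AE r in lborel. crate w r \<noteq> 0 --> (AE th in ck w r. norm (indicator ?S (r, th) *\<^sub>R f (r, th)) <= B)"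
    using bd
   proof eventually_elim
    case (elim r)
    show ?case
    proof
     assume c: "crate w r \<noteq> 0"
     show "AE th in ck w r. norm (indicator ?S (r, th) *\<^sub>R f (r, th)) <= B"
     proof (cases "r \<in> {s<..t}")
      case True
      then have "AE th in ck w r. norm (f (r, th)) <= B" using elim c by blast
      then show ?thesis by eventually_elim (use B in \<open>auto simp: indicator_def\<close>)
     qed (use B in \<open>auto intro!: AE_I2 simp: indicator_def\<close>)
    qed
   qed
  qed measurable
  then show ?thesis by eventually_elim (auto simp: g_def indicator_def)
 qed
 have fmC: "(%x. indicator ?S x *\<^sub>R f x) \<in> borel_measurable ?C" using fm sC by (simp cong: measurable_cong_sets)
 have igm: "(%x. indicator ?S x *\<^sub>R g x) \<in> borel_measurable ?C" using ig by auto
 show "set_integrable ?C ?S f"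
  unfolding set_integrable_def using ig integrable_cong_AE[OF igm fmC aeC] by simp
 have eq1: "(LINT x:?S|?C. f x) = (\<integral>x. \<integral>y. g y \<partial>pk w x \<partial>M)"
  unfolding set_lebesgue_integral_def using integral_cong_AE[OF igm fmC aeC] eg bi(2) by simp
 have pkg: "(\<integral>y. g y \<partial>pk w r) = (\<integral>th. g (r, th) \<partial>ck w r)" for r
  unfolding pk_def by (rule integral_distr[OF Pair_ck gm])
 have aer: "AE r in lborel. (crate w r * indicator {s<..t} r) *\<^sub>R (\<integral>th. g (r, th) \<partial>ck w r)
   = indicator {s<..t} r *\<^sub>R (crate w r *\<^sub>R (\<integral>th. f (r, th) \<partial>ck w r))"
  using bd
 proof eventually_elim
  case (elim r)
  show ?case
  proof (cases "r \<in> {s<..t} & crate w r \<noteq> 0")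
   case True
   have fr: "(%th. f (r, th)) \<in> borel_measurable (ck w r)"
   proof -
    have "(%th. indicator ?S (r, th) *\<^sub>R f (r, th)) = (%th. f (r, th))" using True by (auto simp: fun_eq_iff indicator_def)
    then show ?thesis using measurable_compose[OF Pair_ck[of r w] fm] by (simp only:)
   qed
   have gr: "(%th. g (r, th)) \<in> borel_measurable (ck w r)"
    by (rule measurable_compose[OF Pair_ck gm])
   have "AE th in ck w r. norm (f (r, th)) <= B" using elim True by blast
   then have "AE th in ck w r. g (r, th) = f (r, th)"
    by eventually_elim (use True in \<open>auto simp: g_def indicator_def\<close>)
   then have "(\<integral>th. g (r, th) \<partial>ck w r) = (\<integral>th. f (r, th) \<partial>ck w r)" by (rule integral_cong_AE[OF gr fr])
   then show ?thesis using True by simp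
  qed (auto simp: indicator_def)
 qed
 have mg[measurable]: "(%r. \<integral>y. g y \<partial>pk w r) \<in> borel_measurable borel"
  by (rule measurable_compose[OF measurable_prob_algebraD[OF pk_kernel[OF w]] integral_measurable_subprob_algebra[OF gm]])
 have mp: "(%r. crate w r *\<^sub>R (\<integral>th. indicator ?S (r, th) *\<^sub>R f (r, th) \<partial>ck w r)) \<in> borel_measurable borel"
 proof -
  have "(%r. \<integral>y. indicator ?S y *\<^sub>R f y \<partial>pk w r) \<in> borel_measurable borel"
   by (rule measurable_compose[OF measurable_prob_algebraD[OF pk_kernel[OF w]] integral_measurable_subprob_algebra[OF fm]])
  moreover have "(\<integral>y. indicator ?S y *\<^sub>R f y \<partial>pk w r) = (\<integral>th. indicator ?S (r, th) *\<^sub>R f (r, th) \<partial>ck w r)" for r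
   unfolding pk_def by (rule integral_distr[OF Pair_ck fm])
  ultimately show ?thesis by simp
 qed
 have eqf: "(%r. crate w r *\<^sub>R (\<integral>th. indicator ?S (r, th) *\<^sub>R f (r, th) \<partial>ck w r)) = (%r. indicator {s<..t} r *\<^sub>R (crate w r *\<^sub>R (\<integral>th. f (r, th) \<partial>ck w r)))"
  by (auto simp: fun_eq_iff indicator_def)
 have mfr: "(%r. indicator {s<..t} r *\<^sub>R (crate w r *\<^sub>R (\<integral>th. f (r, th) \<partial>ck w r))) \<in> borel_measurable lborel"
  using mp unfolding eqf by simp
 have mgr: "(%r. (crate w r * indicator {s<..t} r) *\<^sub>R (\<integral>th. g (r, th) \<partial>ck w r)) \<in> borel_measurable lborel"
  using mg unfolding pkg by measurable
 have cn: "AE r in lborel. 0 <= crate w r * indicator {s<..t} r" by (auto simp: crate_nonneg[OF w])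
 have i2: "integrable lborel (%r. (crate w r * indicator {s<..t} r) *\<^sub>R (\<integral>th. g (r, th) \<partial>ck w r))"
  using bi(3) unfolding M_def pkg using mg[unfolded pkg] by (subst (asm) integrable_density) (auto simp: crate_nonneg[OF w])
 show "set_integrable lborel {s<..t} (%r. crate w r *\<^sub>R (\<integral>th. f (r, th) \<partial>ck w r))"
  unfolding set_integrable_def using i2 integrable_cong_AE[OF mgr mfr aer] by simp
 have "(\<integral>x. \<integral>y. g y \<partial>pk w x \<partial>M) = (\<integral>r. (crate w r * indicator {s<..t} r) *\<^sub>R (\<integral>th. g (r, th) \<partial>ck w r) \<partial>lborel)"
  unfolding M_def pkg using mg[unfolded pkg] by (intro integral_density) (auto simp: crate_nonneg[OF w])
 also have "\<dots> = (LINT r:{s<..t}|lborel. crate w r *\<^sub>R (\<integral>th. f (r, th) \<partial>ck w r))"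
  unfolding set_lebesgue_integral_def by (rule integral_cong_AE[OF mgr mfr aer])
 finally show "(LINT x:?S|?C. f x) = (LINT r:{s<..t}|lborel. crate w r *\<^sub>R (\<integral>th. f (r, th) \<partial>ck w r))"
  using eq1 by simp
qed

end

section \<open>Integrals and null sets of the jump measure\<close>

context mode_process
begin

definition jumps where "jumps w = {j. 1 <= j & j <= J & \<tau> j w < \<infinity>}"

lemma finite_jumps: "finite (jumps w)"
 by (rule finite_subset[of _ "{..J}"]) (auto simp: jumps_def)

lemma jump_measure_distr:
 "jump_measure J \<tau> \<gamma> w = distr (count_space (jumps w)) (borel \<Otimes>\<^sub>M borel) (%j. (real_of_ereal (\<tau> j w), \<gamma> j w))"
proof -
 let ?D = "distr (count_space (jumps w)) ((borel :: real measure) \<Otimes>\<^sub>M (borel :: 'e measure)) (%j. (real_of_ereal (\<tau> j w), \<gamma> j w))"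
 have "jump_measure J \<tau> \<gamma> w = measure_of UNIV (sets (borel \<Otimes>\<^sub>M borel)) (emeasure ?D)"
  unfolding jump_measure_def
 proof (rule measure_of_eq)
  show "sets (borel \<Otimes>\<^sub>M borel) \<subseteq> Pow (UNIV :: (real \<times> 'e) set)" by simp
  fix S assume "S \<in> sigma_sets UNIV (sets ((borel :: real measure) \<Otimes>\<^sub>M (borel :: 'e measure)))"
  then have S: "S \<in> sets ((borel :: real measure) \<Otimes>\<^sub>M (borel :: 'e measure))"
   using sets.sigma_sets_eq[of "(borel :: real measure) \<Otimes>\<^sub>M (borel :: 'e measure)"] by (simp add: space_pair_measure)
  have "emeasure ?D S = emeasure (count_space (jumps w)) {j \<in> jumps w. (real_of_ereal (\<tau> j w), \<gamma> j w) \<in> S}"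
   using S by (subst emeasure_distr) (auto intro!: arg_cong2[where f = emeasure] simp: space_pair_measure)
  also have "\<dots> = of_nat (card {j \<in> jumps w. (real_of_ereal (\<tau> j w), \<gamma> j w) \<in> S})"
   using finite_jumps by (subst emeasure_count_space_finite) auto
  also have "\<dots> = (\<Sum>j\<in>jumps w. indicator S (real_of_ereal (\<tau> j w), \<gamma> j w))"
   using finite_jumps by (simp add: indicator_def sum.If_cases Int_def)
  finally show "(\<Sum>j | 1 <= j & j <= J & \<tau> j w < \<infinity>. indicator S (real_of_ereal (\<tau> j w), \<gamma> j w)) = emeasure ?D S"
   by (simp add: jumps_def)
 qed
 also have "\<dots> = ?D"
  using measure_of_of_measure[of ?D] by (simp add: space_pair_measure)
 finally show ?thesis .
qed

lemma jump_measure_integral: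
 fixes f :: "real \<times> 'e => 'v::euclidean_space"
 assumes w: "w \<in> space P"
  and fm: "(%x. indicator ({s<..t} \<times> UNIV) x *\<^sub>R f x) \<in> borel_measurable (borel \<Otimes>\<^sub>M borel)"
 shows "(LINT x:{s<..t} \<times> UNIV|jump_measure J \<tau> \<gamma> w. f x) =
  (\<Sum>j | j \<in> jumps w & ereal s < \<tau> j w & \<tau> j w <= ereal t. f (real_of_ereal (\<tau> j w), \<gamma> j w))"
proof -
 have "(LINT x:{s<..t} \<times> UNIV|jump_measure J \<tau> \<gamma> w. f x) =
   (\<integral>j. indicator ({s<..t} \<times> UNIV) (real_of_ereal (\<tau> j w), \<gamma> j w) *\<^sub>R f (real_of_ereal (\<tau> j w), \<gamma> j w) \<partial>count_space (jumps w))"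
  unfolding set_lebesgue_integral_def jump_measure_distr by (rule integral_distr[OF _ fm]) (simp add: space_pair_measure)
 also have "\<dots> = (\<Sum>j\<in>jumps w. indicator ({s<..t} \<times> UNIV) (real_of_ereal (\<tau> j w), \<gamma> j w) *\<^sub>R f (real_of_ereal (\<tau> j w), \<gamma> j w))"
  using finite_jumps by (simp add: lebesgue_integral_count_space_finite)
 also have "\<dots> = (\<Sum>j\<in>jumps w. if ereal s < \<tau> j w & \<tau> j w <= ereal t then f (real_of_ereal (\<tau> j w), \<gamma> j w) else 0)"
 proof (rule sum.cong)
  fix j assume "j \<in> jumps w"
  then show "indicator ({s<..t} \<times> UNIV) (real_of_ereal (\<tau> j w), \<gamma> j w) *\<^sub>R f (real_of_ereal (\<tau> j w), \<gamma> j w)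
    = (if ereal s < \<tau> j w & \<tau> j w <= ereal t then f (real_of_ereal (\<tau> j w), \<gamma> j w) else 0)"
   using time_nonneg[OF w, of j] by (cases "\<tau> j w") (auto simp: jumps_def indicator_def)
 qed simp
 also have "\<dots> = (\<Sum>j | j \<in> jumps w & ereal s < \<tau> j w & \<tau> j w <= ereal t. f (real_of_ereal (\<tau> j w), \<gamma> j w))"
  using finite_jumps by (simp add: sum.inter_filter)
 finally show ?thesis .
qed

text \<open>The measure consists of finitely many atoms whose supports are Borel points. Therefore
  no measurability of \<open>R\<close> is required.\<close>

lemma jump_measure_AE_iff:
 "(AE x in jump_measure J \<tau> \<gamma> w. R x) \<longleftrightarrow> (\<forall>j\<in>jumps w. R (real_of_ereal (\<tau> j w), \<gamma> j w))"
proof -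
 let ?f = "%j. (real_of_ereal (\<tau> j w), \<gamma> j w)"
 let ?B = "(borel :: real measure) \<Otimes>\<^sub>M (borel :: 'e measure)"
 have fm: "?f \<in> count_space (jumps w) \<rightarrow>\<^sub>M ?B" by (simp add: space_pair_measure)
 have em: "emeasure (jump_measure J \<tau> \<gamma> w) N = emeasure (count_space (jumps w)) (?f -` N \<inter> jumps w)" if "N \<in> sets ?B" for N
  unfolding jump_measure_distr using that by (subst emeasure_distr[OF fm]) auto
 show ?thesis
 proof
  assume "AE x in jump_measure J \<tau> \<gamma> w. R x"
  then obtain N where N: "{x \<in> space (jump_measure J \<tau> \<gamma> w). \<not> R x} \<subseteq> N" "emeasure (jump_measure J \<tau> \<gamma> w) N = 0" "N \<in> sets (jump_measure J \<tau> \<gamma> w)"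
   by (rule AE_E)
  have sN: "N \<in> sets ?B" using N(3) unfolding jump_measure_distr by simp
  have "emeasure (count_space (jumps w)) (?f -` N \<inter> jumps w) = 0" using em[OF sN] N(2) by simp
  then have "?f -` N \<inter> jumps w = {}" by (subst (asm) emeasure_count_space_eq_0) auto
  moreover have "space (jump_measure J \<tau> \<gamma> w) = UNIV" unfolding jump_measure_distr by (simp add: space_pair_measure)
  ultimately show "\<forall>j\<in>jumps w. R (?f j)" using N(1) by auto
 next
  assume R: "\<forall>j\<in>jumps w. R (?f j)"
  have "{?f j} \<in> sets ?B" for j
  proof -
   have "{?f j} = {real_of_ereal (\<tau> j w)} \<times> {\<gamma> j w}" by auto
   then show ?thesis by (simp only:) (intro pair_measureI, auto)
  qed
  then have "(\<Union>j\<in>jumps w. {?f j}) \<in> sets ?B"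
   by (intro sets.finite_UN finite_jumps) simp
  moreover have "(\<Union>j\<in>jumps w. {?f j}) = ?f ` jumps w" by auto
  ultimately have F: "?f ` jumps w \<in> sets ?B" by (simp only:)
  then have N: "UNIV - ?f ` jumps w \<in> sets ?B" using sets.compl_sets[OF F] by (simp add: space_pair_measure)
  show "AE x in jump_measure J \<tau> \<gamma> w. R x"
  proof (rule AE_I[where N = "UNIV - ?f ` jumps w"])
   show "emeasure (jump_measure J \<tau> \<gamma> w) (UNIV - ?f ` jumps w) = 0"
    unfolding em[OF N] by (subst emeasure_count_space_eq_0) auto
   show "UNIV - ?f ` jumps w \<in> sets (jump_measure J \<tau> \<gamma> w)" using N unfolding jump_measure_distr by simp
  qed (use R in auto)
 qed
qed

end

section \<open>The Riccati equation along a path\<close>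

text \<open>Clamping of the time to the interval from 0 to \<open>T\<close>. Processes are
  measurable only on this interval; composed with the clamp, their sections become measurable on the
  whole line.\<close>

definition clp :: "real => real => real" where "clp T r = max 0 (min T r)"

lemma clp_eq: "r \<in> {0..T} ==> clp T r = r" and clp_in: "0 <= T ==> clp T r \<in> {0..T}"
 by (auto simp: clp_def)

lemma clp_measurable: "clp T \<in> borel_measurable borel"
 unfolding clp_def[abs_def] by measurable

lemma set_integrable_bounded_Ioc:
 fixes f :: "real => 'v::euclidean_space"
 assumes m: "(%r. f (clp T r)) \<in> borel_measurable borel" and s: "0 <= s" "t <= T"
  and b: "AE r in lborel. r \<in> {0<..T} --> norm (f r) <= B"
 shows "set_integrable lborel {s<..t} f"
proof -
 have "integrable lborel (%r. indicator {s<..t} r *\<^sub>R f (clp T r))"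
 proof (rule integrableI_bounded_set_indicator)
  show "(%r. f (clp T r)) \<in> borel_measurable lborel" by (rule measurable_lborelI[OF m])
  show "emeasure lborel {s<..t} < \<infinity>"
   by (rule emeasure_bounded_finite) (rule bounded_subset[OF compact_imp_bounded[OF compact_Icc[of s t]]], auto)
  show "AE r in lborel. r \<in> {s<..t} --> norm (f (clp T r)) <= B"
   using b by eventually_elim (use s in \<open>auto simp: clp_eq\<close>)
 qed simp
 moreover have "(%r. indicator {s<..t} r *\<^sub>R f (clp T r)) = (%r. indicator {s<..t} r *\<^sub>R f r)"
  using s by (auto simp: fun_eq_iff indicator_def clp_eq)
 ultimately show ?thesis by (simp add: set_integrable_def)
qed

context mode_process
begin

definition path_driver ::
 "'w => nat => (real => real^'n^'n) => (real => 'e => real^'n^'n) => (real => real^'n^'n) =>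
  (real => real^'d^'n) => (real => 'e => real^'n^'n) => real => real^'n^'n" where
 "path_driver w N S h a b c r = driver (crate w r) (ck w r) (a r) (b r) (c r) N (S r) (h r)"

text \<open>All that the pathwise computations use of one fixed \<open>w\<close>: measurable
  sections, symmetry and bounds. From here on no probability enters until statements are carried
  back to almost all paths.\<close>

definition good_path ::
 "real => real => real => 'w => (real => real^'n^'n) => (real => 'e => real^'n^'n) => (real => real^'n^'n) =>
  (real => real^'d^'n) => (real => 'e => real^'n^'n) => bool" where
 "good_path T K L w S h a b c \<longleftrightarrow> w \<in> space P &
   (%r. S (clp T r)) \<in> borel_measurable borel & (%r. a (clp T r)) \<in> borel_measurable borel &
   (%r. b (clp T r)) \<in> borel_measurable borel &
   (%x. h (clp T (fst x)) (snd x)) \<in> borel_measurable (borel \<Otimes>\<^sub>M borel) &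
   (%x. c (clp T (fst x)) (snd x)) \<in> borel_measurable (borel \<Otimes>\<^sub>M borel) &
   (\<forall>t\<in>{0..T}. S t \<in> sym_mats & (\<forall>th. h t th \<in> sym_mats)) &
   (AE r in lborel. r \<in> {0<..T} --> norm (a r) <= K & norm (b r) <= K & norm (S r) <= L & crate w r <= K &
    (crate w r \<noteq> 0 --> (AE th in ck w r. norm (c r th) <= K & norm (h r th) <= L & possemidef (S r + h r th))))"

text \<open>The compensated integral of \<open>h\<close> is the sum over the jumps minus its
  compensator. The latter is combined with the jump generator and the linear terms into the driver,
  so the right-hand side of the equation becomes jumps minus integrated driver.\<close>

lemma path_rhs:
 fixes S a :: "real => real^'n^'n" and b :: "real => real^'d^'n" and h c :: "real => 'e => real^'n^'n"
 assumes g: "good_path T K L w S h a b c" and K: "0 <= K" "0 <= L" and T: "0 <= T"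
 shows "set_integrable lborel {0<..T} (path_driver w N S h a b c)"
  and "\<exists>c'\<ge>0. AE r in lborel. r \<in> {0<..T} --> norm (path_driver w N S h a b c r) <= c'"
  and "AE r in lborel. r \<in> {0<..T} --> admissible K (crate w r) (ck w r) (a r) (b r) (c r) (S r) (h r)"
  and "t \<in> {0..T} ==>
   (LINT x:{t<..T} \<times> UNIV|compensator J lam Q \<tau> \<gamma> w. jump_generator (c (fst x) (snd x)) (S (fst x)) (h (fst x) (snd x)))
   + compensated_integral (jump_measure J \<tau> \<gamma> w) (compensator J lam Q \<tau> \<gamma> w) ({t<..T} \<times> UNIV) (%x. h (fst x) (snd x))
   + (LINT r:{t<..T}|lborel. a r ** S r + S r ** transpose (a r) - real N *\<^sub>R (b r ** transpose (b r)))
   = (\<Sum>j | j \<in> jumps w & ereal t < \<tau> j w & \<tau> j w <= ereal T. h (real_of_ereal (\<tau> j w)) (\<gamma> j w))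
    - (LINT r:{t<..T}|lborel. path_driver w N S h a b c r)"
proof -
 let ?C = "compensator J lam Q \<tau> \<gamma> w"
 define m where "m = max K L"
 define jg where "jg = (%r th. jump_generator (c r th) (S r) (h r th))"
 define Bj where "Bj = (m * m + m) * (real CARD('n) * (m * m + m))"
 have m0: "0 <= m" using K by (simp add: m_def)
 have Bj0: "0 <= Bj" using m0 by (simp add: Bj_def)
 have w: "w \<in> space P" and Sm: "(%r. S (clp T r)) \<in> borel_measurable borel"
  and am: "(%r. a (clp T r)) \<in> borel_measurable borel" and bm: "(%r. b (clp T r)) \<in> borel_measurable borel"
  and hm: "(%x. h (clp T (fst x)) (snd x)) \<in> borel_measurable (borel \<Otimes>\<^sub>M borel)"
  and cm: "(%x. c (clp T (fst x)) (snd x)) \<in> borel_measurable (borel \<Otimes>\<^sub>M borel)"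
  and sym: "\<And>t. t \<in> {0..T} ==> S t \<in> sym_mats" "\<And>t th. t \<in> {0..T} ==> h t th \<in> sym_mats"
  and bd: "AE r in lborel. r \<in> {0<..T} --> norm (a r) <= K & norm (b r) <= K & norm (S r) <= L & crate w r <= K &
    (crate w r \<noteq> 0 --> (AE th in ck w r. norm (c r th) <= K & norm (h r th) <= L & possemidef (S r + h r th)))"
  using g by (auto simp: good_path_def)
 have Sm2: "(%x. S (clp T (fst x))) \<in> borel_measurable (borel \<Otimes>\<^sub>M borel)"
  by (rule measurable_compose[OF measurable_fst Sm])
 have jm: "(%x. jg (clp T (fst x)) (snd x)) \<in> borel_measurable (borel \<Otimes>\<^sub>M borel)"
  unfolding jg_def by (rule jump_generator_measurable[OF cm Sm2 hm])
 have ind: "(%x. indicator ({s<..t} \<times> UNIV) x *\<^sub>R f (fst x) (snd x)) \<in> borel_measurable (borel \<Otimes>\<^sub>M borel)"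
  if "(%x. f (clp T (fst x)) (snd x)) \<in> borel_measurable (borel \<Otimes>\<^sub>M borel)" "0 <= s" "t <= T" for f :: "real => 'e => real^'n^'n" and s t
 proof -
  have S: "{s<..t} \<times> UNIV \<in> sets ((borel :: real measure) \<Otimes>\<^sub>M (borel :: 'e measure))" by (intro pair_measureI) auto
  have "(%x. indicator ({s<..t} \<times> UNIV) x *\<^sub>R f (fst x) (snd x)) = (%x. indicator ({s<..t} \<times> UNIV) x *\<^sub>R f (clp T (fst x)) (snd x))"
   using that by (auto simp: fun_eq_iff indicator_def clp_eq)
  then show ?thesis using S that(1) by (simp only:) (intro borel_measurable_scaleR borel_measurable_indicator)
 qed
 have sec: "(%th. f r th) \<in> borel_measurable (ck w r)"
  if "(%x. f (clp T (fst x)) (snd x)) \<in> borel_measurable (borel \<Otimes>\<^sub>M borel)" "r \<in> {0<..T}" for f :: "real => 'e => real^'n^'n" and r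
  using measurable_compose[OF Pair_ck[of r w] that(1)] that(2) by (simp add: clp_eq)
 have bdh: "AE r in lborel. r \<in> {s<..t} --> crate w r \<noteq> 0 --> (AE th in ck w r. norm (h r th) <= L)" if "0 <= s" "t <= T" for s t
  using bd
 proof eventually_elim
  case (elim r)
  show ?case
  proof (intro impI)
   assume "r \<in> {s<..t}" "crate w r \<noteq> 0"
   then have "AE th in ck w r. norm (c r th) <= K & norm (h r th) <= L & possemidef (S r + h r th)"
    using elim that by auto
   then show "AE th in ck w r. norm (h r th) <= L" by eventually_elim simp
  qed
 qed
 have bdj: "AE r in lborel. r \<in> {s<..t} --> crate w r \<noteq> 0 --> (AE th in ck w r. norm (jg r th) <= Bj)" if "0 <= s" "t <= T" for s t
  using bd
 proof eventually_elim
  case (elim r)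
  show ?case
  proof (intro impI)
   assume r: "r \<in> {s<..t}" "crate w r \<noteq> 0"
   have nS: "norm (S r) <= m" using elim r that by (auto simp: m_def)
   have "AE th in ck w r. norm (c r th) <= K & norm (h r th) <= L & possemidef (S r + h r th)"
    using elim r that by auto
   then show "AE th in ck w r. norm (jg r th) <= Bj"
   proof eventually_elim
    case (elim th)
    then show ?case using nS unfolding jg_def Bj_def
     by (intro norm_jump_generator_le) (auto simp: m_def)
   qed
  qed
 qed
 have ch: "set_integrable ?C ({s<..t} \<times> UNIV) (%x. h (fst x) (snd x))"
  "(LINT x:{s<..t} \<times> UNIV|?C. h (fst x) (snd x)) = (LINT r:{s<..t}|lborel. crate w r *\<^sub>R (\<integral>th. h r th \<partial>ck w r))"
  "set_integrable lborel {s<..t} (%r. crate w r *\<^sub>R (\<integral>th. h r th \<partial>ck w r))" if "0 <= s" "t <= T" for s t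
  using compensator_integral[OF w ind[OF hm that], of L] bdh[OF that] K(2) that(1) by simp_all
 have cj: "set_integrable ?C ({s<..t} \<times> UNIV) (%x. jg (fst x) (snd x))"
  "(LINT x:{s<..t} \<times> UNIV|?C. jg (fst x) (snd x)) = (LINT r:{s<..t}|lborel. crate w r *\<^sub>R (\<integral>th. jg r th \<partial>ck w r))"
  "set_integrable lborel {s<..t} (%r. crate w r *\<^sub>R (\<integral>th. jg r th \<partial>ck w r))" if "0 <= s" "t <= T" for s t
  using compensator_integral[OF w ind[OF jm that], of Bj] bdj[OF that] Bj0 that(1) by simp_all
 define lin where "lin = (%r. a r ** S r + S r ** transpose (a r) - real N *\<^sub>R (b r ** transpose (b r)))"
 define Bl where "Bl = m * m + m * m + real N * (m * m)"
 have linb: "AE r in lborel. r \<in> {0<..T} --> norm (lin r) <= Bl"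
  using bd
 proof eventually_elim
  case (elim r)
  show ?case
  proof
   assume r: "r \<in> {0<..T}"
   have n: "norm (a r) <= m" "norm (b r) <= m" "norm (S r) <= m" using elim r by (auto simp: m_def)
   have "norm (lin r) <= norm (a r ** S r) + norm (S r ** transpose (a r)) + norm (real N *\<^sub>R (b r ** transpose (b r)))"
    unfolding lin_def by (intro order.trans[OF norm_triangle_ineq4] add_right_mono norm_triangle_ineq)
   also have "\<dots> <= Bl"
    unfolding Bl_def norm_scaleR abs_of_nat
    by (intro add_mono mult_left_mono order.trans[OF norm_matrix_mult_le] mult_mono) (use n m0 in auto)
   finally show "norm (lin r) <= Bl" .
  qed
 qed
 have linm: "(%r. lin (clp T r)) \<in> borel_measurable borel"
  unfolding lin_def using am bm Sm
  by (intro borel_measurable_diff borel_measurable_add borel_measurable_matrix_mult borel_measurable_transpose borel_measurable_scaleR borel_measurable_const)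
 have lini: "set_integrable lborel {s<..t} lin" if "0 <= s" "t <= T" for s t
  by (rule set_integrable_bounded_Ioc[OF linm that linb])
 have eqd: "AE r in lborel. r \<in> {0<..T} --> path_driver w N S h a b c r =
   crate w r *\<^sub>R (\<integral>th. h r th \<partial>ck w r) - crate w r *\<^sub>R (\<integral>th. jg r th \<partial>ck w r) - lin r
   & admissible K (crate w r) (ck w r) (a r) (b r) (c r) (S r) (h r)
   & norm (path_driver w N S h a b c r) <= K * (L + Bj) + Bl"
  using bd bdh[of 0 T, simplified] bdj[of 0 T, simplified] linb
 proof eventually_elim
  case (elim r)
  show ?case
  proof
   assume r: "r \<in> {0<..T}"
   interpret p: prob_space "ck w r" by (rule ck_prob)
   have ih: "integrable (ck w r) (%th. h r th)" if "crate w r \<noteq> 0"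
    using elim(2) r that sec[OF hm r] by (intro p.integrable_const_bound[of _ L]) auto
   have ij: "integrable (ck w r) (%th. jg r th)" if "crate w r \<noteq> 0"
    using elim(3) r that sec[OF jm r] by (intro p.integrable_const_bound[of _ Bj]) auto
   have e: "crate w r *\<^sub>R (\<integral>th. h r th - jg r th \<partial>ck w r) = crate w r *\<^sub>R (\<integral>th. h r th \<partial>ck w r) - crate w r *\<^sub>R (\<integral>th. jg r th \<partial>ck w r)"
    using ih ij by (cases "crate w r = 0") (simp_all add: scaleR_diff_right)
   have pd: "path_driver w N S h a b c r =
     crate w r *\<^sub>R (\<integral>th. h r th \<partial>ck w r) - crate w r *\<^sub>R (\<integral>th. jg r th \<partial>ck w r) - lin r"
    unfolding path_driver_def driver_def lin_def e[symmetric] unfolding jg_def by simp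
   have nb: "norm (crate w r *\<^sub>R (\<integral>th. f th \<partial>ck w r)) <= K * Bf"
    if "crate w r \<noteq> 0 ==> AE th in ck w r. norm (f th) <= Bf" "crate w r \<noteq> 0 ==> integrable (ck w r) f" "0 <= Bf" for f :: "'e => real^'n^'n" and Bf
   proof (cases "crate w r = 0")
    case False
    have "norm (\<integral>th. f th \<partial>ck w r) <= (\<integral>th. norm (f th) \<partial>ck w r)" by (rule integral_norm_bound)
    also have "\<dots> <= (\<integral>th. Bf \<partial>ck w r)" using that False by (intro integral_mono_AE) auto
    finally have "norm (\<integral>th. f th \<partial>ck w r) <= Bf" using p.prob_space by simp
    then show ?thesis using crate_nonneg[OF w, of r] elim(1) r K by (auto intro!: mult_mono)
   qed (use K that(3) in simp)
   have "norm (path_driver w N S h a b c r) <= norm (crate w r *\<^sub>R (\<integral>th. h r th \<partial>ck w r)) + norm (crate w r *\<^sub>R (\<integral>th. jg r th \<partial>ck w r)) + norm (lin r)"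
    unfolding pd by (intro order.trans[OF norm_triangle_ineq4] add_right_mono norm_triangle_ineq4)
   also have "\<dots> <= K * L + K * Bj + Bl"
   proof (intro add_mono nb)
    show "crate w r \<noteq> 0 ==> AE th in ck w r. norm (h r th) <= L" using elim(2) r by auto
    show "crate w r \<noteq> 0 ==> AE th in ck w r. norm (jg r th) <= Bj" using elim(3) r by auto
    show "norm (lin r) <= Bl" using elim(4) r by auto
   qed (use ih ij K Bj0 in auto)
   finally have n: "norm (path_driver w N S h a b c r) <= K * (L + Bj) + Bl" by (simp add: algebra_simps)
   have "admissible K (crate w r) (ck w r) (a r) (b r) (c r) (S r) (h r)"
    unfolding admissible_def
   proof (intro conjI impI)
    show "integrable (ck w r) (%th. h r th - jump_generator (c r th) (S r) (h r th))" if "crate w r \<noteq> 0"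
     using ih[OF that] ij[OF that] unfolding jg_def by (rule Bochner_Integration.integrable_diff)
    show "AE th in ck w r. norm (c r th) <= K & h r th \<in> sym_mats & possemidef (S r + h r th)" if nz: "crate w r \<noteq> 0"
    proof -
     have "AE th in ck w r. norm (c r th) <= K & norm (h r th) <= L & possemidef (S r + h r th)"
      using elim(1) r nz by auto
     then show ?thesis by eventually_elim (use sym(2)[of r] r in auto)
    qed
   qed (use elim(1) r sym(1)[of r] crate_nonneg[OF w] ck_prob in auto)
   then show "path_driver w N S h a b c r =
     crate w r *\<^sub>R (\<integral>th. h r th \<partial>ck w r) - crate w r *\<^sub>R (\<integral>th. jg r th \<partial>ck w r) - lin r
     & admissible K (crate w r) (ck w r) (a r) (b r) (c r) (S r) (h r)
     & norm (path_driver w N S h a b c r) <= K * (L + Bj) + Bl" using pd n by blast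
  qed
 qed
 show "AE r in lborel. r \<in> {0<..T} --> admissible K (crate w r) (ck w r) (a r) (b r) (c r) (S r) (h r)"
  using eqd by eventually_elim blast
 show "\<exists>c'\<ge>0. AE r in lborel. r \<in> {0<..T} --> norm (path_driver w N S h a b c r) <= c'"
 proof (intro exI conjI)
  show "AE r in lborel. r \<in> {0<..T} --> norm (path_driver w N S h a b c r) <= K * (L + Bj) + Bl"
   using eqd by eventually_elim blast
  show "0 <= K * (L + Bj) + Bl" using K Bj0 m0 by (simp add: Bl_def)
 qed
 have pm: "(%r. path_driver w N S h a b c (clp T r)) \<in> borel_measurable borel"
 proof -
  let ?f = "%x. h (clp T (fst x)) (snd x) - jump_generator (c (clp T (fst x)) (snd x)) (S (clp T (fst x))) (h (clp T (fst x)) (snd x))"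
  have fm: "?f \<in> borel_measurable (borel \<Otimes>\<^sub>M borel)"
   using hm jm unfolding jg_def by (rule borel_measurable_diff)
  have "(%r. \<integral>th. ?f (r, th) \<partial>ck w (clp T r)) \<in> borel_measurable borel"
  proof -
   have k: "(%r. distr (ck w (clp T r)) (borel \<Otimes>\<^sub>M borel) (Pair r)) \<in> borel \<rightarrow>\<^sub>M prob_algebra (borel \<Otimes>\<^sub>M borel)"
   proof (rule measurable_distr_prob_space2)
    show "(%r. ck w (clp T r)) \<in> borel \<rightarrow>\<^sub>M prob_algebra borel" by (rule measurable_compose[OF clp_measurable ck_kernel[OF w]])
    show "(%(r, th). (r, th)) \<in> borel \<Otimes>\<^sub>M borel \<rightarrow>\<^sub>M borel \<Otimes>\<^sub>M borel" by simp
   qed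
   have "(%r. \<integral>y. ?f y \<partial>distr (ck w (clp T r)) (borel \<Otimes>\<^sub>M borel) (Pair r)) \<in> borel_measurable borel"
    by (rule measurable_compose[OF measurable_prob_algebraD[OF k] integral_measurable_subprob_algebra[OF fm]])
   moreover have "(\<integral>y. ?f y \<partial>distr (ck w (clp T r)) (borel \<Otimes>\<^sub>M borel) (Pair r)) = (\<integral>th. ?f (r, th) \<partial>ck w (clp T r))" for r
    by (rule integral_distr[OF _ fm]) (simp cong: measurable_cong_sets)
   ultimately show ?thesis by (simp only:)
  qed
  then have i: "(%r. \<integral>th. h (clp T r) th - jump_generator (c (clp T r) th) (S (clp T r)) (h (clp T r) th) \<partial>ck w (clp T r)) \<in> borel_measurable borel"
   by (simp only: fst_conv snd_conv)
  have cr: "(%r. crate w (clp T r)) \<in> borel_measurable borel" by (rule measurable_compose[OF clp_measurable crate_measurable[OF w]])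
  show ?thesis unfolding path_driver_def driver_def
   by (intro borel_measurable_diff borel_measurable_add borel_measurable_matrix_mult borel_measurable_transpose borel_measurable_scaleR borel_measurable_const am bm Sm i cr)
 qed
 have pi: "set_integrable lborel {s<..t} (path_driver w N S h a b c)" if "0 <= s" "t <= T" for s t
 proof (rule set_integrable_bounded_Ioc[OF pm that])
  show "AE r in lborel. r \<in> {0<..T} --> norm (path_driver w N S h a b c r) <= K * (L + Bj) + Bl"
   using eqd by eventually_elim blast
 qed
 show "set_integrable lborel {0<..T} (path_driver w N S h a b c)" using pi[of 0 T] by simp
 assume t: "t \<in> {0..T}"
 then have t0: "0 <= t" "T <= T" by auto
 have "(LINT r:{t<..T}|lborel. path_driver w N S h a b c r) =
   (LINT r:{t<..T}|lborel. crate w r *\<^sub>R (\<integral>th. h r th \<partial>ck w r) - crate w r *\<^sub>R (\<integral>th. jg r th \<partial>ck w r) - lin r)"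
  unfolding set_lebesgue_integral_def
 proof (rule integral_cong_AE)
  show "(%r. indicator {t<..T} r *\<^sub>R path_driver w N S h a b c r) \<in> borel_measurable lborel"
   using pi[OF t0] by (auto simp: set_integrable_def)
  have "set_integrable lborel {t<..T} (%r. crate w r *\<^sub>R (\<integral>th. h r th \<partial>ck w r) - crate w r *\<^sub>R (\<integral>th. jg r th \<partial>ck w r) - lin r)"
   by (intro set_integral_diff ch(3) cj(3) lini t0)
  then show "(%r. indicator {t<..T} r *\<^sub>R (crate w r *\<^sub>R (\<integral>th. h r th \<partial>ck w r) - crate w r *\<^sub>R (\<integral>th. jg r th \<partial>ck w r) - lin r)) \<in> borel_measurable lborel"
   by (auto simp only: set_integrable_def dest: borel_measurable_integrable)
  show "AE r in lborel. indicator {t<..T} r *\<^sub>R path_driver w N S h a b c r =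
    indicator {t<..T} r *\<^sub>R (crate w r *\<^sub>R (\<integral>th. h r th \<partial>ck w r) - crate w r *\<^sub>R (\<integral>th. jg r th \<partial>ck w r) - lin r)"
   using eqd by eventually_elim (use t in \<open>auto simp: indicator_def\<close>)
 qed
 also have "\<dots> = (LINT r:{t<..T}|lborel. crate w r *\<^sub>R (\<integral>th. h r th \<partial>ck w r)) - (LINT r:{t<..T}|lborel. crate w r *\<^sub>R (\<integral>th. jg r th \<partial>ck w r)) - (LINT r:{t<..T}|lborel. lin r)"
  using ch(3)[OF t0] cj(3)[OF t0] lini[OF t0] by (simp add: set_integral_diff)
 finally have *: "(LINT r:{t<..T}|lborel. path_driver w N S h a b c r) = (LINT r:{t<..T}|lborel. crate w r *\<^sub>R (\<integral>th. h r th \<partial>ck w r)) - (LINT r:{t<..T}|lborel. crate w r *\<^sub>R (\<integral>th. jg r th \<partial>ck w r)) - (LINT r:{t<..T}|lborel. lin r)" .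
  have cj2: "(LINT x:{t<..T} \<times> UNIV|?C. jump_generator (c (fst x) (snd x)) (S (fst x)) (h (fst x) (snd x)))
    = (LINT r:{t<..T}|lborel. crate w r *\<^sub>R (\<integral>th. jg r th \<partial>ck w r))"
   using cj(2)[OF t0] by (simp only: jg_def)
 show "(LINT x:{t<..T} \<times> UNIV|?C. jump_generator (c (fst x) (snd x)) (S (fst x)) (h (fst x) (snd x)))
   + compensated_integral (jump_measure J \<tau> \<gamma> w) ?C ({t<..T} \<times> UNIV) (%x. h (fst x) (snd x))
   + (LINT r:{t<..T}|lborel. a r ** S r + S r ** transpose (a r) - real N *\<^sub>R (b r ** transpose (b r)))
   = (\<Sum>j | j \<in> jumps w & ereal t < \<tau> j w & \<tau> j w <= ereal T. h (real_of_ereal (\<tau> j w)) (\<gamma> j w))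
    - (LINT r:{t<..T}|lborel. path_driver w N S h a b c r)"
  unfolding compensated_integral_def jump_measure_integral[OF w ind[OF hm t0]] cj2 ch(2)[OF t0] * by (simp add: lin_def)
qed

end

section \<open>Left limits and jumps\<close>

text \<open>The left limit, with the value at time 0 as a convention, so that the process is defined
  and predictable on the closed interval.\<close>

definition lm :: "(real => 'w => 'v::t2_space) => real => 'w => 'v" where
 "lm X t w = (if t = 0 then X 0 w else Lim (at_left t) (%s. X s w))"

lemma lm_eqI: "t \<noteq> 0 ==> ((%s. X s w) \<longlongrightarrow> l) (at_left t) ==> lm X t w = l" for t :: real
 unfolding lm_def by (simp add: tendsto_Lim)

lemma lm_tendsto:
 fixes T :: real
 assumes "cadlag_on T (%t. X t w)" "t \<in> {0<..T}"
 shows "((%s. X s w) \<longlongrightarrow> lm X t w) (at_left t)"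
proof -
 obtain l where l: "((%s. X s w) \<longlongrightarrow> l) (at_left t)" using assms unfolding cadlag_on_def by blast
 then have "lm X t w = l" using assms(2) by (intro lm_eqI) auto
 then show ?thesis using l by simp
qed

lemma lm_continuous:
 fixes T :: real
 assumes "continuous (at t within {0..T}) (%s. X s w)" "t \<in> {0<..T}"
 shows "lm X t w = X t w"
proof (rule lm_eqI)
 have "((%s. X s w) \<longlongrightarrow> X t w) (at t within {0..T})" using assms(1) by (simp add: continuous_within)
 then have "((%s. X s w) \<longlongrightarrow> X t w) (at t within {0..t})"
  by (rule tendsto_within_subset) (use assms(2) in auto)
 then show "((%s. X s w) \<longlongrightarrow> X t w) (at_left t)" using assms(2) by (simp add: at_within_Icc_at_left)
qed (use assms in auto)

text \<open>For positive \<open>t\<close> the largest multiple of \<open>1 / 2 ^ n\<close> that is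
  strictly below \<open>t\<close>. Strictness makes a process sampled at this time left-continuous
  and hence predictable.\<close>

definition dyl :: "nat => real => real" where
 "dyl n t = (if t = 0 then 0 else real_of_int (\<lceil>t * 2 ^ n\<rceil> - 1) / 2 ^ n)"

lemma dyl_bounds: "0 < t ==> 0 <= dyl n t & dyl n t < t & t - 1 / 2 ^ n <= dyl n t"
proof -
 assume t: "0 < t"
 have "0 < t * 2 ^ n" using t by simp
 then have "1 <= \<lceil>t * 2 ^ n\<rceil>" by linarith
 then have 0: "0 <= dyl n t" using t by (simp add: dyl_def)
 have "real_of_int (\<lceil>t * 2 ^ n\<rceil> - 1) < t * 2 ^ n" "t * 2 ^ n - 1 <= real_of_int (\<lceil>t * 2 ^ n\<rceil> - 1)" by linarith+
 then have "dyl n t < t" "t - 1 / 2 ^ n <= dyl n t" using t by (simp_all add: dyl_def field_simps)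
 then show ?thesis using 0 by simp
qed

lemma dyl_at_left:
 assumes t: "0 < t" shows "filterlim (%n. dyl n t) (at_left t) sequentially"
 unfolding filterlim_at
proof
 have "(%n. t - 1 / 2 ^ n) \<longlonglongrightarrow> t" by real_asymp
 then show "(%n. dyl n t) \<longlonglongrightarrow> t"
  by (rule real_tendsto_sandwich[rotated 2, OF _ tendsto_const]) (use dyl_bounds[OF t] in \<open>auto simp: less_imp_le intro!: always_eventually\<close>)
 show "\<forall>\<^sub>F n in sequentially. dyl n t \<in> {..<t} & dyl n t \<noteq> t"
  using dyl_bounds[OF t] by (intro always_eventually allI) (auto simp: less_le)
qed

context mode_process
begin

text \<open>The left limit is the limit of step processes that on each dyadic interval, open on the
  left, take the value at its left end point; such a value is known at the beginning of the
  interval.\<close>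

lemma lm_predictable:
 fixes X :: "real => 'w => 'v::euclidean_space"
 assumes T: "0 <= T" and ad: "\<And>t. t \<in> {0..T} ==> X t \<in> borel_measurable (FF t)"
  and cad: "\<And>w. w \<in> space P ==> cadlag_on T (%t. X t w)"
 shows "(%p. lm X (snd p) (fst p)) \<in> borel_measurable (pred T)"
proof (rule borel_measurable_LIMSEQ_metric)
 fix n :: nat
 show "(%p. X (dyl n (snd p)) (fst p)) \<in> borel_measurable (pred T)"
 proof (rule measurableI)
  fix B :: "'v set" assume B: "B \<in> sets borel"
  let ?k = "%k :: nat. real k / 2 ^ n"
  have dk: "dyl n t = ?k k" if "?k k < t" "t <= ?k (Suc k)" for k t
  proof -
   have k0: "0 <= ?k k" by simp
   have "0 < t" using k0 that(1) by linarith
   moreover have "\<lceil>t * 2 ^ n\<rceil> = int k + 1"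
    using that by (intro ceiling_unique) (simp_all add: field_simps)
   ultimately show ?thesis by (simp add: dyl_def)
  qed
  have ex: "\<exists>k. ?k k < t & t <= ?k (Suc k)" if "0 < t" for t
  proof -
   have p: "0 < t * 2 ^ n" using that by simp
   have c: "real (nat (\<lceil>t * 2 ^ n\<rceil> - 1)) = real_of_int (\<lceil>t * 2 ^ n\<rceil> - 1)"
    using p by (intro of_nat_nat) linarith
   have "real_of_int (\<lceil>t * 2 ^ n\<rceil> - 1) < t * 2 ^ n" "t * 2 ^ n <= real_of_int (\<lceil>t * 2 ^ n\<rceil> - 1) + 1" by linarith+
   then show ?thesis
    by (intro exI[of _ "nat (\<lceil>t * 2 ^ n\<rceil> - 1)"]) (simp add: c field_simps del: of_int_diff of_nat_nat)
  qed
  have "(%p. X (dyl n (snd p)) (fst p)) -` B \<inter> space (pred T) =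
   (X 0 -` B \<inter> space P) \<times> {0} \<union> (\<Union>k\<in>{k. ?k k < T}. (X (?k k) -` B \<inter> space P) \<times> {?k k<..min T (?k (Suc k))})" (is "?L = ?R")
  proof (intro equalityI subsetI)
   fix p assume p: "p \<in> ?L"
   obtain w t where pt: "p = (w, t)" by (cases p)
   then have w: "w \<in> space P" "0 <= t" "t <= T" "X (dyl n t) w \<in> B" using p by auto
   show "p \<in> ?R"
   proof (cases "t = 0")
    case True
    then show ?thesis using w pt by (simp add: dyl_def)
   next
    case False
    then obtain k where k: "?k k < t" "t <= ?k (Suc k)" using ex[of t] w by auto
    then have "X (?k k) w \<in> B" "?k k < T" using w dk[OF k] by auto
    then show ?thesis using k w pt by auto
   qed
  next
   fix p assume p: "p \<in> ?R"
   obtain w t where pt: "p = (w, t)" by (cases p)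
   from p consider "t = 0" "w \<in> space P" "X 0 w \<in> B"
    | k where "?k k < T" "X (?k k) w \<in> B" "w \<in> space P" "?k k < t" "t <= T" "t <= ?k (Suc k)"
    unfolding pt by auto
   then show "p \<in> ?L"
   proof cases
    case 1
    then show ?thesis using T pt by (simp add: dyl_def)
   next
    case (2 k)
    have "0 <= ?k k" by simp
    then have "0 <= t" using 2(4) by linarith
    then show ?thesis using 2 dk[OF 2(4,6)] pt by simp
   qed
  qed
  moreover have "?R \<in> sets (pred T)"
  proof (intro sets.Un sets.countable_UN'')
   have "X 0 -` B \<inter> space P \<in> sets (FF 0)" using measurable_sets[OF ad[of 0] B] T by simp
   then show "(X 0 -` B \<inter> space P) \<times> {0} \<in> sets (pred T)"
    unfolding sets_pred_eq[OF T] by (intro sigma_sets.Basic UnI1) blast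
   fix k assume k: "k \<in> {k. ?k k < T}"
   then have "X (?k k) -` B \<inter> space P \<in> sets (FF (?k k))" using measurable_sets[OF ad[of "?k k"] B] by simp
   moreover have "?k k <= min T (?k (Suc k))" using k by (simp add: divide_right_mono)
   ultimately show "(X (?k k) -` B \<inter> space P) \<times> {?k k<..min T (?k (Suc k))} \<in> sets (pred T)"
    unfolding sets_pred_eq[OF T]
    by (intro sigma_sets.Basic UnI2 CollectI exI[of _ "X (?k k) -` B \<inter> space P"] exI[of _ "?k k"] exI[of _ "min T (?k (Suc k))"]) auto
  qed auto
  ultimately show "(%p. X (dyl n (snd p)) (fst p)) -` B \<inter> space (pred T) \<in> sets (pred T)" by simp
 qed simp
next
 fix p assume "p \<in> space (pred T)"
 then have w: "fst p \<in> space P" "0 <= snd p" "snd p <= T" by auto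
 show "(%n. X (dyl n (snd p)) (fst p)) \<longlonglongrightarrow> lm X (snd p) (fst p)"
 proof (cases "snd p = 0")
  case True
  then show ?thesis by (simp add: dyl_def lm_def)
 next
  case False
  then have p: "0 < snd p" "snd p \<in> {0<..T}" using w by auto
  show ?thesis
   by (rule filterlim_compose[OF lm_tendsto[of T X "fst p" "snd p", OF cad[OF w(1)] p(2)] dyl_at_left[OF p(1)]])
 qed
qed

text \<open>\<open>Y\<close> is a predictable representation of the jumps of \<open>X\<close>: at
  each jump, the left limit plus \<open>Y\<close> at the new mode is the new value. The notion is
  linear, so differences of two solutions fall under it although they solve no Riccati
  equation.\<close>

definition jump_pair :: "real => (real => 'w => 'v::euclidean_space) => (real => 'e => 'w => 'v) => bool" where
 "jump_pair T X Y \<longleftrightarrow> (\<forall>t\<in>{0..T}. X t \<in> borel_measurable (FF t)) &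
   (\<forall>w\<in>space P. cadlag_on T (%t. X t w)) &
   (\<forall>w\<in>space P. \<forall>t\<in>{0..T}. (\<forall>j\<in>{1..J}. \<tau> j w \<noteq> ereal t) --> continuous (at t within {0..T}) (%s. X s w)) &
   predictable_field P FF T Y &
   (AE w in P. \<forall>j\<in>jumps w. \<tau> j w <= ereal T -->
    lm X (real_of_ereal (\<tau> j w)) w + Y (real_of_ereal (\<tau> j w)) (\<gamma> j w) w = X (real_of_ereal (\<tau> j w)) w)"

lemma jump_time_in:
 assumes "w \<in> space P" "1 <= j" "\<tau> j w <= ereal T"
 shows "real_of_ereal (\<tau> j w) \<in> {0<..T}" "ereal (real_of_ereal (\<tau> j w)) = \<tau> j w"
proof -
 have "0 < \<tau> j w" using time_strict_mono[OF assms(1), of 0 j] time_0[OF assms(1)] assms(2) by simp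
 then show "real_of_ereal (\<tau> j w) \<in> {0<..T}" "ereal (real_of_ereal (\<tau> j w)) = \<tau> j w"
  using assms(3) by (cases "\<tau> j w"; simp)+
qed

lemma cadlag_on_diff:
 fixes f g :: "real => 'v::real_normed_vector"
 shows "cadlag_on T f ==> cadlag_on T g ==> cadlag_on T (%t. f t - g t)"
 unfolding cadlag_on_def by (blast intro: tendsto_diff)

lemma jump_pair_diff:
 assumes "jump_pair T X Y" "jump_pair T X' Y'"
 shows "jump_pair T (%t w. X t w - X' t w) (%t th w. Y t th w - Y' t th w)"
 unfolding jump_pair_def
proof (intro conjI ballI impI)
 show "(%w. X t w - X' t w) \<in> borel_measurable (FF t)" if "t \<in> {0..T}" for t
  using assms that by (auto simp: jump_pair_def intro!: borel_measurable_diff)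
 show "cadlag_on T (%t. X t w - X' t w)" if "w \<in> space P" for w
  using assms that by (auto simp: jump_pair_def intro!: cadlag_on_diff)
 show "continuous (at t within {0..T}) (%s. X s w - X' s w)" if "w \<in> space P" "t \<in> {0..T}" "\<forall>j\<in>{1..J}. \<tau> j w \<noteq> ereal t" for t w
  using assms that by (auto simp: jump_pair_def intro!: continuous_diff)
 show "predictable_field P FF T (%t th w. Y t th w - Y' t th w)"
  using assms unfolding jump_pair_def predictable_field_def by (auto simp: case_prod_beta' intro!: borel_measurable_diff)
 have "AE w in P. \<forall>j\<in>jumps w. \<tau> j w <= ereal T -->
    lm X (real_of_ereal (\<tau> j w)) w + Y (real_of_ereal (\<tau> j w)) (\<gamma> j w) w = X (real_of_ereal (\<tau> j w)) w"
  "AE w in P. \<forall>j\<in>jumps w. \<tau> j w <= ereal T -->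
    lm X' (real_of_ereal (\<tau> j w)) w + Y' (real_of_ereal (\<tau> j w)) (\<gamma> j w) w = X' (real_of_ereal (\<tau> j w)) w"
  using assms by (auto simp: jump_pair_def)
 then show "AE w in P. \<forall>j\<in>jumps w. \<tau> j w <= ereal T -->
    lm (%t w. X t w - X' t w) (real_of_ereal (\<tau> j w)) w + (Y (real_of_ereal (\<tau> j w)) (\<gamma> j w) w - Y' (real_of_ereal (\<tau> j w)) (\<gamma> j w) w)
     = X (real_of_ereal (\<tau> j w)) w - X' (real_of_ereal (\<tau> j w)) w"
  using AE_space
 proof eventually_elim
  case (elim w)
  show ?case
  proof (intro ballI impI)
   fix j assume j: "j \<in> jumps w" "\<tau> j w <= ereal T"
   let ?t = "real_of_ereal (\<tau> j w)"
   have t: "?t \<in> {0<..T}" using jump_time_in[OF elim(3) _ j(2)] j(1) by (simp add: jumps_def)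
   have "lm (%t w. X t w - X' t w) ?t w = lm X ?t w - lm X' ?t w"
    using assms elim(3) t by (intro lm_eqI tendsto_diff lm_tendsto[OF _ t]) (auto simp: jump_pair_def)
   moreover have "lm X ?t w + Y ?t (\<gamma> j w) w = X ?t w" "lm X' ?t w + Y' ?t (\<gamma> j w) w = X' ?t w"
    using elim(1,2) j by auto
   ultimately show "lm (%t w. X t w - X' t w) ?t w + (Y ?t (\<gamma> j w) w - Y' ?t (\<gamma> j w) w) = X ?t w - X' ?t w"
    by (metis add_diff_add diff_add_eq)
  qed
 qed
qed

lemma predictable_ck_transfer:
 assumes j: "j < J" and T: "0 <= T" and psi: "Measurable.pred (pred T \<Otimes>\<^sub>M borel) \<psi>"
  and ae: "AE w in P. \<tau> (Suc j) w <= ereal T --> \<psi> ((w, real_of_ereal (\<tau> (Suc j) w)), \<gamma> (Suc j) w)"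
 shows "AE w in P. AE r in lborel. r \<in> {0<..T} --> idx w r = j --> crate w r \<noteq> 0 --> (AE th in ck w r. \<psi> ((w, r), th))"
 using predictable_transfer[OF assms] AE_space
proof eventually_elim
 case (elim w)
 note w = elim(2)
 from elim(1) show ?case
 proof eventually_elim
  case (elim r)
  show ?case
  proof (intro impI)
   assume r: "r \<in> {0<..T}" "idx w r = j" "crate w r \<noteq> 0"
   then have "AE th in Q (\<gamma> j w) r. \<psi> ((w, r), th)"
    using elim idx_props[OF w, of r] by (auto simp: crate_def split: if_splits)
   moreover have "ck w r = Q (\<gamma> j w) r" using r by (simp add: ck_def Qm_eq)
   ultimately show "AE th in ck w r. \<psi> ((w, r), th)" by (simp only:)
  qed
 qed
qed

text \<open>The left limit of \<open>X\<close> plus \<open>Y\<close> is predictable and equals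
  \<open>X\<close> at the next jump, so its membership in \<open>V\<close> passes to the
  compensator. There the left limit may be replaced by \<open>X\<close>, since the finitely many
  jump times are a Lebesgue null set.\<close>

lemma jump_pair_transfer:
 fixes X :: "real => 'w => 'v::euclidean_space"
 assumes jp: "jump_pair T X Y" and T: "0 <= T" and j: "j < J" and V: "V \<in> sets borel"
  and ae: "AE w in P. \<tau> (Suc j) w <= ereal T --> X (real_of_ereal (\<tau> (Suc j) w)) w \<in> V"
 shows "AE w in P. AE r in lborel. r \<in> {0<..T} --> idx w r = j --> crate w r \<noteq> 0 -->
   (AE th in ck w r. X r w + Y r th w \<in> V)"
proof -
 let ?psi = "%z. lm X (snd (fst z)) (fst (fst z)) + Y (snd (fst z)) (snd z) (fst (fst z)) \<in> V"
 have lmm: "(%p. lm X (snd p) (fst p)) \<in> borel_measurable (pred T)"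
  using jp by (intro lm_predictable T) (auto simp: jump_pair_def)
 have Ym: "(%z. Y (snd (fst z)) (snd z) (fst (fst z))) \<in> borel_measurable (pred T \<Otimes>\<^sub>M borel)"
  using jp by (auto simp: jump_pair_def predictable_field_def case_prod_beta')
 have "(%z. lm X (snd (fst z)) (fst (fst z)) + Y (snd (fst z)) (snd z) (fst (fst z))) \<in> borel_measurable (pred T \<Otimes>\<^sub>M borel)"
  by (rule borel_measurable_add[OF measurable_compose[OF measurable_fst lmm] Ym])
 then have psi: "Measurable.pred (pred T \<Otimes>\<^sub>M borel) ?psi"
  using V by (rule pred_sets2[rotated])
 have "AE w in P. \<forall>j\<in>jumps w. \<tau> j w <= ereal T -->
    lm X (real_of_ereal (\<tau> j w)) w + Y (real_of_ereal (\<tau> j w)) (\<gamma> j w) w = X (real_of_ereal (\<tau> j w)) w"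
  using jp by (auto simp: jump_pair_def)
 then have "AE w in P. \<tau> (Suc j) w <= ereal T --> ?psi ((w, real_of_ereal (\<tau> (Suc j) w)), \<gamma> (Suc j) w)"
  using ae
 proof eventually_elim
  case (elim w)
  show ?case
  proof
   assume t: "\<tau> (Suc j) w <= ereal T"
   then have "Suc j \<in> jumps w" using j by (auto simp: jumps_def)
   then show "?psi ((w, real_of_ereal (\<tau> (Suc j) w)), \<gamma> (Suc j) w)" using elim t by auto
  qed
 qed
 from predictable_ck_transfer[OF j T psi this] show ?thesis using AE_space
 proof eventually_elim
  case (elim w)
  note w = elim(2)
  have "AE r in lborel. \<forall>i\<in>{1..J}. r \<noteq> real_of_ereal (\<tau> i w)"
   by (intro AE_finite_allI) (auto intro: AE_lborel_singleton)
  with elim(1) show ?case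
  proof eventually_elim
   case (elim r)
   show ?case
   proof (intro impI)
    assume r: "r \<in> {0<..T}" "idx w r = j" "crate w r \<noteq> 0"
    have "continuous (at r within {0..T}) (%s. X s w)"
    proof -
     have "\<forall>i\<in>{1..J}. \<tau> i w \<noteq> ereal r" using elim(2) by (metis real_of_ereal.simps(1))
     moreover have "r \<in> {0..T}" using r(1) by simp
     ultimately show ?thesis using jp w unfolding jump_pair_def by blast
    qed
    then have "lm X r w = X r w" using r(1) by (rule lm_continuous)
    then show "AE th in ck w r. X r w + Y r th w \<in> V" using elim(1) r by simp
   qed
  qed
 qed
qed

lemma jump_pair_transfer_all:
 fixes X :: "real => 'w => 'v::euclidean_space"
 assumes jp: "jump_pair T X Y" and T: "0 <= T" and V: "V \<in> sets borel"
  and ae: "AE w in P. \<forall>t\<in>{0..T}. X t w \<in> V"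
 shows "AE w in P. AE r in lborel. r \<in> {0<..T} --> crate w r \<noteq> 0 --> (AE th in ck w r. X r w + Y r th w \<in> V)"
proof -
 have "AE w in P. \<forall>j\<in>{..<J}. AE r in lborel. r \<in> {0<..T} --> idx w r = j --> crate w r \<noteq> 0 -->
   (AE th in ck w r. X r w + Y r th w \<in> V)"
 proof (intro AE_finite_allI)
  fix j assume "j \<in> {..<J}"
  then have j: "j < J" by simp
  have "AE w in P. \<tau> (Suc j) w <= ereal T --> X (real_of_ereal (\<tau> (Suc j) w)) w \<in> V"
   using ae AE_space
  proof eventually_elim
   case (elim w)
   then show ?case using jump_time_in(1)[OF elim(2), of "Suc j" T] by auto
  qed
  from jump_pair_transfer[OF jp T j V this] show "AE w in P. AE r in lborel. r \<in> {0<..T} --> idx w r = j --> crate w r \<noteq> 0 -->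
   (AE th in ck w r. X r w + Y r th w \<in> V)" .
 qed simp
 then show ?thesis
 proof eventually_elim
  case (elim w)
  have "AE r in lborel. \<forall>j\<in>{..<J}. r \<in> {0<..T} --> idx w r = j --> crate w r \<noteq> 0 --> (AE th in ck w r. X r w + Y r th w \<in> V)"
   using elim by (intro AE_finite_allI) auto
  then show ?case
  proof eventually_elim
   case (elim r)
   show ?case
   proof (intro impI)
    assume r: "r \<in> {0<..T}" "crate w r \<noteq> 0"
    then have "idx w r \<in> {..<J}" by (auto simp: crate_def split: if_splits)
    then show "AE th in ck w r. X r w + Y r th w \<in> V" using elim r by blast
   qed
  qed
 qed
qed

lemma adapted_transfer_all:
 fixes X :: "real => 'w => 'v::euclidean_space"
 assumes T: "0 <= T" and V: "closed V"
  and ad: "\<And>t. t \<in> {0..T} ==> X t \<in> borel_measurable (FF t)"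
  and cad: "\<And>w. w \<in> space P ==> cadlag_on T (%t. X t w)"
  and ae: "\<And>j. j <= J ==> AE w in P. ereal T < \<tau> (Suc j) w --> \<tau> j w <= ereal T --> (\<forall>t\<in>{0..T}. \<tau> j w <= ereal t --> X t w \<in> V)"
 shows "AE w in P. \<forall>t\<in>{0..T}. X t w \<in> V"
proof -
 have "AE w in P. \<forall>j\<in>{..J}. \<forall>t\<in>{0..T}. \<tau> j w <= ereal t & ereal t < \<tau> (Suc j) w --> X t w \<in> V"
 proof (rule AE_finite_allI)
  fix j assume "j \<in> {..J}"
  then have j: "j <= J" by simp
  have "AE w in P. ereal T < \<tau> (Suc j) w --> (\<forall>t\<in>{0..T}. \<tau> j w <= ereal t --> X t w \<in> V)"
   using ae[OF j]
  proof eventually_elim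
   case (elim w)
   then show ?case by (meson atLeastAtMost_iff ereal_less_eq(3) order.trans)
  qed
  then show "AE w in P. \<forall>t\<in>{0..T}. \<tau> j w <= ereal t & ereal t < \<tau> (Suc j) w --> X t w \<in> V"
   using cad by (intro adapted_transfer[OF j T V ad]) (auto simp: cadlag_on_def)
 qed simp
 then show ?thesis using AE_space
 proof eventually_elim
  case (elim w)
  show ?case
  proof
   fix t assume t: "t \<in> {0..T}"
   obtain j where "j <= J" "\<tau> j w <= ereal t" "ereal t < \<tau> (Suc j) w"
    using index_exists[OF elim(2), of t] t by auto
   then show "X t w \<in> V" using elim(1) t by auto
  qed
 qed
qed

end

section \<open>Solutions of the Riccati equation\<close>

lemma set_integral_Ioc_diff:
 fixes f :: "real => 'v::euclidean_space"
 assumes f: "set_integrable lborel {0<..T} f" and st: "0 <= s" "s <= t" "t <= T"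
 shows "(LINT r:{s<..T}|lborel. f r) - (LINT r:{t<..T}|lborel. f r) = (LINT r:{s<..t}|lborel. f r)"
proof -
 have "{s<..T} = {s<..t} \<union> {t<..T}" using st by auto
 then have "(LINT r:{s<..T}|lborel. f r) = (LINT r:{s<..t}|lborel. f r) + (LINT r:{t<..T}|lborel. f r)"
  using st by (simp only:) (intro set_integral_Un set_integrable_subset[OF f], auto)
 then show ?thesis by simp
qed

lemma path_increment:
 fixes m :: "'v::ab_group_add"
 assumes "m - S1 = j1 - I1" "m - S2 = j2 - I2" "j1 = h + j2"
 shows "S1 - (S2 - h) = I1 - I2"
proof -
 have "S1 - (S2 - h) = (m - S2) - (m - S1) + h" by simp
 then show ?thesis unfolding assms by simp
qed

lemma loewner_le_mat_mono:
 fixes X :: "real^'n^'n"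
 assumes "X \<preceq> mat a" "a <= b" shows "X \<preceq> mat b"
 unfolding loewner_le_def possemidef_def
proof (intro conjI allI)
 have "mat a - X \<in> sym_mats" using assms(1) by (simp add: loewner_le_def possemidef_def)
 from sym_mats_diff[OF sym_mats_mat this, of a] have "X \<in> sym_mats" by simp
 then show "mat b - X \<in> sym_mats" by (intro sym_mats_diff sym_mats_mat)
 fix v :: "real^'n"
 have "v \<bullet> (X *v v) <= a * (v \<bullet> v)"
  using assms(1) by (simp add: loewner_le_def possemidef_def matrix_vector_mult_diff_rdistrib mat_vec inner_diff_right)
 also have "\<dots> <= b * (v \<bullet> v)" using assms(2) by (rule mult_right_mono) simp
 finally show "0 <= v \<bullet> ((mat b - X) *v v)"
  by (simp add: matrix_vector_mult_diff_rdistrib mat_vec inner_diff_right)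
qed

lemma loewner_le_matD: "X \<preceq> mat a ==> v \<bullet> (X *v v) <= a * (v \<bullet> v)"
 by (simp add: loewner_le_def possemidef_def matrix_vector_mult_diff_rdistrib mat_vec inner_diff_right)

lemma mat_loewner_leD: "mat a \<preceq> X ==> a * (v \<bullet> v) <= v \<bullet> (X *v v)"
 by (simp add: loewner_le_def possemidef_def matrix_vector_mult_diff_rdistrib mat_vec inner_diff_right)

lemma loewner_interval_norm:
 assumes "possemidef X" "X \<preceq> mat a" shows "norm (X *v w) <= a * norm w"
proof (rule sym_mats_norm_le[OF possemidefD(1)[OF assms(1)]])
 show "\<bar>v \<bullet> (X *v v)\<bar> <= a * (v \<bullet> v)" for v
  using possemidefD(2)[OF assms(1), of v] loewner_le_matD[OF assms(2), of v] by simp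
qed

lemma mat_loewner_le_posdef:
 fixes X :: "real^'n^'n"
 assumes "mat c \<preceq> X" "0 < c" "X \<in> sym_mats" shows "posdef X"
 unfolding posdef_def
proof (intro conjI allI impI)
 fix v :: "real^'n" assume "v \<noteq> 0"
 then have "0 < c * (v \<bullet> v)" using assms(2) by simp
 then show "0 < v \<bullet> (X *v v)" using mat_loewner_leD[OF assms(1), of v] by linarith
qed (fact assms(3))

lemma closed_loewner: "closed {X :: real^'n^'n. X \<preceq> Y}" "closed {X :: real^'n^'n. Y \<preceq> X}"
proof -
 have "closed ((%X. Y - X) -` {X :: real^'n^'n. possemidef X})" "closed ((%X. X - Y) -` {X :: real^'n^'n. possemidef X})"
  by (intro closed_vimage closed_possemidef continuous_intros)+
 then show "closed {X :: real^'n^'n. X \<preceq> Y}" "closed {X :: real^'n^'n. Y \<preceq> X}" by (simp_all add: loewner_le_def vimage_def)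
qed

lemma mat_zero_loewner [simp]: "mat 0 \<preceq> X \<longleftrightarrow> possemidef X" for X :: "real^'n^'n"
 by (simp add: loewner_le_def mat_eq_scaleR[of 0])

lemma posdef_possemidef: "posdef X ==> possemidef X"
 unfolding posdef_def possemidef_def by (metis inner_zero_left less_eq_real_def)

lemma pos_type_possemidef: "pos_type M X ==> possemidef X"
 by (cases "M < \<infinity>") (simp_all add: pos_type_def posdef_possemidef)

lemma backward_ode_diff:
 assumes "backward_ode a T S1 \<Psi>1" "backward_ode a T S2 \<Psi>2"
 shows "backward_ode a T (%t. S1 t - S2 t) (%r. \<Psi>1 r - \<Psi>2 r)"
proof -
 obtain c1 c2 where c: "0 <= c1" "0 <= c2" "AE r in lborel. r \<in> {a<..T} --> norm (\<Psi>1 r) <= c1" "AE r in lborel. r \<in> {a<..T} --> norm (\<Psi>2 r) <= c2"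
  using assms by (auto simp: backward_ode_def)
 show ?thesis unfolding backward_ode_def
 proof (intro conjI exI ballI allI impI)
  show "set_integrable lborel {a<..T} (%r. \<Psi>1 r - \<Psi>2 r)" using assms by (auto simp: backward_ode_def intro: set_integral_diff)
  show "AE r in lborel. r \<in> {a<..T} --> norm (\<Psi>1 r - \<Psi>2 r) <= c1 + c2"
   using c(3,4) by eventually_elim (auto intro: order.trans[OF norm_triangle_ineq4])
  show "0 <= c1 + c2" using c by simp
  show "S1 t - S2 t \<in> sym_mats" if "t \<in> {a..T}" for t using assms that by (auto simp: backward_ode_def intro: sym_mats_diff)
  fix s t assume st: "a <= s" "s <= t" "t <= T"
  have i: "set_integrable lborel {s<..t} \<Psi>1" "set_integrable lborel {s<..t} \<Psi>2"
   using assms st by (auto simp: backward_ode_def intro: set_integrable_subset)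
  have "S1 s - S1 t = (LINT r:{s<..t}|lborel. \<Psi>1 r)" "S2 s - S2 t = (LINT r:{s<..t}|lborel. \<Psi>2 r)"
   using assms st by (auto simp: backward_ode_def)
  then show "S1 s - S2 s - (S1 t - S2 t) = (LINT r:{s<..t}|lborel. \<Psi>1 r - \<Psi>2 r)"
   using set_integral_diff(2)[OF i] by (simp add: algebra_simps)
 qed
qed

context mode_process
begin

lemma path_to_pred: "0 <= T ==> w \<in> space P ==> (%r. (w, clp T r)) \<in> borel \<rightarrow>\<^sub>M pred T"
 by (rule measurable_compose[OF _ id_pred])
   (auto intro!: measurable_Pair measurable_restrict_space2 clp_measurable simp: clp_in[unfolded atLeastAtMost_iff])

lemma predictable_section:
 assumes "0 <= T" "w \<in> space P" "(%(w, t). X t w) \<in> borel_measurable (pred T)"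
 shows "(%r. X (clp T r) w) \<in> borel_measurable borel"
 using measurable_compose[OF path_to_pred[OF assms(1,2)] assms(3)] by simp

lemma predictable_field_section:
 assumes T: "0 <= T" and w: "w \<in> space P" and Y: "predictable_field P FF T Y"
 shows "(%x. Y (clp T (fst x)) (snd x) w) \<in> borel_measurable (borel \<Otimes>\<^sub>M borel)"
proof -
 have "(%x. ((w, clp T (fst x)), snd x)) \<in> borel \<Otimes>\<^sub>M borel \<rightarrow>\<^sub>M pred T \<Otimes>\<^sub>M borel"
  by (intro measurable_Pair measurable_compose[OF measurable_fst path_to_pred[OF T w]] measurable_snd)
 from measurable_compose[OF this Y[unfolded predictable_field_def]] show ?thesis by simp
qed

lemma progressive_section:
 assumes T: "0 <= T" and w: "w \<in> space P" and X: "progressive FF T X"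
 shows "(%r. X (clp T r) w) \<in> borel_measurable borel"
proof -
 have "(%r. (w, clp T r)) \<in> borel \<rightarrow>\<^sub>M FF T \<Otimes>\<^sub>M restrict_space borel {0..T}"
  using w clp_in[OF T] by (intro measurable_Pair measurable_const measurable_restrict_space2 clp_measurable) auto
 moreover have "(%(w, s). X s w) \<in> borel_measurable (FF T \<Otimes>\<^sub>M restrict_space borel {0..T})"
  using X T by (auto simp: progressive_def)
 ultimately show ?thesis using measurable_compose by fastforce
qed

lemma progressive_adapted:
 assumes X: "progressive FF T X" and t: "t \<in> {0..T}"
 shows "X t \<in> borel_measurable (FF t)"
proof -
 have "(%w. (w, t)) \<in> FF t \<rightarrow>\<^sub>M FF t \<Otimes>\<^sub>M restrict_space borel {0..t}"
  using t by (intro measurable_Pair measurable_const measurable_ident) (auto simp: space_restrict_space)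
 moreover have "(%(w, s). X s w) \<in> borel_measurable (FF t \<Otimes>\<^sub>M restrict_space borel {0..t})"
  using X t by (auto simp: progressive_def)
 ultimately have "(%w. (%(w, s). X s w) (w, t)) \<in> borel_measurable (FF t)" by (rule measurable_compose)
 then show ?thesis by simp
qed

lemma predictable_ck_transfer_all:
 assumes T: "0 <= T" and psi: "Measurable.pred (pred T \<Otimes>\<^sub>M borel) \<psi>"
  and ae: "AE w in P. \<forall>j\<in>jumps w. \<tau> j w <= ereal T --> \<psi> ((w, real_of_ereal (\<tau> j w)), \<gamma> j w)"
 shows "AE w in P. AE r in lborel. r \<in> {0<..T} --> crate w r \<noteq> 0 --> (AE th in ck w r. \<psi> ((w, r), th))"
proof -
 have "AE w in P. \<forall>j\<in>{..<J}. AE r in lborel. r \<in> {0<..T} --> idx w r = j --> crate w r \<noteq> 0 -->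
   (AE th in ck w r. \<psi> ((w, r), th))"
 proof (intro AE_finite_allI)
  fix j assume "j \<in> {..<J}"
  then have j: "j < J" by simp
  show "AE w in P. AE r in lborel. r \<in> {0<..T} --> idx w r = j --> crate w r \<noteq> 0 --> (AE th in ck w r. \<psi> ((w, r), th))"
  proof (rule predictable_ck_transfer[OF j T psi])
   show "AE w in P. \<tau> (Suc j) w <= ereal T --> \<psi> ((w, real_of_ereal (\<tau> (Suc j) w)), \<gamma> (Suc j) w)"
    using ae
   proof eventually_elim
    case (elim w)
    have "Suc j \<in> jumps w" if "\<tau> (Suc j) w <= ereal T" using j that by (auto simp: jumps_def)
    then show ?case using elim by blast
   qed
  qed
 qed simp
 then show ?thesis
 proof eventually_elim
  case (elim w)
  have "AE r in lborel. \<forall>j\<in>{..<J}. r \<in> {0<..T} --> idx w r = j --> crate w r \<noteq> 0 --> (AE th in ck w r. \<psi> ((w, r), th))"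
   using elim by (intro AE_finite_allI) auto
  then show ?case
  proof eventually_elim
   case (elim r)
   show ?case
   proof (intro impI)
    assume r: "r \<in> {0<..T}" "crate w r \<noteq> 0"
    then have "idx w r \<in> {..<J}" by (auto simp: crate_def split: if_splits)
    then show "AE th in ck w r. \<psi> ((w, r), th)" using elim r by blast
   qed
  qed
 qed
qed

\<comment> \<open>Solutions along almost every path\<close>
end

text \<open>A single constant \<open>K0\<close> bounds the coefficients and the jump rate. The
  constants \<open>Kup\<close>, \<open>kd1\<close>, \<open>kd2\<close> and \<open>Kcmp\<close>
  derived from it involve otherwise only \<open>N\<close>, \<open>T\<close> and \<open>J\<close>,
  and so they are the same for all \<open>M\<close>.\<close>

locale riccati_setting = mode_process P J lam Q \<gamma>\<^sub>0 \<tau> \<gamma>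
 for P :: "'w measure" and J and lam :: "'e::metric_space => real => real" and Q and \<gamma>\<^sub>0 and \<tau> and \<gamma> +
 fixes T K0 :: real and A :: "real => 'w => real^'n^'n" and B :: "real => 'w => real^'d^'n"
  and C :: "real => 'e => 'w => real^'n^'n" and N :: nat
 assumes T_pos: "0 < T" and K0_nonneg: "0 <= K0"
  and A_pred: "(%(w, t). A t w) \<in> borel_measurable (predictable (space P) (mode_filtration (space P) \<tau> \<gamma>) T)"
  and B_pred: "(%(w, t). B t w) \<in> borel_measurable (predictable (space P) (mode_filtration (space P) \<tau> \<gamma>) T)"
  and C_pred: "predictable_field P (mode_filtration (space P) \<tau> \<gamma>) T C"
  and coeff_bound: "AE w in P. (AE r in lborel. r \<in> {0..T} --> norm (A r w) <= K0 & norm (B r w) <= K0) &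
    (\<forall>r\<in>{0..T}. \<forall>th. norm (C r th w) <= K0)"
  and lam_le: "\<And>x t. 0 <= t ==> lam x t <= K0"
  and coeff_zero: "\<And>w t. w \<in> space P ==> t \<in> {0..T} ==> \<tau> J w < ereal t ==> A t w = 0 & B t w = 0"
begin

lemma T0: "0 <= T" using T_pos by simp

abbreviation "sol \<equiv> riccati_solution P T J lam Q \<tau> \<gamma> A B C N"

abbreviation "drv \<Sigma> \<Theta> w \<equiv> path_driver w N (%t. \<Sigma> t w) (%t th. \<Theta> t th w) (%t. A t w) (%t. B t w) (%t th. C t th w)"

lemma crate_le: "crate w r <= K0"
 using K0_nonneg by (cases "0 < r") (auto simp: crate_def idx_def intro!: lam_le)

lemma good_pathI:
 assumes S: "progressive FF T \<Sigma>" "\<And>w t. w \<in> space P ==> t \<in> {0..T} ==> \<Sigma> t w \<in> sym_mats"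
  and Th: "predictable_field P FF T \<Theta>" "\<And>w t th. w \<in> space P ==> t \<in> {0..T} ==> \<Theta> t th w \<in> sym_mats"
  and ae: "AE w in P. AE r in lborel. r \<in> {0<..T} --> norm (\<Sigma> r w) <= L &
    (crate w r \<noteq> 0 --> (AE th in ck w r. norm (\<Theta> r th w) <= L & possemidef (\<Sigma> r w + \<Theta> r th w)))"
 shows "AE w in P. good_path T K0 L w (%t. \<Sigma> t w) (%t th. \<Theta> t th w) (%t. A t w) (%t. B t w) (%t th. C t th w)"
 using ae coeff_bound AE_space
proof eventually_elim
 case (elim w)
 note w = elim(3)
 show ?case unfolding good_path_def
 proof (intro conjI w progressive_section[OF T0 w S(1)] predictable_section[OF T0 w A_pred]
   predictable_section[OF T0 w B_pred] predictable_field_section[OF T0 w Th(1)] predictable_field_section[OF T0 w C_pred])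
  show "\<forall>t\<in>{0..T}. \<Sigma> t w \<in> sym_mats & (\<forall>th. \<Theta> t th w \<in> sym_mats)" using S(2) Th(2) w by blast
  have c1: "AE r in lborel. r \<in> {0..T} --> norm (A r w) <= K0 & norm (B r w) <= K0" and c2: "\<forall>r\<in>{0..T}. \<forall>th. norm (C r th w) <= K0"
   using elim(2) by auto
  show "AE r in lborel. r \<in> {0<..T} --> norm (A r w) <= K0 & norm (B r w) <= K0 & norm (\<Sigma> r w) <= L & crate w r <= K0 &
    (crate w r \<noteq> 0 --> (AE th in ck w r. norm (C r th w) <= K0 & norm (\<Theta> r th w) <= L & possemidef (\<Sigma> r w + \<Theta> r th w)))"
   using elim(1) c1
  proof eventually_elim
   case (elim r)
   show ?case
   proof (intro impI conjI crate_le)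
    assume r: "r \<in> {0<..T}"
    then show "norm (A r w) <= K0" "norm (B r w) <= K0" "norm (\<Sigma> r w) <= L" using elim by auto
    assume "crate w r \<noteq> 0"
    then have "AE th in ck w r. norm (\<Theta> r th w) <= L & possemidef (\<Sigma> r w + \<Theta> r th w)" using elim r by blast
    then show "AE th in ck w r. norm (C r th w) <= K0 & norm (\<Theta> r th w) <= L & possemidef (\<Sigma> r w + \<Theta> r th w)"
     by eventually_elim (use c2 r in auto)
   qed
  qed
 qed
qed

lemma compensator_closed_iff:
 assumes w: "w \<in> space P" and S: "progressive FF T \<Sigma>" and Th: "predictable_field P FF T \<Theta>" and V: "V \<in> sets borel"
 shows "(AE x in compensator J lam Q \<tau> \<gamma> w. fst x \<in> {0..T} --> \<Sigma> (fst x) w + \<Theta> (fst x) (snd x) w \<in> V) \<longleftrightarrow>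
  (AE r in lborel. r \<in> {0<..T} --> crate w r \<noteq> 0 --> (AE th in ck w r. \<Sigma> r w + \<Theta> r th w \<in> V))"
proof -
 let ?R = "%x. fst x \<in> {0..T} --> \<Sigma> (clp T (fst x)) w + \<Theta> (clp T (fst x)) (snd x) w \<in> V"
 have m: "(%x. \<Sigma> (clp T (fst x)) w + \<Theta> (clp T (fst x)) (snd x) w) \<in> borel_measurable (borel \<Otimes>\<^sub>M borel)"
  by (intro borel_measurable_add measurable_compose[OF measurable_fst progressive_section[OF T0 w S]] predictable_field_section[OF T0 w Th])
 have "Measurable.pred (borel \<Otimes>\<^sub>M borel) (%x. fst x \<in> {0..T})" by measurable
 moreover have "Measurable.pred (borel \<Otimes>\<^sub>M borel) (%x. \<Sigma> (clp T (fst x)) w + \<Theta> (clp T (fst x)) (snd x) w \<in> V)"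
  by (rule pred_sets2[OF V m])
 ultimately have R: "Measurable.pred (borel \<Otimes>\<^sub>M borel) ?R" by (rule pred_intros_logic)
 have "(AE x in compensator J lam Q \<tau> \<gamma> w. fst x \<in> {0..T} --> \<Sigma> (fst x) w + \<Theta> (fst x) (snd x) w \<in> V) \<longleftrightarrow> (AE x in compensator J lam Q \<tau> \<gamma> w. ?R x)"
  by (intro arg_cong2[where f = almost_everywhere] refl ext) (auto simp: clp_eq[unfolded atLeastAtMost_iff])
 also have "\<dots> \<longleftrightarrow> (AE r in lborel. crate w r \<noteq> 0 --> (AE th in ck w r. ?R (r, th)))"
  by (rule compensator_AE_iff[OF w R])
 also have "\<dots> \<longleftrightarrow> (AE r in lborel. r \<in> {0<..T} --> crate w r \<noteq> 0 --> (AE th in ck w r. \<Sigma> r w + \<Theta> r th w \<in> V))"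
 proof -
  have "(crate w r \<noteq> 0 --> (AE th in ck w r. ?R (r, th))) \<longleftrightarrow> (r \<in> {0<..T} --> crate w r \<noteq> 0 --> (AE th in ck w r. \<Sigma> r w + \<Theta> r th w \<in> V))" for r
  proof (cases "r \<in> {0<..T}")
   case True
   then show ?thesis by (simp add: clp_eq)
  next
   case False
   then have "r \<notin> {0..T} \<or> crate w r = 0" by (auto simp: crate_def idx_def)
   then show ?thesis using False by auto
  qed
  then show ?thesis by (simp only:)
 qed
 finally show ?thesis .
qed

lemma sol_regular:
 assumes "sol M \<Sigma> \<Theta>"
 shows "progressive FF T \<Sigma>" "\<And>w t. w \<in> space P ==> t \<in> {0..T} ==> \<Sigma> t w \<in> sym_mats"
  "\<And>w. w \<in> space P ==> cadlag_on T (%t. \<Sigma> t w)"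
  "predictable_field P FF T \<Theta>" "\<And>w t th. w \<in> space P ==> t \<in> {0..T} ==> \<Theta> t th w \<in> sym_mats"
 using assms by (auto simp: riccati_solution_def Linf_D_def Linf_q_def)

text \<open>The essential bound of \<open>\<Theta>\<close> is known at the jumps only; being a
  predictable property, it passes to the compensator. Positivity of
  \<open>\<Sigma> + \<Theta>\<close> is given for the compensator directly.\<close>

lemma sol_good:
 assumes s: "sol M \<Sigma> \<Theta>"
 obtains L where "0 <= L" "AE w in P. good_path T K0 L w (%t. \<Sigma> t w) (%t th. \<Theta> t th w) (%t. A t w) (%t. B t w) (%t th. C t th w)"
  "AE w in P. \<forall>t\<in>{0..T}. norm (\<Sigma> t w) <= L"
proof -
 note reg = sol_regular[OF s]
 obtain L1 where L1: "AE w in P. \<forall>t\<in>{0..T}. norm (\<Sigma> t w) <= L1"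
  using s by (auto simp: riccati_solution_def Linf_D_def)
 obtain L2 where L2: "AE w in P. AE (t, th) in jump_measure J \<tau> \<gamma> w. t \<in> {0..T} --> norm (\<Theta> t th w) <= L2"
  using s by (auto simp: riccati_solution_def Linf_q_def)
 define L where "L = max 0 (max L1 L2)"
 have L1L: "L1 <= L" by (simp add: L_def)
 let ?psi = "%z. norm (\<Theta> (snd (fst z)) (snd z) (fst (fst z))) <= L"
 have "(%z. \<Theta> (snd (fst z)) (snd z) (fst (fst z))) \<in> borel_measurable (pred T \<Otimes>\<^sub>M borel)"
  using reg(4) by (simp add: predictable_field_def case_prod_beta')
 then have psi: "Measurable.pred (pred T \<Otimes>\<^sub>M borel) ?psi" by measurable
 have "AE w in P. \<forall>j\<in>jumps w. \<tau> j w <= ereal T --> ?psi ((w, real_of_ereal (\<tau> j w)), \<gamma> j w)"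
  using L2 AE_space
 proof eventually_elim
  case (elim w)
  have e: "\<forall>j\<in>jumps w. real_of_ereal (\<tau> j w) \<in> {0..T} --> norm (\<Theta> (real_of_ereal (\<tau> j w)) (\<gamma> j w) w) <= L2"
   using elim(1) unfolding jump_measure_AE_iff by simp
  show ?case
  proof (intro ballI impI)
   fix j assume j: "j \<in> jumps w" "\<tau> j w <= ereal T"
   have "real_of_ereal (\<tau> j w) \<in> {0..T}" using jump_time_in(1)[OF elim(2) _ j(2)] j(1) by (auto simp: jumps_def)
   then have "norm (\<Theta> (real_of_ereal (\<tau> j w)) (\<gamma> j w) w) <= L2" using e j(1) by blast
   then show "?psi ((w, real_of_ereal (\<tau> j w)), \<gamma> j w)" by (simp add: L_def)
  qed
 qed
 from predictable_ck_transfer_all[OF T0 psi this]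
 have nT: "AE w in P. AE r in lborel. r \<in> {0<..T} --> crate w r \<noteq> 0 --> (AE th in ck w r. norm (\<Theta> r th w) <= L)" by (simp only: fst_conv snd_conv)
 have "AE w in P. AE (t, th) in compensator J lam Q \<tau> \<gamma> w. t \<in> {0..T} --> pos_type M (\<Sigma> t w + \<Theta> t th w)"
  using s by (simp add: riccati_solution_def)
 then have pT: "AE w in P. AE r in lborel. r \<in> {0<..T} --> crate w r \<noteq> 0 --> (AE th in ck w r. \<Sigma> r w + \<Theta> r th w \<in> {X. possemidef X})"
  using AE_space
 proof eventually_elim
  case (elim w)
  from elim(1) have "AE x in compensator J lam Q \<tau> \<gamma> w. fst x \<in> {0..T} --> \<Sigma> (fst x) w + \<Theta> (fst x) (snd x) w \<in> {X. possemidef X}"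
   by eventually_elim (auto intro: pos_type_possemidef)
  then show ?case
   using compensator_closed_iff[OF elim(2) reg(1,4), of "{X. possemidef X}"] borel_closed[OF closed_possemidef] by blast
 qed
 have "AE w in P. AE r in lborel. r \<in> {0<..T} --> norm (\<Sigma> r w) <= L &
    (crate w r \<noteq> 0 --> (AE th in ck w r. norm (\<Theta> r th w) <= L & possemidef (\<Sigma> r w + \<Theta> r th w)))"
  using nT pT L1
 proof eventually_elim
  case (elim w)
  note L1w = elim(3)
  from elim(1,2) show ?case
  proof eventually_elim
   case (elim r)
   show ?case
   proof (intro impI conjI)
    assume r: "r \<in> {0<..T}"
    then have "norm (\<Sigma> r w) <= L1" using L1w by simp
    then show "norm (\<Sigma> r w) <= L" by (rule order.trans[OF _ L1L])
    assume "crate w r \<noteq> 0"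
    then have "AE th in ck w r. norm (\<Theta> r th w) <= L" "AE th in ck w r. \<Sigma> r w + \<Theta> r th w \<in> {X. possemidef X}" using elim r by auto
    then show "AE th in ck w r. norm (\<Theta> r th w) <= L & possemidef (\<Sigma> r w + \<Theta> r th w)" by eventually_elim auto
   qed
  qed
 qed
 from good_pathI[OF reg(1,2,4,5) this]
 have "AE w in P. good_path T K0 L w (%t. \<Sigma> t w) (%t th. \<Theta> t th w) (%t. A t w) (%t. B t w) (%t th. C t th w)" .
 moreover have "AE w in P. \<forall>t\<in>{0..T}. norm (\<Sigma> t w) <= L"
  using L1 by eventually_elim (blast intro: order.trans[OF _ L1L])
 moreover have "0 <= L" by (simp add: L_def)
 ultimately show ?thesis using that by blast
qed

definition jsum where
 "jsum \<Theta> w t = (\<Sum>j | j \<in> jumps w & ereal t < \<tau> j w & \<tau> j w <= ereal T. \<Theta> (real_of_ereal (\<tau> j w)) (\<gamma> j w) w)"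

lemma sol_path:
 assumes s: "sol M \<Sigma> \<Theta>"
 shows "AE w in P. \<forall>t\<in>{0..T}. terminal_value M - \<Sigma> t w = jsum \<Theta> w t - (LINT r:{t<..T}|lborel. drv \<Sigma> \<Theta> w r)"
  and "AE w in P. set_integrable lborel {0<..T} (drv \<Sigma> \<Theta> w)"
  and "AE w in P. \<exists>c\<ge>0. AE r in lborel. r \<in> {0<..T} --> norm (drv \<Sigma> \<Theta> w r) <= c"
  and "AE w in P. AE r in lborel. r \<in> {0<..T} --> admissible K0 (crate w r) (ck w r) (A r w) (B r w) (%th. C r th w) (\<Sigma> r w) (%th. \<Theta> r th w)"
proof -
 obtain L where L: "0 <= L" "AE w in P. good_path T K0 L w (%t. \<Sigma> t w) (%t th. \<Theta> t th w) (%t. A t w) (%t. B t w) (%t th. C t th w)"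
  and "AE w in P. \<forall>t\<in>{0..T}. norm (\<Sigma> t w) <= L"
  by (rule sol_good[OF s])
 have "AE w in P. \<forall>t\<in>{0..T}.
    terminal_value M - \<Sigma> t w =
     (LINT x:{t<..T} \<times> UNIV|compensator J lam Q \<tau> \<gamma> w.
       jump_generator (C (fst x) (snd x) w) (\<Sigma> (fst x) w) (\<Theta> (fst x) (snd x) w))
     + compensated_integral (jump_measure J \<tau> \<gamma> w) (compensator J lam Q \<tau> \<gamma> w)
       ({t<..T} \<times> UNIV) (%x. \<Theta> (fst x) (snd x) w)
     + (LINT r:{t<..T}|lborel. A r w ** \<Sigma> r w + \<Sigma> r w ** transpose (A r w)
        - real N *\<^sub>R (B r w ** transpose (B r w)))"
  using s by (simp add: riccati_solution_def)
 with L(2) show "AE w in P. \<forall>t\<in>{0..T}. terminal_value M - \<Sigma> t w = jsum \<Theta> w t - (LINT r:{t<..T}|lborel. drv \<Sigma> \<Theta> w r)"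
 proof eventually_elim
  case (elim w)
  show ?case
  proof
   fix t assume t: "t \<in> {0..T}"
   show "terminal_value M - \<Sigma> t w = jsum \<Theta> w t - (LINT r:{t<..T}|lborel. drv \<Sigma> \<Theta> w r)"
    unfolding jsum_def by (rule trans[OF bspec[OF elim(2) t] path_rhs(4)[OF elim(1) K0_nonneg L(1) T0 t]])
  qed
 qed
 show "AE w in P. set_integrable lborel {0<..T} (drv \<Sigma> \<Theta> w)"
  using L(2)
 proof eventually_elim
  case (elim w)
  from path_rhs(1)[OF elim K0_nonneg L(1) T0] show ?case .
 qed
 show "AE w in P. \<exists>c\<ge>0. AE r in lborel. r \<in> {0<..T} --> norm (drv \<Sigma> \<Theta> w r) <= c"
  using L(2)
 proof eventually_elim
  case (elim w)
  from path_rhs(2)[OF elim K0_nonneg L(1) T0] show ?case .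
 qed
 show "AE w in P. AE r in lborel. r \<in> {0<..T} --> admissible K0 (crate w r) (ck w r) (A r w) (B r w) (%th. C r th w) (\<Sigma> r w) (%th. \<Theta> r th w)"
  using L(2)
 proof eventually_elim
  case (elim w)
  from path_rhs(3)[OF elim K0_nonneg L(1) T0] show ?case .
 qed
qed

lemma sol_terminal:
 assumes s: "sol M \<Sigma> \<Theta>" shows "AE w in P. \<Sigma> T w = terminal_value M"
 using sol_path(1)[OF s]
proof eventually_elim
 case (elim w)
 have "jsum \<Theta> w T = 0" unfolding jsum_def by (rule sum.neutral) auto
 moreover have "terminal_value M - \<Sigma> T w = jsum \<Theta> w T - (LINT r:{T<..T}|lborel. drv \<Sigma> \<Theta> w r)" using elim T0 by simp
 ultimately show ?case by (simp add: set_lebesgue_integral_def)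
qed

text \<open>The equation holds for all times simultaneously outside one null set. From
  \<open>t\<close> up to the jump time \<open>u\<close> it changes by \<open>\<Theta>\<close> at the
  jump and by an integral of size at most \<open>c * (u - t)\<close>; letting \<open>t\<close>
  increase to \<open>u\<close> identifies the left limit.\<close>

lemma sol_jump_pair:
 assumes s: "sol M \<Sigma> \<Theta>"
 shows "jump_pair T \<Sigma> \<Theta>"
 unfolding jump_pair_def
proof (intro conjI)
 note reg = sol_regular[OF s]
 show "\<forall>t\<in>{0..T}. \<Sigma> t \<in> borel_measurable (FF t)" by (intro ballI progressive_adapted[OF reg(1)])
 show "\<forall>w\<in>space P. cadlag_on T (%t. \<Sigma> t w)" by (intro ballI reg(3))
 show "\<forall>w\<in>space P. \<forall>t\<in>{0..T}. (\<forall>j\<in>{1..J}. \<tau> j w \<noteq> ereal t) --> continuous (at t within {0..T}) (%s. \<Sigma> s w)"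
  using s by (simp add: riccati_solution_def)
 show "predictable_field P FF T \<Theta>" by (rule reg(4))
 show "AE w in P. \<forall>j\<in>jumps w. \<tau> j w <= ereal T -->
    lm \<Sigma> (real_of_ereal (\<tau> j w)) w + \<Theta> (real_of_ereal (\<tau> j w)) (\<gamma> j w) w = \<Sigma> (real_of_ereal (\<tau> j w)) w"
  using sol_path(1)[OF s] sol_path(2)[OF s] sol_path(3)[OF s] AE_space
 proof eventually_elim
  case (elim w)
  note w = elim(4) and elim0 = elim(1)
  obtain c where c: "0 <= c" "AE r in lborel. r \<in> {0<..T} --> norm (drv \<Sigma> \<Theta> w r) <= c" using elim(3) by auto
  show ?case
  proof (intro ballI impI)
   fix j assume j: "j \<in> jumps w" "\<tau> j w <= ereal T"
   define u where "u = real_of_ereal (\<tau> j w)"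
   have j1: "1 <= j" "\<tau> j w < \<infinity>" using j(1) by (auto simp: jumps_def)
   have u: "u \<in> {0<..T}" "\<tau> j w = ereal u" using jump_time_in[OF w j1(1) j(2)] by (auto simp: u_def)
   obtain i where i: "j = Suc i" using j1(1) by (cases j) auto
   have ti: "\<tau> i w < ereal u"
    using time_less[OF w, of i] time_infinite[OF w, of i] u(2) by (cases "\<tau> i w = \<infinity>") (auto simp: i)
   let ?th = "\<Theta> u (\<gamma> j w) w"
   have ev: "\<forall>\<^sub>F t in at_left u. norm (\<Sigma> t w - (\<Sigma> u w - ?th)) <= c * (u - t)"
   proof -
    \<comment> \<open>The number \<open>b\<close> is not before the preceding jump, so that for
      \<open>t\<close> between \<open>b\<close> and \<open>u\<close> the only jump lost in passing
      from \<open>t\<close> to \<open>u\<close> is the one at \<open>u\<close>.\<close>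
    obtain b where b: "\<tau> i w <= ereal b" "b < u" "0 <= b"
     using ti time_nonneg[OF w, of i] by (cases "\<tau> i w") auto
    have "\<forall>\<^sub>F t in at_left u. t \<in> {b<..<u}" using b(2) by (rule eventually_at_leftI[rotated]) auto
    then show ?thesis
    proof eventually_elim
     case (elim t)
     have tT: "t \<in> {0..T}" "u \<in> {0..T}" "0 <= t" "t <= u" "u <= T" using elim b u by auto
     have sets: "{k. k \<in> jumps w & ereal t < \<tau> k w & \<tau> k w <= ereal T} = insert j {k. k \<in> jumps w & ereal u < \<tau> k w & \<tau> k w <= ereal T}"
     proof (intro equalityI subsetI)
      fix k assume k: "k \<in> {k. k \<in> jumps w & ereal t < \<tau> k w & \<tau> k w <= ereal T}"
      have "\<not> k <= i"
      proof
       assume "k <= i"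
       then have "\<tau> k w <= \<tau> i w" by (rule time_mono[OF w])
       also have "\<dots> <= ereal b" by (rule b)
       also have "\<dots> < ereal t" using elim by simp
       finally show False using k by auto
      qed
      then have "k = j \<or> j < k" using i by linarith
      moreover have "ereal u < \<tau> k w" if "j < k" using time_strict_mono[OF w that j1(2)] u(2) by simp
      ultimately show "k \<in> insert j {k. k \<in> jumps w & ereal u < \<tau> k w & \<tau> k w <= ereal T}"
       using k by blast
     next
      fix k assume k: "k \<in> insert j {k. k \<in> jumps w & ereal u < \<tau> k w & \<tau> k w <= ereal T}"
      have tu: "ereal t < ereal u" using elim by simp
      show "k \<in> {k. k \<in> jumps w & ereal t < \<tau> k w & \<tau> k w <= ereal T}"
      proof (cases "k = j")
       case True
       then show ?thesis using j u(2) tu by simp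
      next
       case False
       with k have ku: "ereal u < \<tau> k w" by simp
       show ?thesis using k False less_trans[OF tu ku] by simp
      qed
     qed
     have "jsum \<Theta> w t = ?th + jsum \<Theta> w u"
      unfolding jsum_def sets using finite_jumps[of w] u(2) by (subst sum.insert) auto
     then have "\<Sigma> t w - (\<Sigma> u w - ?th) = (LINT r:{t<..T}|lborel. drv \<Sigma> \<Theta> w r) - (LINT r:{u<..T}|lborel. drv \<Sigma> \<Theta> w r)"
      using path_increment[OF bspec[OF elim0 tT(1)] bspec[OF elim0 tT(2)]] by blast
     also have "\<dots> = (LINT r:{t<..u}|lborel. drv \<Sigma> \<Theta> w r)"
      by (rule set_integral_Ioc_diff[OF \<open>set_integrable lborel {0<..T} (drv \<Sigma> \<Theta> w)\<close> tT(3-5)])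
     also have "norm \<dots> <= c * (u - t)"
     proof (rule set_lebesgue_integral_Ioc_norm_le)
      show "set_integrable lborel {t<..u} (drv \<Sigma> \<Theta> w)"
       by (rule set_integrable_subset[OF \<open>set_integrable lborel {0<..T} (drv \<Sigma> \<Theta> w)\<close>]) (use tT in auto)
      show "AE r in lborel. r \<in> {t<..u} --> norm (drv \<Sigma> \<Theta> w r) <= c"
       using c(2) by eventually_elim (use tT in auto)
     qed (use tT in simp)
     finally show ?case .
    qed
   qed
   have "((%t. c * (u - t)) \<longlongrightarrow> c * (u - u)) (at_left u)" by (intro tendsto_intros)
   then have z: "((%t. c * (u - t)) \<longlongrightarrow> 0) (at_left u)" by simp
   have "((%t. \<Sigma> t w - (\<Sigma> u w - ?th)) \<longlongrightarrow> 0) (at_left u)"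
    by (rule Lim_null_comparison[OF ev z])
   then have "((%t. \<Sigma> t w) \<longlongrightarrow> \<Sigma> u w - ?th) (at_left u)" by (rule LIM_zero_cancel)
   then have "lm \<Sigma> u w = \<Sigma> u w - ?th" using u by (intro lm_eqI) auto
   then show "lm \<Sigma> (real_of_ereal (\<tau> j w)) w + \<Theta> (real_of_ereal (\<tau> j w)) (\<gamma> j w) w = \<Sigma> (real_of_ereal (\<tau> j w)) w"
    by (simp add: u_def)
  qed
 qed
qed

text \<open>If no jump follows up to \<open>T\<close>, the jump sum is empty from
  \<open>\<tau> j\<close> on and the equation reduces to its driver with a deterministic terminal
  value.\<close>

lemma sol_ode:
 assumes s: "sol M \<Sigma> \<Theta>" and j: "j <= J"
 shows "AE w in P. ereal T < \<tau> (Suc j) w --> \<tau> j w <= ereal T -->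
   backward_ode (real_of_ereal (\<tau> j w)) T (%t. \<Sigma> t w) (drv \<Sigma> \<Theta> w) & \<Sigma> T w = terminal_value M"
 using sol_path(1)[OF s] sol_path(2)[OF s] sol_path(3)[OF s] sol_terminal[OF s] AE_space
proof eventually_elim
 case (elim w)
 note w = elim(5)
 show ?case
 proof (intro impI conjI)
  assume T: "ereal T < \<tau> (Suc j) w" "\<tau> j w <= ereal T"
  define a where "a = real_of_ereal (\<tau> j w)"
  have a: "0 <= a" "a <= T" "\<tau> j w = ereal a"
   using T(2) time_nonneg[OF w, of j] by (cases "\<tau> j w"; simp add: a_def)+
  have z: "jsum \<Theta> w t = 0" if "a <= t" for t
   unfolding jsum_def
  proof (rule sum.neutral, rule ballI)
   fix k assume k: "k \<in> {k. k \<in> jumps w & ereal t < \<tau> k w & \<tau> k w <= ereal T}"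
   have "j < k"
   proof (rule ccontr)
    assume "\<not> j < k"
    then have "\<tau> k w <= \<tau> j w" by (intro time_mono[OF w]) simp
    also have "\<dots> <= ereal t" using a(3) that by simp
    finally have "\<not> ereal t < \<tau> k w" by (rule leD)
    then show False using k by blast
   qed
   then have "\<tau> (Suc j) w <= \<tau> k w" by (intro time_mono[OF w]) simp
   with T(1) have "ereal T < \<tau> k w" by (rule less_le_trans)
   then have "\<not> \<tau> k w <= ereal T" by (simp add: not_le)
   then show "\<Theta> (real_of_ereal (\<tau> k w)) (\<gamma> k w) w = 0" using k by blast
  qed
  show "backward_ode (real_of_ereal (\<tau> j w)) T (%t. \<Sigma> t w) (drv \<Sigma> \<Theta> w)"
   unfolding backward_ode_def a_def[symmetric]
  proof (intro conjI ballI allI impI)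
   show "set_integrable lborel {a<..T} (drv \<Sigma> \<Theta> w)"
    by (rule set_integrable_subset[OF elim(2)]) (use a in auto)
   obtain c where c: "0 <= c" "AE r in lborel. r \<in> {0<..T} --> norm (drv \<Sigma> \<Theta> w r) <= c" using elim(3) by auto
   have "AE r in lborel. r \<in> {a<..T} --> norm (drv \<Sigma> \<Theta> w r) <= c"
    using c(2) by eventually_elim (use a in auto)
   then show "\<exists>c\<ge>0. AE r in lborel. r \<in> {a<..T} --> norm (drv \<Sigma> \<Theta> w r) <= c" using c(1) by blast
   show "\<Sigma> t w \<in> sym_mats" if "t \<in> {a..T}" for t using sol_regular(2)[OF s w] that a by auto
   fix s t assume st: "a <= s" "s <= t" "t <= T"
   then have sT: "s \<in> {0..T}" "t \<in> {0..T}" "0 <= s" using a by auto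
   have "\<Sigma> s w - \<Sigma> t w = (LINT r:{s<..T}|lborel. drv \<Sigma> \<Theta> w r) - (LINT r:{t<..T}|lborel. drv \<Sigma> \<Theta> w r)"
    using path_increment[OF bspec[OF elim(1) sT(1)] bspec[OF elim(1) sT(2)], of 0] z[of s] z[of t] st by simp
   then show "\<Sigma> s w - \<Sigma> t w = (LINT r:{s<..t}|lborel. drv \<Sigma> \<Theta> w r)"
    using set_integral_Ioc_diff[OF elim(2) sT(3) st(2,3)] by simp
  qed
 qed (use elim in simp)
qed

end

section \<open>Bounds and comparison of solutions\<close>

lemma mat_le_mat: "a <= b ==> (mat a :: real^'n^'n) \<preceq> mat b"
 by (auto simp: loewner_le_def possemidef_def mat_vec matrix_vector_mult_diff_rdistrib inner_diff_right
   sym_mats_diff sym_mats_mat mult_right_mono)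

lemma possemidef_add: "possemidef X ==> possemidef Y ==> possemidef (X + Y)"
 by (auto simp: possemidef_def matrix_vector_mult_add_rdistrib inner_add_right intro!: sym_mats_add)

lemma loewner_le_trans: "X \<preceq> Y ==> Y \<preceq> Z ==> X \<preceq> Z"
 using possemidef_add[of "Y - X" "Z - Y"] by (simp add: loewner_le_def)

lemma loewner_interval_norm_le:
 fixes X :: "real^'n^'n"
 assumes "possemidef X" "X \<preceq> mat a" shows "norm X <= real CARD('n) * a"
 by (rule norm_matrix_le_of_vector) (rule loewner_interval_norm[OF assms])

definition tm :: "enat => real" where "tm M = (case M of enat m => 1 / real m | \<infinity> => 0)"

lemma terminal_value_tm: "terminal_value M = mat (tm M)"
 by (simp add: terminal_value_def tm_def)

text \<open>These hold for every \<open>M\<close>, including \<open>enat 0\<close>, where the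
  convention for division by zero gives \<open>tm M = 0\<close>.\<close>

lemma tm_bounds: "0 <= tm M" "tm M <= 1"
 by (auto simp: tm_def split: enat.split) (metis One_nat_def Suc_leI gr0I inverse_eq_divide inverse_le_1_iff not_le of_nat_0 of_nat_1 of_nat_le_iff)

lemma lm_closed:
 fixes T :: real
 assumes c: "cadlag_on T (%t. X t w)" and V: "closed V" and X: "\<forall>t\<in>{0..T}. X t w \<in> V" and t: "t \<in> {0<..T}"
 shows "lm X t w \<in> V"
proof (rule Lim_in_closed_set[OF V _ _ lm_tendsto[where X=X, OF c t]])
 have "\<forall>\<^sub>F s in at_left t. s \<in> {0<..<t}" using t by (intro eventually_at_leftI[of 0]) auto
 then show "\<forall>\<^sub>F s in at_left t. X s w \<in> V" by eventually_elim (use X t in auto)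
qed simp

context mode_process begin

lemma last_interval:
 assumes w: "w \<in> space P" and t: "\<tau> j w <= ereal t" "t \<in> {0..T}"
 shows "0 <= real_of_ereal (\<tau> j w)" "real_of_ereal (\<tau> j w) <= T" "t \<in> {real_of_ereal (\<tau> j w)..T}"
  "\<tau> j w = ereal (real_of_ereal (\<tau> j w))"
 using t time_nonneg[OF w, of j] by (cases "\<tau> j w"; simp)+

lemma jump_measure_AE_intro:
 assumes w: "w \<in> space P" and "\<And>j. j \<in> jumps w ==> \<tau> j w <= ereal T ==> R (real_of_ereal (\<tau> j w)) (\<gamma> j w)"
 shows "AE (t, th) in jump_measure J \<tau> \<gamma> w. t \<in> {0..T} --> R t th"
 unfolding jump_measure_AE_iff
proof (intro ballI, simp, intro impI)
 fix j assume j: "j \<in> jumps w" "0 <= real_of_ereal (\<tau> j w) & real_of_ereal (\<tau> j w) <= T"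
 have "\<tau> j w < \<infinity>" using j by (auto simp: jumps_def)
 then have "\<tau> j w <= ereal T" using j(2) time_nonneg[OF w, of j] by (cases "\<tau> j w") auto
 then show "R (real_of_ereal (\<tau> j w)) (\<gamma> j w)" using assms(2) j(1) by blast
qed

text \<open>At a jump \<open>Y\<close> is the difference of \<open>X\<close> and its left limit;
  both are bounded by \<open>b\<close>, hence the factor 2.\<close>

lemma jump_pair_norm:
 fixes X :: "real => 'w => 'v::euclidean_space"
 assumes jp: "jump_pair T X Y" and ae: "AE w in P. \<forall>t\<in>{0..T}. norm (X t w) <= b"
 shows "AE w in P. AE (t, th) in jump_measure J \<tau> \<gamma> w. t \<in> {0..T} --> norm (Y t th w) <= 2 * b"
proof -
 have "AE w in P. \<forall>j\<in>jumps w. \<tau> j w <= ereal T -->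
    lm X (real_of_ereal (\<tau> j w)) w + Y (real_of_ereal (\<tau> j w)) (\<gamma> j w) w = X (real_of_ereal (\<tau> j w)) w"
  using jp by (simp add: jump_pair_def)
 then show ?thesis using ae AE_space
 proof eventually_elim
  case (elim w)
  show ?case
  proof (rule jump_measure_AE_intro[OF elim(3)])
   fix j assume j: "j \<in> jumps w" "\<tau> j w <= ereal T"
   let ?u = "real_of_ereal (\<tau> j w)"
   have u: "?u \<in> {0<..T}" using jump_time_in(1)[OF elim(3) _ j(2)] j(1) by (auto simp: jumps_def)
   have "lm X ?u w \<in> cball 0 b"
    by (rule lm_closed[OF _ closed_cball _ u]) (use jp elim in \<open>auto simp: jump_pair_def\<close>)
   moreover have "X ?u w \<in> cball 0 b" using elim(2) u by auto
   moreover have "Y ?u (\<gamma> j w) w = X ?u w - lm X ?u w" using elim(1) j by (metis add_diff_cancel_left')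
   ultimately show "norm (Y ?u (\<gamma> j w) w) <= 2 * b" using norm_triangle_ineq4[of "X ?u w" "lm X ?u w"] by simp
  qed
 qed
qed

end

context riccati_setting begin

text \<open>The constants of \<open>driver_upper\<close>, \<open>driver_lower\<close> and
  \<open>driver_diff\<close> at \<open>K = K0\<close>. \<open>Kup\<close> is the value of the upper
  barrier that starts at 1, which dominates all terminal values, with rate \<open>ku1 + ku2\<close>
  over the whole time \<open>T\<close>; \<open>kd1\<close> and \<open>kd2\<close> are taken at the
  radius \<open>Kup\<close>.\<close>

definition "ku1 = K0 * (2 * (1 + K0) + 1) + 2 * K0"
definition "ku2 = K0 + real N * K0\<^sup>2"
definition "Kup = exp ((ku1 + ku2) * T)"
definition "kl R = K0 * (1 + (1 + K0)\<^sup>2 * R) + 2 * K0"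
definition "kd1 = K0 * (2 * (1 + K0) + 1 + 2 * (1 + K0) * (1 + (1 + K0) * Kup)) + 2 * K0"
definition "kd2 = K0 * (1 + (1 + K0) * Kup)\<^sup>2"

lemma Kup_pos: "0 < Kup" by (simp add: Kup_def)
lemma k_nonneg: "0 <= ku1" "0 <= ku2" "0 <= R ==> 0 <= kl R" "0 <= kd1" "0 <= kd2"
 using K0_nonneg Kup_pos by (auto simp: ku1_def ku2_def kl_def kd1_def kd2_def intro!: add_nonneg_nonneg mult_nonneg_nonneg)

text \<open>The driver is evaluated at some \<open>s\<close> with
  \<open>norm (s v) \<le> norm (S r v)\<close>, not necessarily at \<open>S r\<close>. This slack
  lets the same a priori bounds serve for solutions and for the truncated equation of the existence
  proof.\<close>

definition driven :: "(real => real^'n^'n) => (real => real^'n^'n) => real => bool" where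
 "driven S \<Psi> r \<longleftrightarrow> (\<exists>l (\<mu> :: 'e measure) a (b :: real^'d^'n) c s h. admissible K0 l \<mu> a b c s h & \<Psi> r = driver l \<mu> a b c N s h &
   (\<forall>v. norm (s *v v) <= norm (S r *v v)))"

lemma path_upper:
 assumes ode: "backward_ode a T S \<Psi>" and a: "0 <= a" "a <= T"
  and dr: "AE r in lborel. r \<in> {0<..T} --> driven S \<Psi> r"
  and T: "S T \<preceq> mat 1" and t: "t \<in> {a..T}"
 shows "S t \<preceq> mat Kup"
proof -
 have up: "AE r in lborel. r \<in> {a<..T} --> (\<forall>v. norm v = 1 --> v \<bullet> (\<Psi> r *v v) <= ku1 * norm (S r *v v) + ku2 * 1)"
  using dr
 proof eventually_elim
  case (elim r)
  show ?case
  proof (intro impI allI)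
   fix v :: "real^'n" assume r: "r \<in> {a<..T}" and v: "norm v = 1"
   then have "r \<in> {0<..T}" using a by auto
   with elim have d: "driven S \<Psi> r" by blast
   obtain l and \<mu> :: "'e measure" and a' and b :: "real^'d^'n" and c s h where ad: "admissible K0 l \<mu> a' b c s h" "\<Psi> r = driver l \<mu> a' b c N s h"
    and s: "\<forall>v. norm (s *v v) <= norm (S r *v v)"
    using d unfolding driven_def by blast
   have "v \<bullet> (\<Psi> r *v v) <= ku1 * norm (s *v v) + ku2"
    unfolding ad(2) using driver_upper[OF ad(1) v K0_nonneg, of ku1 N ku2] by (simp add: ku1_def ku2_def)
   also have "\<dots> <= ku1 * norm (S r *v v) + ku2 * 1"
    using mult_left_mono[OF spec[OF s, of v] k_nonneg(1)] by simp
   finally show "v \<bullet> (\<Psi> r *v v) <= ku1 * norm (S r *v v) + ku2 * 1" .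
  qed
 qed
 have b: "S t \<preceq> mat (1 * exp ((ku1 + ku2) * (T - t)))"
  by (rule backward_ode_upper[OF ode a(2) up _ _ _ T t]) (use k_nonneg in auto)
 have "(ku1 + ku2) * (T - t) <= (ku1 + ku2) * T"
  by (rule mult_left_mono) (use k_nonneg(1,2) a t in auto)
 then have "1 * exp ((ku1 + ku2) * (T - t)) <= Kup" by (simp add: Kup_def)
 with b show ?thesis by (rule loewner_le_mat_mono)
qed

text \<open>The bound \<open>R\<close> enters only through the decay rate \<open>kl R\<close>. For
  \<open>m = 0\<close> the conclusion is positivity, whatever \<open>R\<close> is.\<close>

lemma path_lower:
 assumes ode: "backward_ode a T S \<Psi>" and a: "0 <= a" "a <= T"
  and dr: "AE r in lborel. r \<in> {0<..T} --> driven S \<Psi> r"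
  and R: "\<And>r v. r \<in> {a..T} ==> norm (S r *v v) <= R * norm v" "0 <= R"
  and T: "mat m \<preceq> S T" "0 <= m" and t: "t \<in> {a..T}"
 shows "mat (m * exp (- kl R * T)) \<preceq> S t"
proof -
 have lo: "AE r in lborel. r \<in> {a<..T} --> (\<forall>v. norm v = 1 --> - kl R * norm (S r *v v) <= v \<bullet> (\<Psi> r *v v))"
  using dr
 proof eventually_elim
  case (elim r)
  show ?case
  proof (intro impI allI)
   fix v :: "real^'n" assume r: "r \<in> {a<..T}" and v: "norm v = 1"
   then have "r \<in> {0<..T}" using a by auto
   with elim have d: "driven S \<Psi> r" by blast
   obtain l and \<mu> :: "'e measure" and a' and b :: "real^'d^'n" and c s h where ad: "admissible K0 l \<mu> a' b c s h" "\<Psi> r = driver l \<mu> a' b c N s h"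
    and s: "\<forall>v. norm (s *v v) <= norm (S r *v v)"
    using d unfolding driven_def by blast
   have "norm (s *v v) <= R" using R(1)[of r v] spec[OF s, of v] r v by simp
   from driver_lower[OF ad(1) v K0_nonneg this, of "kl R" N]
   have "- kl R * norm (s *v v) <= v \<bullet> (\<Psi> r *v v)" unfolding ad(2) by (simp add: kl_def)
   moreover have "kl R * norm (s *v v) <= kl R * norm (S r *v v)"
    by (rule mult_left_mono[OF spec[OF s] k_nonneg(3)[OF R(2)]])
   ultimately show "- kl R * norm (S r *v v) <= v \<bullet> (\<Psi> r *v v)" by linarith
  qed
 qed
 have "mat (m * exp (- kl R * (T - t))) \<preceq> S t"
  by (rule backward_ode_lower[OF ode a(2) lo k_nonneg(3)[OF R(2)] T(2,1) t])
 moreover have "m * exp (- kl R * T) <= m * exp (- kl R * (T - t))"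
 proof (rule mult_left_mono[OF _ T(2)])
  have "kl R * (T - t) <= kl R * T" by (rule mult_left_mono) (use k_nonneg(3)[OF R(2)] a t in auto)
  then show "exp (- kl R * T) <= exp (- kl R * (T - t))" by simp
 qed
 ultimately show ?thesis by (blast intro: loewner_le_trans mat_le_mat)
qed

lemma sol_driven:
 assumes s: "sol M \<Sigma> \<Theta>"
 shows "AE w in P. AE r in lborel. r \<in> {0<..T} --> driven (%t. \<Sigma> t w) (drv \<Sigma> \<Theta> w) r"
 using sol_path(4)[OF s]
proof eventually_elim
 case (elim w)
 then show ?case by eventually_elim (unfold driven_def path_driver_def, blast)
qed

lemma sol_transfer:
 assumes s: "sol M \<Sigma> \<Theta>" and V: "closed V"
  and ae: "\<And>j. j <= J ==> AE w in P. ereal T < \<tau> (Suc j) w --> \<tau> j w <= ereal T --> (\<forall>t\<in>{0..T}. \<tau> j w <= ereal t --> \<Sigma> t w \<in> V)"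
 shows "AE w in P. \<forall>t\<in>{0..T}. \<Sigma> t w \<in> V"
proof (rule adapted_transfer_all[where X = \<Sigma>, OF T0 V _ _ ae])
 fix t assume t: "t \<in> {0..T}"
 show "\<Sigma> t \<in> borel_measurable (FF t)" by (rule progressive_adapted[OF sol_regular(1)[OF s] t])
next
 fix w assume w: "w \<in> space P"
 show "cadlag_on T (%t. \<Sigma> t w)" by (rule sol_regular(3)[OF s w])
qed

text \<open>The barrier starts at 1 for every terminal value, so the bound does not depend on
  \<open>M\<close>; \<open>sol_transfer\<close> removes the event that no further jump
  occurs.\<close>

lemma sol_upper:
 assumes s: "sol M \<Sigma> \<Theta>"
 shows "AE w in P. \<forall>t\<in>{0..T}. \<Sigma> t w \<in> {X. X \<preceq> mat Kup}"
proof (rule sol_transfer[OF s closed_loewner(1)])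
 fix j assume j: "j <= J"
 show "AE w in P. ereal T < \<tau> (Suc j) w --> \<tau> j w <= ereal T -->
   (\<forall>t\<in>{0..T}. \<tau> j w <= ereal t --> \<Sigma> t w \<in> {X. X \<preceq> mat Kup})"
  using sol_ode[OF s j] sol_driven[OF s] AE_space
 proof eventually_elim
  case (elim w)
  show ?case
  proof (intro impI ballI CollectI)
   fix t assume h: "ereal T < \<tau> (Suc j) w" "\<tau> j w <= ereal T" "t \<in> {0..T}" "\<tau> j w <= ereal t"
   note li = last_interval[OF elim(3) h(4,3)]
   from elim(1) h have o: "backward_ode (real_of_ereal (\<tau> j w)) T (%t. \<Sigma> t w) (drv \<Sigma> \<Theta> w)" "\<Sigma> T w = terminal_value M" by auto
   show "\<Sigma> t w \<preceq> mat Kup"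
    by (rule path_upper[OF o(1) li(1,2) elim(2) _ li(3)]) (simp add: o(2) terminal_value_tm mat_le_mat tm_bounds)
  qed
 qed
qed

lemma sol_lower:
 assumes s: "sol M \<Sigma> \<Theta>" and R: "AE w in P. \<forall>t\<in>{0..T}. \<forall>v. norm (\<Sigma> t w *v v) <= R * norm v" "0 <= R"
 shows "AE w in P. \<forall>t\<in>{0..T}. \<Sigma> t w \<in> {X. mat (tm M * exp (- kl R * T)) \<preceq> X}"
proof (rule sol_transfer[OF s closed_loewner(2)])
 fix j assume j: "j <= J"
 show "AE w in P. ereal T < \<tau> (Suc j) w --> \<tau> j w <= ereal T -->
   (\<forall>t\<in>{0..T}. \<tau> j w <= ereal t --> \<Sigma> t w \<in> {X. mat (tm M * exp (- kl R * T)) \<preceq> X})"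
  using sol_ode[OF s j] sol_driven[OF s] R(1) AE_space
 proof eventually_elim
  case (elim w)
  show ?case
  proof (intro impI ballI CollectI)
   fix t assume h: "ereal T < \<tau> (Suc j) w" "\<tau> j w <= ereal T" "t \<in> {0..T}" "\<tau> j w <= ereal t"
   note li = last_interval[OF elim(4) h(4,3)]
   from elim(1) h have o: "backward_ode (real_of_ereal (\<tau> j w)) T (%t. \<Sigma> t w) (drv \<Sigma> \<Theta> w)" "\<Sigma> T w = terminal_value M" by auto
   show "mat (tm M * exp (- kl R * T)) \<preceq> \<Sigma> t w"
    by (rule path_lower[OF o(1) li(1,2) elim(2) _ R(2) _ _ li(3)])
     (use elim(3) li in \<open>auto simp: o(2) terminal_value_tm mat_le_mat tm_bounds\<close>)
  qed
 qed
qed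

text \<open>The lower estimate presupposes some bound on \<open>\<Sigma>\<close>. The essential
  bound \<open>L\<close> of the given solution is enough for positivity; together with
  \<open>sol_upper\<close> positivity then gives the bound \<open>Kup\<close>, which no longer
  depends on the solution.\<close>

lemma sol_nonneg:
 assumes s: "sol M \<Sigma> \<Theta>"
 shows "AE w in P. \<forall>t\<in>{0..T}. possemidef (\<Sigma> t w)"
  and "AE w in P. \<forall>t\<in>{0..T}. \<forall>v. norm (\<Sigma> t w *v v) <= Kup * norm v"
proof -
 obtain L where L: "0 <= L" "AE w in P. \<forall>t\<in>{0..T}. norm (\<Sigma> t w) <= L" by (rule sol_good[OF s])
 have "AE w in P. \<forall>t\<in>{0..T}. \<forall>v. norm (\<Sigma> t w *v v) <= L * norm v"
  using L(2)
 proof eventually_elim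
  case (elim w)
  then show ?case by (meson norm_matrix_vector_le mult_right_mono norm_ge_zero order.trans)
 qed
 from sol_lower[OF s this L(1)]
 show p: "AE w in P. \<forall>t\<in>{0..T}. possemidef (\<Sigma> t w)"
 proof eventually_elim
  case (elim w)
  show ?case
  proof
   fix t assume "t \<in> {0..T}"
   then have "mat (tm M * exp (- kl L * T)) \<preceq> \<Sigma> t w" using elim by blast
   then have "mat 0 \<preceq> \<Sigma> t w" by (rule loewner_le_trans[OF mat_le_mat, rotated]) (simp add: tm_bounds)
   then show "possemidef (\<Sigma> t w)" by (simp only: mat_zero_loewner)
  qed
 qed
 from p sol_upper[OF s] show "AE w in P. \<forall>t\<in>{0..T}. \<forall>v. norm (\<Sigma> t w *v v) <= Kup * norm v"
 proof eventually_elim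
  case (elim w)
  then show ?case using loewner_interval_norm by blast
 qed
qed

lemma sol_sum:
 assumes s: "sol M \<Sigma> \<Theta>" and V: "closed V" and ae: "AE w in P. \<forall>t\<in>{0..T}. \<Sigma> t w \<in> V"
 shows "AE w in P. AE (t, th) in compensator J lam Q \<tau> \<gamma> w. t \<in> {0..T} --> \<Sigma> t w + \<Theta> t th w \<in> V"
 using jump_pair_transfer_all[OF sol_jump_pair[OF s] T0 borel_closed[OF V] ae] AE_space
proof eventually_elim
 case (elim w)
 then show ?case
  using compensator_closed_iff[OF elim(2) sol_regular(1,4)[OF s] borel_closed[OF V]] by (simp add: case_prod_beta')
qed

text \<open>At a jump, \<open>\<Theta>\<close> is \<open>\<Sigma>\<close> minus its left limit, and
  the left limit is positive semi-definite.\<close>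

lemma sol_field_upper:
 assumes s: "sol M \<Sigma> \<Theta>"
 shows "AE w in P. AE (t, th) in jump_measure J \<tau> \<gamma> w. t \<in> {0..T} --> \<Theta> t th w \<preceq> mat Kup"
proof -
 have "AE w in P. \<forall>j\<in>jumps w. \<tau> j w <= ereal T -->
    lm \<Sigma> (real_of_ereal (\<tau> j w)) w + \<Theta> (real_of_ereal (\<tau> j w)) (\<gamma> j w) w = \<Sigma> (real_of_ereal (\<tau> j w)) w"
  using sol_jump_pair[OF s] by (simp add: jump_pair_def)
 then show ?thesis using sol_nonneg(1)[OF s] sol_upper[OF s] AE_space
 proof eventually_elim
  case (elim w)
  show ?case
  proof (rule jump_measure_AE_intro[OF elim(4)])
   fix j assume j: "j \<in> jumps w" "\<tau> j w <= ereal T"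
   let ?u = "real_of_ereal (\<tau> j w)"
   have u: "?u \<in> {0<..T}" using jump_time_in(1)[OF elim(4) _ j(2)] j(1) by (auto simp: jumps_def)
   have "lm \<Sigma> ?u w \<in> {X. possemidef X}"
    by (rule lm_closed[where X = \<Sigma>, OF sol_regular(3)[OF s elim(4)] closed_possemidef _ u]) (use elim in auto)
   then have "\<Sigma> ?u w - lm \<Sigma> ?u w \<preceq> \<Sigma> ?u w" by (simp add: loewner_le_def)
   moreover have "\<Sigma> ?u w \<preceq> mat Kup" using elim(3) u by auto
   moreover have "\<Theta> ?u (\<gamma> j w) w = \<Sigma> ?u w - lm \<Sigma> ?u w" using elim(1) j by (metis add_diff_cancel_left')
   ultimately show "\<Theta> ?u (\<gamma> j w) w \<preceq> mat Kup" using loewner_le_trans by metis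
  qed
 qed
qed

text \<open>\<open>IH\<close> bounds the differences of the values after the next jump within an
  order interval, which is what \<open>driver_diff\<close> asks for. On the event without further
  jumps the two ordinary comparisons then apply to the difference, at the cost of one factor
  \<open>exp ((kd1 + kd2) * T)\<close>.\<close>

lemma compare_step:
 fixes e b :: real
 defines "V \<equiv> %b. {X :: real^'n^'n. possemidef X & X \<preceq> mat b}"
 assumes s1: "sol M1 \<Sigma>1 \<Theta>1" and s2: "sol M2 \<Sigma>2 \<Theta>2"
  and e: "tm M2 <= tm M1" "tm M1 - tm M2 <= b" and j: "j <= J"
  and IH: "AE w in P. AE r in lborel. r \<in> {0<..T} --> idx w r = j --> crate w r \<noteq> 0 -->
   (AE th in ck w r. (\<Sigma>1 r w - \<Sigma>2 r w) + (\<Theta>1 r th w - \<Theta>2 r th w) \<in> V b)"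
 shows "AE w in P. \<forall>t\<in>{0..T}. \<tau> j w <= ereal t & ereal t < \<tau> (Suc j) w -->
   \<Sigma>1 t w - \<Sigma>2 t w \<in> V (b * exp ((kd1 + kd2) * T))"
proof (rule adapted_transfer[OF j T0])
 have "V (b * exp ((kd1 + kd2) * T)) = {X. possemidef X} \<inter> {X. X \<preceq> mat (b * exp ((kd1 + kd2) * T))}" by (auto simp: V_def)
 then show "closed (V (b * exp ((kd1 + kd2) * T)))" by (simp add: closed_Int closed_possemidef closed_loewner)
 have jp: "jump_pair T (%t w. \<Sigma>1 t w - \<Sigma>2 t w) (%t th w. \<Theta>1 t th w - \<Theta>2 t th w)"
  by (rule jump_pair_diff[OF sol_jump_pair[OF s1] sol_jump_pair[OF s2]])
 show "(%w. \<Sigma>1 t w - \<Sigma>2 t w) \<in> borel_measurable (FF t)" if "t \<in> {0..T}" for t using jp that by (simp add: jump_pair_def)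
 show "((%s. \<Sigma>1 s w - \<Sigma>2 s w) \<longlongrightarrow> \<Sigma>1 t w - \<Sigma>2 t w) (at_right t)" if "w \<in> space P" "t \<in> {0..<T}" for w t
  using jp that by (simp add: jump_pair_def cadlag_on_def)
 have b0: "0 <= b" using e by simp
 show "AE w in P. ereal T < \<tau> (Suc j) w -->
   (\<forall>t\<in>{0..T}. \<tau> j w <= ereal t --> \<Sigma>1 t w - \<Sigma>2 t w \<in> V (b * exp ((kd1 + kd2) * T)))"
  using sol_ode[OF s1 j] sol_path(4)[OF s1] sol_ode[OF s2 j] sol_path(4)[OF s2] sol_nonneg(2)[OF s1] sol_nonneg(2)[OF s2] IH AE_space
 proof eventually_elim
  case (elim w)
  note w = elim(8) and R1 = elim(5) and R2 = elim(6)
  show ?case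
  proof (intro impI ballI)
   fix t assume h: "ereal T < \<tau> (Suc j) w" "t \<in> {0..T}" "\<tau> j w <= ereal t"
   note li = last_interval[OF w h(3,2)]
   define a where "a = real_of_ereal (\<tau> j w)"
   note li = li[folded a_def]
   have tT: "\<tau> j w <= ereal T" using li by simp
   from elim(1,3) h(1) tT have o: "backward_ode a T (%t. \<Sigma>1 t w) (drv \<Sigma>1 \<Theta>1 w)" "\<Sigma>1 T w = terminal_value M1"
    "backward_ode a T (%t. \<Sigma>2 t w) (drv \<Sigma>2 \<Theta>2 w)" "\<Sigma>2 T w = terminal_value M2" by (auto simp: a_def)
   note od = backward_ode_diff[OF o(1,3)]
   let ?X = "%r. \<Sigma>1 r w - \<Sigma>2 r w" and ?D = "%r. drv \<Sigma>1 \<Theta>1 w r - drv \<Sigma>2 \<Theta>2 w r"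
   have XT: "?X T = mat (tm M1 - tm M2)" using o(2,4) by (simp add: terminal_value_tm vec_eq_iff mat_def)
   have main: "AE r in lborel. r \<in> {a<..T} --> (\<forall>v. norm v = 1 --> - kd1 * norm (?X r *v v) <= v \<bullet> (?D r *v v)
     & v \<bullet> (?D r *v v) <= kd1 * norm (?X r *v v) + kd2 * b)"
    using elim(2,4,7)
   proof eventually_elim
    case (elim r)
    show ?case
    proof (intro impI allI)
     fix v :: "real^'n" assume r: "r \<in> {a<..T}" and v: "norm v = 1"
     have r0: "r \<in> {0<..T}" "r \<in> {0..T}" using r li by auto
     \<comment> \<open>Up to \<open>T\<close> no further jump occurs, so every time after
       \<open>\<tau> j\<close> carries the index \<open>j\<close> for which \<open>IH\<close> is
       stated.\<close>
     have ix: "idx w r = j"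
     proof (rule idx_eq[OF w])
      show "\<tau> j w < ereal r" using li(4) r by simp
      have "ereal r <= ereal T" using r by simp
      then show "ereal r <= \<tau> (Suc j) w" using h(1) by (meson less_imp_le order.trans)
     qed
     have ad: "admissible K0 (crate w r) (ck w r) (A r w) (B r w) (%th. C r th w) (\<Sigma>1 r w) (%th. \<Theta>1 r th w)"
      "admissible K0 (crate w r) (ck w r) (A r w) (B r w) (%th. C r th w) (\<Sigma>2 r w) (%th. \<Theta>2 r th w)"
      using elim r0 by auto
     have R: "norm (\<Sigma>1 r w *v v) <= Kup" "norm (\<Sigma>2 r w *v v) <= Kup"
      using bspec[OF R1 r0(2), THEN spec, of v] bspec[OF R2 r0(2), THEN spec, of v] v by simp_all
     have c: "AE th in ck w r. (\<Sigma>1 r w - \<Sigma>2 r w) + (\<Theta>1 r th w - \<Theta>2 r th w) \<in> V b" if "crate w r \<noteq> 0"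
      using elim(3) r0(1) ix that by blast
     have re: "(x - y) + (z - u) = (x + z) - (y + u)" for x y z u :: "real^'n^'n" by simp
     have c1: "AE th in ck w r. \<Sigma>2 r w + \<Theta>2 r th w \<preceq> \<Sigma>1 r w + \<Theta>1 r th w" if "crate w r \<noteq> 0"
      using c[OF that] by eventually_elim (unfold V_def loewner_le_def re, simp)
     have c2: "AE th in ck w r. (\<Sigma>1 r w + \<Theta>1 r th w) - (\<Sigma>2 r w + \<Theta>2 r th w) \<preceq> mat b" if "crate w r \<noteq> 0"
      using c[OF that] by eventually_elim (unfold V_def re, simp)
     have kk: "K0 * (2 * (1 + K0) + 1 + 2 * (1 + K0) * (1 + (1 + K0) * Kup)) + 2 * K0 <= kd1"
      "K0 * (1 + (1 + K0) * Kup)\<^sup>2 <= kd2" by (simp_all add: kd1_def kd2_def)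
     show "- kd1 * norm (?X r *v v) <= v \<bullet> (?D r *v v) & v \<bullet> (?D r *v v) <= kd1 * norm (?X r *v v) + kd2 * b"
      unfolding path_driver_def
      using driver_diff(1)[OF ad v K0_nonneg R c1 kk(1)] driver_diff(2)[OF ad v K0_nonneg R c1 kk(1) c2 b0 kk(2)] by blast
    qed
   qed
   have lo: "AE r in lborel. r \<in> {a<..T} --> (\<forall>v. norm v = 1 --> - kd1 * norm (?X r *v v) <= v \<bullet> (?D r *v v))"
    using main by (rule eventually_mono) blast
   have up: "AE r in lborel. r \<in> {a<..T} --> (\<forall>v. norm v = 1 --> v \<bullet> (?D r *v v) <= kd1 * norm (?X r *v v) + kd2 * b)"
    using main by (rule eventually_mono) blast
   have XT2: "mat 0 \<preceq> ?X T" "?X T \<preceq> mat b" unfolding XT by (rule mat_le_mat, use e in simp)+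
   have "mat (0 * exp (- kd1 * (T - t))) \<preceq> ?X t"
    by (rule backward_ode_lower[OF od li(2) lo k_nonneg(4) order.refl XT2(1) li(3)])
   then have "possemidef (?X t)" by (simp only: mult_zero_left mat_zero_loewner)
   moreover have "?X t \<preceq> mat (b * exp ((kd1 + kd2) * (T - t)))"
    by (rule backward_ode_upper[OF od li(2) up k_nonneg(4,5) b0 XT2(2) li(3)])
   moreover have "b * exp ((kd1 + kd2) * (T - t)) <= b * exp ((kd1 + kd2) * T)"
   proof (rule mult_left_mono[OF _ b0])
    have "(kd1 + kd2) * (T - t) <= (kd1 + kd2) * T"
     by (rule mult_left_mono) (use k_nonneg(4,5) h in auto)
    then show "exp ((kd1 + kd2) * (T - t)) <= exp ((kd1 + kd2) * T)" by simp
   qed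
   ultimately show "?X t \<in> V (b * exp ((kd1 + kd2) * T))"
    unfolding V_def by (auto intro: loewner_le_mat_mono)
  qed
 qed
qed

text \<open>One exponential factor for each of the \<open>J + 1\<close> numbers of jumps from 0 to
  \<open>J\<close>.\<close>

definition "Kcmp = exp ((kd1 + kd2) * T) ^ Suc J"

lemma sol_compare:
 assumes s1: "sol M1 \<Sigma>1 \<Theta>1" and s2: "sol M2 \<Sigma>2 \<Theta>2" and e: "tm M2 <= tm M1"
 shows "AE w in P. \<forall>t\<in>{0..T}. possemidef (\<Sigma>1 t w - \<Sigma>2 t w) & \<Sigma>1 t w - \<Sigma>2 t w \<preceq> mat ((tm M1 - tm M2) * Kcmp)"
proof -
 define V where "V = (%b. {X :: real^'n^'n. possemidef X & X \<preceq> mat b})"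
 define x where "x = exp ((kd1 + kd2) * T)"
 define d where "d = tm M1 - tm M2"
 have x1: "1 <= x" using k_nonneg T0 by (simp add: x_def)
 have d0: "0 <= d" using e by (simp add: d_def)
 have jp: "jump_pair T (%t w. \<Sigma>1 t w - \<Sigma>2 t w) (%t th w. \<Theta>1 t th w - \<Theta>2 t th w)"
  by (rule jump_pair_diff[OF sol_jump_pair[OF s1] sol_jump_pair[OF s2]])
 have Vm: "V b \<in> sets borel" for b
 proof -
  have "V b = {X. possemidef X} \<inter> {X. X \<preceq> mat b}" by (auto simp: V_def)
  then show ?thesis by (simp add: borel_closed closed_Int closed_possemidef closed_loewner)
 qed
 \<comment> \<open>The bound used in \<open>compare_step\<close> must dominate the gap of the
   terminal values as well as the gap after the next jump.\<close>
 have db: "d <= d * x ^ i" for i using d0 one_le_power[OF x1, of i] by (simp add: mult_le_cancel_left1)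
 have step: "AE w in P. \<forall>t\<in>{0..T}. \<tau> j w <= ereal t & ereal t < \<tau> (Suc j) w --> \<Sigma>1 t w - \<Sigma>2 t w \<in> V (d * x ^ Suc i)"
  if j: "j <= J" and IH: "AE w in P. AE r in lborel. r \<in> {0<..T} --> idx w r = j --> crate w r \<noteq> 0 -->
   (AE th in ck w r. (\<Sigma>1 r w - \<Sigma>2 r w) + (\<Theta>1 r th w - \<Theta>2 r th w) \<in> V (d * x ^ i))" for i j
  using compare_step[OF s1 s2 e db[unfolded d_def] j IH[unfolded V_def d_def]] by (simp only: V_def d_def x_def power_Suc2 mult.assoc)
 have ind: "AE w in P. \<forall>t\<in>{0..T}. \<tau> (J - i) w <= ereal t & ereal t < \<tau> (Suc (J - i)) w --> \<Sigma>1 t w - \<Sigma>2 t w \<in> V (d * x ^ Suc i)"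
  if "i <= J" for i
  using that
 proof (induction i)
  case 0
  show ?case
  proof (rule step)
   \<comment> \<open>With all \<open>J\<close> jumps made the rate is zero, so the condition on the
     values after a jump is void and the induction can start.\<close>
   have "\<not> (idx w r = J - 0 & crate w r \<noteq> 0)" for w r by (simp add: crate_def)
   then show "AE w in P. AE r in lborel. r \<in> {0<..T} --> idx w r = J - 0 --> crate w r \<noteq> 0 -->
    (AE th in ck w r. (\<Sigma>1 r w - \<Sigma>2 r w) + (\<Theta>1 r th w - \<Theta>2 r th w) \<in> V (d * x ^ 0))" by (intro AE_I2) blast
  qed simp
 next
  case (Suc i)
  define j where "j = J - Suc i"
  have j: "j < J" "Suc j = J - i" using Suc.prems by (auto simp: j_def)
  have "AE w in P. \<tau> (Suc j) w <= ereal T --> \<Sigma>1 (real_of_ereal (\<tau> (Suc j) w)) w - \<Sigma>2 (real_of_ereal (\<tau> (Suc j) w)) w \<in> V (d * x ^ Suc i)"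
   using Suc.IH[OF Suc_leD[OF Suc.prems], folded j(2)] AE_space
  proof eventually_elim
   case (elim w)
   show ?case
   proof
    assume t: "\<tau> (Suc j) w <= ereal T"
    let ?u = "real_of_ereal (\<tau> (Suc j) w)"
    have u: "?u \<in> {0<..T}" "ereal ?u = \<tau> (Suc j) w" using jump_time_in[OF elim(2) _ t] by auto
    have "\<tau> (Suc j) w < \<infinity>" by (rule le_less_trans[OF t]) simp
    \<comment> \<open>At its own jump time the path already belongs to the interval with index
      \<open>Suc j\<close>, where the induction hypothesis holds.\<close>
    from time_less[OF elim(2) this] show "\<Sigma>1 ?u w - \<Sigma>2 ?u w \<in> V (d * x ^ Suc i)" using elim(1) u by auto
   qed
  qed
  from jump_pair_transfer[OF jp T0 j(1) Vm this]
  show ?case unfolding j_def[symmetric] by (rule step[OF less_imp_le[OF j(1)]])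
 qed
 have "AE w in P. \<forall>i\<in>{..J}. \<forall>t\<in>{0..T}. \<tau> (J - i) w <= ereal t & ereal t < \<tau> (Suc (J - i)) w --> \<Sigma>1 t w - \<Sigma>2 t w \<in> V (d * x ^ Suc i)"
  by (rule AE_finite_allI) (use ind in auto)
 then show ?thesis using AE_space
 proof eventually_elim
  case (elim w)
  show ?case
  proof
   fix t assume t: "t \<in> {0..T}"
   obtain j where j: "j <= J" "\<tau> j w <= ereal t" "ereal t < \<tau> (Suc j) w" using index_exists[OF elim(2), of t] t by auto
   have "\<Sigma>1 t w - \<Sigma>2 t w \<in> V (d * x ^ Suc (J - j))"
    using bspec[OF elim(1), of "J - j"] t j by simp
   moreover have "d * x ^ Suc (J - j) <= d * Kcmp"
    unfolding Kcmp_def x_def[symmetric] using x1 d0 by (intro mult_left_mono power_increasing) auto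
   ultimately show "possemidef (\<Sigma>1 t w - \<Sigma>2 t w) & \<Sigma>1 t w - \<Sigma>2 t w \<preceq> mat ((tm M1 - tm M2) * Kcmp)"
    by (auto simp: V_def d_def intro: loewner_le_mat_mono)
  qed
 qed
qed

lemma sol_compare_norm:
 assumes s1: "sol M1 \<Sigma>1 \<Theta>1" and s2: "sol M2 \<Sigma>2 \<Theta>2" and e: "tm M2 <= tm M1"
 shows "AE w in P. \<forall>t\<in>{0..T}. norm (\<Sigma>1 t w - \<Sigma>2 t w) <= real CARD('n) * ((tm M1 - tm M2) * Kcmp)"
  and "AE w in P. AE (t, th) in jump_measure J \<tau> \<gamma> w. t \<in> {0..T} -->
   norm (\<Theta>1 t th w - \<Theta>2 t th w) <= 2 * (real CARD('n) * ((tm M1 - tm M2) * Kcmp))"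
proof -
 show 1: "AE w in P. \<forall>t\<in>{0..T}. norm (\<Sigma>1 t w - \<Sigma>2 t w) <= real CARD('n) * ((tm M1 - tm M2) * Kcmp)"
  using sol_compare[OF assms] by eventually_elim (use loewner_interval_norm_le in blast)
 show "AE w in P. AE (t, th) in jump_measure J \<tau> \<gamma> w. t \<in> {0..T} -->
   norm (\<Theta>1 t th w - \<Theta>2 t th w) <= 2 * (real CARD('n) * ((tm M1 - tm M2) * Kcmp))"
  by (rule jump_pair_norm[OF jump_pair_diff[OF sol_jump_pair[OF s1] sol_jump_pair[OF s2]] 1])
qed

text \<open>For equal terminal values the gap in the comparison is zero.\<close>

lemma sol_unique:
 assumes s1: "sol M \<Sigma>1 \<Theta>1" and s2: "sol M \<Sigma>2 \<Theta>2"
 shows "eq_D P T \<Sigma>1 \<Sigma>2 & eq_q P T (jump_measure J \<tau> \<gamma>) \<Theta>1 \<Theta>2"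
 using sol_compare_norm[OF s1 s2 order.refl] by (simp add: eq_D_def eq_q_def)

lemma sol_pos:
 assumes m: "1 <= m"
 shows "\<exists>c>0. \<forall>\<Sigma> \<Theta>. sol (enat m) \<Sigma> \<Theta> -->
   (AE w in P. \<forall>t\<in>{0..T}. posdef (\<Sigma> t w) & mat c \<preceq> \<Sigma> t w) &
   (AE w in P. AE (t, th) in compensator J lam Q \<tau> \<gamma> w. t \<in> {0..T} -->
    posdef (\<Sigma> t w + \<Theta> t th w) & mat c \<preceq> \<Sigma> t w + \<Theta> t th w)"
proof (intro exI conjI allI impI)
 \<comment> \<open>The decay rate is taken at the universal radius \<open>Kup\<close>, so that
   \<open>c\<close> depends on \<open>m\<close> but not on the solution.\<close>
 define c where "c = tm (enat m) * exp (- kl Kup * T)"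
 show c0: "0 < c" using m by (simp add: c_def tm_def)
 fix \<Sigma> \<Theta> assume s: "sol (enat m) \<Sigma> \<Theta>"
 have lo: "AE w in P. \<forall>t\<in>{0..T}. \<Sigma> t w \<in> {X. mat c \<preceq> X}"
  unfolding c_def by (rule sol_lower[OF s sol_nonneg(2)[OF s]]) (use Kup_pos in simp)
 show "AE w in P. \<forall>t\<in>{0..T}. posdef (\<Sigma> t w) & mat c \<preceq> \<Sigma> t w"
  using lo AE_space by eventually_elim (use mat_loewner_le_posdef[OF _ c0] sol_regular(2)[OF s] in blast)
 show "AE w in P. AE (t, th) in compensator J lam Q \<tau> \<gamma> w. t \<in> {0..T} -->
    posdef (\<Sigma> t w + \<Theta> t th w) & mat c \<preceq> \<Sigma> t w + \<Theta> t th w"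
  using sol_sum[OF s closed_loewner(2) lo] AE_space
 proof eventually_elim
  case (elim w)
  from elim(1) show ?case
  proof eventually_elim
   case (elim x)
   show ?case
   proof (cases x)
    case (Pair t th)
    have "posdef (\<Sigma> t w + \<Theta> t th w)" if "t \<in> {0..T}" "mat c \<preceq> \<Sigma> t w + \<Theta> t th w"
     using sol_regular(2,5)[OF s \<open>w \<in> space P\<close> that(1)]
     by (intro mat_loewner_le_posdef[OF that(2) c0] sym_mats_add)
    then show ?thesis using elim Pair by auto
   qed
  qed
 qed
qed

lemma sol_converges:
 assumes s: "\<forall>M\<ge>1. sol M (\<Sigma> M) (\<Theta> M)" and e: "0 < e"
 shows "\<exists>m\<^sub>0\<ge>1. \<forall>m\<ge>m\<^sub>0. (AE w in P. \<forall>t\<in>{0..T}. norm (\<Sigma> (enat m) t w - \<Sigma> \<infinity> t w) <= e) &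
   (AE w in P. AE (t, th) in jump_measure J \<tau> \<gamma> w. t \<in> {0..T} --> norm (\<Theta> (enat m) t th w - \<Theta> \<infinity> t th w) <= e)"
proof -
 \<comment> \<open>The constant in the estimate for \<open>\<Theta>\<close>; the estimate for
   \<open>\<Sigma>\<close> has half of it, and the gap of the terminal values is
   \<open>1 / m\<close>.\<close>
 define c where "c = 2 * (real CARD('n) * Kcmp)"
 have c0: "0 < c" by (simp add: c_def Kcmp_def)
 obtain m0 where m0: "c / e < real m0" using reals_Archimedean2 by blast
 have "0 < c / e" using c0 e by simp
 with m0 have "0 < real m0" by (rule less_trans[rotated])
 then have "0 < m0" by simp
 show ?thesis
 proof (intro exI[of _ m0] conjI allI impI)
  show "1 <= m0" using \<open>0 < m0\<close> by simp
  fix m assume m: "m0 <= m"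
  have "c / e <= real m" using m0 m by linarith
  then have le: "c * (1 / real m) <= e" using e \<open>0 < m0\<close> m by (simp add: field_simps)
  have m1: "sol (enat m) (\<Sigma> (enat m)) (\<Theta> (enat m))" using s \<open>0 < m0\<close> m by (simp add: one_enat_def)
  have mi: "sol \<infinity> (\<Sigma> \<infinity>) (\<Theta> \<infinity>)" using s by simp
  have tt: "tm \<infinity> <= tm (enat m)" "tm (enat m) - tm \<infinity> = 1 / real m" by (auto simp: tm_def)
  note cmp = sol_compare_norm[OF m1 mi tt(1), unfolded tt(2)]
  have b2: "2 * (real CARD('n) * (1 / real m * Kcmp)) <= e" using le by (simp add: c_def mult_ac)
  have half: "x <= e" if "2 * x <= e" "0 <= x" for x using that by linarith
  have b1: "real CARD('n) * (1 / real m * Kcmp) <= e" by (rule half[OF b2]) (simp add: Kcmp_def)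
  show "AE w in P. \<forall>t\<in>{0..T}. norm (\<Sigma> (enat m) t w - \<Sigma> \<infinity> t w) <= e"
   using cmp(1) by eventually_elim (use b1 in force)
  show "AE w in P. AE (t, th) in jump_measure J \<tau> \<gamma> w. t \<in> {0..T} --> norm (\<Theta> (enat m) t th w - \<Theta> \<infinity> t th w) <= e"
   using cmp(2)
  proof eventually_elim
   case (elim w)
   then show ?case by eventually_elim (use b2 in force)
  qed
 qed
qed

lemma sol_antimono:
 assumes s: "\<forall>M\<ge>1. sol M (\<Sigma> M) (\<Theta> M)" and m: "1 <= m" "m <= m'"
 shows "(AE w in P. \<forall>t\<in>{0..T}. \<Sigma> (enat m') t w \<preceq> \<Sigma> (enat m) t w) &
   (AE w in P. AE (t, th) in compensator J lam Q \<tau> \<gamma> w. t \<in> {0..T} -->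
    \<Sigma> (enat m') t w + \<Theta> (enat m') t th w \<preceq> \<Sigma> (enat m) t w + \<Theta> (enat m) t th w)"
proof
 have s1: "sol (enat m) (\<Sigma> (enat m)) (\<Theta> (enat m))" and s2: "sol (enat m') (\<Sigma> (enat m')) (\<Theta> (enat m'))"
  using s m by (auto simp: one_enat_def)
 let ?X = "%t w. \<Sigma> (enat m) t w - \<Sigma> (enat m') t w" and ?Y = "%t th w. \<Theta> (enat m) t th w - \<Theta> (enat m') t th w"
 have e: "tm (enat m') <= tm (enat m)" using m by (auto simp: tm_def intro!: divide_left_mono)
 have p: "AE w in P. \<forall>t\<in>{0..T}. ?X t w \<in> {X. possemidef X}"
  using sol_compare[OF s1 s2 e] by eventually_elim auto
 then show "AE w in P. \<forall>t\<in>{0..T}. \<Sigma> (enat m') t w \<preceq> \<Sigma> (enat m) t w" by (simp add: loewner_le_def)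
 note reg1 = sol_regular[OF s1] and reg2 = sol_regular[OF s2]
 have pX: "progressive FF T ?X"
  using reg1(1) reg2(1) unfolding progressive_def case_prod_beta' by (auto intro!: borel_measurable_diff)
 have pY: "predictable_field P FF T ?Y"
  using reg1(4) reg2(4) unfolding predictable_field_def case_prod_beta' by (auto intro!: borel_measurable_diff)
 have cl: "{X :: real^'n^'n. possemidef X} \<in> sets borel" by (rule borel_closed[OF closed_possemidef])
 have re: "(x - y) + (z - u) = (x + z) - (y + u)" for x y z u :: "real^'n^'n" by simp
 show "AE w in P. AE (t, th) in compensator J lam Q \<tau> \<gamma> w. t \<in> {0..T} -->
    \<Sigma> (enat m') t w + \<Theta> (enat m') t th w \<preceq> \<Sigma> (enat m) t w + \<Theta> (enat m) t th w"
  using jump_pair_transfer_all[OF jump_pair_diff[OF sol_jump_pair[OF s1] sol_jump_pair[OF s2]] T0 cl p] AE_space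
 proof eventually_elim
  case (elim w)
  have "AE x in compensator J lam Q \<tau> \<gamma> w. fst x \<in> {0..T} --> ?X (fst x) w + ?Y (fst x) (snd x) w \<in> {X. possemidef X}"
   unfolding compensator_closed_iff[OF elim(2) pX pY cl] by (rule elim(1))
  then show ?case by (simp only: case_prod_beta' loewner_le_def re mem_Collect_eq)
 qed
qed

end

section \<open>Backward equations with Lipschitz drivers\<close>

text \<open>The radial retraction onto the ball of radius \<open>K\<close>. The maximum in the
  denominator covers points inside and outside the ball by one formula.\<close>

definition radial :: "real => 'v::real_normed_vector => 'v" where
 "radial K x = (K / max K (norm x)) *\<^sub>R x"

lemma radial_eq: "0 < K ==> norm x <= K ==> radial K x = x"
 by (simp add: radial_def)

lemma norm_radial_le:
 assumes "0 < K" shows "norm (radial K x) <= K" "0 <= K / max K (norm x)" "K / max K (norm x) <= 1"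
proof -
 have p: "0 < max K (norm x)" using assms by simp
 show "0 <= K / max K (norm x)" "K / max K (norm x) <= 1" using assms p by (simp_all add: divide_le_eq)
 have "K * norm x <= K * max K (norm x)" using assms by (intro mult_left_mono) auto
 then show "norm (radial K x) <= K" using assms p by (simp add: radial_def divide_le_eq)
qed

text \<open>The difference is the scaled \<open>x - y\<close> plus the change of the scaling factor
  applied to \<open>y\<close>. Each part is at most \<open>norm (x - y)\<close>, which gives the
  constant 2 in any normed space.\<close>

lemma radial_lipschitz:
 assumes K: "0 < K" shows "norm (radial K x - radial K y) <= 2 * norm (x - y)"
proof -
 define a b where "a = max K (norm x)" and "b = max K (norm y)"
 have p: "0 < a" "0 < b" "K <= a" "norm y <= b" using K by (auto simp: a_def b_def)
 have e: "radial K x - radial K y = (K / a) *\<^sub>R (x - y) + (K / a - K / b) *\<^sub>R y"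
  by (simp add: radial_def a_def b_def algebra_simps)
 have "K / a * norm (x - y) <= 1 * norm (x - y)" using K p by (intro mult_right_mono) auto
 then have 1: "norm ((K / a) *\<^sub>R (x - y)) <= norm (x - y)" using K p by simp
 have ba: "\<bar>b - a\<bar> <= norm (x - y)" using norm_triangle_ineq3[of x y] by (auto simp: a_def b_def max_def)
 have "K / a - K / b = (K / a) * ((b - a) / b)" using p by (simp add: field_simps)
 then have "\<bar>K / a - K / b\<bar> * norm y = (K / a) * (\<bar>b - a\<bar> * (norm y / b))" using K p by (simp add: abs_mult)
 also have "\<dots> <= 1 * (norm (x - y) * 1)" using K p ba by (intro mult_mono) auto
 finally have "norm ((K / a - K / b) *\<^sub>R y) <= norm (x - y)" by simp
 with 1 show ?thesis unfolding e using norm_triangle_ineq[of "(K / a) *\<^sub>R (x - y)" "(K / a - K / b) *\<^sub>R y"] by linarith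
qed

text \<open>Clamping the lower limit continues the tail integral to the whole line as a bounded
  continuous function, the form required by the space of the fixed point argument.\<close>

lemma tail_integral_continuous:
 fixes f :: "real => 'v::euclidean_space"
 assumes T: "0 <= T" and f: "f \<in> borel_measurable borel" and B: "\<And>r. norm (f r) <= B"
 shows "continuous_on UNIV (%t. LINT r:{clp T t<..T}|lborel. f r)"
  and "0 <= s ==> t <= T ==> set_integrable lborel {s<..t} f"
  and "norm (LINT r:{clp T t<..T}|lborel. f r) <= B * T"
proof -
 have si: "set_integrable lborel {s<..t} f" if "0 <= s" "t <= T" for s t
  by (rule set_integrable_bounded_Ioc[OF measurable_compose[OF clp_measurable f] that, of B]) (use B in simp)
 show "0 <= s ==> t <= T ==> set_integrable lborel {s<..t} f" by (rule si)
 have B0: "0 <= B" using order.trans[OF norm_ge_zero B] .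
 have le: "norm ((LINT r:{u<..T}|lborel. f r) - (LINT r:{v<..T}|lborel. f r)) <= B * (v - u)" if "0 <= u" "u <= v" "v <= T" for u v
  unfolding set_integral_Ioc_diff[OF si[OF order.refl order.refl] that]
  by (rule set_lebesgue_integral_Ioc_norm_le[OF si]) (use that B in auto)
 have "B-lipschitz_on UNIV (%t. LINT r:{clp T t<..T}|lborel. f r)"
 proof (rule lipschitz_onI[OF _ B0])
  fix s t :: real
  have in0: "clp T s \<in> {0..T}" "clp T t \<in> {0..T}" using T clp_in by auto
  have c: "\<bar>clp T s - clp T t\<bar> <= \<bar>s - t\<bar>" by (auto simp: clp_def)
  have "norm ((LINT r:{clp T s<..T}|lborel. f r) - (LINT r:{clp T t<..T}|lborel. f r)) <= B * \<bar>clp T s - clp T t\<bar>"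
  proof (cases "clp T s <= clp T t")
   case True then show ?thesis using le[of "clp T s" "clp T t"] in0 by auto
  next
   case False then show ?thesis using le[of "clp T t" "clp T s"] in0 by (auto simp: norm_minus_commute)
  qed
  also have "\<dots> <= B * \<bar>s - t\<bar>" by (rule mult_left_mono[OF c B0])
  finally show "dist (LINT r:{clp T s<..T}|lborel. f r) (LINT r:{clp T t<..T}|lborel. f r) <= B * dist s t"
   by (simp add: dist_norm dist_real_def)
 qed
 then show "continuous_on UNIV (%t. LINT r:{clp T t<..T}|lborel. f r)" by (rule lipschitz_on_continuous_on)
 have in0: "clp T t \<in> {0..T}" using T clp_in by auto
 have "norm (LINT r:{clp T t<..T}|lborel. f r) <= B * (T - clp T t)"
  by (rule set_lebesgue_integral_Ioc_norm_le[OF si]) (use in0 B in auto)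
 also have "\<dots> <= B * T" using in0 B0 by (intro mult_left_mono) auto
 finally show "norm (LINT r:{clp T t<..T}|lborel. f r) <= B * T" .
qed

text \<open>In the norm weighted with \<open>exp (2 * L * (T - t))\<close> the integral operator is a contraction.\<close>

lemma backward_picard:
 fixes G :: "real => 'v::euclidean_space => 'v"
 assumes T: "0 <= T" and L: "0 < L"
  and lip: "\<And>r x y. norm (G r x - G r y) <= L * norm (x - y)"
  and bd: "\<And>r x. norm (G r x) <= B"
  and meas: "\<And>x. continuous_on UNIV x ==> (%r. G r (x r)) \<in> borel_measurable borel"
 obtains S where "continuous_on UNIV S" "\<And>t. t \<in> {0..T} ==> S t = m + (LINT r:{t<..T}|lborel. G r (S r))"
proof -
 define e where "e t = exp (2 * L * (T - clp T t))" for t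
 have c_clp: "continuous_on UNIV (clp T)" unfolding clp_def by (intro continuous_intros)
 have ec: "continuous_on UNIV e" unfolding e_def by (intro continuous_intros c_clp)
 have e1: "1 <= e t" for t using L T clp_in[OF T, of t] by (simp add: e_def)
 have e0: "0 < e t" for t by (simp add: e_def)
 \<comment> \<open>The fixed point variable \<open>y\<close> is the candidate divided by the weight;
   the ordinary supremum distance of \<open>y\<close> is then the weighted distance of
   \<open>X y\<close>.\<close>
 define X where "X y r = e r *\<^sub>R apply_bcontfun y r" for y :: "real \<Rightarrow>\<^sub>C 'v" and r
 have Xc: "continuous_on UNIV (X y)" for y unfolding X_def by (intro continuous_intros ec) auto
 note tail = tail_integral_continuous[OF T meas[OF Xc] bd]
 define F where "F y t = (1 / e t) *\<^sub>R (m + (LINT r:{clp T t<..T}|lborel. G r (X y r)))" for y t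
 have Fb: "F y \<in> bcontfun" for y
  unfolding bcontfun_def
 proof (intro CollectI conjI)
  show "continuous_on UNIV (F y)" unfolding F_def
   by (intro continuous_intros ec tail(1)) (use e0 in \<open>auto simp: less_imp_neq[symmetric]\<close>)
  have "norm (F y t) <= norm m + B * T" for t
  proof -
   have "norm (m + (LINT r:{clp T t<..T}|lborel. G r (X y r))) <= norm m + B * T"
    by (rule order.trans[OF norm_triangle_ineq add_left_mono[OF tail(3)]])
   then have "norm (F y t) <= (1 / e t) * (norm m + B * T)"
    unfolding F_def using e0[of t] by (simp add: divide_right_mono)
   also have "\<dots> <= 1 * (norm m + B * T)"
    using e1[of t] T order.trans[OF norm_ge_zero bd] by (intro mult_right_mono) auto
   finally show ?thesis by simp
  qed
  then show "bounded (range (F y))" by (auto simp: bounded_iff)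
 qed
 define \<Phi> where "\<Phi> y = Bcontfun (F y)" for y
 have \<Phi>: "apply_bcontfun (\<Phi> y) = F y" for y unfolding \<Phi>_def by (rule Bcontfun_inverse[OF Fb])
 have contr: "dist (\<Phi> y) (\<Phi> z) <= 1 / 2 * dist y z" for y z
 proof (rule dist_bound)
  fix t
  define u where "u = clp T t"
  have u: "0 <= u" "u <= T" using clp_in[OF T, of t] by (auto simp: u_def)
  define d where "d = dist y z"
  \<comment> \<open>The majorant \<open>?h\<close> is \<open>L * e r * d\<close>, arranged as
    \<open>2 * L\<close> times an exponential with the same rate. Its integral is therefore at most
    \<open>d / 2\<close> times the weight at \<open>t\<close>, and the contraction factor is one
    half.\<close>
  let ?f = "%r. G r (X y r)" and ?g = "%r. G r (X z r)" and ?h = "%r. 2 * L * (d / 2 * exp (2 * L * (T - r)))"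
  have pt: "norm (?f r - ?g r) <= ?h r" if "r \<in> {u<..T}" for r
  proof -
   have r: "clp T r = r" using that u by (intro clp_eq) auto
   have "norm (?f r - ?g r) <= L * norm (X y r - X z r)" by (rule lip)
   also have "X y r - X z r = e r *\<^sub>R (apply_bcontfun y r - apply_bcontfun z r)" by (simp add: X_def scaleR_diff_right)
   also have "norm \<dots> = e r * dist (apply_bcontfun y r) (apply_bcontfun z r)" using e0[of r] by (simp add: dist_norm)
   also have "L * \<dots> <= L * (e r * d)"
    unfolding d_def using e0[of r] L by (intro mult_left_mono dist_bounded) auto
   also have "\<dots> = ?h r" by (simp add: e_def r)
   finally show ?thesis .
  qed
  have si: "set_integrable lborel {u<..T} ?f" "set_integrable lborel {u<..T} ?g" using tail(2) u by auto
  note hx = exp_backward_ode[OF u(2), of "2 * L" "d / 2" T]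
  have "norm ((LINT r:{u<..T}|lborel. ?f r) - (LINT r:{u<..T}|lborel. ?g r)) = norm (LINT r:{u<..T}|lborel. ?f r - ?g r)"
   using set_integral_diff(2)[OF si] by simp
  also have "\<dots> <= (LINT r:{u<..T}|lborel. norm (?f r - ?g r))"
   by (rule set_integral_norm_bound[OF set_integral_diff(1)[OF si]])
  also have "\<dots> <= (LINT r:{u<..T}|lborel. ?h r)"
   by (rule set_integral_mono[OF set_integrable_norm[OF set_integral_diff(1)[OF si]] hx(1) pt])
  also have "\<dots> = d / 2 * exp (2 * L * (T - u)) - d / 2 * exp (2 * L * (T - T))" by (rule hx(2))
  also have "\<dots> <= d / 2 * e t" by (simp add: e_def u_def d_def)
  finally have le: "norm ((LINT r:{u<..T}|lborel. ?f r) - (LINT r:{u<..T}|lborel. ?g r)) <= d / 2 * e t" .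
  have "F y t - F z t = (1 / e t) *\<^sub>R ((LINT r:{u<..T}|lborel. ?f r) - (LINT r:{u<..T}|lborel. ?g r))"
   unfolding F_def u_def by (simp add: scaleR_diff_right[symmetric])
  then have "norm (F y t - F z t) = norm ((LINT r:{u<..T}|lborel. ?f r) - (LINT r:{u<..T}|lborel. ?g r)) / e t"
   using e0[of t] by simp
  also have "\<dots> <= d / 2" using le e0[of t] by (simp add: divide_le_eq)
  finally show "dist (apply_bcontfun (\<Phi> y) t) (apply_bcontfun (\<Phi> z) t) <= 1 / 2 * dist y z"
   by (simp add: \<Phi> dist_norm d_def)
 qed
 have "\<exists>!y. \<Phi> y = y" by (rule banach_fix_type[of "1 / 2"]) (use contr in auto)
 then obtain y where y: "\<Phi> y = y" by blast
 show ?thesis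
 proof
  show "continuous_on UNIV (X y)" by (rule Xc)
  fix t assume t: "t \<in> {0..T}"
  have "X y t = e t *\<^sub>R F y t" unfolding X_def using \<Phi>[of y] y by simp
  also have "\<dots> = m + (LINT r:{t<..T}|lborel. G r (X y r))" using e0[of t] clp_eq[OF t] by (simp add: F_def)
  finally show "X y t = m + (LINT r:{t<..T}|lborel. G r (X y r))" .
 qed
qed

lemma integral_kernel_measurable:
 fixes f :: "'a => 'b => 'v::euclidean_space"
 assumes f[measurable]: "(%(x, y). f x y) \<in> borel_measurable (M \<Otimes>\<^sub>M N)" and L[measurable]: "L \<in> M \<rightarrow>\<^sub>M subprob_algebra N"
 shows "(%x. \<integral>y. f x y \<partial>L x) \<in> borel_measurable M"
proof -
 note measurable_distr2[measurable]
 have "(%x. \<integral>z. (case z of (x, y) => f x y) \<partial>distr (L x) (M \<Otimes>\<^sub>M N) (%y. (x, y))) \<in> borel_measurable M" by measurable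
 then show ?thesis
  by (rule measurable_cong[THEN iffD1, rotated]) (simp add: integral_distr)
qed

lemma norm_res_le:
 fixes U :: "real^'n^'n"
 assumes "possemidef U" shows "norm (res U) <= real CARD('n)"
 using norm_matrix_le_of_vector[of "res U" 1] res_bounds(1)[OF assms] by simp

lemma norm_mult3_le:
 fixes X Y :: "real^'n^'n"
 assumes "norm X <= x" "norm R <= r" "norm Y <= y"
 shows "norm (X ** R ** Y) <= x * r * y"
proof -
 have 0: "0 <= x" "0 <= r" using assms norm_ge_zero order.trans by blast+
 have "norm (X ** R) <= x * r" by (rule order.trans[OF norm_matrix_mult_le mult_mono]) (use assms 0 in auto)
 then show ?thesis by (intro order.trans[OF norm_matrix_mult_le mult_mono]) (use assms 0 in auto)
qed

text \<open>Since \<open>h = U - p\<close>, the matrix \<open>p + h = U\<close> inside the inverse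
  does not move with \<open>p\<close>. The jump term is then a product of two affine functions of
  \<open>p\<close> with a fixed bounded middle factor, and no resolvent has to be
  differentiated.\<close>

lemma jump_term_lipschitz:
 fixes c U p p' :: "real^'n^'n"
 assumes K: "norm c <= K" "norm U <= K" "norm p <= K" "norm p' <= K" and U: "possemidef U"
 shows "norm ((U - p - jump_generator c p (U - p)) - (U - p' - jump_generator c p' (U - p')))
  <= (1 + 2 * ((K + 1) * real CARD('n) * (K * K + 2 * K))) * norm (p - p')"
proof -
 define d where "d = norm (p - p')"
 define D where "D = K * K + 2 * K"
 have K0: "0 <= K" using K(1) norm_ge_zero order.trans by blast
 have D0: "0 <= D" using K0 by (simp add: D_def)
 let ?X = "%p. p ** transpose c - (U - p)" and ?Y = "%p. c ** p - (U - p)" and ?R = "res U"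
 have jg: "jump_generator c p (U - p) = ?X p ** ?R ** ?Y p" for p by (simp add: jump_generator_def res_def)
 have nm: "norm (x ** y) <= K * K" if "norm x <= K" "norm y <= K" for x y :: "real^'n^'n"
  by (rule order.trans[OF norm_matrix_mult_le mult_mono]) (use that K0 in auto)
 have X: "norm (?X p) <= D" "norm (?Y p) <= D" if "norm p <= K" for p
 proof -
  have "norm (?X p) <= norm (p ** transpose c) + (norm U + norm p)"
   using norm_triangle_ineq4[of "p ** transpose c" "U - p"] norm_triangle_ineq4[of U p] by linarith
  moreover have "norm (?Y p) <= norm (c ** p) + (norm U + norm p)"
   using norm_triangle_ineq4[of "c ** p" "U - p"] norm_triangle_ineq4[of U p] by linarith
  ultimately show "norm (?X p) <= D" "norm (?Y p) <= D"
   using nm[of p "transpose c"] nm[of c p] that K by (auto simp: D_def)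
 qed
 have eX: "?X p - ?X p' = (p - p') ** transpose c + (p - p')"
  by (simp add: bounded_bilinear.diff_left[OF bounded_bilinear_matrix_mult])
 have eY: "?Y p - ?Y p' = c ** (p - p') + (p - p')"
  by (simp add: bounded_bilinear.diff_right[OF bounded_bilinear_matrix_mult])
 have "norm ((p - p') ** transpose c) <= d * K" "norm (c ** (p - p')) <= K * d"
  using norm_matrix_mult_le[of "p - p'" "transpose c"] norm_matrix_mult_le[of c "p - p'"]
   mult_left_mono[OF K(1), of d] mult_right_mono[OF K(1), of d] by (auto simp: d_def)
 then have dX: "norm (?X p - ?X p') <= (K + 1) * d" and dY: "norm (?Y p - ?Y p') <= (K + 1) * d"
  unfolding eX eY using norm_triangle_ineq[of "(p - p') ** transpose c" "p - p'"] norm_triangle_ineq[of "c ** (p - p')" "p - p'"]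
  by (auto simp: d_def algebra_simps)
 have split: "x ** r ** y - x' ** r ** y' = (x - x') ** r ** y + x' ** r ** (y - y')" for x x' r y y' :: "real^'n^'n"
  by (simp add: bounded_bilinear.diff_right[OF bounded_bilinear_matrix_mult] bounded_bilinear.diff_left[OF bounded_bilinear_matrix_mult])
 have "?X p ** ?R ** ?Y p - ?X p' ** ?R ** ?Y p' = (?X p - ?X p') ** ?R ** ?Y p + ?X p' ** ?R ** (?Y p - ?Y p')" by (rule split)
 also have "norm \<dots> <= (K + 1) * d * real CARD('n) * D + D * real CARD('n) * ((K + 1) * d)"
  by (intro order.trans[OF norm_triangle_ineq] add_mono norm_mult3_le dX dY X norm_res_le U K)
 finally have j: "norm (jump_generator c p (U - p) - jump_generator c p' (U - p')) <= 2 * ((K + 1) * real CARD('n) * D) * d"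
  unfolding jg by (simp add: algebra_simps)
 have "norm ((U - p - jump_generator c p (U - p)) - (U - p' - jump_generator c p' (U - p')))
  = norm ((p' - p) - (jump_generator c p (U - p) - jump_generator c p' (U - p')))" by (simp add: algebra_simps)
 also have "\<dots> <= d + norm (jump_generator c p (U - p) - jump_generator c p' (U - p'))"
  unfolding d_def norm_minus_commute[of p p'] by (rule norm_triangle_ineq4)
 finally show ?thesis using j unfolding D_def d_def[symmetric] by (simp add: algebra_simps)
qed

context riccati_setting begin

text \<open>Truncation makes the quadratic driver Lipschitz. It is radial, so it does not increase \<open>norm (S *v v)\<close>, and the a priori bounds
 remain valid for the truncated equation.\<close>

definition prj :: "real => real^'n^'n => real^'n^'n" where
 "prj k S = radial k ((1 / 2) *\<^sub>R (S + transpose S))"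

lemma prj_sym: "prj k S \<in> sym_mats"
 unfolding prj_def radial_def by (intro sym_mats_scaleR) (simp add: sym_mats_def transpose_add transpose_transpose add.commute)

lemma prj_norm: "0 < k ==> norm (prj k S) <= k"
 unfolding prj_def by (rule norm_radial_le)

lemma prj_lipschitz:
 assumes "0 < k" shows "norm (prj k S - prj k S') <= 2 * norm (S - S')"
proof -
 have "(1 / 2) *\<^sub>R (S + transpose S) - (1 / 2) *\<^sub>R (S' + transpose S') = (1 / 2) *\<^sub>R ((S - S') + transpose (S - S'))"
  by (simp add: transpose_diff algebra_simps)
 also have "norm \<dots> <= norm (S - S')"
  using norm_triangle_ineq[of "S - S'" "transpose (S - S')"] by simp
 finally show ?thesis unfolding prj_def using radial_lipschitz[OF assms, of "(1 / 2) *\<^sub>R (S + transpose S)" "(1 / 2) *\<^sub>R (S' + transpose S')"] by linarith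
qed

lemma prj_of_sym: "S \<in> sym_mats ==> prj k S = radial k S"
proof -
 assume "S \<in> sym_mats"
 then have "(1 / 2) *\<^sub>R (S + transpose S) = S" by (simp add: sym_mats_def scaleR_2[symmetric])
 then show ?thesis by (simp add: prj_def)
qed

lemma prj_vec_le:
 assumes k: "0 < k" and S: "S \<in> sym_mats" shows "norm (prj k S *v v) <= norm (S *v v)"
proof -
 have "norm (prj k S *v v) = (k / max k (norm S)) * norm (S *v v)"
  using abs_of_nonneg[OF norm_radial_le(2)[OF k, of S]]
  by (simp add: prj_of_sym[OF S] radial_def scaleR_matrix_vector_assoc[symmetric] del: abs_divide)
 also have "\<dots> <= 1 * norm (S *v v)" by (rule mult_right_mono[OF norm_radial_le(3)[OF k]]) simp
 finally show ?thesis by simp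
qed

text \<open>\<open>U r th\<close> stands for the value after a jump to \<open>th\<close>. With these
  values given, the unknown \<open>h\<close> is \<open>U - S\<close>, and the equation between two
  jumps is an ordinary one for \<open>S\<close> alone.\<close>

lemma mode_ode:
 fixes a :: "real => real^'n^'n" and b :: "real => real^'d^'n" and c U :: "real => 'e => real^'n^'n"
 assumes a: "a \<in> borel_measurable borel" "\<And>r. norm (a r) <= K0" and b: "b \<in> borel_measurable borel" "\<And>r. norm (b r) <= K0"
  and c: "(%p. c (fst p) (snd p)) \<in> borel_measurable (borel \<Otimes>\<^sub>M borel)" "\<And>r th. norm (c r th) <= K0"
  and U: "(%p. U (fst p) (snd p)) \<in> borel_measurable (borel \<Otimes>\<^sub>M borel)" "\<And>r th. norm (U r th) <= Ku" "\<And>r th. possemidef (U r th)"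
  and m: "0 <= m" "m <= 1"
 obtains S where "continuous_on UNIV S" "S T = mat m"
  "backward_ode 0 T S (%r. driver (lam x (max 0 r)) (Qm x r) (a r) (b r) (c r) N (S r) (%th. U r th - S r))"
  "\<And>t. t \<in> {0..T} ==> mat (m * exp (- kl Kup * T)) \<preceq> S t" "\<And>t. t \<in> {0..T} ==> S t \<preceq> mat Kup"
proof -
 \<comment> \<open>The truncation radius exceeds \<open>CARD('n) * Kup\<close>, the norm bound
   implied by the a priori order bounds, so the truncation turns out to be inactive. It also exceeds
   \<open>Ku\<close> and \<open>K0\<close>, so that one radius serves in the Lipschitz
   estimate.\<close>
 define k where "k = real CARD('n) * Kup + Ku + K0 + 1"
 have Ku0: "0 <= Ku" using order.trans[OF norm_ge_zero U(2)] .
 have nK: "0 <= real CARD('n) * Kup" using Kup_pos by simp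
 have k: "0 < k" "Ku <= k" "K0 <= k" "real CARD('n) * Kup <= k" using Ku0 K0_nonneg nK by (auto simp: k_def)
 define p where "p = prj k"
 define j where "j c U q = U - q - jump_generator c q (U - q)" for c U q :: "real^'n^'n"
 define Lj where "Lj = 1 + 2 * ((k + 1) * real CARD('n) * (k * k + 2 * k))"
 define Bj where "Bj = k + k + ((2 * k) * (2 * k) + 2 * k) * (real CARD('n) * ((2 * k) * (2 * k) + 2 * k))"
 define l where "l r = lam x (max 0 r)" for r
 define G where "G r S = driver (l r) (Qm x r) (a r) (b r) (c r) N (p S) (%th. U r th - p S)" for r S
 have l: "0 <= l r" "l r <= K0" for r by (auto simp: l_def lam_nonneg lam_le)
 have pn: "norm (p S) <= k" for S unfolding p_def by (rule prj_norm[OF k(1)])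
 have ps: "p S \<in> sym_mats" for S unfolding p_def by (rule prj_sym)
 have cU: "norm (c r th) <= k" "norm (U r th) <= k" for r th using c(2)[of r th] U(2)[of r th] k by auto
 have jL: "norm (j (c r th) (U r th) (p S) - j (c r th) (U r th) (p S')) <= Lj * norm (p S - p S')" for r th S S'
  unfolding j_def Lj_def by (rule jump_term_lipschitz[OF cU pn pn U(3)])
 have jB: "norm (j (c r th) (U r th) (p S)) <= Bj" for r th S
 proof -
  have "norm (U r th - p S) <= k + k" using norm_triangle_ineq4[of "U r th" "p S"] cU(2)[of r th] pn[of S] by linarith
  moreover have "norm (jump_generator (c r th) (p S) (U r th - p S)) <= ((2 * k) * (2 * k) + 2 * k) * (real CARD('n) * ((2 * k) * (2 * k) + 2 * k))"
   by (rule norm_jump_generator_le) (use U(3) cU(1)[of r th] pn[of S] k calculation in auto)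
  ultimately show ?thesis
   unfolding j_def Bj_def using norm_triangle_ineq4[of "U r th - p S" "jump_generator (c r th) (p S) (U r th - p S)"] by linarith
 qed
 have jm2: "(%z. j (c (fst z) (snd z)) (U (fst z) (snd z)) (q (fst z))) \<in> borel_measurable (borel \<Otimes>\<^sub>M borel)"
  if q: "q \<in> borel_measurable borel" for q
 proof -
  have q2: "(%z. q (fst z)) \<in> borel_measurable (borel \<Otimes>\<^sub>M (borel :: 'e measure))" by (rule measurable_compose[OF measurable_fst q])
  show ?thesis unfolding j_def
   by (intro borel_measurable_diff jump_generator_measurable c(1) U(1) q2)
 qed
 have jm: "(%th. j (c r th) (U r th) (p S)) \<in> borel_measurable (Qm x r)" for r S
 proof -
  have "Pair r \<in> Qm x r \<rightarrow>\<^sub>M borel \<Otimes>\<^sub>M borel" unfolding measurable_cong_sets[OF sets_Qm refl] by (rule Pair_measurable)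
  from measurable_compose[OF this jm2[of "%_. p S"]] show ?thesis by simp
 qed
 interpret Qp: prob_space "Qm x r" for r by (rule Qm_prob)
 have ji: "integrable (Qm x r) (%th. j (c r th) (U r th) (p S))" for r S
  by (rule Qp.integrable_const_bound[OF _ jm]) (use jB in auto)
 have G: "G r S = l r *\<^sub>R (\<integral>th. j (c r th) (U r th) (p S) \<partial>Qm x r) - (a r ** p S + p S ** transpose (a r)) + real N *\<^sub>R (b r ** transpose (b r))" for r S
  by (simp add: G_def driver_def j_def)
 have nint: "norm (\<integral>th. f th \<partial>Qm x r) <= B" if "integrable (Qm x r) f" "\<And>th. norm (f th) <= B" for f :: "'e => real^'n^'n" and B r
 proof -
  have "norm (\<integral>th. f th \<partial>Qm x r) <= (\<integral>th. norm (f th) \<partial>Qm x r)" by (rule integral_norm_bound)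
  also have "\<dots> <= (\<integral>th. B \<partial>Qm x r)" by (rule integral_mono) (use that in auto)
  finally show ?thesis using Qp.prob_space[of r] unfolding space_Qm by simp
 qed
 have am: "norm (a r ** y + y ** transpose (a r)) <= 2 * K0 * norm y" for r and y :: "real^'n^'n"
 proof -
  have "norm (a r ** y) <= K0 * norm y" by (rule order.trans[OF norm_matrix_mult_le mult_right_mono[OF a(2)]]) simp
  moreover have "norm (y ** transpose (a r)) <= norm y * K0"
   by (rule order.trans[OF norm_matrix_mult_le mult_left_mono]) (use a(2) in auto)
  ultimately have "norm (a r ** y + y ** transpose (a r)) <= K0 * norm y + norm y * K0"
   by (rule order.trans[OF norm_triangle_ineq add_mono])
  then show ?thesis by (simp add: algebra_simps)
 qed
 \<comment> \<open>The factor 2 is the Lipschitz constant of the truncation \<open>prj\<close>; the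
   added 1 ensures strict positivity.\<close>
 define L where "L = (K0 * Lj + 2 * K0) * 2 + 1"
 have Lj0: "0 <= Lj" using k by (simp add: Lj_def)
 have L0: "0 < L" using Lj0 K0_nonneg by (simp add: L_def add_nonneg_pos)
 have lip: "norm (G r S - G r S') <= L * norm (S - S')" for r S S'
 proof -
  define d where "d = norm (p S - p S')"
  have d0: "0 <= d" by (simp add: d_def)
  have e1: "G r S - G r S' = l r *\<^sub>R (\<integral>th. j (c r th) (U r th) (p S) - j (c r th) (U r th) (p S') \<partial>Qm x r)
    - (a r ** (p S - p S') + (p S - p S') ** transpose (a r))"
   unfolding G Bochner_Integration.integral_diff[OF ji ji]
   by (simp add: scaleR_diff_right bounded_bilinear.diff_left[OF bounded_bilinear_matrix_mult] bounded_bilinear.diff_right[OF bounded_bilinear_matrix_mult])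
  have "norm (\<integral>th. j (c r th) (U r th) (p S) - j (c r th) (U r th) (p S') \<partial>Qm x r) <= Lj * d"
   unfolding d_def by (rule nint[OF Bochner_Integration.integrable_diff[OF ji ji] jL])
  then have n1: "norm (l r *\<^sub>R (\<integral>th. j (c r th) (U r th) (p S) - j (c r th) (U r th) (p S') \<partial>Qm x r)) <= K0 * (Lj * d)"
   using l[of r] Lj0 d0 by (simp add: mult_mono)
  have "norm (G r S - G r S') <= K0 * (Lj * d) + 2 * K0 * d"
   unfolding e1 by (rule order.trans[OF norm_triangle_ineq4 add_mono[OF n1]]) (unfold d_def, rule am)
  also have "\<dots> = (K0 * Lj + 2 * K0) * d" by (simp add: algebra_simps)
  also have "\<dots> <= (K0 * Lj + 2 * K0) * (2 * norm (S - S'))"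
   unfolding d_def p_def using K0_nonneg Lj0 by (intro mult_left_mono prj_lipschitz k) auto
  also have "\<dots> <= L * norm (S - S')" by (simp add: L_def algebra_simps)
  finally show ?thesis .
 qed
 define B where "B = K0 * Bj + 2 * K0 * k + real N * (K0 * K0)"
 have bd: "norm (G r S) <= B" for r S
 proof -
  have "norm (\<integral>th. j (c r th) (U r th) (p S) \<partial>Qm x r) <= Bj" by (rule nint[OF ji jB])
  moreover have "0 <= Bj" using order.trans[OF norm_ge_zero jB] .
  ultimately have 1: "norm (l r *\<^sub>R (\<integral>th. j (c r th) (U r th) (p S) \<partial>Qm x r)) <= K0 * Bj" using l[of r] by (simp add: mult_mono)
  have 2: "norm (a r ** p S + p S ** transpose (a r)) <= 2 * K0 * k"
   by (rule order.trans[OF am mult_left_mono[OF pn]]) (use K0_nonneg in simp)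
  have "norm (b r ** transpose (b r)) <= K0 * K0"
   by (rule order.trans[OF norm_matrix_mult_le mult_mono]) (use b(2) K0_nonneg in auto)
  then have 3: "norm (real N *\<^sub>R (b r ** transpose (b r))) <= real N * (K0 * K0)" by (simp add: mult_left_mono)
  show ?thesis unfolding G B_def by (rule order.trans[OF norm_triangle_ineq add_mono[OF order.trans[OF norm_triangle_ineq4 add_mono[OF 1 2]] 3]])
 qed
 have lm0: "l \<in> borel_measurable borel"
  unfolding l_def using measurable_compose[OF _ lam_measurable, of "%r. (x, r)" borel] by simp
 have Qk: "Qm x \<in> borel \<rightarrow>\<^sub>M subprob_algebra borel"
  using measurable_prob_algebraD[OF measurable_compose[OF _ Qm_kernel, of "%r. (x, r)" borel]] by simp
 have meas: "(%r. G r (S r)) \<in> borel_measurable borel" if S: "continuous_on UNIV S" for S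
 proof -
  have "2-lipschitz_on UNIV p" unfolding p_def by (rule lipschitz_onI) (use prj_lipschitz[OF k(1)] in \<open>auto simp: dist_norm\<close>)
  then have "continuous_on UNIV p" by (rule lipschitz_on_continuous_on)
  then have pS: "(%r. p (S r)) \<in> borel_measurable borel"
   by (intro borel_measurable_continuous_onI continuous_on_compose2[OF _ S]) auto
  have "(%r. \<integral>th. j (c r th) (U r th) (p (S r)) \<partial>Qm x r) \<in> borel_measurable borel"
   by (rule integral_kernel_measurable[OF _ Qk]) (use jm2[OF pS] in \<open>simp add: case_prod_beta'\<close>)
  then show ?thesis unfolding G
   by (intro borel_measurable_add borel_measurable_diff borel_measurable_scaleR lm0 borel_measurable_matrix_mult
     borel_measurable_transpose a(1) b(1) pS borel_measurable_const)
 qed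
 obtain S where S: "continuous_on UNIV S" "\<And>t. t \<in> {0..T} ==> S t = mat m + (LINT r:{t<..T}|lborel. G r (S r))"
  using backward_picard[OF T0 L0 lip bd meas, of "mat m"] by blast
 note tail = tail_integral_continuous[OF T0 meas[OF S(1)] bd]
 have hs: "U r th - p S \<in> sym_mats" for r th S by (intro sym_mats_diff ps possemidefD(1) U(3))
 have adm: "admissible K0 (l r) (Qm x r) (a r) (b r) (c r) (p S) (%th. U r th - p S)" for r S
  unfolding admissible_def using l a b c ps Qm_prob hs U(3) ji[of r S] by (auto simp: j_def)
 have Gs: "G r S \<in> sym_mats" for r S
 proof -
  have js: "j (c r th) (U r th) (p S) \<in> sym_mats" for th
   unfolding j_def by (rule jump_generator_sym[OF ps hs]) (simp add: U(3))
  have "transpose (\<integral>th. j (c r th) (U r th) (p S) \<partial>Qm x r) = (\<integral>th. transpose (j (c r th) (U r th) (p S)) \<partial>Qm x r)"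
   by (rule integral_bounded_linear[OF bounded_linear_transpose ji, symmetric])
  also have "\<dots> = (\<integral>th. j (c r th) (U r th) (p S) \<partial>Qm x r)" using js by (simp add: sym_mats_def)
  finally have 1: "(\<integral>th. j (c r th) (U r th) (p S) \<partial>Qm x r) \<in> sym_mats" by (simp add: sym_mats_def)
  have 2: "a r ** p S + p S ** transpose (a r) \<in> sym_mats"
   using ps[of S] by (simp add: sym_mats_def transpose_add matrix_transpose_mul transpose_transpose add.commute)
  have 3: "b r ** transpose (b r) \<in> sym_mats" by (simp add: sym_mats_def matrix_transpose_mul transpose_transpose)
  show ?thesis unfolding G by (intro sym_mats_add sym_mats_diff sym_mats_scaleR 1 2 3)
 qed
 \<comment> \<open>The fixed point lives in the space of all matrices. Symmetry is recovered because
   \<open>prj\<close> symmetrises its argument, so that the driver only takes symmetric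
   values.\<close>
 have Ssym: "S t \<in> sym_mats" if t: "t \<in> {0..T}" for t
 proof -
  have si: "integrable lborel (%r. indicator {t<..T} r *\<^sub>R G r (S r))"
   using tail(2)[of t T] t by (simp add: set_integrable_def)
  have "transpose (LINT r:{t<..T}|lborel. G r (S r)) = (\<integral>r. transpose (indicator {t<..T} r *\<^sub>R G r (S r)) \<partial>lborel)"
   unfolding set_lebesgue_integral_def by (rule integral_bounded_linear[OF bounded_linear_transpose si, symmetric])
  also have "\<dots> = (LINT r:{t<..T}|lborel. G r (S r))"
   unfolding set_lebesgue_integral_def using Gs by (simp add: sym_mats_def transpose_scaleR)
  finally have "(LINT r:{t<..T}|lborel. G r (S r)) \<in> sym_mats" by (simp add: sym_mats_def)
  then show ?thesis unfolding S(2)[OF t] by (intro sym_mats_add sym_mats_mat)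
 qed
 have ST: "S T = mat m" using S(2)[of T] T0 by (simp add: set_lebesgue_integral_def)
 have ode: "backward_ode 0 T S (%r. G r (S r))"
  unfolding backward_ode_def
 proof (intro conjI ballI allI impI)
  show "set_integrable lborel {0<..T} (%r. G r (S r))" by (rule tail(2)) auto
  show "\<exists>c\<ge>0. AE r in lborel. r \<in> {0<..T} --> norm (G r (S r)) <= c"
   using bd order.trans[OF norm_ge_zero bd] by blast
  show "S t \<in> sym_mats" if "t \<in> {0..T}" for t by (rule Ssym[OF that])
  fix s t assume st: "0 <= s" "s <= t" "t <= T"
  have "S s - S t = (LINT r:{s<..T}|lborel. G r (S r)) - (LINT r:{t<..T}|lborel. G r (S r))"
   using S(2)[of s] S(2)[of t] st by simp
  also have "\<dots> = (LINT r:{s<..t}|lborel. G r (S r))"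
   by (rule set_integral_Ioc_diff[OF tail(2) st]) auto
  finally show "S s - S t = (LINT r:{s<..t}|lborel. G r (S r))" .
 qed
 have dr: "AE r in lborel. r \<in> {0<..T} --> driven S (%r. G r (S r)) r"
 proof (intro AE_I2 impI)
  fix r assume "r \<in> {0<..T}"
  then have "S r \<in> sym_mats" by (intro Ssym) auto
  then have "\<forall>v. norm (p (S r) *v v) <= norm (S r *v v)" unfolding p_def using prj_vec_le[OF k(1)] by blast
  then show "driven S (%r. G r (S r)) r" unfolding driven_def using adm[of r "S r"] G_def[of r "S r"] by blast
 qed
 have Tm: "mat m \<preceq> S T" "S T \<preceq> mat 1" unfolding ST by (rule mat_le_mat, use m in simp)+
 have up: "S t \<preceq> mat Kup" if "t \<in> {0..T}" for t
  by (rule path_upper[OF ode order.refl T0 dr Tm(2) that])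
 \<comment> \<open>A crude bound from continuity. It is enough for positivity, after which the lower
   estimate is repeated with the explicit radius \<open>Kup\<close>.\<close>
 obtain R where R: "0 <= R" "\<And>r v. r \<in> {0..T} ==> norm (S r *v v) <= R * norm v"
 proof -
  have "bounded (S ` {0..T})" by (rule compact_imp_bounded[OF compact_continuous_image[OF continuous_on_subset[OF S(1)]]]) auto
  then obtain R where "\<forall>y\<in>S ` {0..T}. norm y <= R" unfolding bounded_iff by blast
  then have R: "norm (S r) <= R" if "r \<in> {0..T}" for r using that by blast
  have "norm (S r *v v) <= R * norm v" if "r \<in> {0..T}" for r v
   by (rule order.trans[OF norm_matrix_vector_le mult_right_mono[OF R[OF that]]]) simp
  moreover have "0 <= R" using order.trans[OF norm_ge_zero R[of 0]] T0 by simp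
  ultimately show ?thesis using that by blast
 qed
 have pos: "possemidef (S t)" if "t \<in> {0..T}" for t
 proof -
  have "mat (m * exp (- kl R * T)) \<preceq> S t" by (rule path_lower[OF ode order.refl T0 dr R(2,1) Tm(1) m(1) that])
  then have "mat 0 \<preceq> S t" by (rule loewner_le_trans[OF mat_le_mat, rotated]) (use m in simp)
  then show ?thesis by (simp only: mat_zero_loewner)
 qed
 have lo: "mat (m * exp (- kl Kup * T)) \<preceq> S t" if "t \<in> {0..T}" for t
  by (rule path_lower[OF ode order.refl T0 dr _ less_imp_le[OF Kup_pos] Tm(1) m(1) that])
   (rule loewner_interval_norm[OF pos up])
 \<comment> \<open>Within the bounds just obtained the truncation is the identity, so
   \<open>S\<close> solves the original equation.\<close>
 have pS: "p (S t) = S t" if t: "t \<in> {0..T}" for t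
  unfolding p_def prj_of_sym[OF Ssym[OF t]]
  by (rule radial_eq[OF k(1) order.trans[OF loewner_interval_norm_le[OF pos[OF t] up[OF t]] k(4)]])
 have eq: "G r (S r) = driver (lam x (max 0 r)) (Qm x r) (a r) (b r) (c r) N (S r) (%th. U r th - S r)" if "r \<in> {0..T}" for r
  using pS[OF that] by (simp add: G_def l_def)
 let ?D = "%r. driver (lam x (max 0 r)) (Qm x r) (a r) (b r) (c r) N (S r) (%th. U r th - S r)"
 have cong: "set_integrable lborel {s<..t} ?D \<longleftrightarrow> set_integrable lborel {s<..t} (%r. G r (S r))"
  "(LINT r:{s<..t}|lborel. ?D r) = (LINT r:{s<..t}|lborel. G r (S r))" if "0 <= s" "t <= T" for s t
  by (rule set_integrable_cong set_lebesgue_integral_cong; use eq that in simp)+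
 have "backward_ode 0 T S ?D"
  unfolding backward_ode_def
 proof (intro conjI ballI allI impI)
  show "set_integrable lborel {0<..T} ?D" using ode cong(1)[of 0 T] by (simp add: backward_ode_def)
  show "\<exists>c\<ge>0. AE r in lborel. r \<in> {0<..T} --> norm (?D r) <= c"
  proof (intro exI[of _ B] conjI AE_I2 impI)
   show "0 <= B" by (rule order.trans[OF norm_ge_zero bd])
   show "norm (?D r) <= B" if "r \<in> {0<..T}" for r
   proof -
    have "r \<in> {0..T}" using that by simp
    from bd[of r "S r", unfolded eq[OF this]] show ?thesis .
   qed
  qed
  show "S t \<in> sym_mats" if "t \<in> {0..T}" for t by (rule Ssym[OF that])
  show "S s - S t = (LINT r:{s<..t}|lborel. ?D r)" if "0 <= s" "s <= t" "t <= T" for s t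
   using ode cong(2)[of s t] that by (simp add: backward_ode_def)
 qed
 with S(1) ST lo up show ?thesis using that by blast
qed

end

section \<open>The visible history of the mode process\<close>

text \<open>Off the countable cover \<open>g\<close> may be arbitrary; on each piece it coincides
  with a globally measurable function that may change from piece to piece.\<close>

lemma local_measurable:
 fixes g :: "'a => 'v::euclidean_space"
 assumes F: "countable F" "\<And>S. S \<in> F ==> S \<in> sets M"
  and loc: "\<And>S. S \<in> F ==> \<exists>h. h \<in> borel_measurable M & (\<forall>x\<in>S. g x = h x)"
 shows "(%x. if x \<in> \<Union>F then g x else 0) \<in> borel_measurable M"
proof (rule measurable_piecewise_restrict[of "insert (space M - \<Union>F) F"])
 have U: "\<Union>F \<in> sets M" using sets.countable_Union[OF F(1)] F(2) by blast
 fix \<Omega> assume \<Omega>: "\<Omega> \<in> insert (space M - \<Union>F) F"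
 then show "\<Omega> \<inter> space M \<in> sets M" using U F(2) by auto
 show "(%x. if x \<in> \<Union>F then g x else 0) \<in> borel_measurable (restrict_space M \<Omega>)"
 proof (cases "\<Omega> \<in> F")
  case True
  then obtain h where h: "h \<in> borel_measurable M" "\<forall>x\<in>\<Omega>. g x = h x" using loc by blast
  have "h \<in> borel_measurable (restrict_space M \<Omega>)" by (rule measurable_restrict_space1[OF h(1)])
  then show ?thesis by (rule measurable_cong[THEN iffD1, rotated]) (use h(2) True in \<open>auto simp: space_restrict_space\<close>)
 next
  case False
  then have e: "\<Omega> = space M - \<Union>F" using \<Omega> by simp
  have "(%x. 0 :: 'v) \<in> borel_measurable (restrict_space M \<Omega>)" by simp
  then show ?thesis by (rule measurable_cong[THEN iffD1, rotated]) (auto simp: space_restrict_space e)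
 qed
qed (use F in auto)

lemma measurable_mode_list:
 fixes f :: "'a => 'b"
 assumes "countable (UNIV :: 'b set)" "\<And>l. {x \<in> space M. f x = l} \<in> sets M"
 shows "f \<in> M \<rightarrow>\<^sub>M count_space UNIV"
proof -
 have "f -` {l} \<inter> space M = {x \<in> space M. f x = l}" for l by auto
 then show ?thesis using assms by (simp add: measurable_count_space_eq_countable)
qed

definition upd :: "'e list => 'e => 'e list" where
 "upd l x = (if last l = x then l else l @ [x])"

lemma last_upd [simp]: "last (upd l x) = x" by (simp add: upd_def)

context mode_process begin

text \<open>The filtration is not completed and does not see a jump of the mode process to its current mode. Such jumps have
 probability zero, but adapted processes must ignore them on every path.\<close>

primrec visible :: "'w => nat => 'e list" where
 "visible w 0 = [\<gamma> 0 w]"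
| "visible w (Suc j) = upd (visible w j) (\<gamma> (Suc j) w)"

lemma last_visible [simp]: "last (visible w j) = \<gamma> j w"
 by (cases j) auto

definition history :: "real => 'w => 'e list" where
 "history t w = visible w (THE j. \<tau> j w <= ereal t & ereal t < \<tau> (Suc j) w)"

text \<open>The left-continuous counterpart. Time 0 is separated because there \<open>idx\<close>
  has its default value \<open>J\<close>, which would reveal the whole history.\<close>

definition history_left :: "real => 'w => 'e list" where
 "history_left t w = (if t = 0 then history 0 w else visible w (idx w t))"

lemma history_eq:
 assumes "w \<in> space P" "\<tau> j w <= ereal t" "ereal t < \<tau> (Suc j) w"
 shows "history t w = visible w j"
 unfolding history_def using assms index_unique[OF assms(1)] by (auto intro!: arg_cong[where f = "visible w"] the_equality)

lemma history_left_eq: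
 assumes "w \<in> space P" "\<tau> j w < ereal t" "ereal t <= \<tau> (Suc j) w"
 shows "history_left t w = visible w j"
 using idx_eq[OF assms] by (simp add: history_left_def)

text \<open>Only finitely many gaps are involved, so their minimum is positive. It says how fine a
  grid must be for this path to show at most one jump per cell.\<close>

lemma jump_gap:
 assumes w: "w \<in> space P"
 shows "\<exists>\<delta>>0. \<forall>j<k. \<tau> (Suc j) w < \<infinity> --> \<tau> j w + ereal \<delta> <= \<tau> (Suc j) w"
proof (induction k)
 case 0
 show ?case by (auto intro: exI[of _ 1])
next
 case (Suc k)
 then obtain \<delta> where d: "0 < \<delta>" "\<forall>j<k. \<tau> (Suc j) w < \<infinity> --> \<tau> j w + ereal \<delta> <= \<tau> (Suc j) w" by blast
 obtain \<epsilon> where e: "0 < \<epsilon>" "\<tau> (Suc k) w < \<infinity> --> \<tau> k w + ereal \<epsilon> <= \<tau> (Suc k) w"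
 proof (cases "\<tau> (Suc k) w < \<infinity>")
  case False
  then show ?thesis using that[of 1] by simp
 next
  case True
  have f: "\<tau> k w < \<infinity>" using time_infinite[OF w, of k] True by (cases "\<tau> k w = \<infinity>") auto
  have lt: "\<tau> k w < \<tau> (Suc k) w" by (rule time_less[OF w f])
  obtain a b where "\<tau> k w = ereal a" "\<tau> (Suc k) w = ereal b"
   using f True time_nonneg[OF w, of k] time_nonneg[OF w, of "Suc k"] by (cases "\<tau> k w"; cases "\<tau> (Suc k) w") auto
  then show ?thesis using that[of "b - a"] lt by simp
 qed
 show ?case
 proof (intro exI[of _ "min \<delta> \<epsilon>"] conjI allI impI)
  show "0 < min \<delta> \<epsilon>" using d e by simp
  fix j assume j: "j < Suc k" "\<tau> (Suc j) w < \<infinity>"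
  have mono: "\<tau> j w + ereal (min \<delta> \<epsilon>) <= \<tau> j w + ereal x" if "min \<delta> \<epsilon> <= x" for x by (rule add_left_mono) (simp only: ereal_less_eq that)
  show "\<tau> j w + ereal (min \<delta> \<epsilon>) <= \<tau> (Suc j) w"
  proof (cases "j = k")
   case True
   then show ?thesis using mono[of \<epsilon>] e(2) j by (auto intro: order.trans)
  next
   case False
   then have "\<tau> j w + ereal \<delta> <= \<tau> (Suc j) w" using d(2) j by simp
   then show ?thesis using mono[of \<delta>] by (auto intro: order.trans)
  qed
 qed
qed

text \<open>Within less than the minimal gap at most one jump occurs, and its mark is the mode
  observed at the end. If no jump occurs, \<open>upd\<close> leaves the list unchanged.\<close>

lemma history_step:
 assumes w: "w \<in> space P" and \<delta>: "\<forall>j<J. \<tau> (Suc j) w < \<infinity> --> \<tau> j w + ereal \<delta> <= \<tau> (Suc j) w"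
  and s: "0 <= s" "s <= s'" "s' < s + \<delta>"
 shows "history s' w = upd (history s w) (mode \<tau> \<gamma> s' w)"
proof -
 obtain i where i: "i <= J" "\<tau> i w <= ereal s" "ereal s < \<tau> (Suc i) w" by (rule index_exists[OF w s(1)])
 have "0 <= s'" using s by simp
 then obtain j where j: "j <= J" "\<tau> j w <= ereal s'" "ereal s' < \<tau> (Suc j) w" by (rule index_exists[OF w])
 note eqs = history_eq[OF w i(2,3)] history_eq[OF w j(2,3)] mode_eq[OF w j(2,3)]
 have ij: "i <= j"
 proof (rule ccontr)
  assume "\<not> i <= j"
  then have "\<tau> (Suc j) w <= \<tau> i w" by (intro time_mono[OF w]) simp
  with i j have "ereal s' < ereal s" by (meson less_le_trans order.trans)
  then show False using s by simp
 qed
 have "j <= Suc i"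
 proof (rule ccontr)
  assume "\<not> j <= Suc i"
  then have k: "Suc (Suc i) <= j" by simp
  have "\<tau> (Suc (Suc i)) w <= ereal s'" using time_mono[OF w k] j(2) by (rule order.trans)
  moreover from this have "\<tau> (Suc (Suc i)) w < \<infinity>" by (rule le_less_trans) simp
  moreover have "Suc i < J" using k j(1) by simp
  ultimately have "\<tau> (Suc i) w + ereal \<delta> <= ereal s'" using \<delta> by (blast intro: order.trans)
  moreover have "ereal s + ereal \<delta> <= \<tau> (Suc i) w + ereal \<delta>" by (rule add_right_mono) (use i in simp)
  ultimately have "ereal s + ereal \<delta> <= ereal s'" by (rule order.trans[rotated])
  then show False using s by simp
 qed
 then consider "j = i" | "j = Suc i" using ij by linarith
 then show ?thesis
 proof cases
  case 1
  then show ?thesis using eqs by (simp add: upd_def)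
 next
  case 2
  then show ?thesis using eqs by simp
 qed
qed

context
 assumes cnt: "countable (UNIV :: 'e set)" and disc: "\<And>S :: 'e set. open S"
begin

lemma countable_lists_UNIV: "countable (UNIV :: 'e list set)"
 using countable_lists[OF cnt] by (simp add: lists_UNIV)

lemma sets_borel_discrete: "sets (borel :: 'e measure) = UNIV"
 using disc by auto

lemma mark_count_space: "f \<in> M \<rightarrow>\<^sub>M (borel :: 'e measure) ==> f \<in> M \<rightarrow>\<^sub>M count_space UNIV"
 using measurable_cong_sets[of M M borel "count_space UNIV :: 'e measure"] sets_borel_discrete by simp

lemma mode_measurable:
 assumes "0 <= s" "s <= t" shows "mode \<tau> \<gamma> s \<in> FF t \<rightarrow>\<^sub>M count_space UNIV"
proof (rule mark_count_space, rule measurableI)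
 fix S :: "'e set" assume S: "S \<in> sets borel"
 have "mode \<tau> \<gamma> s -` S \<inter> space P \<in> sets (FF t)"
  unfolding mode_filtration_def by (rule in_measure_of) (use assms S in auto)
 then show "mode \<tau> \<gamma> s -` S \<inter> space (FF t) \<in> sets (FF t)" by simp
qed simp

text \<open>The history is rebuilt from the modes observed on a grid up to \<open>t\<close>. How
  fine the grid must be depends on the path, so the events are recovered as a lower limit over the
  grids.\<close>

lemma history_measurable:
 assumes t: "0 <= t"
 shows "history t \<in> FF t \<rightarrow>\<^sub>M count_space UNIV"
proof (rule measurable_mode_list[OF countable_lists_UNIV])
 define g where "g n k = t * real k / real (Suc n)" for n k
 \<comment> \<open>\<open>fw n k\<close> is the history reconstructed from the observations at the
   grid points \<open>g n 0\<close> to \<open>g n k\<close>.\<close>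
 define fw where "fw n = rec_nat (%w. [mode \<tau> \<gamma> 0 w]) (%k f w. upd (f w) (mode \<tau> \<gamma> (g n (Suc k)) w))" for n
 have fw: "fw n 0 = (%w. [mode \<tau> \<gamma> 0 w])" "fw n (Suc k) = (%w. upd (fw n k w) (mode \<tau> \<gamma> (g n (Suc k)) w))" for n k
  by (simp_all add: fw_def)
 have gt: "0 <= g n k" "k <= Suc n ==> g n k <= t" for n k
  using t by (auto simp: g_def divide_le_eq intro!: mult_left_mono)
 have m: "fw n k \<in> FF t \<rightarrow>\<^sub>M count_space UNIV" if "k <= Suc n" for n k
  using that
 proof (induction k)
  case 0
  show ?case unfolding fw
   by (rule measurable_compose[OF mode_measurable[OF order.refl t]]) simp
 next
  case (Suc k)
  show ?case unfolding fw
  proof (rule measurable_compose_countable'[OF _ Suc.IH countable_lists_UNIV])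
   show "(%w. upd l (mode \<tau> \<gamma> (g n (Suc k)) w)) \<in> FF t \<rightarrow>\<^sub>M count_space UNIV" for l
    by (rule measurable_compose[OF mode_measurable[OF gt(1) gt(2)[OF Suc.prems]]]) simp
  qed (use Suc.prems in simp)
 qed
 have lim: "\<exists>n0. \<forall>n\<ge>n0. fw n (Suc n) w = history t w" if w: "w \<in> space P" for w
 proof -
  obtain \<delta> where \<delta>: "0 < \<delta>" "\<forall>j<J. \<tau> (Suc j) w < \<infinity> --> \<tau> j w + ereal \<delta> <= \<tau> (Suc j) w"
   using jump_gap[OF w] by blast
  obtain n0 :: nat where n0: "t / \<delta> < real n0" using reals_Archimedean2 by blast
  have "fw n (Suc n) w = history t w" if n: "n0 <= n" for n
  proof -
   have "t / \<delta> < real (Suc n)" using n0 n by linarith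
   then have td: "t / real (Suc n) < \<delta>" using \<delta>(1) by (simp add: field_simps)
   have "fw n k w = history (g n k) w" for k
   proof (induction k)
    case 0
    have "\<tau> 0 w = 0" by (rule time_0[OF w])
    then have "history 0 w = visible w 0" "mode \<tau> \<gamma> 0 w = \<gamma> 0 w"
     using history_eq[OF w, of 0 0] mode_eq[OF w, of 0 0] time_less[OF w, of 0] by (auto simp: zero_ereal_def)
    then show ?case by (simp add: fw g_def)
   next
    case (Suc k)
    have "g n (Suc k) = g n k + t / real (Suc n)" by (simp add: g_def distrib_left add_divide_distrib add.commute)
    then have "g n k <= g n (Suc k)" "g n (Suc k) < g n k + \<delta>" using t td by auto
    from history_step[OF w \<delta>(2) gt(1) this] show ?case using Suc.IH by (simp add: fw)
   qed
   moreover have "g n (Suc n) = t" by (simp add: g_def)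
   ultimately show ?thesis by simp
  qed
  then show ?thesis by blast
 qed
 fix l
 have "{w \<in> space (FF t). history t w = l} = (\<Union>n0. \<Inter>n\<in>{n0..}. fw n (Suc n) -` {l} \<inter> space (FF t))" (is "?L = ?R")
 proof (intro equalityI subsetI)
  fix w assume "w \<in> ?L"
  then show "w \<in> ?R" using lim[of w] by auto
 next
  fix w assume "w \<in> ?R"
  then obtain n1 where n1: "\<And>n. n1 <= n ==> fw n (Suc n) w = l" "w \<in> space P" by auto
  obtain n0 where n0: "\<And>n. n0 <= n ==> fw n (Suc n) w = history t w" using lim[OF n1(2)] by blast
  show "w \<in> ?L" using n1(1)[of "max n0 n1"] n0[of "max n0 n1"] n1(2) by simp
 qed
 also have "\<dots> \<in> sets (FF t)"
 proof (rule sets.countable_UN, rule image_subsetI)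
  have "fw n (Suc n) -` {l} \<inter> space (FF t) \<in> sets (FF t)" for n by (rule measurable_sets[OF m]) auto
  then show "(\<Inter>n\<in>{n0..}. fw n (Suc n) -` {l} \<inter> space (FF t)) \<in> sets (FF t)" for n0
   by (intro sets.countable_INT') auto
 qed
 finally show "{w \<in> space (FF t). history t w = l} \<in> sets (FF t)" .
qed

text \<open>Within an interval between jumps the list is constant, so the regularity of
  \<open>F l\<close> in time becomes that of the process, and a left limit is read off from
  \<open>history_left\<close>.\<close>

lemma history_process:
 fixes F :: "'e list => real => 'v::euclidean_space" and T :: real
 assumes F: "\<And>l. continuous_on UNIV (F l)"
 defines "X \<equiv> %t w. F (history t w) t"
 shows "0 <= t ==> X t \<in> borel_measurable (FF t)"
  and "w \<in> space P ==> cadlag_on T (%t. X t w)"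
  and "w \<in> space P ==> 0 <= t ==> lm X t w = F (history_left t w) t"
  and "w \<in> space P ==> t \<in> {0..T} ==> \<forall>j\<in>{1..J}. \<tau> j w \<noteq> ereal t ==> continuous (at t within {0..T}) (%s. X s w)"
proof -
 show "X t \<in> borel_measurable (FF t)" if "0 <= t"
  unfolding X_def by (rule measurable_compose[OF history_measurable[OF that]]) simp
 have Ft: "(F l \<longlongrightarrow> F l t) (at t within S)" for l t S
 proof -
  have "(F l \<longlongrightarrow> F l t) (at t)" using F[of l] by (simp add: continuous_on_eq_continuous_at isCont_def)
  then show ?thesis by (rule tendsto_within_subset) simp
 qed
 have left: "((%s. X s w) \<longlongrightarrow> F (history_left t w) t) (at_left t)" if w: "w \<in> space P" and t: "0 < t" for w t
 proof -
  obtain j where j: "j <= J" "\<tau> j w < ereal t" "ereal t <= \<tau> (Suc j) w" by (rule index_exists'[OF w t])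
  obtain a where a: "\<tau> j w = ereal a" "a < t" using j(2) time_nonneg[OF w, of j] by (cases "\<tau> j w") auto
  have "\<forall>\<^sub>F s in at_left t. s \<in> {a<..<t}" using a(2) by (intro eventually_at_leftI[of a]) auto
  then have "\<forall>\<^sub>F s in at_left t. F (visible w j) s = X s w"
  proof eventually_elim
   case (elim s)
   then have s: "\<tau> j w <= ereal s" "ereal s < ereal t" using a by auto
   show ?case unfolding X_def history_eq[OF w s(1) less_le_trans[OF s(2) j(3)]] ..
  qed
  then show ?thesis unfolding history_left_eq[OF w j(2,3)] by (rule Lim_transform_eventually[OF Ft])
 qed
 have near: "((%s. X s w) \<longlongrightarrow> X t w) (at t within S)"
  if w: "w \<in> space P" and j: "\<tau> j w <= ereal t" "ereal t < \<tau> (Suc j) w" and O: "open O'" "t \<in> O'" "\<And>s. s \<in> O' \<inter> S ==> \<tau> j w <= ereal s"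
  for w t S j O'
 proof -
  obtain b where b: "t < b" "ereal b <= \<tau> (Suc j) w"
   using j(2) ereal_dense2[of "ereal t" "\<tau> (Suc j) w"] by (force intro: less_imp_le)
  have "\<forall>\<^sub>F s in at t within S. F (visible w j) s = X s w"
   unfolding eventually_at_topological
  proof (intro exI[of _ "O' \<inter> {..<b}"] conjI ballI impI)
   fix s assume s: "s \<in> O' \<inter> {..<b}" "s \<noteq> t" "s \<in> S"
   have sb: "ereal s < ereal b" using s by simp
   have so: "\<tau> j w <= ereal s" by (rule O(3)) (use s in simp)
   show "F (visible w j) s = X s w" unfolding X_def history_eq[OF w so less_le_trans[OF sb b(2)]] ..
  qed (use O b in auto)
  then have "((%s. X s w) \<longlongrightarrow> F (visible w j) t) (at t within S)" by (rule Lim_transform_eventually[OF Ft])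
  then show ?thesis by (simp add: X_def history_eq[OF w j])
 qed
 show "cadlag_on T (%t. X t w)" if w: "w \<in> space P"
  unfolding cadlag_on_def
 proof (intro conjI ballI)
  fix t assume t: "t \<in> {0..<T}"
  then obtain j where j: "\<tau> j w <= ereal t" "ereal t < \<tau> (Suc j) w" using index_exists[OF w, of t] by auto
  show "((%t. X t w) \<longlongrightarrow> X t w) (at_right t)"
   by (rule near[OF w j open_UNIV]) (auto intro: order.trans[OF j(1)])
 qed (use left[OF w] in auto)
 show "lm X t w = F (history_left t w) t" if w: "w \<in> space P" and t: "0 <= t"
 proof (cases "t = 0")
  case True
  then show ?thesis by (simp add: lm_def X_def history_left_def)
 next
  case False
  then show ?thesis using left[OF w] t by (intro lm_eqI) auto
 qed
 show "continuous (at t within {0..T}) (%s. X s w)"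
  if w: "w \<in> space P" and t: "t \<in> {0..T}" and nj: "\<forall>j\<in>{1..J}. \<tau> j w \<noteq> ereal t"
 proof -
  obtain j where j: "j <= J" "\<tau> j w <= ereal t" "ereal t < \<tau> (Suc j) w" using index_exists[OF w, of t] t by auto
  show ?thesis unfolding continuous_within
  proof (cases "j = 0")
   case True
   show "((%s. X s w) \<longlongrightarrow> X t w) (at t within {0..T})"
    by (rule near[OF w j(2,3) open_UNIV]) (use True time_0[OF w] in \<open>auto simp: zero_ereal_def\<close>)
  next
   case False
   then have "\<tau> j w \<noteq> ereal t" using bspec[OF nj, of j] j(1) by simp
   then have lt: "\<tau> j w < ereal t" using j(2) by (rule le_neq_trans[rotated])
   obtain a where a: "\<tau> j w = ereal a" "a < t" using lt time_nonneg[OF w, of j] by (cases "\<tau> j w") auto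
   show "((%s. X s w) \<longlongrightarrow> X t w) (at t within {0..T})"
   proof (rule near[OF w j(2,3) open_greaterThan[of a]])
    show "t \<in> {a<..}" using a(2) by simp
    show "\<tau> j w <= ereal s" if "s \<in> {a<..} \<inter> {0..T}" for s using that by (simp add: a(1))
   qed
  qed
 qed
qed

text \<open>The indicator of a given history is an adapted process with left limits; its left limit
  is predictable and is the indicator for the left-continuous history.\<close>

lemma history_left_measurable:
 assumes T: "0 <= T"
 shows "(%p. history_left (snd p) (fst p)) \<in> pred T \<rightarrow>\<^sub>M count_space UNIV"
proof (rule measurable_mode_list[OF countable_lists_UNIV])
 fix l
 define F :: "'e list => real => real" where "F = (%l' t. if l' = l then 1 else 0)"
 have F: "continuous_on UNIV (F l')" for l' by (simp add: F_def)
 have m: "(%p. lm (%t w. F (history t w) t) (snd p) (fst p)) \<in> borel_measurable (pred T)"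
  by (rule lm_predictable[OF T history_process(1)[where F = F, OF F] history_process(2)[where F = F, OF F]]) auto
 have "{p \<in> space (pred T). history_left (snd p) (fst p) = l} =
  (%p. lm (%t w. F (history t w) t) (snd p) (fst p)) -` {1} \<inter> space (pred T)"
  (is "?L = ?R")
 proof (intro set_eqI)
  fix p
  show "p \<in> ?L \<longleftrightarrow> p \<in> ?R"
   using history_process(3)[where F = F, OF F, of "fst p" "snd p"] by (cases p) (auto simp: F_def split: if_splits)
 qed
 also have "\<dots> \<in> sets (pred T)" by (rule measurable_sets[OF m]) simp
 finally show "{p \<in> space (pred T). history_left (snd p) (fst p) = l} \<in> sets (pred T)" .
qed

lemma time_predictable:
 assumes T: "0 <= T" shows "(%p. snd p) \<in> pred T \<rightarrow>\<^sub>M (borel :: real measure)"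
proof -
 note hp = history_process[where F = "%_ t. t", OF continuous_on_id]
 have "(%p. lm (%t w. t) (snd p) (fst p)) \<in> borel_measurable (pred T)"
  by (rule lm_predictable[OF T hp(1,2)]) auto
 then show ?thesis by (rule measurable_cong[THEN iffD1, rotated]) (auto simp: hp(3))
qed

text \<open>For a fixed mode \<open>x\<close> the mark law gives the event probability zero, because
  the kernel does not charge its own mode; countability of the modes allows the union over
  \<open>x\<close>.\<close>

lemma no_self_jump: "AE w in P. \<forall>j\<in>{..<J}. \<tau> (Suc j) w < \<infinity> --> \<gamma> (Suc j) w \<noteq> \<gamma> j w"
proof (rule AE_finite_allI)
 fix j assume "j \<in> {..<J}"
 then have j: "j < J" by simp
 have "AE w in P. \<tau> (Suc j) w < \<infinity> & \<gamma> j w = x --> \<gamma> (Suc j) w \<noteq> x" for x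
 proof -
  define G where "G = (\<tau> (Suc j) -` {..<\<infinity>} \<inter> space (GN j)) \<inter> (\<gamma> j -` {x} \<inter> space (GG j))"
  have gm: "\<gamma> j -` {x} \<inter> space (GG j) \<in> sets (GN j)"
   using measurable_sets[OF mark_GG[OF order.refl], of "{x}" j] sets_GG_GN sets_borel_discrete by auto
  have Gm: "G \<in> sets (GN j)" unfolding G_def by (rule sets.Int[OF measurable_sets[OF time_GN] gm]) simp
  have "emeasure P (G \<inter> {w \<in> space P. \<gamma> (Suc j) w \<in> {x}}) =
   (\<integral>\<^sup>+w. indicator G w * emeasure (Qm (\<gamma> j w) (real_of_ereal (\<tau> (Suc j) w))) {x} \<partial>P)"
   by (rule mark_law_set[OF j Gm]) (use sets_borel_discrete in \<open>auto simp: G_def\<close>)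
  also have "\<dots> = (\<integral>\<^sup>+w. 0 \<partial>P)"
  proof (rule nn_integral_cong)
   fix w assume "w \<in> space P"
   interpret q: prob_space "Qm (\<gamma> j w) (real_of_ereal (\<tau> (Suc j) w))" by (rule Qm_prob)
   have "emeasure (Qm (\<gamma> j w) (real_of_ereal (\<tau> (Suc j) w))) {\<gamma> j w} = 0"
    unfolding q.emeasure_eq_measure by (simp add: Qm_def Q_no_self_jump)
   then show "indicator G w * emeasure (Qm (\<gamma> j w) (real_of_ereal (\<tau> (Suc j) w))) {x} = 0"
    by (auto simp: G_def indicator_def)
  qed
  finally have z: "emeasure P (G \<inter> {w \<in> space P. \<gamma> (Suc j) w \<in> {x}}) = 0" by simp
  have "{w \<in> space P. \<gamma> (Suc j) w \<in> {x}} = \<gamma> (Suc j) -` {x} \<inter> space P" by auto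
  also have "\<dots> \<in> sets P" by (rule measurable_sets[OF mark_measurable]) (simp add: sets_borel_discrete)
  finally have "G \<inter> {w \<in> space P. \<gamma> (Suc j) w \<in> {x}} \<in> null_sets P"
   using z Gm sets_GN by (intro null_setsI sets.Int) auto
  then show ?thesis by (rule AE_I') (auto simp: G_def)
 qed
 then have "AE w in P. \<forall>x\<in>UNIV. \<tau> (Suc j) w < \<infinity> & \<gamma> j w = x --> \<gamma> (Suc j) w \<noteq> x"
  unfolding AE_ball_countable[OF cnt] by blast
 then show "AE w in P. \<tau> (Suc j) w < \<infinity> --> \<gamma> (Suc j) w \<noteq> \<gamma> j w" by eventually_elim auto
qed simp

end

lemma visible_no_self_jump:
 assumes w: "w \<in> space P" and n: "\<forall>j\<in>{..<J}. \<tau> (Suc j) w < \<infinity> --> \<gamma> (Suc j) w \<noteq> \<gamma> j w"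
  and j: "\<tau> j w < \<infinity>"
 shows "visible w j = map (%i. \<gamma> i w) [0..<Suc j]"
 using j
proof (induction j)
 case (Suc j)
 have "\<tau> j w < \<infinity>" using time_infinite[OF w, of j] Suc.prems by (cases "\<tau> j w = \<infinity>") auto
 moreover have "j < J"
 proof (rule ccontr)
  assume "\<not> j < J"
  then show False using time_after_J[OF w, of "Suc j"] Suc.prems by simp
 qed
 then have "\<gamma> (Suc j) w \<noteq> \<gamma> j w" using n Suc.prems by simp
 ultimately show ?case using Suc.IH by (simp add: upd_def)
qed simp

text \<open>The process is sampled at the next dyadic time to the right, capped at \<open>t\<close>
  so that each sample is known at time \<open>t\<close>. For \<open>s = t\<close> the cap makes the
  approximation exact.\<close>

lemma right_continuous_progressive:
 fixes X :: "real => 'w => 'v::euclidean_space"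
 assumes ad: "\<And>t. 0 <= t ==> X t \<in> borel_measurable (FF t)"
  and rc: "\<And>w t. w \<in> space P ==> 0 <= t ==> ((%s. X s w) \<longlongrightarrow> X t w) (at_right t)"
 shows "progressive FF T X"
 unfolding progressive_def
proof
 fix t assume t: "t \<in> {0..T}"
 let ?M = "FF t \<Otimes>\<^sub>M restrict_space (borel :: real measure) {0..t}"
 define a where "a n s = min t ((real_of_int \<lfloor>s * 2 ^ n\<rfloor> + 1) / 2 ^ n)" for n :: nat and s :: real
 have sm: "(%p. snd p) \<in> ?M \<rightarrow>\<^sub>M borel"
  by (rule measurable_compose[OF measurable_snd]) (rule measurable_restrict_space1, simp)
 have sp: "snd p \<in> {0..t}" "fst p \<in> space P" if "p \<in> space ?M" for p using that by (auto simp: space_pair_measure space_restrict_space)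
 show "(%(w, s). X s w) \<in> borel_measurable ?M"
  unfolding case_prod_beta'
 proof (rule borel_measurable_LIMSEQ_metric)
  fix n :: nat
  have X0: "(%p. X (max 0 (min t ((real_of_int k + 1) / 2 ^ n))) (fst p)) \<in> borel_measurable ?M" for k
  proof -
   let ?u = "max 0 (min t ((real_of_int k + 1) / 2 ^ n))"
   have "X ?u \<in> borel_measurable (FF t)"
    using measurable_mono[OF order.refl refl sets_FF_mono[of ?u t] _, of borel] ad[of ?u] t by auto
   then show ?thesis by (rule measurable_compose[OF measurable_fst])
  qed
  have fl: "(%p. \<lfloor>snd p * 2 ^ n\<rfloor>) \<in> ?M \<rightarrow>\<^sub>M count_space UNIV" using sm by measurable
  have "(%p. X (max 0 (a n (snd p))) (fst p)) \<in> borel_measurable ?M"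
   unfolding a_def by (rule measurable_compose_countable'[OF X0 fl]) simp
  then show "(%p. X (max 0 (a n (snd p))) (fst p)) \<in> borel_measurable ?M" .
 next
  fix p assume p: "p \<in> space ?M"
  obtain w s where os: "p = (w, s)" "w \<in> space P" "0 <= s" "s <= t" using sp[OF p] by (cases p) auto
  show "(%n. X (max 0 (a n (snd p))) (fst p)) \<longlonglongrightarrow> X (snd p) (fst p)"
  proof (cases "s = t")
   case True
   have "a n s = t" for n
   proof -
    have "s * 2 ^ n <= real_of_int \<lfloor>s * 2 ^ n\<rfloor> + 1" by linarith
    then have "s <= (real_of_int \<lfloor>s * 2 ^ n\<rfloor> + 1) / 2 ^ n" by (simp add: field_simps)
    then show ?thesis using True by (simp add: a_def)
   qed
   then show ?thesis using os True by simp
  next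
   case False
   have gt: "s < a n s" for n
   proof -
    have "s * 2 ^ n < real_of_int \<lfloor>s * 2 ^ n\<rfloor> + 1" by linarith
    then have "s < (real_of_int \<lfloor>s * 2 ^ n\<rfloor> + 1) / 2 ^ n" by (simp add: field_simps)
    then show ?thesis using False os by (simp add: a_def)
   qed
   have le: "a n s <= s + (1 / 2) ^ n" for n
   proof -
    have "real_of_int \<lfloor>s * 2 ^ n\<rfloor> + 1 <= s * 2 ^ n + 1" by linarith
    then have "(real_of_int \<lfloor>s * 2 ^ n\<rfloor> + 1) / 2 ^ n <= s + (1 / 2) ^ n" by (simp add: field_simps power_one_over)
    then show ?thesis by (simp add: a_def)
   qed
   have "(%n. s + (1 / 2) ^ n) \<longlonglongrightarrow> s + (0 :: real)" by (intro tendsto_intros LIMSEQ_realpow_zero) auto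
   then have up: "(%n. s + (1 / 2) ^ n) \<longlonglongrightarrow> s" by simp
   have lim: "(%n. a n s) \<longlonglongrightarrow> s"
   proof (rule tendsto_sandwich[OF _ _ tendsto_const up])
    show "\<forall>\<^sub>F n in sequentially. s <= a n s" by (intro always_eventually allI less_imp_le gt)
    show "\<forall>\<^sub>F n in sequentially. a n s <= s + (1 / 2) ^ n" by (intro always_eventually allI le)
   qed
   have "a n s \<in> {s<..} & a n s \<noteq> s" for n using gt[of n] by simp
   then have "filterlim (%n. a n s) (at_right s) sequentially" by (simp add: filterlim_at lim)
   from filterlim_compose[OF rc[OF os(2,3)] this] have "(%n. X (a n s) w) \<longlonglongrightarrow> X s w" .
   moreover have "max 0 (a n s) = a n s" for n using gt[of n] os(3) by simp
   ultimately show ?thesis by (simp add: os(1))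
  qed
 qed
qed

end

section \<open>Existence for jump time-homogeneous coefficients\<close>

locale homogeneous_setting = riccati_setting P J lam Q \<gamma>\<^sub>0 \<tau> \<gamma> T K0 A B C N
 for P :: "'w measure" and J and lam :: "'e::metric_space => real => real" and Q and \<gamma>\<^sub>0 and \<tau> and \<gamma> and T K0
  and A :: "real => 'w => real^'n^'n" and B :: "real => 'w => real^'d^'n" and C :: "real => 'e => 'w => real^'n^'n" and N +
 fixes M :: enat and fA :: "'e list => real => real^'n^'n" and fB :: "'e list => real => real^'d^'n"
  and fC :: "'e list => real => 'e => real^'n^'n"
 assumes cnt: "countable (UNIV :: 'e set)" and disc: "\<And>S :: 'e set. open S"
  and hom: "\<And>w t j. w \<in> space P ==> t \<in> {0..T} ==> \<tau> j w < ereal t ==> ereal t <= \<tau> (Suc j) w ==>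
   A t w = fA (map (%i. \<gamma> i w) [0..<Suc j]) t & B t w = fB (map (%i. \<gamma> i w) [0..<Suc j]) t &
   (\<forall>th. C t th w = fC (map (%i. \<gamma> i w) [0..<Suc j]) t th)"
begin

text \<open>The functions of the mode lists are arbitrary outside the times at which some path is in the given list. On these
 times they agree locally with a section of a predictable process, which makes the cut-off coefficients measurable.\<close>

definition ivl where "ivl w j = {r. 0 < r & r < T & \<tau> j w < ereal r & ereal r < \<tau> (Suc j) w}"
definition witness where "witness l = {w \<in> space P. l \<noteq> [] & map (%i. \<gamma> i w) [0..<length l] = l}"
definition cover where "cover l = (\<Union>w\<in>witness l. ivl w (length l - 1))"
text \<open>The bound \<open>K0\<close> on the coefficients holds for almost all paths and times
  only, while \<open>mode_ode\<close> asks for it everywhere; values that are too large are set to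
  zero.\<close>

definition cut :: "'v::euclidean_space => 'v" where "cut x = (if norm x <= K0 then x else 0)"
definition cA where "cA l r = cut (if r \<in> cover l then fA l r else 0)"
definition cB where "cB l r = cut (if r \<in> cover l then fB l r else 0)"
definition cC where "cC l r th = cut (if r \<in> cover l then fC l r th else 0)"

lemma norm_cut: "norm (cut x) <= K0"
 using K0_nonneg by (simp add: cut_def)

lemma open_ivl: "open (ivl w j)"
 unfolding ivl_def by (intro open_Collect_conj open_Collect_less continuous_intros continuous_on_ereal)

lemma ivl_hom:
 assumes w: "w \<in> space P" and r: "r \<in> ivl w j"
 defines "l \<equiv> map (%i. \<gamma> i w) [0..<Suc j]"
 shows "A r w = fA l r" "B r w = fB l r" "C r th w = fC l r th" "r \<in> cover l"
proof -
 have "r \<in> {0..T}" "\<tau> j w < ereal r" "ereal r <= \<tau> (Suc j) w" using r by (auto simp: ivl_def)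
 from hom[OF w this] show "A r w = fA l r" "B r w = fB l r" "C r th w = fC l r th" by (auto simp: l_def)
 have "w \<in> witness l" using w by (simp add: witness_def l_def)
 moreover have "length l - 1 = j" by (simp add: l_def)
 ultimately show "r \<in> cover l" using r unfolding cover_def by blast
qed

text \<open>\<open>cover l\<close> is a union over possibly uncountably many paths. The intervals
  are open, so by Lindelof countably many of them suffice, and on each of them \<open>g\<close>
  agrees with a measurable section.\<close>

lemma coefficient_measurable:
 fixes g :: "'x => 'v::euclidean_space"
 assumes pr: "pr \<in> MM \<rightarrow>\<^sub>M (borel :: real measure)" and sp: "space MM = UNIV"
  and loc: "\<And>w. w \<in> witness l ==> \<exists>h. h \<in> borel_measurable MM & (\<forall>x. pr x \<in> ivl w (length l - 1) --> g x = h x)"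
 shows "(%x. cut (if pr x \<in> cover l then g x else 0)) \<in> borel_measurable MM"
proof -
 obtain F where F: "F \<subseteq> (%w. ivl w (length l - 1)) ` witness l" "countable F" "\<Union>F = \<Union>((%w. ivl w (length l - 1)) ` witness l)"
  by (rule Lindelof[of "(%w. ivl w (length l - 1)) ` witness l"]) (use open_ivl in auto)
 let ?F = "(%S. pr -` S \<inter> space MM) ` F"
 have "(%x. if x \<in> \<Union>?F then g x else 0) \<in> borel_measurable MM"
 proof (rule local_measurable)
  show "countable ?F" using F(2) by simp
  fix S assume "S \<in> ?F"
  then obtain w where w: "w \<in> witness l" "S = pr -` ivl w (length l - 1) \<inter> space MM" using F(1) by auto
  show "S \<in> sets MM" unfolding w(2) by (rule measurable_sets[OF pr borel_open[OF open_ivl]])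
  show "\<exists>h. h \<in> borel_measurable MM & (\<forall>x\<in>S. g x = h x)" using loc[OF w(1)] w(2) by auto
 qed
 moreover have "x \<in> \<Union>?F \<longleftrightarrow> pr x \<in> cover l" for x using F(3) sp unfolding cover_def by auto
 ultimately have m: "(%x. if pr x \<in> cover l then g x else 0) \<in> borel_measurable MM" by simp
 have "(cut :: 'v => 'v) \<in> borel_measurable borel" unfolding cut_def by measurable
 from measurable_compose[OF m this] show ?thesis .
qed

lemma coefficients_measurable:
 "cA l \<in> borel_measurable borel" "cB l \<in> borel_measurable borel"
 "(%p. cC l (fst p) (snd p)) \<in> borel_measurable (borel \<Otimes>\<^sub>M borel)"
proof -
 have wl: "w \<in> space P" "map (%i. \<gamma> i w) [0..<Suc (length l - 1)] = l" if "w \<in> witness l" for w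
  using that by (auto simp: witness_def)
 have cl: "clp T r = r" if "r \<in> ivl w j" for r w j using that by (intro clp_eq) (auto simp: ivl_def)
 show "cA l \<in> borel_measurable borel"
  unfolding cA_def
 proof (rule coefficient_measurable)
  fix w assume w: "w \<in> witness l"
  show "\<exists>h. h \<in> borel_measurable borel & (\<forall>x. x \<in> ivl w (length l - 1) --> fA l x = h x)"
   using predictable_section[OF T0 wl(1)[OF w] A_pred] ivl_hom(1)[OF wl(1)[OF w], of _ "length l - 1"] cl[of _ w "length l - 1"]
   unfolding wl(2)[OF w] by (intro exI[of _ "%r. A (clp T r) w"]) auto
 qed auto
 show "cB l \<in> borel_measurable borel"
  unfolding cB_def
 proof (rule coefficient_measurable)
  fix w assume w: "w \<in> witness l"
  show "\<exists>h. h \<in> borel_measurable borel & (\<forall>x. x \<in> ivl w (length l - 1) --> fB l x = h x)"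
   using predictable_section[OF T0 wl(1)[OF w] B_pred] ivl_hom(2)[OF wl(1)[OF w], of _ "length l - 1"] cl[of _ w "length l - 1"]
   unfolding wl(2)[OF w] by (intro exI[of _ "%r. B (clp T r) w"]) auto
 qed auto
 show "(%p. cC l (fst p) (snd p)) \<in> borel_measurable (borel \<Otimes>\<^sub>M borel)"
  unfolding cC_def
 proof (rule coefficient_measurable)
  fix w assume w: "w \<in> witness l"
  show "\<exists>h. h \<in> borel_measurable (borel \<Otimes>\<^sub>M borel) & (\<forall>x. fst x \<in> ivl w (length l - 1) --> fC l (fst x) (snd x) = h x)"
   using predictable_field_section[OF T0 wl(1)[OF w] C_pred] ivl_hom(3)[OF wl(1)[OF w], of _ "length l - 1"] cl[of _ w "length l - 1"]
   unfolding wl(2)[OF w] by (intro exI[of _ "%x. C (clp T (fst x)) (snd x) w"]) auto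
 qed (auto simp: space_pair_measure)
qed

definition good :: "'e list => ('e => real => real^'n^'n) => (real => real^'n^'n) => bool" where
 "good l U S \<longleftrightarrow> backward_ode 0 T S (%r. driver (lam (last l) (max 0 r)) (Qm (last l) r) (cA l r) (cB l r) (cC l r) N (S r)
   (%th. U th (clp T r) - S r))"

definition "cM = tm M * exp (- kl Kup * T)"

definition bnd :: "(real => real^'n^'n) => bool" where
 "bnd S \<longleftrightarrow> continuous_on UNIV S & S T = mat (tm M) & (\<forall>t\<in>{0..T}. S t \<in> sym_mats & mat cM \<preceq> S t & S t \<preceq> mat Kup)"

text \<open>\<open>sg i l\<close> solves the equation after the modes in \<open>l\<close> have been
  visited, with \<open>i\<close> jumps left; the solutions for the lists extended by one mode are
  the values after the next jump. With no jump left coefficients and rate vanish, and the solution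
  is the constant terminal value.\<close>

primrec sg :: "nat => 'e list => real => real^'n^'n" where
 "sg 0 l = (%t. mat (tm M))"
| "sg (Suc i) l = (SOME S. good l (%th. sg i (l @ [th])) S & bnd S)"

lemma cM: "0 <= cM" "cM <= tm M"
proof -
 show "0 <= cM" by (simp add: cM_def tm_bounds)
 have "exp (- kl Kup * T) <= 1" using k_nonneg(3)[OF less_imp_le[OF Kup_pos]] T0 by simp
 then show "cM <= tm M" unfolding cM_def using mult_left_mono[of "exp (- kl Kup * T)" 1 "tm M"] tm_bounds(1) by simp
qed

lemma bndD:
 assumes "bnd S" "t \<in> {0..T}"
 shows "S t \<in> sym_mats" "mat cM \<preceq> S t" "S t \<preceq> mat Kup" "possemidef (S t)" "norm (S t) <= real CARD('n) * Kup"
proof -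
 show 1: "S t \<in> sym_mats" "mat cM \<preceq> S t" "S t \<preceq> mat Kup" using assms by (auto simp: bnd_def)
 have "mat 0 \<preceq> S t" by (rule loewner_le_trans[OF mat_le_mat[OF cM(1)] 1(2)])
 then show 2: "possemidef (S t)" by (simp only: mat_zero_loewner)
 show "norm (S t) <= real CARD('n) * Kup" by (rule loewner_interval_norm_le[OF 2 1(3)])
qed

lemma sg_step:
 assumes U: "\<And>th. bnd (U th)" shows "\<exists>S. good l U S & bnd S"
proof -
 have cl: "clp T r \<in> {0..T}" for r by (rule clp_in[OF T0])
 have Uc: "U th \<in> borel_measurable borel" for th using U[of th] by (intro borel_measurable_continuous_onI) (simp add: bnd_def)
 have "(%p. snd p) \<in> (borel :: real measure) \<Otimes>\<^sub>M (borel :: 'e measure) \<rightarrow>\<^sub>M count_space UNIV"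
  by (rule mark_count_space[OF cnt disc measurable_snd])
 \<comment> \<open>Countability of the modes makes a family of continuous functions jointly
   measurable in time and mode.\<close>
 then have Um: "(%p. U (snd p) (clp T (fst p))) \<in> borel_measurable (borel \<Otimes>\<^sub>M borel)"
  by (rule measurable_compose_countable'[where f = "%th p. U th (clp T (fst p))", rotated])
   (intro cnt measurable_compose[OF measurable_fst measurable_compose[OF clp_measurable Uc]])+
 have nc: "norm (cA l r) <= K0" "norm (cB l r) <= K0" "norm (cC l r th) <= K0" for r th
  by (simp_all add: cA_def cB_def cC_def norm_cut)
 obtain S where S: "continuous_on UNIV S" "S T = mat (tm M)"
  "backward_ode 0 T S (%r. driver (lam (last l) (max 0 r)) (Qm (last l) r) (cA l r) (cB l r) (cC l r) N (S r) (%th. U th (clp T r) - S r))"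
  "\<And>t. t \<in> {0..T} ==> mat (tm M * exp (- kl Kup * T)) \<preceq> S t" "\<And>t. t \<in> {0..T} ==> S t \<preceq> mat Kup"
  by (rule mode_ode[where x = "last l" and m = "tm M", OF coefficients_measurable(1)[of l] nc(1) coefficients_measurable(2)[of l] nc(2)
     coefficients_measurable(3)[of l] nc(3) Um bndD(5)[OF U cl] bndD(4)[OF U cl] tm_bounds]) (rule that; (assumption | blast))
 have "S t \<in> sym_mats" if "t \<in> {0..T}" for t using S(3) that by (simp add: backward_ode_def)
 then show ?thesis using S unfolding good_def bnd_def cM_def by blast
qed

lemma sg_bnd: "bnd (sg i l)"
proof (induction i arbitrary: l)
 case 0
 have "1 <= Kup" unfolding Kup_def using k_nonneg(1,2) T0 by simp
 then have "tm M <= Kup" using tm_bounds(2)[of M] by linarith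
 then show ?case using cM by (simp add: bnd_def sym_mats_mat mat_le_mat)
next
 case (Suc i)
 show ?case using someI_ex[OF sg_step[of "%th. sg i (l @ [th])" l, OF Suc.IH]] by simp
qed

lemma sg_good: "good l (%th. sg i (l @ [th])) (sg (Suc i) l)"
 using someI_ex[OF sg_step[of "%th. sg i (l @ [th])" l, OF sg_bnd]] by simp

text \<open>A list contains the initial mode, so after \<open>j\<close> jumps its length is
  \<open>j + 1\<close> and \<open>J - j\<close> jumps are left.\<close>

definition "sig l = sg (Suc J - length l) l"
definition "SS t w = sig (history t w) t"
text \<open>The list is extended by \<open>@\<close> and not by \<open>upd\<close>. The two differ
  only for a jump to the current mode, and such jumps have probability zero.\<close>

definition "TT t th w = sig (history_left t w @ [th]) (clp T t) - sig (history_left t w) (clp T t)"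

lemma sig_bnd: "bnd (sig l)" unfolding sig_def by (rule sg_bnd)

lemma sig_continuous: "continuous_on UNIV (sig l)" using sig_bnd by (simp add: bnd_def)

lemmas SS_process = history_process[OF cnt disc, where F = sig, OF sig_continuous, folded SS_def]

lemma SS_eq: "w \<in> space P ==> \<tau> j w <= ereal t ==> ereal t < \<tau> (Suc j) w ==> SS t w = sig (visible w j) t"
 unfolding SS_def by (simp only: history_eq)

lemma TT_eq: "w \<in> space P ==> t \<in> {0..T} ==> \<tau> j w < ereal t ==> ereal t <= \<tau> (Suc j) w ==>
  TT t th w = sig (visible w j @ [th]) t - sig (visible w j) t"
 unfolding TT_def by (simp only: history_left_eq clp_eq)

lemma TT_sym: "TT t th w \<in> sym_mats"
 unfolding TT_def by (intro sym_mats_diff bndD(1)[OF sig_bnd clp_in[OF T0]])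

lemma SS_progressive: "progressive FF T SS"
proof (rule right_continuous_progressive)
 show "SS t \<in> borel_measurable (FF t)" if "0 <= t" for t by (rule SS_process(1)[OF that])
 fix w t assume "w \<in> space P" "0 <= (t :: real)"
 then show "((%s. SS s w) \<longlongrightarrow> SS t w) (at_right t)"
  using SS_process(2)[of w "t + 1"] by (simp add: cadlag_on_def)
qed

lemma TT_field: "predictable_field P FF T TT"
proof -
 let ?M = "pred T \<Otimes>\<^sub>M (borel :: 'e measure)"
 have t: "(%z. clp T (snd (fst z))) \<in> ?M \<rightarrow>\<^sub>M borel"
  by (rule measurable_compose[OF measurable_compose[OF measurable_fst time_predictable[OF cnt disc T0]] clp_measurable])
 have s: "(%z. sig l (clp T (snd (fst z)))) \<in> borel_measurable ?M" for l
  by (rule measurable_compose[OF t borel_measurable_continuous_onI[OF sig_continuous]])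
 have hl: "(%z. history_left (snd (fst z)) (fst (fst z))) \<in> ?M \<rightarrow>\<^sub>M count_space UNIV"
  by (rule measurable_compose[OF measurable_fst history_left_measurable[OF cnt disc T0]])
 have th: "(%z. snd z) \<in> ?M \<rightarrow>\<^sub>M count_space UNIV" by (rule mark_count_space[OF cnt disc measurable_snd])
 have 1: "(%z. sig (l @ [snd z]) (clp T (snd (fst z))) - sig l (clp T (snd (fst z)))) \<in> borel_measurable ?M" for l
  by (intro borel_measurable_diff s measurable_compose_countable'[where f = "%th z. sig (l @ [th]) (clp T (snd (fst z)))", OF _ th cnt])
 have "(%z. TT (snd (fst z)) (snd z) (fst (fst z))) \<in> borel_measurable ?M"
  unfolding TT_def
  by (rule measurable_compose_countable'[where f = "%l z. sig (l @ [snd z]) (clp T (snd (fst z))) - sig l (clp T (snd (fst z)))",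
     OF 1 hl countable_lists_UNIV[OF cnt disc]])
 then show ?thesis unfolding predictable_field_def case_prod_beta' .
qed

definition "LS = 2 * (real CARD('n) * Kup)"

lemma SS_norm: "t \<in> {0..T} ==> norm (SS t w) <= LS" and TT_norm: "norm (TT t th w) <= LS"
proof -
 have 0: "0 <= real CARD('n) * Kup" using Kup_pos by simp
 have b: "norm (sig l t) <= real CARD('n) * Kup" if "t \<in> {0..T}" for l t by (rule bndD(5)[OF sig_bnd that])
 show "norm (SS t w) <= LS" if "t \<in> {0..T}" unfolding SS_def LS_def by (rule order.trans[OF b[OF that]]) (use Kup_pos in simp)
 show "norm (TT t th w) <= LS"
  unfolding TT_def LS_def mult_2 by (rule order.trans[OF norm_triangle_ineq4 add_mono[OF b b]]; rule clp_in[OF T0])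
qed

text \<open>Away from the jump times the sum telescopes to the solution for the extended list, so it
  inherits the bounds of that solution for every \<open>th\<close>.\<close>

lemma SS_TT_lower:
 assumes w: "w \<in> space P"
 shows "AE r in lborel. r \<in> {0<..T} --> (\<forall>th. SS r w + TT r th w \<in> {X. mat cM \<preceq> X})"
proof -
 have "AE r in lborel. \<forall>j\<in>{..Suc J}. r \<noteq> real_of_ereal (\<tau> j w)"
  by (rule AE_finite_allI) (use AE_lborel_singleton in auto)
 then show ?thesis
 proof eventually_elim
  case (elim r)
  show ?case
  proof (intro impI allI)
   fix th assume r: "r \<in> {0<..T}"
   then have r0: "0 < r" "r \<in> {0..T}" by auto
   obtain j where j: "j <= J" "\<tau> j w < ereal r" "ereal r <= \<tau> (Suc j) w" by (rule index_exists'[OF w r0(1)])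
   have "ereal r \<noteq> \<tau> (Suc j) w" using elim j(1) by (metis Suc_le_mono atMost_iff real_of_ereal.simps(1))
   then have lt: "ereal r < \<tau> (Suc j) w" using j(3) by simp
   have "SS r w + TT r th w = sig (visible w j @ [th]) r"
    unfolding TT_eq[OF w r0(2) j(2,3)] SS_eq[OF w less_imp_le[OF j(2)] lt] by simp
   then show "SS r w + TT r th w \<in> {X. mat cM \<preceq> X}" using bndD(2)[OF sig_bnd r0(2)] by simp
  qed
 qed
qed

lemma SS_good_path: "AE w in P. good_path T K0 LS w (%t. SS t w) (%t th. TT t th w) (%t. A t w) (%t. B t w) (%t th. C t th w)"
proof (rule good_pathI[OF SS_progressive _ TT_field TT_sym])
 show "SS t w \<in> sym_mats" if "t \<in> {0..T}" for w t unfolding SS_def by (rule bndD(1)[OF sig_bnd that])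
 show "AE w in P. AE r in lborel. r \<in> {0<..T} --> norm (SS r w) <= LS &
   (crate w r \<noteq> 0 --> (AE th in ck w r. norm (TT r th w) <= LS & possemidef (SS r w + TT r th w)))"
  using AE_space
 proof eventually_elim
  case (elim w)
  from SS_TT_lower[OF elim] show ?case
  proof eventually_elim
   case (elim r)
   show ?case
   proof (intro impI conjI AE_I2)
    assume r: "r \<in> {0<..T}"
    then show "norm (SS r w) <= LS" by (intro SS_norm) auto
    fix th show "norm (TT r th w) <= LS" by (rule TT_norm)
    have "mat cM \<preceq> SS r w + TT r th w" using elim r by blast
    then have "mat 0 \<preceq> SS r w + TT r th w" by (rule loewner_le_trans[OF mat_le_mat[OF cM(1)]])
    then show "possemidef (SS r w + TT r th w)" by (simp only: mat_zero_loewner)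
   qed
  qed
 qed
qed

lemma visible_length:
 assumes "w \<in> space P" "\<forall>j\<in>{..<J}. \<tau> (Suc j) w < \<infinity> --> \<gamma> (Suc j) w \<noteq> \<gamma> j w" "\<tau> j w < \<infinity>"
 shows "length (visible w j) = Suc j"
 unfolding visible_no_self_jump[OF assms] by simp

text \<open>Without self-jumps the visible history is the list of all marks, and inside the open
  interval the cut-off coefficients of this list are the coefficients of the path.\<close>

lemma drv_eq:
 assumes w: "w \<in> space P" and n: "\<forall>j\<in>{..<J}. \<tau> (Suc j) w < \<infinity> --> \<gamma> (Suc j) w \<noteq> \<gamma> j w"
  and j: "j < J" and r: "r \<in> ivl w j"
  and bd: "norm (A r w) <= K0" "norm (B r w) <= K0" "\<And>th. norm (C r th w) <= K0"
 defines "l \<equiv> visible w j"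
 shows "drv SS TT w r = driver (lam (last l) (max 0 r)) (Qm (last l) r) (cA l r) (cB l r) (cC l r) N (sig l r)
   (%th. sig (l @ [th]) (clp T r) - sig l r)"
proof -
 have r2: "0 < r" "r \<in> {0..T}" "\<tau> j w < ereal r" "ereal r < \<tau> (Suc j) w" using r by (auto simp: ivl_def)
 have "\<tau> j w < \<infinity>" using r2(3) by (rule less_trans) simp
 then have l: "l = map (%i. \<gamma> i w) [0..<Suc j]" unfolding l_def by (rule visible_no_self_jump[OF w n])
 note h = ivl_hom[OF w r, folded l]
 have c: "cA l r = A r w" "cB l r = B r w" "cC l r = (%th. C r th w)"
  using h bd by (auto simp: cA_def cB_def cC_def cut_def)
 have ix: "idx w r = j" by (rule idx_eq(1)[OF w r2(3) less_imp_le[OF r2(4)]])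
 have "crate w r = lam (last l) (max 0 r)" "ck w r = Qm (last l) r"
  using ix j r2(1) by (auto simp: crate_def ck_def l_def)
 moreover have "SS r w = sig l r" unfolding l_def by (rule SS_eq[OF w less_imp_le[OF r2(3)] r2(4)])
 moreover have "(%th. TT r th w) = (%th. sig (l @ [th]) (clp T r) - sig l r)"
  unfolding l_def TT_eq[OF w r2(2,3) less_imp_le[OF r2(4)]] clp_eq[OF r2(2)] ..
 ultimately show ?thesis unfolding path_driver_def c by simp
qed

lemma sig_increment:
 assumes w: "w \<in> space P" and n: "\<forall>j\<in>{..<J}. \<tau> (Suc j) w < \<infinity> --> \<gamma> (Suc j) w \<noteq> \<gamma> j w"
  and bd: "AE r in lborel. r \<in> {0..T} --> norm (A r w) <= K0 & norm (B r w) <= K0" "\<forall>r\<in>{0..T}. \<forall>th. norm (C r th w) <= K0"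
  and di: "set_integrable lborel {0<..T} (drv SS TT w)"
  and j: "j <= J" and s: "0 <= s" "s <= t" "t <= T" "\<tau> j w <= ereal s" "ereal t <= \<tau> (Suc j) w"
 shows "sig (visible w j) s - sig (visible w j) t = (LINT r:{s<..t}|lborel. drv SS TT w r)"
proof (cases "j = J")
 case True
 have "\<tau> j w < \<infinity>" using s(4) by (rule le_less_trans) simp
 then have "length (visible w j) = Suc J" using visible_length[OF w n] True by blast
 then have "sig (visible w j) = (%t. mat (tm M))" by (simp add: sig_def)
 \<comment> \<open>After the last jump the rate is zero and the coefficients vanish, which matches
   the constant solution chosen for lists of full length.\<close>
 moreover have "drv SS TT w r = 0" if r: "r \<in> {s<..t}" for r
 proof -
  have r2: "r \<in> {0..T}" "0 < r" using r s by auto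
  have lt: "\<tau> J w < ereal r" using s(4) r True by (auto intro: le_less_trans)
  have "idx w r = J" by (rule idx_eq(1)[OF w lt]) (simp add: time_Suc_J[OF w])
  then have "crate w r = 0" by (simp add: crate_def)
  then show ?thesis using coeff_zero[OF w r2(1) lt]
   by (simp add: path_driver_def driver_def bounded_bilinear.zero_left[OF bounded_bilinear_matrix_mult]
    bounded_bilinear.zero_right[OF bounded_bilinear_matrix_mult] transpose_def zero_vec_def[symmetric])
 qed
 then have "(LINT r:{s<..t}|lborel. drv SS TT w r) = (LINT r:{s<..t}|lborel. 0)"
  by (intro set_lebesgue_integral_cong) auto
 ultimately show ?thesis by (simp add: set_lebesgue_integral_def)
next
 case False
 then have jJ: "j < J" using j by simp
 have "\<tau> j w < \<infinity>" using s(4) by (rule le_less_trans) simp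
 then have len: "length (visible w j) = Suc j" using visible_length[OF w n] by blast
 define l where "l = visible w j"
 obtain i where i: "J - j = Suc i" using jJ by (cases "J - j") auto
 have "J - Suc j = i" using i by simp
 with len i have sl: "sig l = sg (Suc i) l" "sig (l @ [th]) = sg i (l @ [th])" for th by (auto simp: sig_def l_def)
 let ?D = "%r. driver (lam (last l) (max 0 r)) (Qm (last l) r) (cA l r) (cB l r) (cC l r) N (sig l r) (%th. sig (l @ [th]) (clp T r) - sig l r)"
 have ode: "backward_ode 0 T (sig l) ?D" using sg_good[of l i] unfolding good_def sl .
 have "sig l s - sig l t = (LINT r:{s<..t}|lborel. ?D r)" using ode s(1,2,3) by (simp add: backward_ode_def)
 also have "\<dots> = (LINT r:{s<..t}|lborel. drv SS TT w r)"
  unfolding set_lebesgue_integral_def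
 proof (rule integral_cong_AE)
  have "set_integrable lborel {s<..t} ?D" "set_integrable lborel {s<..t} (drv SS TT w)"
   using ode di s by (auto simp: backward_ode_def intro: set_integrable_subset)
  then show "(%r. indicator {s<..t} r *\<^sub>R ?D r) \<in> borel_measurable lborel" "(%r. indicator {s<..t} r *\<^sub>R drv SS TT w r) \<in> borel_measurable lborel"
   unfolding set_integrable_def by (auto dest: borel_measurable_integrable)
  \<comment> \<open>The intervals \<open>ivl\<close> are open, and the right end point
    \<open>t\<close> may be the next jump time.\<close>
  have "AE r in lborel. r \<noteq> t" by (rule AE_lborel_singleton)
  with bd(1) show "AE r in lborel. indicator {s<..t} r *\<^sub>R ?D r = indicator {s<..t} r *\<^sub>R drv SS TT w r"
  proof eventually_elim
   case (elim r)
   show ?case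
   proof (cases "r \<in> {s<..t}")
    case True
    then have r: "s < r" "r < t" "r \<in> {0..T}" using elim(2) s by auto
    have "\<tau> j w < ereal r" by (rule le_less_trans[OF s(4)]) (use r in simp)
    moreover have "ereal r < \<tau> (Suc j) w" by (rule less_le_trans[OF _ s(5)]) (use r in simp)
    ultimately have "r \<in> ivl w j" using r s by (auto simp: ivl_def)
    from drv_eq[OF w n jJ this, folded l_def] show ?thesis using elim(1) bd(2) r(3) by simp
   qed simp
  qed
 qed
 finally show ?thesis unfolding l_def .
qed

lemma jsum_index:
 assumes w: "w \<in> space P" and t: "\<tau> j w <= ereal t" "ereal t < \<tau> (Suc j) w"
 shows "jsum \<Theta> w t = (\<Sum>k | k \<in> jumps w & j < k & \<tau> k w <= ereal T. \<Theta> (real_of_ereal (\<tau> k w)) (\<gamma> k w) w)"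
proof -
 have "ereal t < \<tau> k w \<longleftrightarrow> j < k" for k
 proof
  assume "ereal t < \<tau> k w"
  show "j < k"
  proof (rule ccontr)
   assume "\<not> j < k"
   then have "\<tau> k w <= \<tau> j w" by (intro time_mono[OF w]) simp
   with t(1) have "\<tau> k w <= ereal t" by (rule order.trans[rotated])
   with \<open>ereal t < \<tau> k w\<close> show False by simp
  qed
 next
  assume "j < k"
  then have "\<tau> (Suc j) w <= \<tau> k w" by (intro time_mono[OF w]) simp
  with t(2) show "ereal t < \<tau> k w" by (rule less_le_trans)
 qed
 then show ?thesis unfolding jsum_def by simp
qed

text \<open>Up to the next jump the increment is that of the solution for the current list; at the
  jump, \<open>TT\<close> is the difference between the solutions for the new and the old list. The
  remainder is the same statement with one jump less.\<close>

lemma SS_equation: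
 assumes w: "w \<in> space P" and n: "\<forall>j\<in>{..<J}. \<tau> (Suc j) w < \<infinity> --> \<gamma> (Suc j) w \<noteq> \<gamma> j w"
  and bd: "AE r in lborel. r \<in> {0..T} --> norm (A r w) <= K0 & norm (B r w) <= K0" "\<forall>r\<in>{0..T}. \<forall>th. norm (C r th w) <= K0"
  and di: "set_integrable lborel {0<..T} (drv SS TT w)"
  and j: "j <= J" and t: "t \<in> {0..T}" "\<tau> j w <= ereal t" "ereal t < \<tau> (Suc j) w"
 shows "mat (tm M) - SS t w = jsum TT w t - (LINT r:{t<..T}|lborel. drv SS TT w r)"
 using j t
proof (induction "J - j" arbitrary: j t rule: less_induct)
 case less
 note j = less.prems(1) and t = less.prems(2-4)
 let ?I = "%s t. LINT r:{s<..t}|lborel. drv SS TT w r"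
 note inc = sig_increment[OF w n bd di j _ _ _ t(2)]
 have St: "SS t w = sig (visible w j) t" by (rule SS_eq[OF w t(2,3)])
 show ?case
 proof (cases "\<tau> (Suc j) w <= ereal T")
  case False
  then have "ereal T <= \<tau> (Suc j) w" by simp
  then have "sig (visible w j) t - sig (visible w j) T = ?I t T" using inc[of T] t(1) by simp
  moreover have "sig (visible w j) T = mat (tm M)" using sig_bnd by (simp add: bnd_def)
  moreover have "jsum TT w t = 0"
   unfolding jsum_index[OF w t(2,3)]
  proof (rule sum.neutral, rule ballI)
   fix k assume k: "k \<in> {k. k \<in> jumps w & j < k & \<tau> k w <= ereal T}"
   then have "\<tau> (Suc j) w <= \<tau> k w" by (intro time_mono[OF w]) simp
   with k False have False by (auto dest: order.trans)
   then show "TT (real_of_ereal (\<tau> k w)) (\<gamma> k w) w = 0" ..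
  qed
  ultimately show ?thesis unfolding St by (simp add: algebra_simps)
 next
  case True
  have jJ: "j < J"
  proof (rule ccontr)
   assume "\<not> j < J"
   then have "j = J" using j by simp
   then show False using True time_Suc_J[OF w] by simp
  qed
  define u where "u = real_of_ereal (\<tau> (Suc j) w)"
  have u: "u \<in> {0<..T}" "ereal u = \<tau> (Suc j) w" using jump_time_in[OF w _ True] by (auto simp: u_def)
  have fin: "\<tau> (Suc j) w < \<infinity>" using True by (rule le_less_trans) simp
  have uj: "\<tau> (Suc j) w <= ereal u" "ereal u < \<tau> (Suc (Suc j)) w" using u(2) time_less[OF w fin] by auto
  have tu: "t < u" using t(3) u(2) by (metis ereal_less(1) less_ereal.simps(1))
  have uT: "u \<in> {0..T}" using u(1) by simp
  \<comment> \<open>Here the absence of self-jumps enters: the visible history grows exactly as the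
    list used in \<open>TT\<close>.\<close>
  have vis: "visible w (Suc j) = visible w j @ [\<gamma> (Suc j) w]"
   using n jJ fin by (auto simp: upd_def)
  have Su: "SS u w = sig (visible w j @ [\<gamma> (Suc j) w]) u" unfolding SS_eq[OF w uj] vis ..
  have IH: "mat (tm M) - SS u w = jsum TT w u - ?I u T"
   by (rule less.hyps[of "Suc j" u]) (use jJ uT uj in auto)
  have "\<tau> j w < ereal u" by (rule le_less_trans[OF t(2)]) (use tu in simp)
  then have TTu: "TT u (\<gamma> (Suc j) w) w = sig (visible w j @ [\<gamma> (Suc j) w]) u - sig (visible w j) u"
   by (rule TT_eq[OF w uT]) (simp add: u(2))
  have i1: "sig (visible w j) t - sig (visible w j) u = ?I t u"
   by (rule inc) (use t tu u in auto)
  have i2: "?I t T - ?I u T = ?I t u"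
   by (rule set_integral_Ioc_diff[OF di]) (use t tu u in auto)
  have seteq: "{k. k \<in> jumps w & j < k & \<tau> k w <= ereal T} = insert (Suc j) {k. k \<in> jumps w & Suc j < k & \<tau> k w <= ereal T}"
   using True fin jJ by (auto simp: jumps_def less_Suc_eq_le Suc_le_eq le_less)
  have js: "jsum TT w t = TT u (\<gamma> (Suc j) w) w + jsum TT w u"
   unfolding jsum_index[OF w t(2,3)] jsum_index[OF w uj] seteq by (subst sum.insert) (auto simp: finite_jumps u_def)
  have "mat (tm M) - SS t w = (mat (tm M) - SS u w) + (SS u w - sig (visible w j) u) - (sig (visible w j) t - sig (visible w j) u)"
   unfolding St by simp
  also have "\<dots> = (jsum TT w u - ?I u T) + TT u (\<gamma> (Suc j) w) w - ?I t u"
   unfolding IH i1 TTu unfolding Su ..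
  also have "\<dots> = jsum TT w t - ?I t T" unfolding js i2[symmetric] by (simp add: algebra_simps)
  finally show ?thesis .
 qed
qed

text \<open>For finite \<open>M\<close> positivity of \<open>cM\<close> comes from
  \<open>0 < tm M\<close>, which uses \<open>1 \<le> M\<close>.\<close>

lemma pos_type_lower:
 assumes "X \<in> sym_mats" "mat cM \<preceq> X" and M: "1 <= M"
 shows "pos_type M X"
proof (cases M)
 case (enat m)
 then have "1 <= m" using M by (simp add: one_enat_def)
 then have "0 < tm M" by (simp add: tm_def enat)
 then have "0 < cM" unfolding cM_def by simp
 from mat_loewner_le_posdef[OF assms(2) this assms(1)] show ?thesis by (simp add: pos_type_def enat)
next
 case infinity
 have "mat 0 \<preceq> X" by (rule loewner_le_trans[OF mat_le_mat[OF cM(1)] assms(2)])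
 then have "possemidef X" by (simp only: mat_zero_loewner)
 then show ?thesis by (simp add: pos_type_def infinity)
qed

lemma SS_solution:
 assumes M: "1 <= M" shows "sol M SS TT"
 unfolding riccati_solution_def
proof (intro conjI ballI impI)
 have Ssym: "SS t w \<in> sym_mats" "mat cM \<preceq> SS t w" if "t \<in> {0..T}" for w t
  unfolding SS_def using bndD(1,2)[OF sig_bnd that] by auto
 show "SS \<in> Linf_D P FF T sym_mats"
  unfolding Linf_D_def
 proof (intro CollectI conjI ballI SS_progressive)
  show "cadlag_on T (%t. SS t w)" if "w \<in> space P" for w by (rule SS_process(2)[OF that])
  show "\<exists>K. AE w in P. \<forall>t\<in>{0..T}. norm (SS t w) <= K" using SS_norm by (intro exI[of _ LS] AE_I2) blast
 qed (rule Ssym)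
 show "TT \<in> Linf_q P FF T (jump_measure J \<tau> \<gamma>) sym_mats"
  unfolding Linf_q_def
 proof (intro CollectI conjI ballI allI TT_sym TT_field)
  show "\<exists>K. AE w in P. AE (t, th) in jump_measure J \<tau> \<gamma> w. t \<in> {0..T} --> norm (TT t th w) <= K"
   using TT_norm by (intro exI[of _ LS] AE_I2) auto
 qed
 show "AE (w, t) in P \<Otimes>\<^sub>M restrict_space lborel {0..T}. pos_type M (SS t w)"
  by (rule AE_I2) (auto simp: space_pair_measure space_restrict_space intro!: pos_type_lower Ssym M)
 show "AE w in P. AE (t, th) in compensator J lam Q \<tau> \<gamma> w. t \<in> {0..T} --> pos_type M (SS t w + TT t th w)"
  using AE_space
 proof eventually_elim
  case (elim w)
  have "AE r in lborel. r \<in> {0<..T} --> crate w r \<noteq> 0 --> (AE th in ck w r. SS r w + TT r th w \<in> {X. mat cM \<preceq> X})"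
   using SS_TT_lower[OF elim] by eventually_elim (intro impI AE_I2, blast)
  then have "AE x in compensator J lam Q \<tau> \<gamma> w. fst x \<in> {0..T} --> SS (fst x) w + TT (fst x) (snd x) w \<in> {X. mat cM \<preceq> X}"
   unfolding compensator_closed_iff[OF elim SS_progressive TT_field borel_closed[OF closed_loewner(2)]] .
  then show ?case
  proof eventually_elim
   case (elim x)
   show ?case
   proof (cases x)
    case (Pair t th)
    have "pos_type M (SS t w + TT t th w)" if "t \<in> {0..T}"
     by (rule pos_type_lower[OF sym_mats_add[OF Ssym(1)[OF that] TT_sym] _ M]) (use elim Pair that in simp)
    then show ?thesis by (simp add: Pair)
   qed
  qed
 qed
 show "continuous (at t within {0..T}) (%s. SS s w)" if "w \<in> space P" "t \<in> {0..T}" "\<forall>j\<in>{1..J}. \<tau> j w \<noteq> ereal t" for w t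
  by (rule SS_process(4)[OF that])
 show "AE w in P. \<forall>t\<in>{0..T}. terminal_value M - SS t w =
     (LINT x:{t<..T} \<times> UNIV|compensator J lam Q \<tau> \<gamma> w.
       jump_generator (C (fst x) (snd x) w) (SS (fst x) w) (TT (fst x) (snd x) w))
     + compensated_integral (jump_measure J \<tau> \<gamma> w) (compensator J lam Q \<tau> \<gamma> w)
       ({t<..T} \<times> UNIV) (%x. TT (fst x) (snd x) w)
     + (LINT r:{t<..T}|lborel. A r w ** SS r w + SS r w ** transpose (A r w)
        - real N *\<^sub>R (B r w ** transpose (B r w)))"
  using SS_good_path no_self_jump[OF cnt disc] coeff_bound AE_space
 proof eventually_elim
  case (elim w)
  note g = elim(1) and n = elim(2) and w = elim(4)
  have L0: "0 <= LS" using Kup_pos by (simp add: LS_def)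
  note rhs = path_rhs[OF g K0_nonneg L0 T0]
  show ?case
  proof
   fix t assume t: "t \<in> {0..T}"
   then have "0 <= t" by simp
   then obtain j where j: "j <= J" "\<tau> j w <= ereal t" "ereal t < \<tau> (Suc j) w" by (rule index_exists[OF w])
   have "terminal_value M - SS t w = jsum TT w t - (LINT r:{t<..T}|lborel. drv SS TT w r)"
    unfolding terminal_value_tm
    by (rule SS_equation[OF w n conjunct1[OF elim(3)] conjunct2[OF elim(3)] rhs(1) j(1) t j(2,3)])
   then show "terminal_value M - SS t w =
     (LINT x:{t<..T} \<times> UNIV|compensator J lam Q \<tau> \<gamma> w.
       jump_generator (C (fst x) (snd x) w) (SS (fst x) w) (TT (fst x) (snd x) w))
     + compensated_integral (jump_measure J \<tau> \<gamma> w) (compensator J lam Q \<tau> \<gamma> w)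
       ({t<..T} \<times> UNIV) (%x. TT (fst x) (snd x) w)
     + (LINT r:{t<..T}|lborel. A r w ** SS r w + SS r w ** transpose (A r w)
        - real N *\<^sub>R (B r w ** transpose (B r w)))"
    unfolding rhs(4)[OF t] jsum_def .
  qed
 qed
qed

end

section \<open>From the standing assumptions to the locales, and the result\<close>

lemma AE_pair_interval:
 fixes T :: real
 assumes P: "prob_space P" and T: "0 <= T" and ae: "AE (w, t) in P \<Otimes>\<^sub>M restrict_space lborel {0..T}. R w t"
 shows "AE w in P. AE r in lborel. r \<in> {0..T} --> R w r"
proof -
 interpret P: prob_space P by (rule P)
 interpret L: finite_measure "restrict_space lborel {0..T}"
  by (rule finite_measureI) (use T in \<open>simp add: emeasure_restrict_space space_restrict_space\<close>)
 interpret pair_sigma_finite P "restrict_space lborel {0..T}" ..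
 have "AE w in P. AE r in restrict_space lborel {0..T}. R w r" using AE_pair[OF ae] by simp
 then show ?thesis by eventually_elim (subst (asm) AE_restrict_space_iff, simp_all)
qed

lemma riccati_settingI:
 assumes T: "0 < T" and mode: "mode_process P J lam Q \<gamma>\<^sub>0 \<tau> \<gamma>" and coeff: "riccati_coefficients P T J \<tau> \<gamma> A B C"
 obtains K0 where "riccati_setting P J lam Q \<gamma>\<^sub>0 \<tau> \<gamma> T K0 A B C"
proof -
 let ?F = "mode_filtration (space P) \<tau> \<gamma>"
 have pp: "prob_space P" using mode by (simp add: mode_process_def)
 have T0: "0 <= T" using T by simp
 have A: "A \<in> Linf_pred P ?F T" and B: "B \<in> Linf_pred P ?F T" and C: "C \<in> L2_q P ?F T (jump_measure J \<tau> \<gamma>)"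
  and Z: "\<forall>w\<in>space P. \<forall>t\<in>{0..T}. \<tau> J w < ereal t --> A t w = 0 & B t w = 0 & (\<forall>th. C t th w = 0)"
  using coeff by (auto simp: riccati_coefficients_def)
 obtain KA where KA: "AE (w, t) in P \<Otimes>\<^sub>M restrict_space lborel {0..T}. norm (A t w) <= KA" using A by (auto simp: Linf_pred_def)
 obtain KB where KB: "AE (w, t) in P \<Otimes>\<^sub>M restrict_space lborel {0..T}. norm (B t w) <= KB" using B by (auto simp: Linf_pred_def)
 obtain KC where KC: "AE w in P. \<forall>r\<in>{0..T}. \<forall>th. norm (C r th w) <= KC" using coeff by (auto simp: riccati_coefficients_def)
 obtain KL where KL: "\<forall>x. \<forall>t\<ge>0. lam x t <= KL" using mode_process.lam_bounded[OF mode] by blast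
 define K0 where "K0 = max 0 (max (max KA KB) (max KC KL))"
 have K: "0 <= K0" "KA <= K0" "KB <= K0" "KC <= K0" "KL <= K0" by (auto simp: K0_def)
 have "riccati_setting_axioms P J lam \<tau> \<gamma> T K0 A B C"
 proof
  show "0 < T" "0 <= K0" by (fact T K(1))+
  show "(%(w, t). A t w) \<in> borel_measurable (predictable (space P) ?F T)"
   "(%(w, t). B t w) \<in> borel_measurable (predictable (space P) ?F T)" "predictable_field P ?F T C"
   using A B C by (auto simp: Linf_pred_def L2_q_def)
  show "AE w in P. (AE r in lborel. r \<in> {0..T} --> norm (A r w) <= K0 & norm (B r w) <= K0) & (\<forall>r\<in>{0..T}. \<forall>th. norm (C r th w) <= K0)"
   using AE_pair_interval[OF pp T0 KA] AE_pair_interval[OF pp T0 KB] KC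
  proof eventually_elim
   case (elim w)
   have "AE r in lborel. r \<in> {0..T} --> norm (A r w) <= K0 & norm (B r w) <= K0"
    using elim(1,2)
   proof eventually_elim
    case (elim r)
    then show ?case using K(2,3) by (meson order.trans)
   qed
   moreover have "\<forall>r\<in>{0..T}. \<forall>th. norm (C r th w) <= K0" using elim(3) K(4) by (meson order.trans)
   ultimately show ?case by blast
  qed
  show "lam x t <= K0" if "0 <= t" for x t using KL that K(5) by (meson order.trans)
  show "A t w = 0 & B t w = 0" if "w \<in> space P" "t \<in> {0..T}" "\<tau> J w < ereal t" for w t using Z that by blast
 qed
 then show ?thesis using that mode by (intro that riccati_setting.intro)
qed

theorem corollary5p4:
  fixes P :: "'w measure" and T :: real and J N :: nat
    and lam :: "'e::metric_space \<Rightarrow> real \<Rightarrow> real" and Q :: "'e \<Rightarrow> real \<Rightarrow> 'e measure" and \<gamma>\<^sub>0 :: 'e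
    and \<tau> :: "nat \<Rightarrow> 'w \<Rightarrow> ereal" and \<gamma> :: "nat \<Rightarrow> 'w \<Rightarrow> 'e"
    and A :: "real \<Rightarrow> 'w \<Rightarrow> real^'n^'n" and B :: "real \<Rightarrow> 'w \<Rightarrow> real^'d^'n"
    and C :: "real \<Rightarrow> 'e \<Rightarrow> 'w \<Rightarrow> real^'n^'n"
    and q qhat :: "'w \<Rightarrow> (real \<times> 'e) measure"
    and sol :: "enat \<Rightarrow> (real \<Rightarrow> 'w \<Rightarrow> real^'n^'n) \<Rightarrow> (real \<Rightarrow> 'e \<Rightarrow> 'w \<Rightarrow> real^'n^'n) \<Rightarrow> bool"
  assumes T_pos: "0 < T" and N_pos: "1 \<le> N"
    and mode: "mode_process P J lam Q \<gamma>\<^sub>0 \<tau> \<gamma>"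
    and coeff: "riccati_coefficients P T J \<tau> \<gamma> A B C"
    and q_def: "q = jump_measure J \<tau> \<gamma>"
    and qhat_def: "qhat = compensator J lam Q \<tau> \<gamma>"
    and sol_def: "sol = riccati_solution P T J lam Q \<tau> \<gamma> A B C N"
  shows
    "(\<forall>M\<ge>1. \<forall>\<Sigma> \<Theta> \<Sigma>' \<Theta>'. sol M \<Sigma> \<Theta> \<longrightarrow> sol M \<Sigma>' \<Theta>' \<longrightarrow> eq_D P T \<Sigma> \<Sigma>' \<and> eq_q P T q \<Theta> \<Theta>') \<and>
     (\<exists>K. \<forall>M\<ge>1. \<forall>\<Sigma> \<Theta>. sol M \<Sigma> \<Theta> \<longrightarrow>
       (AE \<omega> in P. \<forall>t\<in>{0..T}. \<Sigma> t \<omega> \<preceq> mat K) \<and>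
       (AE \<omega> in P. AE (t, \<theta>) in q \<omega>. t \<in> {0..T} \<longrightarrow> \<Theta> t \<theta> \<omega> \<preceq> mat K))
     \<and>
     (\<forall>m\<ge>1. \<exists>c>0. \<forall>\<Sigma> \<Theta>. sol (enat m) \<Sigma> \<Theta> \<longrightarrow>
       (AE \<omega> in P. \<forall>t\<in>{0..T}. posdef (\<Sigma> t \<omega>) \<and> mat c \<preceq> \<Sigma> t \<omega>) \<and>
       (AE \<omega> in P. AE (t, \<theta>) in qhat \<omega>. t \<in> {0..T} \<longrightarrow>
          posdef (\<Sigma> t \<omega> + \<Theta> t \<theta> \<omega>) \<and> mat c \<preceq> \<Sigma> t \<omega> + \<Theta> t \<theta> \<omega>))
     \<and>
     (\<forall>\<Sigma> \<Theta>. (\<forall>M\<ge>1. sol M (\<Sigma> M) (\<Theta> M)) \<longrightarrow>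
       (\<forall>e>0. \<exists>m\<^sub>0\<ge>1. \<forall>m\<ge>m\<^sub>0.
          (AE \<omega> in P. \<forall>t\<in>{0..T}. norm (\<Sigma> (enat m) t \<omega> - \<Sigma> \<infinity> t \<omega>) \<le> e) \<and>
          (AE \<omega> in P. AE (t, \<theta>) in q \<omega>. t \<in> {0..T} \<longrightarrow>
             norm (\<Theta> (enat m) t \<theta> \<omega> - \<Theta> \<infinity> t \<theta> \<omega>) \<le> e)) \<and>
       (\<forall>m\<ge>1. \<forall>m'\<ge>m.
          (AE \<omega> in P. \<forall>t\<in>{0..T}. \<Sigma> (enat m') t \<omega> \<preceq> \<Sigma> (enat m) t \<omega>) \<and>
          (AE \<omega> in P. AE (t, \<theta>) in qhat \<omega>. t \<in> {0..T} \<longrightarrow>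
             \<Sigma> (enat m') t \<omega> + \<Theta> (enat m') t \<theta> \<omega> \<preceq> \<Sigma> (enat m) t \<omega> + \<Theta> (enat m) t \<theta> \<omega>)))
     \<and>
     (countable (UNIV :: 'e set) \<and> (\<forall>S :: 'e set. open S) \<and>
      jump_time_homogeneous P T \<tau> \<gamma> A \<and> jump_time_homogeneous P T \<tau> \<gamma> B \<and>
      jump_time_homogeneous P T \<tau> \<gamma> (\<lambda>t \<omega> \<theta>. C t \<theta> \<omega>) \<longrightarrow>
      (\<forall>M\<ge>1. \<exists>\<Sigma> \<Theta>. sol M \<Sigma> \<Theta> \<and>
        (\<forall>\<Sigma>' \<Theta>'. sol M \<Sigma>' \<Theta>' \<longrightarrow> eq_D P T \<Sigma> \<Sigma>' \<and> eq_q P T q \<Theta> \<Theta>')))"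
proof (intro conjI)
 obtain K0 where rs: "riccati_setting P J lam Q \<gamma>\<^sub>0 \<tau> \<gamma> T K0 A B C" by (rule riccati_settingI[OF T_pos mode coeff])
 show "\<forall>M\<ge>1. \<forall>\<Sigma> \<Theta> \<Sigma>' \<Theta>'. sol M \<Sigma> \<Theta> --> sol M \<Sigma>' \<Theta>' --> eq_D P T \<Sigma> \<Sigma>' & eq_q P T q \<Theta> \<Theta>'"
  unfolding sol_def q_def using riccati_setting.sol_unique[OF rs] by blast
 have up: "(AE w in P. \<forall>t\<in>{0..T}. \<Sigma> t w \<preceq> mat (riccati_setting.Kup T K0 N)) &
   (AE w in P. AE (t, th) in q w. t \<in> {0..T} --> \<Theta> t th w \<preceq> mat (riccati_setting.Kup T K0 N))" if "sol M \<Sigma> \<Theta>" for M \<Sigma> \<Theta>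
  using riccati_setting.sol_upper[OF rs that[unfolded sol_def]] riccati_setting.sol_field_upper[OF rs that[unfolded sol_def]]
  unfolding q_def mem_Collect_eq by blast
 show "\<exists>K. \<forall>M\<ge>1. \<forall>\<Sigma> \<Theta>. sol M \<Sigma> \<Theta> --> (AE w in P. \<forall>t\<in>{0..T}. \<Sigma> t w \<preceq> mat K) &
    (AE w in P. AE (t, th) in q w. t \<in> {0..T} --> \<Theta> t th w \<preceq> mat K)"
  \<comment> \<open>The bound involves only \<open>K0\<close>, \<open>N\<close> and
    \<open>T\<close>, so it can be chosen before \<open>M\<close>.\<close>
  by (rule exI[of _ "riccati_setting.Kup T K0 N"]) (intro allI impI up)
 show "\<forall>m\<ge>1. \<exists>c>0. \<forall>\<Sigma> \<Theta>. sol (enat m) \<Sigma> \<Theta> -->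
    (AE w in P. \<forall>t\<in>{0..T}. posdef (\<Sigma> t w) & mat c \<preceq> \<Sigma> t w) &
    (AE w in P. AE (t, th) in qhat w. t \<in> {0..T} -->
     posdef (\<Sigma> t w + \<Theta> t th w) & mat c \<preceq> \<Sigma> t w + \<Theta> t th w)"
  unfolding sol_def qhat_def by (intro allI impI riccati_setting.sol_pos[OF rs])
 show "\<forall>\<Sigma> \<Theta>. (\<forall>M\<ge>1. sol M (\<Sigma> M) (\<Theta> M)) -->
    (\<forall>e>0. \<exists>m\<^sub>0\<ge>1. \<forall>m\<ge>m\<^sub>0.
     (AE w in P. \<forall>t\<in>{0..T}. norm (\<Sigma> (enat m) t w - \<Sigma> \<infinity> t w) <= e) &
     (AE w in P. AE (t, th) in q w. t \<in> {0..T} -->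
       norm (\<Theta> (enat m) t th w - \<Theta> \<infinity> t th w) <= e)) &
    (\<forall>m\<ge>1. \<forall>m'\<ge>m.
     (AE w in P. \<forall>t\<in>{0..T}. \<Sigma> (enat m') t w \<preceq> \<Sigma> (enat m) t w) &
     (AE w in P. AE (t, th) in qhat w. t \<in> {0..T} -->
       \<Sigma> (enat m') t w + \<Theta> (enat m') t th w \<preceq> \<Sigma> (enat m) t w + \<Theta> (enat m) t th w))"
  unfolding sol_def q_def qhat_def
  by (intro allI impI, rule conjI, intro allI impI, rule riccati_setting.sol_converges[OF rs], assumption, assumption,
    intro allI impI, rule riccati_setting.sol_antimono[OF rs], assumption+)
 show "countable (UNIV :: 'e set) & (\<forall>S :: 'e set. open S) &
   jump_time_homogeneous P T \<tau> \<gamma> A & jump_time_homogeneous P T \<tau> \<gamma> B &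
   jump_time_homogeneous P T \<tau> \<gamma> (%t w th. C t th w) -->
   (\<forall>M\<ge>1. \<exists>\<Sigma> \<Theta>. sol M \<Sigma> \<Theta> &
    (\<forall>\<Sigma>' \<Theta>'. sol M \<Sigma>' \<Theta>' --> eq_D P T \<Sigma> \<Sigma>' & eq_q P T q \<Theta> \<Theta>'))"
 proof (intro impI allI)
  fix M :: enat
  assume h: "countable (UNIV :: 'e set) & (\<forall>S :: 'e set. open S) &
   jump_time_homogeneous P T \<tau> \<gamma> A & jump_time_homogeneous P T \<tau> \<gamma> B &
   jump_time_homogeneous P T \<tau> \<gamma> (%t w th. C t th w)" and M: "1 <= M"
  obtain fA where fA: "\<forall>w\<in>space P. \<forall>t\<in>{0..T}. \<forall>j. \<tau> j w < ereal t & ereal t <= \<tau> (Suc j) w --> A t w = fA (map (%i. \<gamma> i w) [0..<Suc j]) t"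
   using h unfolding jump_time_homogeneous_def by blast
  obtain fB where fB: "\<forall>w\<in>space P. \<forall>t\<in>{0..T}. \<forall>j. \<tau> j w < ereal t & ereal t <= \<tau> (Suc j) w --> B t w = fB (map (%i. \<gamma> i w) [0..<Suc j]) t"
   using h unfolding jump_time_homogeneous_def by blast
  obtain fC where fC: "\<forall>w\<in>space P. \<forall>t\<in>{0..T}. \<forall>j. \<tau> j w < ereal t & ereal t <= \<tau> (Suc j) w -->
    (%th. C t th w) = fC (map (%i. \<gamma> i w) [0..<Suc j]) t"
   using h unfolding jump_time_homogeneous_def by blast
  have "homogeneous_setting_axioms P \<tau> \<gamma> T A B C fA fB fC"
  proof
   show "countable (UNIV :: 'e set)" "open S" for S :: "'e set" using h by auto
   fix w t j assume a: "w \<in> space P" "t \<in> {0..T}" "\<tau> j w < ereal t" "ereal t <= \<tau> (Suc j) w"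
   have "(%th. C t th w) = fC (map (%i. \<gamma> i w) [0..<Suc j]) t" using fC a by blast
   then have "\<forall>th. C t th w = fC (map (%i. \<gamma> i w) [0..<Suc j]) t th" by (rule fun_cong[THEN allI])
   then show "A t w = fA (map (%i. \<gamma> i w) [0..<Suc j]) t & B t w = fB (map (%i. \<gamma> i w) [0..<Suc j]) t &
     (\<forall>th. C t th w = fC (map (%i. \<gamma> i w) [0..<Suc j]) t th)" using fA fB a by blast
  qed
  then have hs: "homogeneous_setting P J lam Q \<gamma>\<^sub>0 \<tau> \<gamma> T K0 A B C fA fB fC" by (rule homogeneous_setting.intro[OF rs])
  show "\<exists>\<Sigma> \<Theta>. sol M \<Sigma> \<Theta> & (\<forall>\<Sigma>' \<Theta>'. sol M \<Sigma>' \<Theta>' --> eq_D P T \<Sigma> \<Sigma>' & eq_q P T q \<Theta> \<Theta>')"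
   unfolding sol_def q_def
   using homogeneous_setting.SS_solution[OF hs M, where N = N] riccati_setting.sol_unique[OF rs] by blast
 qed
qed

end
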